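(* Let $(M,g)$ be a spacetime of signature $(p,q)$ with a Cauchy time function $T : M \to N$ (where $N$ is a $q$-dimensional manifold). Assume that $M$ admits a foliation $F$ by causal leaves of dimension $q$, and let $P$ be a level set of $T$. Then there exists a homeomorphism $M \simeq P \times N$ under which $T$ is the projection $\mathrm{pr}_2$ on the second factor and the leaves of $F$ are the fibers of the projection $\mathrm{pr}_1$ on the first factor.
   Context: $(M,g)$ is a connected smooth pseudo-Riemannian manifold of signature $(p,q)$ ($p$ positive, $q$ negative directions); it is a spacetime if it is orientable and time orientable, i.e. the double cover of the bundle of negative definite $q$-planes of $TM$ formed by the oriented negative definite $q$-planes is trivial. A tangent vector $v$ is causal if $g(v)\le 0$, timelike if $g(v)<0$; a tangent subspace $Q$ is causal if $g|_Q\le 0$, timelike if $g|_Q<0$. An immersed submanifold is causal if all its tangent spaces are. Cylindrical neighborhood: for $x\in M$, an open set $C(a,b)=(-a,a)^p\times \mathbb{D}^q(0,b)\subset T_xM\cong\mathbb{R}^p\times\mathbb{R}^q$ ($a\gg b$, coordinates given by an orthonormal basis with $g_x=\sum x_i^2-\sum y_j^2$, $\mathbb{D}^q(0,b)$ the open ball), on which $\exp_x$ is a diffeomorphism onto its image, identified with that image, and such that for some $\varepsilon>0$ the constant metrics $g_\pm=\sum x_i^2-(1\mp\varepsilon)\sum y_j^2$ satisfy $g_-<\exp_x^*g<g_+$; here $g_1<g_2$ means that every nonzero vector causal for $g_2$ is timelike for $g_1$. A continuous map $f:N_0\to M$ from a connected $q$-dimensional smooth manifold is causal if for each $y\in N_0$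 there is a cylindrical neighborhood $C(a,b)$ of $x=f(y)$ such that the restriction of $f$ to the connected component of $f^{-1}(C(a,b))$ containing $y$ is the graph of a map $\mathbb{D}^q(0,b)\to(-a,a)^p$, with the graph contained in $\{g_x\le 0\}$. A path $c:(a,b)\to X$ is inextendible in $X$ if it converges in $X$ neither at $a$ nor at $b$. A continuous map $f:N_0\to M$ is inextendible if for each continuous path $c:I\to N_0$ inextendible in $N_0$, $f\circ c$ is inextendible in $M$. A Cauchy time function is a continuous map $T:M\to N$, with $N$ a $q$-dimensional manifold, such that for every inextendible causal map $f:N_0\to M$ (with $\dim N_0=q$), $T\circ f:N_0\to N$ is a homeomorphism. *)

theory Defs
  imports "HOL-Analysis.Analysis" "Jordan_Normal_Form.Determinant"
begin

section \<open>Calculus on \<open>\<real>\<^sup>n\<close>\<close>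

text \<open>
  Since the dimensions \<open>p\<close> and \<open>q\<close> are arbitrary natural numbers (\<open>0\<close> included), \<open>\<real>\<^sup>n\<close> is the library's
  \<^const>\<open>Euclidean_space\<close>, whose points are functions \<open>nat \<Rightarrow> real\<close> vanishing at all indices
  \<open>\<ge> n\<close>. Coordinates are numbered from \<open>0\<close>.
\<close>

type_synonym rvec = "nat \<Rightarrow> real"

abbreviation R_n :: "nat \<Rightarrow> rvec set" where
  "R_n n \<equiv> topspace (Euclidean_space n)"

definition pd :: "nat \<Rightarrow> (rvec \<Rightarrow> real) \<Rightarrow> rvec \<Rightarrow> real" where
  "pd i f z = deriv (\<lambda>t. f (z(i := t))) (z i)"

text \<open>\<open>U\<close> is meant to be open in \<open>\<real>\<^sup>n\<close>; the values of \<open>f\<close> outside \<open>U\<close> are irrelevant.\<close>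

fun Ck_on :: "nat \<Rightarrow> nat \<Rightarrow> rvec set \<Rightarrow> (rvec \<Rightarrow> real) \<Rightarrow> bool" where
  "Ck_on 0 n U f \<longleftrightarrow> continuous_map (subtopology (Euclidean_space n) U) euclideanreal f"
| "Ck_on (Suc k) n U f \<longleftrightarrow>
     continuous_map (subtopology (Euclidean_space n) U) euclideanreal f \<and>
     (\<forall>i<n. (\<forall>z\<in>U. (\<lambda>t. f (z(i := t))) field_differentiable (at (z i))) \<and> Ck_on k n U (pd i f))"

definition smooth_fun :: "nat \<Rightarrow> rvec set \<Rightarrow> (rvec \<Rightarrow> real) \<Rightarrow> bool" where
  "smooth_fun n U f \<longleftrightarrow> (\<forall>k. Ck_on k n U f)"

definition jacobian :: "(rvec \<Rightarrow> rvec) \<Rightarrow> rvec \<Rightarrow> nat \<Rightarrow> nat \<Rightarrow> real" where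
  "jacobian \<Phi> z i j = pd j (\<lambda>w. \<Phi> w i) z"

definition differential :: "nat \<Rightarrow> (rvec \<Rightarrow> rvec) \<Rightarrow> rvec \<Rightarrow> rvec \<Rightarrow> rvec" where
  "differential n \<Phi> z u = (\<lambda>i. if i < n then \<Sum>j<n. jacobian \<Phi> z i j * u j else 0)"

definition det_n :: "nat \<Rightarrow> (nat \<Rightarrow> nat \<Rightarrow> real) \<Rightarrow> real" where
  "det_n n a = Determinant.det (Matrix.mat n n (\<lambda>(i, j). a i j))"

section \<open>Manifolds\<close>

text \<open>A chart is a pair of its domain and its coordinate map.\<close>

type_synonym 'a chart = "'a set \<times> ('a \<Rightarrow> rvec)"

definition is_chart :: "nat \<Rightarrow> 'a topology \<Rightarrow> 'a chart \<Rightarrow> bool" where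
  "is_chart n X c \<longleftrightarrow>
     openin X (fst c) \<and> openin (Euclidean_space n) (snd c ` fst c) \<and>
     homeomorphic_map (subtopology X (fst c))
       (subtopology (Euclidean_space n) (snd c ` fst c)) (snd c)"

definition chart_inv :: "'a chart \<Rightarrow> rvec \<Rightarrow> 'a" where
  "chart_inv c = inv_into (fst c) (snd c)"

definition transition :: "'a chart \<Rightarrow> 'a chart \<Rightarrow> rvec \<Rightarrow> rvec" where
  "transition c d z = snd d (chart_inv c z)"

definition smooth_transition :: "nat \<Rightarrow> 'a chart \<Rightarrow> 'a chart \<Rightarrow> bool" where
  "smooth_transition n c d \<longleftrightarrow>
     (\<forall>i<n. smooth_fun n (snd c ` (fst c \<inter> fst d)) (\<lambda>z. transition c d z i))"

definition topological_manifold :: "nat \<Rightarrow> 'a topology \<Rightarrow> bool" where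
  "topological_manifold n X \<longleftrightarrow>
     Hausdorff_space X \<and> second_countable X \<and>
     (\<forall>x\<in>topspace X. \<exists>c. is_chart n X c \<and> x \<in> fst c)"

text \<open>The atlas \<open>A\<close> need not be maximal; \<open>smooth_charts\<close> is the maximal atlas it generates.\<close>

definition smooth_manifold :: "nat \<Rightarrow> 'a topology \<Rightarrow> 'a chart set \<Rightarrow> bool" where
  "smooth_manifold n X A \<longleftrightarrow>
     Hausdorff_space X \<and> second_countable X \<and>
     (\<forall>c\<in>A. is_chart n X c) \<and> (\<Union>c\<in>A. fst c) = topspace X \<and>
     (\<forall>c\<in>A. \<forall>d\<in>A. smooth_transition n c d)"

definition smooth_charts :: "nat \<Rightarrow> 'a topology \<Rightarrow> 'a chart set \<Rightarrow> 'a chart set" where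
  "smooth_charts n X A =
     {c. is_chart n X c \<and> (\<forall>d\<in>A. smooth_transition n c d \<and> smooth_transition n d c)}"

text \<open>Connected manifolds are nonempty; note that \<^const>\<open>connected_space\<close> admits the empty space.\<close>

definition connected_smooth_manifold :: "nat \<Rightarrow> 'a topology \<Rightarrow> 'a chart set \<Rightarrow> bool" where
  "connected_smooth_manifold n X A \<longleftrightarrow>
     smooth_manifold n X A \<and> connected_space X \<and> topspace X \<noteq> {}"

definition orientable :: "nat \<Rightarrow> 'a topology \<Rightarrow> 'a chart set \<Rightarrow> bool" where
  "orientable n X A \<longleftrightarrow>
     (\<exists>B \<subseteq> smooth_charts n X A. (\<Union>c\<in>B. fst c) = topspace X \<and>
        (\<forall>c\<in>B. \<forall>d\<in>B. \<forall>z\<in>snd c ` (fst c \<inter> fst d). det_n n (jacobian (transition c d) z) > 0))"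

section \<open>Tangent vectors\<close>

text \<open>
  A tangent vector at \<open>x\<close> is the family of its coordinate vectors in all the charts of the atlas
  around \<open>x\<close>, subject to the usual transformation law. The entries at all other charts are
  set to \<open>0\<close>, so that equality of tangent vectors at \<open>x\<close> is equality of functions.
\<close>

type_synonym 'a tvec = "'a chart \<Rightarrow> rvec"

definition tangent_space :: "nat \<Rightarrow> 'a chart set \<Rightarrow> 'a \<Rightarrow> 'a tvec set" where
  "tangent_space n A x =
     {v. (\<forall>c\<in>A. x \<in> fst c \<longrightarrow> v c \<in> R_n n) \<and>
         (\<forall>c\<in>A. \<forall>d\<in>A. x \<in> fst c \<inter> fst d \<longrightarrow>
            v d = differential n (transition c d) (snd c x) (v c)) \<and>
         (\<forall>c. \<not> (c \<in> A \<and> x \<in> fst c) \<longrightarrow> v c = (\<lambda>_. 0))}"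

definition zero_tvec :: "'a tvec" where
  "zero_tvec = (\<lambda>_ _. 0)"

definition lincomb :: "nat \<Rightarrow> rvec \<Rightarrow> (nat \<Rightarrow> 'a tvec) \<Rightarrow> 'a tvec" where
  "lincomb k a e = (\<lambda>c l. \<Sum>i<k. a i * e i c l)"

text \<open>\<open>V\<close> is a \<open>k\<close>-dimensional vector space with ordered basis \<open>e 0, \<dots>, e (k - 1)\<close>.\<close>

definition is_basis :: "nat \<Rightarrow> 'a tvec set \<Rightarrow> (nat \<Rightarrow> 'a tvec) \<Rightarrow> bool" where
  "is_basis k V e \<longleftrightarrow> bij_betw (\<lambda>a. lincomb k a e) (R_n k) V"

text \<open>The tangent vector at \<open>x\<close> with coordinates \<open>u\<close> in the chart \<open>c \<in> smooth_charts n X A\<close>.\<close>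

definition tvec_of :: "nat \<Rightarrow> 'a chart set \<Rightarrow> 'a chart \<Rightarrow> 'a \<Rightarrow> rvec \<Rightarrow> 'a tvec" where
  "tvec_of n A c x u =
     (\<lambda>d. if d \<in> A \<and> x \<in> fst d then differential n (transition c d) (snd c x) u else (\<lambda>_. 0))"

definition unit_vec :: "nat \<Rightarrow> rvec" where
  "unit_vec i = (\<lambda>j. if j = i then 1 else 0)"

section \<open>Pseudo-Riemannian metrics\<close>

type_synonym 'a metr = "'a \<Rightarrow> 'a tvec \<Rightarrow> 'a tvec \<Rightarrow> real"

definition metric_comp ::
  "nat \<Rightarrow> 'a chart set \<Rightarrow> 'a metr \<Rightarrow> 'a chart \<Rightarrow> nat \<Rightarrow> nat \<Rightarrow> rvec \<Rightarrow> real" where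
  "metric_comp n A g c i j z =
     (let x = chart_inv c z in g x (tvec_of n A c x (unit_vec i)) (tvec_of n A c x (unit_vec j)))"

definition bilinear_form :: "'a tvec set \<Rightarrow> ('a tvec \<Rightarrow> 'a tvec \<Rightarrow> real) \<Rightarrow> bool" where
  "bilinear_form V b \<longleftrightarrow>
     (\<forall>u\<in>V. \<forall>v\<in>V. \<forall>w\<in>V. \<forall>r s.
        b (\<lambda>c i. r * u c i + s * v c i) w = r * b u w + s * b v w \<and>
        b w (\<lambda>c i. r * u c i + s * v c i) = r * b w u + s * b w v)"

definition orthonormal_basis ::
  "nat \<Rightarrow> nat \<Rightarrow> 'a chart set \<Rightarrow> 'a metr \<Rightarrow> 'a \<Rightarrow> (nat \<Rightarrow> 'a tvec) \<Rightarrow> bool" where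
  "orthonormal_basis p q A g x e \<longleftrightarrow>
     is_basis (p + q) (tangent_space (p + q) A x) e \<and>
     (\<forall>i<p+q. \<forall>j<p+q. g x (e i) (e j) = (if i \<noteq> j then 0 else if i < p then 1 else - 1))"

definition pseudo_riemannian_metric ::
  "nat \<Rightarrow> nat \<Rightarrow> 'a topology \<Rightarrow> 'a chart set \<Rightarrow> 'a metr \<Rightarrow> bool" where
  "pseudo_riemannian_metric p q X A g \<longleftrightarrow>
     (\<forall>x\<in>topspace X.
        bilinear_form (tangent_space (p + q) A x) (g x) \<and>
        (\<forall>u\<in>tangent_space (p + q) A x. \<forall>v\<in>tangent_space (p + q) A x. g x u v = g x v u) \<and>
        (\<exists>e. orthonormal_basis p q A g x e)) \<and>
     (\<forall>c\<in>A. \<forall>i<p+q. \<forall>j<p+q. smooth_fun (p + q) (snd c ` fst c) (metric_comp (p + q) A g c i j))"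

definition causal_subspace :: "'a metr \<Rightarrow> 'a \<Rightarrow> 'a tvec set \<Rightarrow> bool" where
  "causal_subspace g x Q \<longleftrightarrow> (\<forall>v\<in>Q. g x v v \<le> 0)"

definition timelike_subspace :: "'a metr \<Rightarrow> 'a \<Rightarrow> 'a tvec set \<Rightarrow> bool" where
  "timelike_subspace g x Q \<longleftrightarrow> (\<forall>v\<in>Q. v \<noteq> zero_tvec \<longrightarrow> g x v v < 0)"

section \<open>Spacetimes\<close>

definition final_topology ::
  "'b set \<Rightarrow> 'i set \<Rightarrow> ('i \<Rightarrow> 'c topology) \<Rightarrow> ('i \<Rightarrow> 'c \<Rightarrow> 'b) \<Rightarrow> 'b topology" where
  "final_topology S I Y h =
     topology (\<lambda>W. W \<subseteq> S \<and> (\<forall>i\<in>I. openin (Y i) {y \<in> topspace (Y i). h i y \<in> W}))"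

lemma openin_final_topology:
  "openin (final_topology S I Y h) W \<longleftrightarrow>
     W \<subseteq> S \<and> (\<forall>i\<in>I. openin (Y i) {y \<in> topspace (Y i). h i y \<in> W})"
proof -
  have "istopology (\<lambda>W. W \<subseteq> S \<and> (\<forall>i\<in>I. openin (Y i) {y \<in> topspace (Y i). h i y \<in> W}))"
    unfolding istopology_def
  proof (intro conjI allI impI ballI)
    fix V W i
    assume V: "V \<subseteq> S \<and> (\<forall>i\<in>I. openin (Y i) {y \<in> topspace (Y i). h i y \<in> V})"
      and W: "W \<subseteq> S \<and> (\<forall>i\<in>I. openin (Y i) {y \<in> topspace (Y i). h i y \<in> W})"
    show "V \<inter> W \<subseteq> S"
      using V by blast
    assume "i \<in> I"
    then have "openin (Y i) ({y \<in> topspace (Y i). h i y \<in> V} \<inter> {y \<in> topspace (Y i). h i y \<in> W})"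
      using V W by blast
    moreover have "{y \<in> topspace (Y i). h i y \<in> V} \<inter> {y \<in> topspace (Y i). h i y \<in> W}
        = {y \<in> topspace (Y i). h i y \<in> V \<inter> W}"
      by blast
    ultimately show "openin (Y i) {y \<in> topspace (Y i). h i y \<in> V \<inter> W}"
      by simp
  next
    fix \<K>
    assume K: "\<forall>V\<in>\<K>. V \<subseteq> S \<and> (\<forall>i\<in>I. openin (Y i) {y \<in> topspace (Y i). h i y \<in> V})"
    show "\<Union>\<K> \<subseteq> S"
      using K by blast
    fix i
    assume "i \<in> I"
    then have "openin (Y i) (\<Union>V\<in>\<K>. {y \<in> topspace (Y i). h i y \<in> V})"
      using K by blast
    moreover have "(\<Union>V\<in>\<K>. {y \<in> topspace (Y i). h i y \<in> V}) = {y \<in> topspace (Y i). h i y \<in> \<Union>\<K>}"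
      by blast
    ultimately show "openin (Y i) {y \<in> topspace (Y i). h i y \<in> \<Union>\<K>}"
      by simp
  qed
  then show ?thesis
    by (simp add: final_topology_def)
qed

text \<open>The bundle of negative definite \<open>q\<close>-planes, topologized by the local frames
  \<open>(z, m) \<mapsto> span {m 0, \<dots>, m (q - 1)}\<close> over the charts.\<close>

definition neg_planes ::
  "nat \<Rightarrow> nat \<Rightarrow> 'a topology \<Rightarrow> 'a chart set \<Rightarrow> 'a metr \<Rightarrow> ('a \<times> 'a tvec set) set" where
  "neg_planes p q X A g =
     {(x, Q). x \<in> topspace X \<and> Q \<subseteq> tangent_space (p + q) A x \<and> (\<exists>e. is_basis q Q e) \<and>
        timelike_subspace g x Q}"

definition frame_in_chart ::
  "nat \<Rightarrow> 'a chart set \<Rightarrow> 'a chart \<Rightarrow> rvec \<times> (nat \<Rightarrow> rvec) \<Rightarrow> nat \<Rightarrow> 'a tvec" where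
  "frame_in_chart n A c y = (\<lambda>i. tvec_of n A c (chart_inv c (fst y)) (snd y i))"

definition plane_in_chart ::
  "nat \<Rightarrow> nat \<Rightarrow> 'a chart set \<Rightarrow> 'a chart \<Rightarrow> rvec \<times> (nat \<Rightarrow> rvec) \<Rightarrow> 'a \<times> 'a tvec set" where
  "plane_in_chart p q A c y =
     (chart_inv c (fst y), (\<lambda>a. lincomb q a (frame_in_chart (p + q) A c y)) ` R_n q)"

definition neg_frames ::
  "nat \<Rightarrow> nat \<Rightarrow> 'a topology \<Rightarrow> 'a chart set \<Rightarrow> 'a metr \<Rightarrow> 'a chart
     \<Rightarrow> (rvec \<times> (nat \<Rightarrow> rvec)) topology" where
  "neg_frames p q X A g c =
     subtopology
       (prod_topology (Euclidean_space (p + q))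
          (product_topology (\<lambda>_. Euclidean_space (p + q)) {..<q}))
       {y. fst y \<in> snd c ` fst c \<and> plane_in_chart p q A c y \<in> neg_planes p q X A g \<and>
           is_basis q (snd (plane_in_chart p q A c y)) (frame_in_chart (p + q) A c y)}"

definition neg_planes_top ::
  "nat \<Rightarrow> nat \<Rightarrow> 'a topology \<Rightarrow> 'a chart set \<Rightarrow> 'a metr \<Rightarrow> ('a \<times> 'a tvec set) topology" where
  "neg_planes_top p q X A g =
     final_topology (neg_planes p q X A g) A (neg_frames p q X A g) (plane_in_chart p q A)"

text \<open>
  An orientation of \<open>Q\<close> gives every ordered basis of \<open>Q\<close> a sign, multiplied under change of basis
  by the sign of the determinant; it is the choice of one of the two classes of bases,
  with the usual convention that a \<open>0\<close>-dimensional space also has two orientations.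
\<close>

definition orientations ::
  "nat \<Rightarrow> 'a tvec set \<Rightarrow> ((nat \<Rightarrow> 'a tvec) \<Rightarrow> real) set" where
  "orientations q Q =
     {s. (\<forall>e. s e \<in> (if is_basis q Q e then {- 1, 1} else {0})) \<and>
         (\<forall>e e' a. is_basis q Q e \<and> is_basis q Q e' \<and>
            (\<forall>j<q. e' j = lincomb q (\<lambda>i. a i j) e) \<longrightarrow> s e' = sgn (det_n q a) * s e)}"

definition oriented_neg_planes_top ::
  "nat \<Rightarrow> nat \<Rightarrow> 'a topology \<Rightarrow> 'a chart set \<Rightarrow> 'a metr
     \<Rightarrow> (('a \<times> 'a tvec set) \<times> ((nat \<Rightarrow> 'a tvec) \<Rightarrow> real)) topology" where
  "oriented_neg_planes_top p q X A g =
     final_topology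
       {(Q, s). Q \<in> neg_planes p q X A g \<and> s \<in> orientations q (snd Q)} A
       (\<lambda>c. prod_topology (neg_frames p q X A g c) (discrete_topology {- 1, 1 :: real}))
       (\<lambda>c (y, r). (plane_in_chart p q A c y,
          THE s. s \<in> orientations q (snd (plane_in_chart p q A c y)) \<and>
                 s (frame_in_chart (p + q) A c y) = r))"

definition time_orientable ::
  "nat \<Rightarrow> nat \<Rightarrow> 'a topology \<Rightarrow> 'a chart set \<Rightarrow> 'a metr \<Rightarrow> bool" where
  "time_orientable p q X A g \<longleftrightarrow>
     (\<exists>h. homeomorphic_map (oriented_neg_planes_top p q X A g)
            (prod_topology (neg_planes_top p q X A g) (discrete_topology {- 1, 1 :: real})) h \<and>
          (\<forall>y\<in>topspace (oriented_neg_planes_top p q X A g). fst (h y) = fst y))"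

definition spacetime ::
  "nat \<Rightarrow> nat \<Rightarrow> 'a topology \<Rightarrow> 'a chart set \<Rightarrow> 'a metr \<Rightarrow> bool" where
  "spacetime p q X A g \<longleftrightarrow>
     connected_smooth_manifold (p + q) X A \<and> pseudo_riemannian_metric p q X A g \<and>
     orientable (p + q) X A \<and> time_orientable p q X A g"

section \<open>The exponential map and cylindrical neighborhoods\<close>

text \<open>Christoffel symbols of the first kind.\<close>

definition christoffel ::
  "nat \<Rightarrow> 'a chart set \<Rightarrow> 'a metr \<Rightarrow> 'a chart \<Rightarrow> nat \<Rightarrow> nat \<Rightarrow> nat \<Rightarrow> rvec \<Rightarrow> real" where
  "christoffel n A g c l i j z =
     (pd i (metric_comp n A g c j l) z + pd j (metric_comp n A g c i l) z
        - pd l (metric_comp n A g c i j) z) / 2"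

text \<open>The geodesic equation, with its free index lowered by the metric.\<close>

definition geodesic_on ::
  "nat \<Rightarrow> 'a topology \<Rightarrow> 'a chart set \<Rightarrow> 'a metr \<Rightarrow> real set \<Rightarrow> (real \<Rightarrow> 'a) \<Rightarrow> bool" where
  "geodesic_on n X A g J \<gamma> \<longleftrightarrow>
     continuous_map (top_of_set J) X \<gamma> \<and>
     (\<forall>c\<in>A. \<forall>t\<in>J. \<gamma> t \<in> fst c \<longrightarrow>
        (let u = (\<lambda>k \<tau>. snd c (\<gamma> \<tau>) k) in
         (\<forall>k<n. u k field_differentiable (at t) \<and> deriv (u k) field_differentiable (at t)) \<and>
         (\<forall>l<n. (\<Sum>k<n. metric_comp n A g c l k (snd c (\<gamma> t)) * deriv (deriv (u k)) t)
              + (\<Sum>i<n. \<Sum>j<n. christoffel n A g c l i j (snd c (\<gamma> t))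
                                  * deriv (u i) t * deriv (u j) t) = 0)))"

definition has_velocity ::
  "nat \<Rightarrow> 'a chart set \<Rightarrow> (real \<Rightarrow> 'a) \<Rightarrow> real \<Rightarrow> 'a tvec \<Rightarrow> bool" where
  "has_velocity n A \<gamma> t v \<longleftrightarrow>
     v \<in> tangent_space n A (\<gamma> t) \<and>
     (\<forall>c\<in>A. \<gamma> t \<in> fst c \<longrightarrow> (\<forall>k<n. ((\<lambda>\<tau>. snd c (\<gamma> \<tau>) k) has_field_derivative v c k) (at t)))"

definition exp_related ::
  "nat \<Rightarrow> 'a topology \<Rightarrow> 'a chart set \<Rightarrow> 'a metr \<Rightarrow> 'a \<Rightarrow> 'a tvec \<Rightarrow> 'a \<Rightarrow> bool" where
  "exp_related n X A g x v y \<longleftrightarrow>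
     (\<exists>\<gamma> s t. s < 0 \<and> 1 < t \<and> geodesic_on n X A g {s<..<t} \<gamma> \<and>
        \<gamma> 0 = x \<and> has_velocity n A \<gamma> 0 v \<and> \<gamma> 1 = y)"

definition exp_dom ::
  "nat \<Rightarrow> 'a topology \<Rightarrow> 'a chart set \<Rightarrow> 'a metr \<Rightarrow> 'a \<Rightarrow> 'a tvec set" where
  "exp_dom n X A g x = {v. \<exists>y. exp_related n X A g x v y}"

definition exp_map ::
  "nat \<Rightarrow> 'a topology \<Rightarrow> 'a chart set \<Rightarrow> 'a metr \<Rightarrow> 'a \<Rightarrow> 'a tvec \<Rightarrow> 'a" where
  "exp_map n X A g x v = (THE y. exp_related n X A g x v y)"

definition disc :: "nat \<Rightarrow> real \<Rightarrow> rvec set" where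
  "disc q b = {y \<in> R_n q. (\<Sum>j<q. (y j)\<^sup>2) < b\<^sup>2}"

definition cube :: "nat \<Rightarrow> real \<Rightarrow> rvec set" where
  "cube p a = {x \<in> R_n p. \<forall>i<p. \<bar>x i\<bar> < a}"

definition join :: "nat \<Rightarrow> rvec \<Rightarrow> rvec \<Rightarrow> rvec" where
  "join p x y = (\<lambda>i. if i < p then x i else y (i - p))"

definition cylinder :: "nat \<Rightarrow> nat \<Rightarrow> real \<Rightarrow> real \<Rightarrow> rvec set" where
  "cylinder p q a b = {join p x y | x y. x \<in> cube p a \<and> y \<in> disc q b}"

text \<open>\<open>quad p q r u = \<Sum> x\<^sub>i\<^sup>2 - r \<Sum> y\<^sub>j\<^sup>2\<close> for \<open>u = (x, y)\<close>.\<close>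

definition quad :: "nat \<Rightarrow> nat \<Rightarrow> real \<Rightarrow> rvec \<Rightarrow> real" where
  "quad p q r u = (\<Sum>i<p. (u i)\<^sup>2) - r * (\<Sum>j<q. (u (p + j))\<^sup>2)"

text \<open>\<open>Q1 < Q2\<close> for the quadratic forms of two metrics on \<open>\<real>\<^sup>n\<close>.\<close>

definition metric_less :: "nat \<Rightarrow> (rvec \<Rightarrow> real) \<Rightarrow> (rvec \<Rightarrow> real) \<Rightarrow> bool" where
  "metric_less n Q1 Q2 \<longleftrightarrow> (\<forall>u\<in>R_n n. u \<noteq> (\<lambda>_. 0) \<and> Q2 u \<le> 0 \<longrightarrow> Q1 u < 0)"

text \<open>
  \<open>C(a,b)\<close> around \<open>x\<close> is given by the chart \<open>\<kappa>\<close> of \<open>M\<close> inverse to \<open>exp_x\<close> read in the orthonormal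
  basis \<open>e\<close>: that \<open>exp_x\<close> is a diffeomorphism of \<open>C(a,b)\<close> onto its image means precisely that
  this inverse is a chart of the maximal atlas. In these coordinates, \<open>exp_x\<^sup>* g\<close> is \<open>g\<close>
  read in the chart \<open>\<kappa>\<close>.

  The informal requirement that \<open>a\<close> be much larger than \<open>b\<close> is rendered as \<open>b < a\<close>. Causal maps do
  not depend on the ratio demanded: a cylindrical neighborhood witnessing causality at a point may
  be replaced by the one with the same \<open>a\<close> and any smaller \<open>b\<close>.
\<close>

definition cylindrical_nbhd ::
  "nat \<Rightarrow> nat \<Rightarrow> 'a topology \<Rightarrow> 'a chart set \<Rightarrow> 'a metr \<Rightarrow> 'a \<Rightarrow> real \<Rightarrow> real \<Rightarrow> 'a chart \<Rightarrow> bool" where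
  "cylindrical_nbhd p q X A g x a b \<kappa> \<longleftrightarrow>
     0 < b \<and> b < a \<and>
     \<kappa> \<in> smooth_charts (p + q) X A \<and> snd \<kappa> ` fst \<kappa> = cylinder p q a b \<and>
     (\<exists>e. orthonormal_basis p q A g x e \<and>
        (\<forall>u\<in>cylinder p q a b. lincomb (p + q) u e \<in> exp_dom (p + q) X A g x \<and>
           exp_map (p + q) X A g x (lincomb (p + q) u e) = chart_inv \<kappa> u)) \<and>
     (\<exists>\<epsilon>>0. \<forall>m\<in>fst \<kappa>.
        metric_less (p + q) (quad p q (1 + \<epsilon>))
          (\<lambda>u. g m (tvec_of (p + q) A \<kappa> m u) (tvec_of (p + q) A \<kappa> m u)) \<and>
        metric_less (p + q) (\<lambda>u. g m (tvec_of (p + q) A \<kappa> m u) (tvec_of (p + q) A \<kappa> m u))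
          (quad p q (1 - \<epsilon>)))"

section \<open>Causal maps and Cauchy time functions\<close>

text \<open>\<open>f\<close> restricted to the component \<open>K\<close> is the graph of \<open>\<phi>\<close> when it is a homeomorphism of \<open>K\<close> onto
  that graph.\<close>

definition causal_map ::
  "nat \<Rightarrow> nat \<Rightarrow> 'a topology \<Rightarrow> 'a chart set \<Rightarrow> 'a metr \<Rightarrow> 'c topology \<Rightarrow> ('c \<Rightarrow> 'a) \<Rightarrow> bool" where
  "causal_map p q X A g X0 f \<longleftrightarrow>
     continuous_map X0 X f \<and>
     (\<forall>y\<in>topspace X0. \<exists>a b \<kappa>. cylindrical_nbhd p q X A g (f y) a b \<kappa> \<and>
        (let K = connected_component_of_set (subtopology X0 {z \<in> topspace X0. f z \<in> fst \<kappa>}) y in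
         \<exists>\<phi>. continuous_map (subtopology (Euclidean_space q) (disc q b))
                 (subtopology (Euclidean_space p) (cube p a)) \<phi> \<and>
             homeomorphic_map (subtopology X0 K)
                 (subtopology X (chart_inv \<kappa> ` {join p (\<phi> w) w | w. w \<in> disc q b})) f \<and>
             (\<forall>w\<in>disc q b. quad p q 1 (join p (\<phi> w) w) \<le> 0)))"

definition inextendible_path :: "'a topology \<Rightarrow> real \<Rightarrow> real \<Rightarrow> (real \<Rightarrow> 'a) \<Rightarrow> bool" where
  "inextendible_path X a b c \<longleftrightarrow>
     (\<nexists>l. limitin X c l (at_right a)) \<and> (\<nexists>l. limitin X c l (at_left b))"

definition inextendible_map :: "'c topology \<Rightarrow> 'a topology \<Rightarrow> ('c \<Rightarrow> 'a) \<Rightarrow> bool" where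
  "inextendible_map X0 X f \<longleftrightarrow>
     (\<forall>a b c. a < b \<and> continuous_map (top_of_set {a<..<b}) X0 c \<and> inextendible_path X0 a b c \<longrightarrow>
        inextendible_path X a b (f \<circ> c))"

text \<open>
  The connected \<open>q\<close>-manifolds \<open>X0\<close> range over all those whose points are of type \<open>nat \<Rightarrow> real\<close>.
  This loses nothing: a second countable Hausdorff space has at most continuum many points, so every
  manifold is diffeomorphic to one carried by a subset of that type.
\<close>

definition cauchy_time_function ::
  "nat \<Rightarrow> nat \<Rightarrow> 'a topology \<Rightarrow> 'a chart set \<Rightarrow> 'a metr \<Rightarrow> 'b topology \<Rightarrow> ('a \<Rightarrow> 'b) \<Rightarrow> bool" where
  "cauchy_time_function p q X A g N T \<longleftrightarrow>
     topological_manifold q N \<and> continuous_map X N T \<and>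
     (\<forall>(X0 :: (nat \<Rightarrow> real) topology) A0 f.
        connected_smooth_manifold q X0 A0 \<and> causal_map p q X A g X0 f \<and> inextendible_map X0 X f \<longrightarrow>
        homeomorphic_map X0 N (T \<circ> f))"

section \<open>Foliations\<close>

text \<open>
  A foliation of dimension \<open>q\<close> (and codimension \<open>p\<close>) is given by a foliated atlas \<open>F\<close>: charts onto
  cubes, whose plaques are the slices on which the first \<open>p\<close> coordinates are constant. The vanishing
  of the partial derivatives says that the transition maps have locally the form
  \<open>(x, y) \<mapsto> (h1 x, h2 x y)\<close>.
\<close>

definition foliation :: "nat \<Rightarrow> nat \<Rightarrow> 'a topology \<Rightarrow> 'a chart set \<Rightarrow> 'a chart set \<Rightarrow> bool" where
  "foliation p q X A F \<longleftrightarrow>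
     F \<subseteq> smooth_charts (p + q) X A \<and> (\<Union>c\<in>F. fst c) = topspace X \<and>
     (\<forall>c\<in>F. snd c ` fst c = cube (p + q) 1) \<and>
     (\<forall>c\<in>F. \<forall>d\<in>F. \<forall>z\<in>snd c ` (fst c \<inter> fst d). \<forall>i<p. \<forall>j\<in>{p..<p+q}.
        jacobian (transition c d) z i j = 0)"

definition same_plaque :: "nat \<Rightarrow> 'a chart set \<Rightarrow> 'a \<Rightarrow> 'a \<Rightarrow> bool" where
  "same_plaque p F x y \<longleftrightarrow> (\<exists>c\<in>F. x \<in> fst c \<and> y \<in> fst c \<and> (\<forall>i<p. snd c x i = snd c y i))"

text \<open>Leaves are the equivalence classes of points joined by a chain of plaques.\<close>

definition leaves :: "nat \<Rightarrow> 'a topology \<Rightarrow> 'a chart set \<Rightarrow> 'a set set" where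
  "leaves p X F = {{y. (same_plaque p F)\<^sup>*\<^sup>* x y} | x. x \<in> topspace X}"

text \<open>The tangent space at \<open>x\<close> of the leaf through \<open>x\<close>; it is the same for all \<open>c \<in> F\<close> around \<open>x\<close>.\<close>

definition leaf_tangent :: "nat \<Rightarrow> nat \<Rightarrow> 'a chart set \<Rightarrow> 'a chart set \<Rightarrow> 'a \<Rightarrow> 'a tvec set" where
  "leaf_tangent p q A F x =
     {tvec_of (p + q) A c x (join p (\<lambda>_. 0) w) | c w. c \<in> F \<and> x \<in> fst c \<and> w \<in> R_n q}"

definition causal_leaf ::
  "nat \<Rightarrow> nat \<Rightarrow> 'a chart set \<Rightarrow> 'a metr \<Rightarrow> 'a chart set \<Rightarrow> 'a set \<Rightarrow> bool" where
  "causal_leaf p q A g F L \<longleftrightarrow> (\<forall>x\<in>L. causal_subspace g x (leaf_tangent p q A F x))"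

end

theory Submission
  imports Defs "HOL-Homology.Homology"
begin

text \<open>
  With its leaf topology, every leaf is a connected \<open>q\<close>-manifold whose inclusion into \<open>M\<close> is causal and
  inextendible, so \<open>T\<close> maps each leaf homeomorphically onto \<open>N\<close>. The homeomorphism sends \<open>m\<close> to the
  point of its leaf on the level set, together with \<open>T m\<close>. By invariance of domain, the transverse
  coordinates of a foliated chart and \<open>T\<close> together form local coordinates, which gives continuity
  of the leaf projection along chains of plaques.

  The geometric point is that a leaf is, near each of its points, the graph of a map with
  \<open>g\<^sub>x \<le> 0\<close> in a cylindrical neighborhood. Such neighborhoods come from the exponential map, hence from
  smooth dependence of geodesics on initial data; by the Gauss lemma, \<open>g\<^sub>x\<close> cannot become positive
  along the rays of a causal graph.
\<close>

section \<open>Calculus on coordinate spaces\<close>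

text \<open>The definition of a causal map compares a whole graph with the single form
  \<open>g_x\<close>, whereas a leaf is causal only for the metric at each of its own points.
  Comparing with the constant metrics \<open>g_-\<close> and \<open>g_+\<close> loses a factor
  depending on \<epsilon> in the wrong direction. What helps is that the graph passes through the
  centre: if \<open>f t\<close> is the value of \<open>g_x\<close> along a ray of the graph in
  normal coordinates, the inequality \<open>t * f' \<le> f\<close> makes \<open>f t / t\<close>
  nonincreasing, and this quotient tends to 0 at the centre.

  Two further obstacles shape the proof. A priori a leaf could accumulate on itself, so its own
  topology may be finer than the induced one, and its second countability, part of being a manifold,
  is proved by counting plaques. And T is only continuous: its injectivity on leaves has to replace
  transversality.

  Since p and q are variables, the analysis runs on functions \<open>nat \<Rightarrow> real\<close>
  supported on the first n indices, with partial derivatives and coordinatewise estimates.\<close>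

abbreviation (input) "open_n n \<equiv> openin (Euclidean_space n)"
abbreviation (input) "zero_n \<equiv> \<lambda>_. 0"
abbreviation (input) "cp f i \<equiv> \<lambda>x. f x i"
abbreviation (input) "sub_n n \<equiv> subtopology (Euclidean_space n)"

text \<open>Sup-norm cubes form a neighborhood basis in which estimates are made one coordinate at a
  time; they replace metric balls in the epsilon-delta arguments on coordinate space.\<close>

definition nbox :: "nat \<Rightarrow> rvec \<Rightarrow> real \<Rightarrow> rvec set" where
  "nbox n z e = {w \<in> R_n n. \<forall>i<n. \<bar>w i - z i\<bar> < e}"

lemma R_n_iff: "x \<in> R_n n \<longleftrightarrow> (\<forall>i\<ge>n. x i = 0)"
  by (simp add: topspace_Euclidean_space)

lemma Euclidean_space_eq: "Euclidean_space n = top_of_set (R_n n)"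
  by (simp add: Euclidean_space_def euclidean_product_topology)

lemma openin_Rn_open: "open_n n S \<longleftrightarrow> (\<exists>V. open V \<and> S = R_n n \<inter> V)"
  by (subst Euclidean_space_eq) (rule openin_open)

lemma subtopology_Rn: "U \<subseteq> R_n n \<Longrightarrow> sub_n n U = top_of_set U"
  by (subst Euclidean_space_eq) (simp add: subtopology_subtopology Int_absorb1)

lemma openin_nbox: "open_n n (nbox n z e)"
proof -
  have "open {w::rvec. \<forall>i<n. \<bar>w i - z i\<bar> < e}"
  proof -
    have "open (\<Inter>i\<in>{..<n}. {w::rvec. \<bar>w i - z i\<bar> < e})"
    proof (intro open_INT ballI)
      fix i
      have "continuous_on UNIV (\<lambda>w::rvec. w i)"
        by (rule continuous_on_product_coordinates)
      thus "open {w::rvec. \<bar>w i - z i\<bar> < e}"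
        by (intro open_Collect_less continuous_intros)
    qed simp
    moreover have "(\<Inter>i\<in>{..<n}. {w::rvec. \<bar>w i - z i\<bar> < e}) = {w. \<forall>i<n. \<bar>w i - z i\<bar> < e}"
      by auto
    ultimately show ?thesis by simp
  qed
  moreover have "nbox n z e = R_n n \<inter> {w. \<forall>i<n. \<bar>w i - z i\<bar> < e}"
    by (auto simp: nbox_def)
  ultimately show ?thesis
    by (auto simp: openin_Rn_open)
qed

lemma nbox_center: "z \<in> R_n n \<Longrightarrow> 0 < e \<Longrightarrow> z \<in> nbox n z e"
  by (simp add: nbox_def)

lemma nbox_mono: "d \<le> e \<Longrightarrow> nbox n z d \<subseteq> nbox n z e"
  by (force simp: nbox_def)

text \<open>Only the radii at indices below n count: beyond them the points of the box and z both
  vanish.\<close>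

lemma open_nbox_subset:
  assumes "open V" "z \<in> V" "z \<in> R_n n"
  shows "\<exists>e>0. nbox n z e \<subseteq> V"
proof -
  have "openin (product_topology (\<lambda>i. euclidean) UNIV) V"
    using assms(1) by (simp add: euclidean_product_topology)
  from product_topology_open_contains_basis[OF this assms(2)]
  obtain X where X: "z \<in> Pi\<^sub>E UNIV X" "\<And>i. open (X i)" "Pi\<^sub>E UNIV X \<subseteq> V"
    by auto
  have "\<forall>i. \<exists>e>0. \<forall>y. \<bar>y - z i\<bar> < e \<longrightarrow> y \<in> X i"
  proof
    fix i
    have "z i \<in> X i" using X(1) by auto
    thus "\<exists>e>0. \<forall>y. \<bar>y - z i\<bar> < e \<longrightarrow> y \<in> X i"
      using X(2)[of i] by (auto simp: open_dist dist_real_def)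
  qed
  then obtain e where e: "\<And>i. 0 < e i" "\<And>i y. \<bar>y - z i\<bar> < e i \<Longrightarrow> y \<in> X i"
    by metis
  \<comment> \<open>The entry 1 keeps the set nonempty when n = 0.\<close>
  define d where "d = Min (insert 1 (e ` {..<n}))"
  have d: "0 < d" "\<And>i. i < n \<Longrightarrow> d \<le> e i"
    using e by (auto simp: d_def)
  have "nbox n z d \<subseteq> V"
  proof
    fix w assume w: "w \<in> nbox n z d"
    have "w i \<in> X i" for i
    proof (cases "i < n")
      case True
      thus ?thesis using w d(2)[OF True] e(2)[of "w i" i] by (force simp: nbox_def)
    next
      case False
      hence "w i = z i" using w assms(3) by (auto simp: nbox_def R_n_iff)
      thus ?thesis using e by simp
    qed
    thus "w \<in> V" using X(3) by auto
  qed
  with d show ?thesis by blast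
qed

lemma openin_Euclidean_iff:
  "open_n n U \<longleftrightarrow> U \<subseteq> R_n n \<and> (\<forall>z\<in>U. \<exists>e>0. nbox n z e \<subseteq> U)"
proof
  assume L: "open_n n U"
  then obtain V where V: "open V" "U = R_n n \<inter> V"
    by (auto simp: openin_Rn_open)
  show "U \<subseteq> R_n n \<and> (\<forall>z\<in>U. \<exists>e>0. nbox n z e \<subseteq> U)"
  proof (intro conjI ballI)
    show "U \<subseteq> R_n n" using V by auto
    fix z assume "z \<in> U"
    hence "z \<in> V" "z \<in> R_n n" using V(2) by auto
    from open_nbox_subset[OF V(1) this]
    obtain e where "e > 0" "nbox n z e \<subseteq> V" by auto
    moreover have "nbox n z e \<subseteq> R_n n" by (auto simp: nbox_def)
    ultimately show "\<exists>e>0. nbox n z e \<subseteq> U"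
      unfolding V(2) by (intro exI[of _ e]) simp
  qed
next
  assume R: "U \<subseteq> R_n n \<and> (\<forall>z\<in>U. \<exists>e>0. nbox n z e \<subseteq> U)"
  show "open_n n U"
  proof (subst openin_subopen, rule ballI)
    fix z assume z: "z \<in> U"
    then obtain e where "e > 0" "nbox n z e \<subseteq> U" using R by blast
    thus "\<exists>T. open_n n T \<and> z \<in> T \<and> T \<subseteq> U"
      using openin_nbox nbox_center[of z n e] R z by (intro exI[of _ "nbox n z e"]) auto
  qed
qed

lemma openin_Rn_sub: "open_n n U \<Longrightarrow> U \<subseteq> R_n n"
  by (simp add: openin_Euclidean_iff)

lemma continuous_on_nbox_iff:
  fixes f :: "rvec \<Rightarrow> 'm::metric_space"
  assumes "U \<subseteq> R_n n"
  shows "continuous_on U f \<longleftrightarrow>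
    (\<forall>z\<in>U. \<forall>e>0. \<exists>d>0. \<forall>w\<in>U \<inter> nbox n z d. dist (f w) (f z) < e)"
proof
  assume L: "continuous_on U f"
  show "\<forall>z\<in>U. \<forall>e>0. \<exists>d>0. \<forall>w\<in>U \<inter> nbox n z d. dist (f w) (f z) < e"
  proof (intro ballI allI impI)
    fix z e assume z: "z \<in> U" and e: "0 < (e::real)"
    then obtain A where A: "open A" "z \<in> A" "\<forall>y\<in>U. y \<in> A \<longrightarrow> f y \<in> ball (f z) e"
      using L unfolding continuous_on_topological by (metis centre_in_ball open_ball)
    obtain d where "d > 0" "nbox n z d \<subseteq> A"
      using open_nbox_subset A assms z by blast
    thus "\<exists>d>0. \<forall>w\<in>U \<inter> nbox n z d. dist (f w) (f z) < e"
      using A(3) by (intro exI[of _ d]) (auto simp: dist_commute)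
  qed
next
  assume R: "\<forall>z\<in>U. \<forall>e>0. \<exists>d>0. \<forall>w\<in>U \<inter> nbox n z d. dist (f w) (f z) < e"
  show "continuous_on U f"
    unfolding continuous_on_topological
  proof (intro ballI allI impI)
    fix z B assume z: "z \<in> U" and B: "open B" "f z \<in> B"
    then obtain e where e: "e > 0" "ball (f z) e \<subseteq> B" by (meson open_contains_ball)
    then obtain d where d: "d > 0" "\<forall>w\<in>U \<inter> nbox n z d. dist (f w) (f z) < e"
      using R z by blast
    obtain A where A: "open A" "nbox n z d = R_n n \<inter> A"
      using openin_nbox[of n z d] by (auto simp: openin_Rn_open)
    have "z \<in> A" using A nbox_center[of z n d] d z assms by auto
    moreover have "\<forall>y\<in>U. y \<in> A \<longrightarrow> f y \<in> B"
      using A d e assms by (auto simp: dist_commute subset_iff)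
    ultimately show "\<exists>A. open A \<and> z \<in> A \<and> (\<forall>y\<in>U. y \<in> A \<longrightarrow> f y \<in> B)"
      using A by blast
  qed
qed

lemma continuous_map_Rn_iff:
  assumes "U \<subseteq> R_n n"
  shows "continuous_map (sub_n n U) euclidean f \<longleftrightarrow> continuous_on U f"
proof -
  have "sub_n n U = top_of_set U"
    using assms by (rule subtopology_Rn)
  thus ?thesis by simp
qed

section \<open>Functions of class k: locality, closure properties, chain rule, symmetry of second
  derivatives\<close>

lemmas Ck_simps = Ck_on.simps
declare Ck_on.simps [simp del]

lemma Ck_on_0: "U \<subseteq> R_n n \<Longrightarrow> Ck_on 0 n U f \<longleftrightarrow> continuous_on U f"
  by (simp add: Ck_simps continuous_map_Rn_iff)

lemma eventually_fun_upd_mem: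
  assumes "open_n n U" "z \<in> U" "i < n"
  shows "\<forall>\<^sub>F t in nhds (z i). z(i := t) \<in> U"
proof -
  obtain e where e: "e > 0" "nbox n z e \<subseteq> U"
    using assms by (auto simp: openin_Euclidean_iff)
  have "\<forall>\<^sub>F t in nhds (z i). \<bar>t - z i\<bar> < e"
    using e(1) by (auto simp: eventually_nhds_metric dist_real_def)
  thus ?thesis
  proof eventually_elim
    case (elim t)
    have "z(i := t) \<in> nbox n z e"
      using elim e assms openin_Rn_sub[OF assms(1)] by (auto simp: nbox_def R_n_iff)
    thus ?case using e by blast
  qed
qed

lemma pd_unique:
  "((\<lambda>t. f (z(i := t))) has_real_derivative D) (at (z i)) \<Longrightarrow> pd i f z = D"
  unfolding pd_def by (rule DERIV_imp_deriv)

lemma Ck_on_SucD: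
  assumes "Ck_on (Suc k) n U f" "U \<subseteq> R_n n"
  shows "continuous_on U f"
    "\<And>i z. i < n \<Longrightarrow> z \<in> U \<Longrightarrow> ((\<lambda>t. f (z(i := t))) has_real_derivative pd i f z) (at (z i))"
    "\<And>i. i < n \<Longrightarrow> Ck_on k n U (pd i f)"
  using assms by (auto simp: Ck_simps continuous_map_Rn_iff pd_def DERIV_deriv_iff_field_differentiable)

lemma has_derivative_cong_on:
  assumes "open_n n U" "z \<in> U" "i < n" "\<And>z. z \<in> U \<Longrightarrow> f z = g z"
  shows "((\<lambda>t. f (z(i := t))) has_real_derivative D) (at (z i)) \<longleftrightarrow>
    ((\<lambda>t. g (z(i := t))) has_real_derivative D) (at (z i))"
  by (rule DERIV_cong_ev) (use eventually_fun_upd_mem[OF assms(1-3)] assms(4) in \<open>auto elim: eventually_mono\<close>)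

lemma pd_cong_on:
  assumes "open_n n U" "z \<in> U" "i < n" "\<And>z. z \<in> U \<Longrightarrow> f z = g z"
  shows "pd i f z = pd i g z"
  unfolding pd_def
  by (rule deriv_cong_ev) (use eventually_fun_upd_mem[OF assms(1-3)] assms(4) in \<open>auto elim: eventually_mono\<close>)

lemma Ck_on_cong:
  assumes "open_n n U" "\<And>z. z \<in> U \<Longrightarrow> f z = g z" "Ck_on k n U f"
  shows "Ck_on k n U g"
  using assms(2,3)
proof (induction k arbitrary: f g)
  case 0
  thus ?case
    using openin_Rn_sub[OF assms(1)] continuous_on_cong[of U U f g] by (simp add: Ck_simps continuous_map_Rn_iff)
next
  case (Suc k)
  note U = openin_Rn_sub[OF assms(1)]
  note D = Ck_on_SucD[OF Suc.prems(2) U]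
  have "continuous_on U g"
    using D(1) Suc.prems(1) continuous_on_cong[of U U f g] by simp
  moreover have "((\<lambda>t. g (z(i := t))) has_real_derivative pd i f z) (at (z i))" if "i < n" "z \<in> U" for i z
    using D(2)[OF that] has_derivative_cong_on[OF assms(1) that(2,1), of f g] Suc.prems(1) by blast
  moreover have "Ck_on k n U (pd i g)" if "i < n" for i
    using Suc.IH[OF _ D(3)[OF that]] pd_cong_on[OF assms(1) _ that, of _ f g] Suc.prems(1) by blast
  ultimately show ?case
    using U by (auto simp: Ck_simps continuous_map_Rn_iff field_differentiable_def)
qed

lemma Ck_on_SucI:
  assumes "open_n n U" "continuous_on U f"
    "\<And>i z. i < n \<Longrightarrow> z \<in> U \<Longrightarrow> ((\<lambda>t. f (z(i := t))) has_real_derivative D i z) (at (z i))"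
    "\<And>i. i < n \<Longrightarrow> Ck_on k n U (D i)"
  shows "Ck_on (Suc k) n U f"
proof -
  have "Ck_on k n U (pd i f)" if "i < n" for i
    by (rule Ck_on_cong[OF assms(1) _ assms(4)[OF that]]) (simp add: pd_unique[OF assms(3)[OF that]])
  thus ?thesis
    using assms openin_Rn_sub[OF assms(1)]
    by (auto simp: Ck_simps continuous_map_Rn_iff field_differentiable_def)
qed

lemma Ck_on_SucE: "Ck_on (Suc k) n U f \<Longrightarrow> Ck_on k n U f"
  by (induction k arbitrary: f) (auto simp: Ck_simps)

lemma Ck_on_le: "Ck_on k n U f \<Longrightarrow> j \<le> k \<Longrightarrow> Ck_on j n U f"
  by (induction k) (auto simp: le_Suc_eq dest: Ck_on_SucE)

lemma Ck_on_subset: "Ck_on k n U f \<Longrightarrow> V \<subseteq> U \<Longrightarrow> Ck_on k n V f"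
proof (induction k arbitrary: f)
  case 0
  thus ?case by (auto simp: Ck_simps intro: continuous_map_from_subtopology_mono)
next
  case (Suc k)
  thus ?case by (fastforce simp: Ck_simps intro: continuous_map_from_subtopology_mono)
qed

lemma Ck_on_continuous: "Ck_on k n U f \<Longrightarrow> U \<subseteq> R_n n \<Longrightarrow> continuous_on U f"
  by (cases k) (auto simp: Ck_simps continuous_map_Rn_iff)

lemma continuous_on_coord: "continuous_on U (\<lambda>z::rvec. z i)"
  by (rule continuous_on_subset[OF continuous_on_product_coordinates]) simp

lemma Ck_on_const: "open_n n U \<Longrightarrow> Ck_on k n U (\<lambda>_. c)"
proof (induction k arbitrary: c)
  case 0
  thus ?case by (simp add: Ck_simps)
next
  case (Suc k)
  show ?case
    by (rule Ck_on_SucI[where D = "\<lambda>_ _. 0"]) (use Suc in \<open>auto intro!: derivative_eq_intros\<close>)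
qed

lemma Ck_on_coord:
  assumes "open_n n U"
  shows "Ck_on k n U (\<lambda>z. z i)"
proof (cases k)
  case 0
  thus ?thesis using Ck_on_0[OF openin_Rn_sub[OF assms]] continuous_on_coord by blast
next
  case (Suc k')
  show ?thesis unfolding Suc
  proof (rule Ck_on_SucI[where D = "\<lambda>j _. if j = i then 1 else 0"])
    fix j z
    show "((\<lambda>t. (z(j := t)) i) has_real_derivative (if j = i then 1 else 0)) (at (z j))"
      by auto
  qed (use assms in \<open>auto intro: Ck_on_const continuous_on_coord\<close>)
qed

lemma Ck_on_add:
  assumes "open_n n U" "Ck_on k n U f" "Ck_on k n U g"
  shows "Ck_on k n U (\<lambda>z. f z + g z)"
  using assms(2,3)
proof (induction k arbitrary: f g)
  case 0
  thus ?case using openin_Rn_sub[OF assms(1)] by (auto simp: Ck_on_0 intro: continuous_intros)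
next
  case (Suc k)
  note f = Ck_on_SucD[OF Suc.prems(1) openin_Rn_sub[OF assms(1)]]
  note g = Ck_on_SucD[OF Suc.prems(2) openin_Rn_sub[OF assms(1)]]
  show ?case
    by (rule Ck_on_SucI[where D = "\<lambda>i z. pd i f z + pd i g z"])
       (use assms(1) f g Suc.IH in \<open>auto intro!: continuous_intros derivative_eq_intros\<close>)
qed

lemma Ck_on_mult:
  assumes "open_n n U" "Ck_on k n U f" "Ck_on k n U g"
  shows "Ck_on k n U (\<lambda>z. f z * g z)"
  using assms(2,3)
proof (induction k arbitrary: f g)
  case 0
  thus ?case using openin_Rn_sub[OF assms(1)] by (auto simp: Ck_on_0 intro: continuous_intros)
next
  case (Suc k)
  note f = Ck_on_SucD[OF Suc.prems(1) openin_Rn_sub[OF assms(1)]] Ck_on_SucE[OF Suc.prems(1)]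
  note g = Ck_on_SucD[OF Suc.prems(2) openin_Rn_sub[OF assms(1)]] Ck_on_SucE[OF Suc.prems(2)]
  show ?case
  proof (rule Ck_on_SucI[where D = "\<lambda>i z. pd i f z * g z + pd i g z * f z"])
    fix i z assume "i < n" "z \<in> U"
    from DERIV_mult[OF f(2)[OF this] g(2)[OF this]]
    show "((\<lambda>t. f (z(i := t)) * g (z(i := t))) has_real_derivative pd i f z * g z + pd i g z * f z) (at (z i))"
      by (simp add: algebra_simps fun_upd_def)
  qed (use assms(1) f g Suc.IH Ck_on_add in \<open>auto intro!: continuous_intros\<close>)
qed

lemma Ck_on_inverse:
  assumes "open_n n U" "Ck_on k n U f" "\<And>z. z \<in> U \<Longrightarrow> f z \<noteq> 0"
  shows "Ck_on k n U (\<lambda>z. inverse (f z))"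
  using assms(2)
proof (induction k)
  case 0
  thus ?case using openin_Rn_sub[OF assms(1)] assms(3)
    by (auto simp: Ck_on_0 intro!: continuous_intros)
next
  case (Suc k)
  note f = Ck_on_SucD[OF Suc.prems(1) openin_Rn_sub[OF assms(1)]] Ck_on_SucE[OF Suc.prems(1)]
  note m = Ck_on_mult[OF assms(1)]
  \<comment> \<open>The derivative is written as a product of inverses, so that the induction
    hypothesis applies to its factors.\<close>
  show ?case
  proof (rule Ck_on_SucI[where D = "\<lambda>i z. (-1) * (pd i f z * (inverse (f z) * inverse (f z)))"])
    fix i z assume iz: "i < n" "z \<in> U"
    have "f (z(i := z i)) \<noteq> 0" using assms(3) iz by simp
    from DERIV_inverse'[OF f(2)[OF iz] this]
    show "((\<lambda>t. inverse (f (z(i := t)))) has_real_derivative (-1) * (pd i f z * (inverse (f z) * inverse (f z)))) (at (z i))"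
      by (simp add: algebra_simps fun_upd_def)
  next
    fix i assume "i < n"
    thus "Ck_on k n U (\<lambda>z. (-1) * (pd i f z * (inverse (f z) * inverse (f z))))"
      by (intro m Ck_on_const assms(1) f Suc.IH)
  qed (use assms(1,3) f in \<open>auto intro!: continuous_intros\<close>)
qed

lemma Ck_on_sum:
  assumes "open_n n U" "\<And>i. i \<in> I \<Longrightarrow> Ck_on k n U (f i)"
  shows "Ck_on k n U (\<lambda>z. \<Sum>i\<in>I. f i z)"
  using assms(2)
  by (induction I rule: infinite_finite_induct)
     (auto intro!: Ck_on_const Ck_on_add assms(1))

lemma Ck_on_prod:
  assumes "open_n n U" "\<And>i. i \<in> I \<Longrightarrow> Ck_on k n U (f i)"
  shows "Ck_on k n U (\<lambda>z. \<Prod>i\<in>I. f i z)"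
  using assms(2)
  by (induction I rule: infinite_finite_induct)
     (auto intro!: Ck_on_const Ck_on_mult assms(1))

lemma Ck_on_cmult: "open_n n U \<Longrightarrow> Ck_on k n U f \<Longrightarrow> Ck_on k n U (\<lambda>z. c * f z)"
  by (intro Ck_on_mult Ck_on_const)

lemma Ck_on_diff: "open_n n U \<Longrightarrow> Ck_on k n U f \<Longrightarrow> Ck_on k n U g \<Longrightarrow> Ck_on k n U (\<lambda>z. f z - g z)"
  using Ck_on_add[of n U k f "\<lambda>z. (-1) * g z"] Ck_on_cmult[of n U k g "-1"] by simp

lemma Ck_on_divide: "open_n n U \<Longrightarrow> Ck_on k n U f \<Longrightarrow> Ck_on k n U g \<Longrightarrow>
   (\<And>z. z \<in> U \<Longrightarrow> g z \<noteq> 0) \<Longrightarrow> Ck_on k n U (\<lambda>z. f z / g z)"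
  unfolding divide_inverse by (intro Ck_on_mult Ck_on_inverse)

text \<open>Being of class k is local. Statements about charts are proved near one point, with an
  auxiliary chart chosen for that point, and globalized by this lemma.\<close>

lemma Ck_on_nbhds:
  assumes "\<And>z. z \<in> U \<Longrightarrow> \<exists>V. open_n n V \<and> z \<in> V \<and> Ck_on k n V f"
    and "U \<subseteq> R_n n"
  shows "Ck_on k n U f"
  using assms(1)
proof (induction k arbitrary: f)
  case 0
  have "continuous_on U f"
    unfolding continuous_on_nbox_iff[OF assms(2)]
  proof (intro ballI allI impI)
    fix z e assume "z \<in> U" "0 < (e::real)"
    then obtain V where V: "open_n n V" "z \<in> V" "continuous_on V f"
      using 0 Ck_on_0 openin_Rn_sub by metis
    obtain d where d: "d > 0" "\<forall>w\<in>V \<inter> nbox n z d. dist (f w) (f z) < e"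
      using V(2,3) \<open>0 < e\<close> unfolding continuous_on_nbox_iff[OF openin_Rn_sub[OF V(1)]] by blast
    obtain d' where d': "d' > 0" "nbox n z d' \<subseteq> V"
      using V(1,2) by (auto simp: openin_Euclidean_iff)
    show "\<exists>d>0. \<forall>w\<in>U \<inter> nbox n z d. dist (f w) (f z) < e"
      using nbox_mono[of "min d d'" d n z] nbox_mono[of "min d d'" d' n z]
      d d' by (intro exI[of _ "min d d'"]) auto
  qed
  thus ?case using Ck_on_0[OF assms(2)] by blast
next
  case (Suc k)
  have "Ck_on 0 n U f"
  proof (rule Suc.IH[THEN Ck_on_le])
    fix z assume "z \<in> U"
    thus "\<exists>V. open_n n V \<and> z \<in> V \<and> Ck_on k n V f"
      using Suc.prems[of z] Ck_on_SucE[of k n _ f] by metis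
  qed simp
  moreover have "(\<lambda>t. f (z(i := t))) field_differentiable at (z i)" if "z \<in> U" "i < n" for z i
    using Suc.prems[OF that(1)] that by (auto simp: Ck_simps)
  moreover have "Ck_on k n U (pd i f)" if "i < n" for i
    using Suc.IH[of "pd i f"] Suc.prems that by (fastforce simp: Ck_simps)
  ultimately show ?case by (auto simp: Ck_simps)
qed

text \<open>Moving from z to x one coordinate at a time, with the one-variable mean value theorem
  for each move, writes the increment exactly as a linear form whose coefficients converge to the
  partial derivatives. In this form total differentiability yields the chain rule and the derivative
  of an inverse map by passing to the limit in finite sums.\<close>

lemma C1_increment:
  assumes U: "open_n n U" and f: "Ck_on 1 n U f" and z: "z \<in> U"
  shows "\<exists>q. (\<forall>x\<in>R_n n. f x - f z = (\<Sum>i<n. q i x * (x i - z i))) \<and>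
    (\<forall>i<n. \<forall>e>0. \<exists>d>0. \<forall>x\<in>nbox n z d. \<bar>q i x - pd i f z\<bar> < e)"
proof -
  note UR = openin_Rn_sub[OF U]
  note D = Ck_on_SucD[OF f[unfolded One_nat_def] UR]
  \<comment> \<open>\<open>h i x\<close> carries the first i coordinates of x and the others of z,
    so that consecutive points differ only in coordinate i. \<open>q\<close> is the difference
    quotient of that move, with the limit value inserted where the move is trivial.\<close>
  define h where "h i x = (\<lambda>j. if j < i then x j else z j)" for i :: nat and x :: rvec
  define q where "q i x = (if x i = z i then pd i f z else (f (h (Suc i) x) - f (h i x)) / (x i - z i))" for i x
  have hS: "h (Suc i) x = (h i x)(i := x i)" for i x
    by (auto simp: h_def less_Suc_eq)
  show ?thesis
  proof (intro exI[of _ q] conjI ballI allI impI)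
    fix x assume x: "x \<in> R_n n"
    have "h n x = x"
      using x z UR by (auto simp: h_def R_n_iff subset_iff fun_eq_iff)
    moreover have "h 0 x = z" by (simp add: h_def)
    ultimately have "f x - f z = (\<Sum>i<n. f (h (Suc i) x) - f (h i x))"
      using sum_lessThan_telescope[of "\<lambda>i. f (h i x)" n] by simp
    also have "\<dots> = (\<Sum>i<n. q i x * (x i - z i))"
    proof (rule sum.cong)
      fix i
      show "f (h (Suc i) x) - f (h i x) = q i x * (x i - z i)"
      proof (cases "x i = z i")
        case True
        hence "h (Suc i) x = h i x" by (auto simp: h_def less_Suc_eq)
        thus ?thesis using True by simp
      qed (simp add: q_def)
    qed simp
    finally show "f x - f z = (\<Sum>i<n. q i x * (x i - z i))" .
  next
    fix i and e :: real assume i: "i < n" and e: "0 < e"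
    have "continuous_on U (pd i f)"
      using D(3)[OF i] Ck_on_0[OF UR] by simp
    then obtain d1 where d1: "d1 > 0" "\<forall>w\<in>U \<inter> nbox n z d1. dist (pd i f w) (pd i f z) < e"
      using z e unfolding continuous_on_nbox_iff[OF UR] by blast
    obtain d2 where d2: "d2 > 0" "nbox n z d2 \<subseteq> U"
      using U z by (auto simp: openin_Euclidean_iff)
    define d where "d = min d1 d2"
    have dd: "nbox n z d \<subseteq> U" "nbox n z d \<subseteq> nbox n z d1"
      using d2 nbox_mono[of d d2 n z] nbox_mono[of d d1 n z] by (auto simp: d_def)
    show "\<exists>d>0. \<forall>x\<in>nbox n z d. \<bar>q i x - pd i f z\<bar> < e"
    proof (intro exI[of _ d] conjI ballI)
      show "d > 0" using d1 d2 by (simp add: d_def)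
      fix x assume x: "x \<in> nbox n z d"
      show "\<bar>q i x - pd i f z\<bar> < e"
      proof (cases "x i = z i")
        case True
        thus ?thesis using e by (simp add: q_def)
      next
        case False
        define y where "y t = (h i x)(i := t)" for t
        have y: "y t \<in> nbox n z d" if "min (x i) (z i) \<le> t" "t \<le> max (x i) (z i)" for t
        proof -
          have "\<bar>t - z i\<bar> \<le> \<bar>x i - z i\<bar>" using that by auto
          hence "\<bar>t - z i\<bar> < d" using x i by (force simp: nbox_def)
          thus ?thesis
            using x z UR i d1 d2 by (auto simp: nbox_def y_def h_def R_n_iff subset_iff d_def)
        qed
        have der: "((\<lambda>t. f (y t)) has_real_derivative pd i f (y t)) (at t)"
          if "min (x i) (z i) \<le> t" "t \<le> max (x i) (z i)" for t
          using D(2)[OF i, of "y t"] y[OF that] dd(1) by (auto simp: y_def)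
        have "min (x i) (z i) < max (x i) (z i)" using False by auto
        from MVT2[OF this der] obtain s where s: "min (x i) (z i) < s" "s < max (x i) (z i)"
          "f (y (max (x i) (z i))) - f (y (min (x i) (z i))) = (max (x i) (z i) - min (x i) (z i)) * pd i f (y s)"
          by metis
        have yx: "y (x i) = h (Suc i) x" "y (z i) = h i x"
          by (auto simp: y_def h_def less_Suc_eq)
        have "f (h (Suc i) x) - f (h i x) = (x i - z i) * pd i f (y s)"
          using s(3) yx by (cases "x i \<le> z i") (auto simp: min_def max_def algebra_simps)
        hence "q i x = pd i f (y s)"
          using False by (simp add: q_def)
        moreover have "y s \<in> U \<inter> nbox n z d1"
          using y[of s] s dd by auto
        ultimately show ?thesis using d1(2) by (auto simp: dist_real_def)
      qed
    qed
  qed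
qed

lemma eventually_nbox_curve:
  assumes "\<And>i. i < n \<Longrightarrow> ((cp u i) \<longlongrightarrow> u0 i) F" "\<forall>\<^sub>F t in F. u t \<in> R_n n" "0 < e"
  shows "\<forall>\<^sub>F t in F. u t \<in> nbox n u0 e"
proof -
  have "\<forall>i<n. \<forall>\<^sub>F t in F. \<bar>u t i - u0 i\<bar> < e"
    using assms(1,3) by (auto simp: tendsto_iff dist_real_def)
  hence "\<forall>\<^sub>F t in F. \<forall>i\<in>{..<n}. \<bar>u t i - u0 i\<bar> < e"
    by (intro eventually_ball_finite) auto
  with assms(2) show ?thesis
    by eventually_elim (auto simp: nbox_def)
qed

text \<open>Derivatives are taken within S, so that curves on closed intervals are covered at their
  end points too. The increment formula is divided by \<open>t - t0\<close>.\<close>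

lemma C1_chain:
  assumes U: "open_n n U" and f: "Ck_on 1 n U f" and z: "u t0 \<in> U"
    and uR: "\<forall>\<^sub>F t in at t0 within S. u t \<in> R_n n"
    and du: "\<And>i. i < n \<Longrightarrow> ((cp u i) has_real_derivative u' i) (at t0 within S)"
  shows "((\<lambda>t. f (u t)) has_real_derivative (\<Sum>i<n. pd i f (u t0) * u' i)) (at t0 within S)"
proof -
  obtain q where q: "\<And>x. x \<in> R_n n \<Longrightarrow> f x - f (u t0) = (\<Sum>i<n. q i x * (x i - u t0 i))"
    "\<And>i e. i < n \<Longrightarrow> 0 < e \<Longrightarrow> \<exists>d>0. \<forall>x\<in>nbox n (u t0) d. \<bar>q i x - pd i f (u t0)\<bar> < e"
    using C1_increment[OF U f z] by auto
  have lim: "((cp u i) \<longlongrightarrow> u t0 i) (at t0 within S)" if "i < n" for i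
    using DERIV_continuous[OF du[OF that]] by (simp add: continuous_within)
  have ql: "((\<lambda>t. q i (u t)) \<longlongrightarrow> pd i f (u t0)) (at t0 within S)" if i: "i < n" for i
  proof (rule tendstoI)
    fix e :: real assume "0 < e"
    then obtain d where d: "d > 0" "\<forall>x\<in>nbox n (u t0) d. \<bar>q i x - pd i f (u t0)\<bar> < e"
      using q(2)[OF i \<open>0 < e\<close>] by auto
    have "\<forall>\<^sub>F t in at t0 within S. u t \<in> nbox n (u t0) d"
      by (rule eventually_nbox_curve) (use lim uR d in auto)
    thus "\<forall>\<^sub>F t in at t0 within S. dist (q i (u t)) (pd i f (u t0)) < e"
      by eventually_elim (use d in \<open>auto simp: dist_real_def\<close>)
  qed
  have "((\<lambda>t. \<Sum>i<n. q i (u t) * ((u t i - u t0 i) / (t - t0))) \<longlongrightarrow> (\<Sum>i<n. pd i f (u t0) * u' i)) (at t0 within S)"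
    by (intro tendsto_intros ql) (use du in \<open>auto simp: has_field_derivative_iff\<close>)
  moreover have "\<forall>\<^sub>F t in at t0 within S. (\<Sum>i<n. q i (u t) * ((u t i - u t0 i) / (t - t0))) = (f (u t) - f (u t0)) / (t - t0)"
    using uR by eventually_elim (simp add: q(1) sum_divide_distrib)
  ultimately show ?thesis
    unfolding has_field_derivative_iff by (rule Lim_transform_eventually)
qed

lemma C1_MVT:
  assumes U: "open_n n U" and f: "Ck_on 1 n U f"
    and seg: "\<And>s. 0 \<le> s \<Longrightarrow> s \<le> 1 \<Longrightarrow> (\<lambda>i. z i + s * (x i - z i)) \<in> U"
  obtains s where "0 < s" "s < 1" "f x - f z = (\<Sum>i<n. pd i f (\<lambda>i. z i + s * (x i - z i)) * (x i - z i))"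
proof -
  define y where "y s = (\<lambda>i. z i + s * (x i - z i))" for s :: real
  have yR: "y s \<in> R_n n" for s
  proof -
    have "y 0 \<in> R_n n" "y 1 \<in> R_n n" using seg[of 0] seg[of 1] openin_Rn_sub[OF U] by (auto simp: y_def)
    thus ?thesis by (auto simp: R_n_iff y_def)
  qed
  have "((\<lambda>s. f (y s)) has_real_derivative (\<Sum>i<n. pd i f (y s) * (x i - z i))) (at s)" if "0 \<le> s" "s \<le> 1" for s
    by (rule C1_chain[OF U f]) (use seg[OF that] yR in \<open>auto simp: y_def intro!: derivative_eq_intros\<close>)
  from MVT2[of 0 1, OF _ this] obtain s where "0 < s" "s < 1" "f (y 1) - f (y 0) = (1 - 0) * (\<Sum>i<n. pd i f (y s) * (x i - z i))"
    by auto
  thus ?thesis by (intro that[of s]) (auto simp: y_def)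
qed

lemma continuous_on_vec:
  fixes \<Phi> :: "'x::topological_space \<Rightarrow> rvec"
  assumes "\<And>j. j < m \<Longrightarrow> continuous_on U (cp \<Phi> j)" "\<And>z. z \<in> U \<Longrightarrow> \<Phi> z \<in> R_n m"
  shows "continuous_on U \<Phi>"
proof (rule continuous_on_coordinatewise_then_product)
  fix j
  show "continuous_on U (cp \<Phi> j)"
  proof (cases "j < m")
    case False
    hence "continuous_on U (cp \<Phi> j) \<longleftrightarrow> continuous_on U (\<lambda>z. 0::real)"
      using assms(2) by (intro continuous_on_cong) (auto simp: R_n_iff)
    thus ?thesis by simp
  qed (rule assms)
qed

lemma pd_compose:
  assumes U: "open_n n U" and W: "open_n m W"
    and \<Phi>: "\<And>j. j < m \<Longrightarrow> Ck_on 1 n U (cp \<Phi> j)" "\<And>z. z \<in> U \<Longrightarrow> \<Phi> z \<in> W"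
    and f: "Ck_on 1 m W f" and iz: "i < n" "z \<in> U"
  shows "((\<lambda>t. f (\<Phi> (z(i := t)))) has_real_derivative
      (\<Sum>j<m. pd j f (\<Phi> z) * pd i (cp \<Phi> j) z)) (at (z i))"
proof -
  have "((\<lambda>t. f ((\<lambda>t. \<Phi> (z(i := t))) t)) has_real_derivative
      (\<Sum>j<m. pd j f ((\<lambda>t. \<Phi> (z(i := t))) (z i)) * pd i (cp \<Phi> j) z)) (at (z i))"
  proof (rule C1_chain[OF W f])
    show "\<forall>\<^sub>F t in at (z i). \<Phi> (z(i := t)) \<in> R_n m"
      using eventually_fun_upd_mem[OF U iz(2,1)] unfolding eventually_nhds_conv_at
      using \<Phi>(2) openin_Rn_sub[OF W] by (auto elim!: eventually_mono)
    fix j assume "j < m"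
    thus "((\<lambda>t. \<Phi> (z(i := t)) j) has_real_derivative pd i (cp \<Phi> j) z) (at (z i))"
      using Ck_on_SucD(2)[OF \<Phi>(1)[unfolded One_nat_def] openin_Rn_sub[OF U] iz] by simp
  qed (use \<Phi>(2) iz in auto)
  thus ?thesis by simp
qed

lemma Ck_on_compose:
  assumes U: "open_n n U" and W: "open_n m W"
    and \<Phi>: "\<And>j. j < m \<Longrightarrow> Ck_on k n U (cp \<Phi> j)" "\<And>z. z \<in> U \<Longrightarrow> \<Phi> z \<in> W"
    and f: "Ck_on k m W f"
  shows "Ck_on k n U (\<lambda>z. f (\<Phi> z))"
  using \<Phi>(1) f
proof (induction k arbitrary: f)
  case 0
  have "continuous_on U \<Phi>"
    using 0(1) \<Phi>(2) openin_Rn_sub[OF W] by (intro continuous_on_vec[of m]) (auto simp: Ck_on_0[OF openin_Rn_sub[OF U]])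
  thus ?case
    using 0(2) \<Phi>(2) unfolding Ck_on_0[OF openin_Rn_sub[OF U]] Ck_on_0[OF openin_Rn_sub[OF W]]
    by (auto intro: continuous_on_compose2[of W f U \<Phi>])
next
  case (Suc k)
  note UR = openin_Rn_sub[OF U]
  have C1: "Ck_on 1 n U (cp \<Phi> j)" if "j < m" for j
    using Suc.prems(1)[OF that] by (rule Ck_on_le) simp
  have \<Phi>k: "Ck_on k n U (cp \<Phi> j)" if "j < m" for j
    using Suc.prems(1)[OF that] by (rule Ck_on_SucE)
  show ?case
  proof (rule Ck_on_SucI[OF U, where D = "\<lambda>i z. \<Sum>j<m. pd j f (\<Phi> z) * pd i (cp \<Phi> j) z"])
    show "continuous_on U (\<lambda>z. f (\<Phi> z))"
      by (rule Ck_on_continuous[OF Suc.IH UR]) (use \<Phi>k Suc.prems Ck_on_SucE in auto)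
    show "((\<lambda>t. f (\<Phi> (z(i := t)))) has_real_derivative (\<Sum>j<m. pd j f (\<Phi> z) * pd i (cp \<Phi> j) z)) (at (z i))"
      if "i < n" "z \<in> U" for i z
      by (rule pd_compose[OF U W C1 \<Phi>(2) _ that]) (use Suc.prems(2) in \<open>auto intro: Ck_on_le\<close>)
    show "Ck_on k n U (\<lambda>z. \<Sum>j<m. pd j f (\<Phi> z) * pd i (cp \<Phi> j) z)" if i: "i < n" for i
    proof (rule Ck_on_sum[OF U])
      fix j assume "j \<in> {..<m}"
      hence j: "j < m" by simp
      have "Ck_on k n U (\<lambda>z. pd j f (\<Phi> z))"
        by (rule Suc.IH[OF \<Phi>k Ck_on_SucD(3)[OF Suc.prems(2) openin_Rn_sub[OF W] j]])
      thus "Ck_on k n U (\<lambda>z. pd j f (\<Phi> z) * pd i (cp \<Phi> j) z)"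
        by (rule Ck_on_mult[OF U _ Ck_on_SucD(3)[OF Suc.prems(1)[OF j] UR i]])
    qed
  qed
qed

text \<open>The mean value theorem is applied in direction i to the difference in direction j, and
  then in direction j to the result; the mixed second difference thus becomes one mixed partial
  derivative at a nearby point.\<close>

lemma second_difference:
  assumes U: "open_n n U" and f: "Ck_on 2 n U f" and z: "z \<in> R_n n" and e: "nbox n z e \<subseteq> U"
    and ij: "i < n" "j < n" "i \<noteq> j" and h: "0 < h" "h < e"
  obtains \<xi> where "\<xi> \<in> nbox n z e"
    "f (z(i := z i + h, j := z j + h)) - f (z(i := z i + h)) - f (z(j := z j + h)) + f z = h * h * pd j (pd i f) \<xi>"
proof -
  define y where "y s t = z(i := z i + s, j := z j + t)" for s t
  note UR = openin_Rn_sub[OF U]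
  note D = Ck_on_SucD[OF f[unfolded numeral_2_eq_2] UR]
  note D2 = Ck_on_SucD[OF D(3) UR]
  have yb: "y s t \<in> nbox n z e" if "0 \<le> s" "s \<le> h" "0 \<le> t" "t \<le> h" for s t
    using that h z ij by (auto simp: nbox_def y_def R_n_iff)
  have d1: "((\<lambda>s. f (y s t)) has_real_derivative pd i f (y s t)) (at s)"
    if "0 \<le> s" "s \<le> h" "0 \<le> t" "t \<le> h" for s t
  proof -
    have "((\<lambda>r. f ((y s t)(i := r))) has_real_derivative pd i f (y s t)) (at (z i + s))"
      using D(2)[OF ij(1), of "y s t"] yb[OF that] e ij by (auto simp: y_def)
    moreover have "((\<lambda>s. z i + s) has_real_derivative 1) (at s)"
      by (auto intro!: derivative_eq_intros)
    ultimately have "((\<lambda>s'. f ((y s t)(i := z i + s'))) has_real_derivative pd i f (y s t) * 1) (at s)"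
      by (rule DERIV_chain2)
    moreover have "(y s t)(i := z i + s') = y s' t" for s' using ij by (auto simp: y_def fun_upd_def)
    ultimately show ?thesis by simp
  qed
  have d2: "((\<lambda>t. pd i f (y s t)) has_real_derivative pd j (pd i f) (y s t)) (at t)"
    if "0 \<le> s" "s \<le> h" "0 \<le> t" "t \<le> h" for s t
  proof -
    have "((\<lambda>r. pd i f ((y s t)(j := r))) has_real_derivative pd j (pd i f) (y s t)) (at (z j + t))"
      using D2(2)[OF ij(1,2), of "y s t"] yb[OF that] e ij by (auto simp: y_def)
    moreover have "((\<lambda>s. z j + s) has_real_derivative 1) (at t)"
      by (auto intro!: derivative_eq_intros)
    ultimately have "((\<lambda>s'. pd i f ((y s t)(j := z j + s'))) has_real_derivative pd j (pd i f) (y s t) * 1) (at t)"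
      by (rule DERIV_chain2)
    moreover have "(y s t)(j := z j + s') = y s s'" for s' using ij by (auto simp: y_def fun_upd_def)
    ultimately show ?thesis by simp
  qed
  have "((\<lambda>s. f (y s h) - f (y s 0)) has_real_derivative pd i f (y s h) - pd i f (y s 0)) (at s)"
    if "0 \<le> s" "s \<le> h" for s
    using that h by (intro DERIV_diff d1) auto
  from MVT2[OF h(1) this] obtain s where s: "0 < s" "s < h"
    "f (y h h) - f (y h 0) - (f (y 0 h) - f (y 0 0)) = (h - 0) * (pd i f (y s h) - pd i f (y s 0))"
    by blast
  from s have "((\<lambda>t. pd i f (y s t)) has_real_derivative pd j (pd i f) (y s t)) (at t)"
    if "0 \<le> t" "t \<le> h" for t using that by (intro d2) auto
  from MVT2[OF h(1) this] obtain t where t: "0 < t" "t < h"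
    "pd i f (y s h) - pd i f (y s 0) = (h - 0) * pd j (pd i f) (y s t)"
    by blast
  have "y h 0 = z(i := z i + h)" "y 0 h = z(j := z j + h)" "y 0 0 = z" using ij by (auto simp: y_def)
  hence "f (z(i := z i + h, j := z j + h)) - f (z(i := z i + h)) - f (z(j := z j + h)) + f z = h * h * pd j (pd i f) (y s t)"
    using s(3) t(3) by (simp add: y_def)
  thus ?thesis using that[of "y s t"] yb[of s t] s t by auto
qed

text \<open>The second difference does not change when i and j are exchanged, so the two mixed
  derivatives take equal values at points arbitrarily close to z; continuity does the rest.\<close>

lemma pd_symmetric:
  assumes U: "open_n n U" and f: "Ck_on 2 n U f" and z: "z \<in> U"
    and ij: "i < n" "j < n"
  shows "pd j (pd i f) z = pd i (pd j f) z"
proof (rule ccontr)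
  assume ne: "pd j (pd i f) z \<noteq> pd i (pd j f) z"
  hence ij3: "i \<noteq> j" by auto
  \<comment> \<open>Half the supposed gap: on the chosen box each mixed derivative moves by less
    than this, too little for the two to meet.\<close>
  define e where "e = \<bar>pd j (pd i f) z - pd i (pd j f) z\<bar> / 2"
  have e: "e > 0" using ne by (simp add: e_def)
  note UR = openin_Rn_sub[OF U]
  have c: "continuous_on U (pd j (pd i f))" "continuous_on U (pd i (pd j f))"
    using f ij UR by (auto simp: numeral_2_eq_2 Ck_simps continuous_map_Rn_iff)
  obtain d1 where d1: "d1 > 0" "\<forall>w\<in>U \<inter> nbox n z d1. dist (pd j (pd i f) w) (pd j (pd i f) z) < e"
    using c(1) z e unfolding continuous_on_nbox_iff[OF UR] by blast
  obtain d2 where d2: "d2 > 0" "\<forall>w\<in>U \<inter> nbox n z d2. dist (pd i (pd j f) w) (pd i (pd j f) z) < e"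
    using c(2) z e unfolding continuous_on_nbox_iff[OF UR] by blast
  obtain d3 where d3: "d3 > 0" "nbox n z d3 \<subseteq> U"
    using U z by (auto simp: openin_Euclidean_iff)
  define d where "d = min d1 (min d2 d3)"
  have d: "0 < d" "nbox n z d \<subseteq> U" "nbox n z d \<subseteq> nbox n z d1" "nbox n z d \<subseteq> nbox n z d2"
    using d1 d2 d3 nbox_mono[of d d1 n z] nbox_mono[of d d2 n z] nbox_mono[of d d3 n z] unfolding d_def by (simp_all add: subset_trans[OF _ d3(2)])
  have h: "0 < d/2" "d/2 < d" using d by auto
  have zR: "z \<in> R_n n" using z UR by auto
  obtain \<xi> where xi: "\<xi> \<in> nbox n z d"
    "f (z(i := z i + d/2, j := z j + d/2)) - f (z(i := z i + d/2)) - f (z(j := z j + d/2)) + f z = d/2 * (d/2) * pd j (pd i f) \<xi>"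
    by (rule second_difference[OF U f zR d(2) ij ij3 h])
  obtain \<eta> where eta: "\<eta> \<in> nbox n z d"
    "f (z(j := z j + d/2, i := z i + d/2)) - f (z(j := z j + d/2)) - f (z(i := z i + d/2)) + f z = d/2 * (d/2) * pd i (pd j f) \<eta>"
    by (rule second_difference[OF U f zR d(2) ij(2,1) ij3[symmetric] h])
  have "d/2 * (d/2) * pd j (pd i f) \<xi> = d/2 * (d/2) * pd i (pd j f) \<eta>"
    using xi(2) eta(2) unfolding fun_upd_twist[OF ij3] by linarith
  hence "pd j (pd i f) \<xi> = pd i (pd j f) \<eta>" using d(1) by simp
  moreover have "\<bar>pd j (pd i f) \<xi> - pd j (pd i f) z\<bar> < e"
    using d1(2) xi(1) d by (auto simp: dist_real_def)
  moreover have "\<bar>pd i (pd j f) \<eta> - pd i (pd j f) z\<bar> < e"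
    using d2(2) eta(1) d by (auto simp: dist_real_def)
  moreover have "\<bar>pd j (pd i f) z - pd i (pd j f) z\<bar> \<le> \<bar>pd j (pd i f) \<xi> - pd j (pd i f) z\<bar> + \<bar>pd j (pd i f) \<xi> - pd i (pd j f) z\<bar>"
    by linarith
  ultimately show False by (simp add: e_def)
qed

section \<open>Determinants and inverse matrices with smooth entries\<close>

lemma det_n_sum:
  "det_n n a = (\<Sum>\<pi> | \<pi> permutes {0..<n}. of_int (sign \<pi>) * (\<Prod>i = 0..<n. a i (\<pi> i)))"
proof -
  have "det_n n a = (\<Sum>\<pi> | \<pi> permutes {0..<n}. of_int (sign \<pi>) * (\<Prod>i = 0..<n. Matrix.mat n n (\<lambda>(i, j). a i j) $$ (i, \<pi> i)))"
    unfolding det_n_def by (rule det_def') simp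
  also have "\<dots> = (\<Sum>\<pi> | \<pi> permutes {0..<n}. of_int (sign \<pi>) * (\<Prod>i = 0..<n. a i (\<pi> i)))"
    by (intro sum.cong prod.cong refl arg_cong2[where f = "(*)"]) (auto dest: permutes_in_image)
  finally show ?thesis .
qed

lemma Ck_on_det:
  assumes "open_n m U" "\<And>i j. i < n \<Longrightarrow> j < n \<Longrightarrow> Ck_on k m U (a i j)"
  shows "Ck_on k m U (\<lambda>z. det_n n (\<lambda>i j. a i j z))"
  unfolding det_n_sum
  by (intro Ck_on_sum Ck_on_mult Ck_on_prod Ck_on_const assms) (auto dest: permutes_in_image)

text \<open>Cramer's rule: column i is replaced by the unit vector j. As a quotient of polynomials
  in the entries, the inverse inherits their smoothness.\<close>

definition mat_inverse :: "nat \<Rightarrow> (nat \<Rightarrow> nat \<Rightarrow> real) \<Rightarrow> nat \<Rightarrow> nat \<Rightarrow> real" where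
  "mat_inverse n a i j = det_n n (\<lambda>r c. if c = i then (if r = j then 1 else 0) else a r c) / det_n n a"

lemma Ck_on_mat_inverse:
  assumes "open_n m U" "\<And>i j. i < n \<Longrightarrow> j < n \<Longrightarrow> Ck_on k m U (a i j)"
    "\<And>z. z \<in> U \<Longrightarrow> det_n n (\<lambda>i j. a i j z) \<noteq> 0"
  shows "Ck_on k m U (\<lambda>z. mat_inverse n (\<lambda>i j. a i j z) i j)"
proof -
  have "Ck_on k m U (\<lambda>z. det_n n (\<lambda>r c. (if c = i then (\<lambda>_. if r = j then 1 else 0) else a r c) z))"
    by (rule Ck_on_det) (use assms Ck_on_const in auto)
  moreover have "(\<lambda>z. det_n n (\<lambda>r c. (if c = i then (\<lambda>_. if r = j then 1 else 0) else a r c) z)) =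
     (\<lambda>z. det_n n (\<lambda>r c. if c = i then (if r = j then 1 else 0) else a r c z))"
    by (intro ext arg_cong[where f = "det_n n"]) auto
  ultimately show ?thesis
    unfolding mat_inverse_def by (intro Ck_on_divide[OF assms(1) _ Ck_on_det[OF assms(1,2)] assms(3)]) simp_all
qed

lemma mat_inverse:
  assumes "det_n n a \<noteq> 0" "i < n" "j < n"
  shows "(\<Sum>l<n. a i l * mat_inverse n a l j) = (if i = j then 1 else 0)"
    and "(\<Sum>l<n. mat_inverse n a i l * a l j) = (if i = j then 1 else 0)"
proof -
  define A where "A = Matrix.mat n n (\<lambda>(i, j). a i j)"
  have A: "A \<in> carrier_mat n n" by (simp add: A_def)
  have dA: "Determinant.det A \<noteq> 0" using assms(1) by (simp add: A_def det_n_def)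
  obtain B where B: "B \<in> carrier_mat n n" "A * B = 1\<^sub>m n" "B * A = 1\<^sub>m n"
    using det_non_zero_imp_unit[OF A dA] by (auto simp: Units_def ring_mat_def)
  have BI: "mat_inverse n a r c = B $$ (r, c)" if rc: "r < n" "c < n" for r c
  proof -
    have "A *\<^sub>v col B c = col (A * B) c" by (rule col_mult2[OF A B(1) rc(2), symmetric])
    hence "A *\<^sub>v col B c = Matrix.unit_vec n c" using B rc by simp
    moreover have "Determinant.det (replace_col A (A *\<^sub>v col B c) r) = col B c $ r * Determinant.det A"
      by (rule cramer_lemma_mat[OF A _ rc(1)]) (use B in auto)
    moreover have "replace_col A (Matrix.unit_vec n c) r = Matrix.mat n n (\<lambda>(i, j). if j = r then (if i = c then 1 else 0) else a i j)"
      by (rule eq_matI) (auto simp: replace_col_def A_def Matrix.unit_vec_def)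
    ultimately show ?thesis
      using dA rc B(1) by (simp add: mat_inverse_def det_n_def A_def[symmetric])
  qed
  have "(\<Sum>l<n. a i l * mat_inverse n a l j) = (A * B) $$ (i, j)"
    using assms B(1) BI by (simp add: A_def scalar_prod_def atLeast0LessThan)
  thus "(\<Sum>l<n. a i l * mat_inverse n a l j) = (if i = j then 1 else 0)"
    using B assms by simp
  have "(\<Sum>l<n. mat_inverse n a i l * a l j) = (B * A) $$ (i, j)"
    using assms B(1) BI by (simp add: A_def scalar_prod_def atLeast0LessThan)
  thus "(\<Sum>l<n. mat_inverse n a i l * a l j) = (if i = j then 1 else 0)"
    using B assms by simp
qed

lemma det_n_nonzero:
  assumes "\<And>v. v \<in> R_n n \<Longrightarrow> (\<And>i. i < n \<Longrightarrow> (\<Sum>j<n. a i j * v j) = 0) \<Longrightarrow> v = zero_n"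
  shows "det_n n a \<noteq> 0"
proof
  define A where "A = Matrix.mat n n (\<lambda>(i, j). a i j)"
  have A: "A \<in> carrier_mat n n" by (simp add: A_def)
  assume "det_n n a = 0"
  hence "Determinant.det A = 0" by (simp add: A_def det_n_def)
  then obtain v where v: "v \<in> carrier_vec n" "v \<noteq> 0\<^sub>v n" "A *\<^sub>v v = 0\<^sub>v n"
    using det_0_iff_vec_prod_zero[OF A] by auto
  define w where "w = (\<lambda>i. if i < n then v $ i else 0)"
  have "w = zero_n"
  proof (rule assms)
    show "w \<in> R_n n" by (simp add: w_def R_n_iff)
    fix i assume i: "i < n"
    have "(A *\<^sub>v v) $ i = (\<Sum>j<n. a i j * w j)"
      using i v(1) by (auto simp: A_def scalar_prod_def atLeast0LessThan w_def intro!: sum.cong)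
    thus "(\<Sum>j<n. a i j * w j) = 0" using v i by simp
  qed
  hence "v = 0\<^sub>v n"
    using v(1) by (intro eq_vecI) (auto simp: w_def fun_eq_iff split: if_splits)
  thus False using v by simp
qed

section \<open>Flows of smooth vector fields\<close>

text \<open>Closed boxes are compact and convex: the former gives uniform bounds, the latter the
  segments for the mean value theorem.\<close>

definition cnbox :: "nat \<Rightarrow> rvec \<Rightarrow> real \<Rightarrow> rvec set" where
  "cnbox n z e = {w \<in> R_n n. \<forall>i<n. \<bar>w i - z i\<bar> \<le> e}"

lemma compact_cnbox: "compact (cnbox n z e)"
proof -
  have "cnbox n z e = Pi\<^sub>E UNIV (\<lambda>i. if i < n then {z i - e..z i + e} else {0})" (is "_ = Pi\<^sub>E UNIV ?S")
  proof (rule Set.set_eqI)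
    fix w
    have "w \<in> Pi\<^sub>E UNIV ?S \<longleftrightarrow> (\<forall>i. w i \<in> ?S i)" by (simp add: PiE_iff)
    also have "\<dots> \<longleftrightarrow> (\<forall>i\<ge>n. w i = 0) \<and> (\<forall>i<n. \<bar>w i - z i\<bar> \<le> e)"
    proof (intro iffI conjI allI impI)
      fix i assume "\<forall>i. w i \<in> ?S i" "n \<le> i"
      thus "w i = 0" by (metis (full_types) leD singletonD)
    next
      fix i assume "\<forall>i. w i \<in> ?S i" "i < n"
      hence "w i \<in> {z i - e..z i + e}" by (metis (full_types))
      thus "\<bar>w i - z i\<bar> \<le> e" by (simp add: abs_le_iff)
    next
      fix i assume a: "(\<forall>i\<ge>n. w i = 0) \<and> (\<forall>i<n. \<bar>w i - z i\<bar> \<le> e)"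
      show "w i \<in> ?S i"
      proof (cases "i < n")
        case True
        hence "\<bar>w i - z i\<bar> \<le> e" using a by simp
        thus ?thesis using True by (simp add: abs_le_iff)
      qed (use a in simp)
    qed
    finally show "w \<in> cnbox n z e \<longleftrightarrow> w \<in> Pi\<^sub>E UNIV ?S" by (simp add: cnbox_def R_n_iff)
  qed
  moreover have "compactin (product_topology (\<lambda>i::nat. euclideanreal) UNIV) (Pi\<^sub>E UNIV ?S)"
    by (subst compactin_PiE) auto
  ultimately show ?thesis by (simp add: euclidean_product_topology)
qed

lemma cnbox_sub_nbox: "d < e \<Longrightarrow> cnbox n z d \<subseteq> nbox n z e"
  by (force simp: cnbox_def nbox_def)

lemma nbox_sub_cnbox: "nbox n z e \<subseteq> cnbox n z e"
  by (force simp: cnbox_def nbox_def)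

lemma cnbox_segment:
  assumes "x \<in> cnbox n z e" "y \<in> cnbox n z e" "0 \<le> s" "s \<le> 1"
  shows "(\<lambda>i. y i + s * (x i - y i)) \<in> cnbox n z e"
proof -
  have "\<bar>y i + s * (x i - y i) - z i\<bar> \<le> e" if "i < n" for i
  proof -
    have "y i + s * (x i - y i) - z i = (1 - s) * (y i - z i) + s * (x i - z i)"
      by (simp add: algebra_simps)
    also have "\<bar>\<dots>\<bar> \<le> (1 - s) * \<bar>y i - z i\<bar> + s * \<bar>x i - z i\<bar>"
      using assms(3,4) by (intro order_trans[OF abs_triangle_ineq]) (simp add: abs_mult)
    also have "\<dots> \<le> (1 - s) * e + s * e"
      using assms that by (intro add_mono mult_left_mono) (auto simp: cnbox_def)
    finally show ?thesis by (simp add: algebra_simps)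
  qed
  thus ?thesis using assms by (auto simp: cnbox_def R_n_iff)
qed

lemma C0_bounded_cnbox:
  fixes f :: "nat \<Rightarrow> rvec \<Rightarrow> real"
  assumes "\<And>i. i < k \<Longrightarrow> continuous_on (cnbox n z e) (f i)"
  obtains B where "0 \<le> B" "\<And>i x. i < k \<Longrightarrow> x \<in> cnbox n z e \<Longrightarrow> \<bar>f i x\<bar> \<le> B"
proof -
  have "\<exists>b\<ge>0. \<forall>x\<in>cnbox n z e. \<bar>f i x\<bar> \<le> b" if "i < k" for i
  proof -
    have "bounded (f i ` cnbox n z e)"
      using compact_continuous_image[OF assms[OF that] compact_cnbox] by (rule compact_imp_bounded)
    then obtain b where "\<forall>x\<in>cnbox n z e. \<bar>f i x\<bar> \<le> b"
      by (auto simp: bounded_iff)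
    thus ?thesis by (intro exI[of _ "max 0 b"]) force
  qed
  then obtain b where b: "\<And>i. i < k \<Longrightarrow> 0 \<le> b i \<and> (\<forall>x\<in>cnbox n z e. \<bar>f i x\<bar> \<le> b i)"
    by metis
  show ?thesis
  proof (rule that[of "\<Sum>i<k. b i"])
    show "0 \<le> (\<Sum>i<k. b i)" using b by (intro sum_nonneg) auto
    fix i x assume "i < k" "x \<in> cnbox n z e"
    hence "\<bar>f i x\<bar> \<le> b i" "b i \<le> (\<Sum>i<k. b i)"
      using b by (auto intro!: member_le_sum)
    thus "\<bar>f i x\<bar> \<le> (\<Sum>i<k. b i)" by linarith
  qed
qed

text \<open>The bound S on the coordinate differences is a free variable instead of their maximum.
  This form keeps its meaning for n = 0 and is the one in which \<open>gronwall_small\<close>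
  receives its hypothesis.\<close>

lemma C1_Lipschitz_cnbox:
  fixes f :: "nat \<Rightarrow> rvec \<Rightarrow> real"
  assumes U: "open_n n U" and f: "\<And>i. i < k \<Longrightarrow> Ck_on 1 n U (f i)" and sub: "cnbox n z e \<subseteq> U"
  shows "\<exists>L\<ge>0. \<forall>i<k. \<forall>x\<in>cnbox n z e. \<forall>y\<in>cnbox n z e. \<forall>S.
     (\<forall>j<n. \<bar>x j - y j\<bar> \<le> S) \<longrightarrow> \<bar>f i x - f i y\<bar> \<le> L * S"
proof -
  note UR = openin_Rn_sub[OF U]
  \<comment> \<open>The pair (i, j) is coded as \<open>l = i * n + j\<close>, so that a single
    constant bounds all first derivatives.\<close>
  have "continuous_on (cnbox n z e) (pd (l mod n) (f (l div n)))" if "l < k * n" for l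
  proof -
    have "l mod n < n" "l div n < k" using that by (auto simp: less_mult_imp_div_less) (cases n; simp)
    hence "Ck_on 0 n U (pd (l mod n) (f (l div n)))"
      using Ck_on_SucD(3)[OF f[unfolded One_nat_def] UR] by auto
    thus ?thesis using Ck_on_0[OF UR] continuous_on_subset sub by blast
  qed
  then obtain B where B: "0 \<le> B" "\<And>l x. l < k * n \<Longrightarrow> x \<in> cnbox n z e \<Longrightarrow> \<bar>pd (l mod n) (f (l div n)) x\<bar> \<le> B"
    using C0_bounded_cnbox[of "k * n" n z e "\<lambda>l. pd (l mod n) (f (l div n))"] by metis
  have B': "\<bar>pd j (f i) x\<bar> \<le> B" if "i < k" "j < n" "x \<in> cnbox n z e" for i j x
  proof -
    have "i * n + j < k * n"
    proof -
      have "i * n + j < Suc i * n" using that by simp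
      also have "\<dots> \<le> k * n" using that by (intro mult_le_mono1) simp
      finally show ?thesis .
    qed
    from B(2)[OF this that(3)] show ?thesis using that by simp
  qed
  show ?thesis
  proof (intro exI[of _ "real n * B"] conjI allI ballI impI)
    show "0 \<le> real n * B" using B by simp
    fix i x y S assume i: "i < k" and x: "x \<in> cnbox n z e" and y: "y \<in> cnbox n z e"
      and S': "\<forall>j<n. \<bar>x j - y j\<bar> \<le> S"
    hence S: "\<And>j. j < n \<Longrightarrow> \<bar>x j - y j\<bar> \<le> S" by simp
    obtain s where s: "0 < s" "s < 1" "f i x - f i y = (\<Sum>j<n. pd j (f i) (\<lambda>j. y j + s * (x j - y j)) * (x j - y j))"
      by (rule C1_MVT[OF U f[OF i], of y x]) (use cnbox_segment[OF x y] sub in auto)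
    have "\<bar>f i x - f i y\<bar> \<le> (\<Sum>j<n. \<bar>pd j (f i) (\<lambda>j. y j + s * (x j - y j)) * (x j - y j)\<bar>)"
      unfolding s(3) by (rule sum_abs)
    also have "\<dots> \<le> (\<Sum>j<n. B * S)"
      unfolding abs_mult
      by (intro sum_mono mult_mono B' S i cnbox_segment x y) (use s B in auto)
    finally show "\<bar>f i x - f i y\<bar> \<le> real n * B * S" by simp
  qed
qed

text \<open>On an interval with \<open>\<tau> * L \<le> 1/2\<close> the exponential estimate reduces
  to an absorption: the supremum S of all coordinates over all times satisfies
  \<open>S \<le> c0 + \<tau> * (L * S + C)\<close>, and the term with S moves to the left
  side.\<close>

lemma gronwall_small:
  fixes w w' :: "real \<Rightarrow> rvec"
  assumes ab: "t0 \<in> {a..b}" "b - a \<le> \<tau>"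
    and der: "\<And>t i. t \<in> {a..b} \<Longrightarrow> i < m \<Longrightarrow> ((cp w i) has_real_derivative w' t i) (at t within {a..b})"
    and bnd: "\<And>t i S. t \<in> {a..b} \<Longrightarrow> i < m \<Longrightarrow> (\<And>j. j < m \<Longrightarrow> \<bar>w t j\<bar> \<le> S) \<Longrightarrow> \<bar>w' t i\<bar> \<le> L * S + C"
    and init: "\<And>i. i < m \<Longrightarrow> \<bar>w t0 i\<bar> \<le> c0"
    and L: "0 \<le> L" "0 \<le> C" "\<tau> * L \<le> 1/2"
    and t: "t \<in> {a..b}" "i < m"
  shows "\<bar>w t i\<bar> \<le> 2 * (c0 + \<tau> * C)"
proof -
  \<comment> \<open>One supremum over times and coordinates together; it is finite because each
    coordinate is continuous on a compact interval.\<close>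
  define Z where "Z = (\<lambda>(t, i). \<bar>w t i\<bar>) ` ({a..b} \<times> {..<m})"
  have "bdd_above ((\<lambda>t. \<bar>w t i\<bar>) ` {a..b})" if "i < m" for i
  proof -
    have "continuous_on {a..b} (cp w i)"
      using der[OF _ that] by (intro DERIV_continuous_on) auto
    hence "continuous_on {a..b} (\<lambda>t. \<bar>w t i\<bar>)" by (intro continuous_intros)
    from compact_continuous_image[OF this] show ?thesis
      by (intro bounded_imp_bdd_above compact_imp_bounded) auto
  qed
  hence "bdd_above (\<Union>i<m. (\<lambda>t. \<bar>w t i\<bar>) ` {a..b})"
    by (intro bdd_above_UN[THEN iffD2]) auto
  moreover have "Z = (\<Union>i<m. (\<lambda>t. \<bar>w t i\<bar>) ` {a..b})" by (auto simp: Z_def)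
  ultimately have bd: "bdd_above Z" by simp
  define S where "S = Sup Z"
  have S: "\<bar>w t i\<bar> \<le> S" if "t \<in> {a..b}" "i < m" for t i
    unfolding S_def by (rule cSup_upper[OF _ bd]) (use that in \<open>auto simp: Z_def\<close>)
  have S0: "0 \<le> S" using S[OF t] by linarith
  have est: "\<bar>w t i\<bar> \<le> c0 + \<tau> * (L * S + C)" if ti: "t \<in> {a..b}" "i < m" for t i
  proof -
    have "norm (w t i - w t0 i) \<le> (L * S + C) * norm (t - t0)"
      by (rule field_differentiable_bound[of "{a..b}" "\<lambda>t. w t i" "\<lambda>t. w' t i"])
         (use der ti bnd S ab in auto)
    also have "\<dots> \<le> (L * S + C) * \<tau>"
      using ti ab L S0 by (intro mult_left_mono) auto
    finally show ?thesis using init[OF ti(2)] by (simp add: mult.commute)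
  qed
  have "S \<le> c0 + \<tau> * (L * S + C)"
    unfolding S_def
  proof (rule cSup_least)
    show "Z \<noteq> {}" using t by (auto simp: Z_def)
  qed (use est in \<open>auto simp: Z_def S_def\<close>)
  also have "\<dots> = c0 + \<tau> * L * S + \<tau> * C" by (simp add: algebra_simps)
  also have "\<tau> * L * S \<le> 1/2 * S" using L S0 by (intro mult_right_mono) auto
  finally have "S \<le> 2 * (c0 + \<tau> * C)" by simp
  thus ?thesis using S[OF t] by linarith
qed

text \<open>Derivatives are taken within J: a closed interval carries one-sided derivatives at its
  ends, while for open J they are the usual ones.\<close>

definition ode_sol :: "nat \<Rightarrow> (nat \<Rightarrow> rvec \<Rightarrow> real) \<Rightarrow> rvec set \<Rightarrow> real set \<Rightarrow> (real \<Rightarrow> rvec) \<Rightarrow> bool" where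
  "ode_sol m V U J x \<longleftrightarrow> (\<forall>t\<in>J. x t \<in> U \<and>
     (\<forall>i<m. ((cp x i) has_real_derivative V i (x t)) (at t within J)))"

lemma ode_solD:
  assumes "ode_sol m V U J x" "t \<in> J"
  shows "x t \<in> U" "i < m \<Longrightarrow> ((cp x i) has_real_derivative V i (x t)) (at t within J)"
  using assms by (auto simp: ode_sol_def)

lemma ode_sol_subset: "ode_sol m V U J x \<Longrightarrow> J' \<subseteq> J \<Longrightarrow> ode_sol m V U J' x"
  unfolding ode_sol_def by (blast intro: DERIV_subset)

lemma ode_sol_near:
  assumes x: "ode_sol m V U J x" and t: "t \<in> J" and U: "U \<subseteq> R_n m" and e: "0 < e"
  shows "\<exists>d>0. \<forall>s\<in>J. \<bar>s - t\<bar> < d \<longrightarrow> x s \<in> nbox m (x t) e"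
proof -
  have "((cp x i) \<longlongrightarrow> x t i) (at t within J)" if "i < m" for i
    using DERIV_continuous[OF ode_solD(2)[OF x t that]] by (simp add: continuous_within)
  moreover have "\<forall>\<^sub>F s in at t within J. x s \<in> R_n m"
    using ode_solD(1)[OF x] U by (auto simp: eventually_at intro!: exI[of _ 1])
  ultimately have "\<forall>\<^sub>F s in at t within J. x s \<in> nbox m (x t) e"
    using e by (intro eventually_nbox_curve) auto
  then obtain d where "d > 0" "\<forall>s\<in>J. s \<noteq> t \<and> dist s t < d \<longrightarrow> x s \<in> nbox m (x t) e"
    unfolding eventually_at by auto
  moreover have "x t \<in> nbox m (x t) e"
    using ode_solD(1)[OF x t] U e by (intro nbox_center) auto
  ultimately show ?thesis
    by (intro exI[of _ d]) (auto simp: dist_real_def)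
qed

text \<open>Agreement is propagated over the connected set J. Near a time of disagreement the
  solutions keep disagreeing by continuity; near a time of agreement both stay in one box, where the
  Lipschitz bound and \<open>gronwall_small\<close> with zero data force them to coincide.\<close>

lemma ode_unique:
  assumes U: "open_n m U" and V: "\<And>i. i < m \<Longrightarrow> Ck_on 1 m U (V i)"
    and J: "is_interval J" and x: "ode_sol m V U J x" and y: "ode_sol m V U J y"
    and t0: "t0 \<in> J" "x t0 = y t0" and t: "t \<in> J"
  shows "x t = y t"
proof -
  note UR = openin_Rn_sub[OF U]
  show ?thesis
  proof (rule connected_induction_simple[where S = J and P = "\<lambda>t. x t = y t" and a = t0 and b = t])
    show "connected J" using J by (rule is_interval_connected)
    fix a assume a: "a \<in> J"
    show "\<exists>T. openin (top_of_set J) T \<and> a \<in> T \<and> (\<forall>u\<in>T. \<forall>v\<in>T. x u = y u \<longrightarrow> x v = y v)"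
    proof (cases "x a = y a")
      case False
      then obtain i where i: "x a i \<noteq> y a i" by (auto simp: fun_eq_iff)
      have "x a \<in> R_n m" "y a \<in> R_n m" using ode_solD(1)[OF x a] ode_solD(1)[OF y a] UR by auto
      with i have im: "i < m" by (metis R_n_iff linorder_not_less)
      define e where "e = \<bar>x a i - y a i\<bar> / 2"
      have e: "0 < e" using i by (simp add: e_def)
      obtain d1 where d1: "d1 > 0" "\<forall>s\<in>J. \<bar>s - a\<bar> < d1 \<longrightarrow> x s \<in> nbox m (x a) e"
        using ode_sol_near[OF x a UR e] by auto
      obtain d2 where d2: "d2 > 0" "\<forall>s\<in>J. \<bar>s - a\<bar> < d2 \<longrightarrow> y s \<in> nbox m (y a) e"
        using ode_sol_near[OF y a UR e] by auto
      define T where "T = J \<inter> ball a (min d1 d2)"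
      have "x u \<noteq> y u" if "u \<in> T" for u
      proof
        assume eq: "x u = y u"
        have "\<bar>x u i - x a i\<bar> < e" "\<bar>y u i - y a i\<bar> < e"
          using that d1 d2 im by (auto simp: T_def nbox_def dist_real_def abs_minus_commute)
        moreover have "\<bar>x a i - y a i\<bar> \<le> \<bar>x u i - x a i\<bar> + \<bar>x u i - y a i\<bar>" by linarith
        ultimately show False using eq by (simp add: e_def)
      qed
      thus ?thesis
        using d1 d2 a by (intro exI[of _ T]) (auto simp: T_def openin_open)
    next
      case True
      obtain e where e: "e > 0" "nbox m (x a) e \<subseteq> U"
        using ode_solD(1)[OF x a] U by (auto simp: openin_Euclidean_iff)
      define r where "r = e / 2"
      have r: "0 < r" "cnbox m (x a) r \<subseteq> U"
        using e cnbox_sub_nbox[of r e m "x a"] by (auto simp: r_def)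
      obtain L where L: "0 \<le> L" "\<forall>i<m. \<forall>x'\<in>cnbox m (x a) r. \<forall>y\<in>cnbox m (x a) r. \<forall>S.
           (\<forall>j<m. \<bar>x' j - y j\<bar> \<le> S) \<longrightarrow> \<bar>V i x' - V i y\<bar> \<le> L * S"
        using C1_Lipschitz_cnbox[where k = m and f = V, OF U V r(2)] by auto
      obtain d1 where d1: "d1 > 0" "\<forall>s\<in>J. \<bar>s - a\<bar> < d1 \<longrightarrow> x s \<in> nbox m (x a) r"
        using ode_sol_near[OF x a UR r(1)] by auto
      obtain d2 where d2: "d2 > 0" "\<forall>s\<in>J. \<bar>s - a\<bar> < d2 \<longrightarrow> y s \<in> nbox m (y a) r"
        using ode_sol_near[OF y a UR r(1)] by auto
      \<comment> \<open>Two times within \<tau> of a span at most \<open>2 * \<tau>\<close>, so it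
        is \<open>2 * \<tau> * L\<close> that has to be at most 1/2.\<close>
      define \<tau> where "\<tau> = min (min d1 d2) (1 / (4 * (L + 1)))"
      have \<tau>: "0 < \<tau>" using d1 d2 L by (simp add: \<tau>_def)
      have "\<tau> * L \<le> 1 / (4 * (L + 1)) * L" using L by (intro mult_right_mono) (auto simp: \<tau>_def)
      also have "\<dots> \<le> 1/4" using L by (simp add: field_simps)
      finally have \<tau>L: "2 * \<tau> * L \<le> 1/2" by simp
      have main: "x v = y v" if uv: "u \<in> J" "v \<in> J" "\<bar>u - a\<bar> < \<tau>" "\<bar>v - a\<bar> < \<tau>" "x u = y u" for u v
      proof -
        define A where "A = {min u v..max u v}"
        have AJ: "A \<subseteq> J"
        proof
          fix s assume s: "s \<in> A"
          have "min u v \<in> J" "max u v \<in> J" using uv by (auto simp: min_def max_def)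
          thus "s \<in> J" using J s mem_is_interval_1_I unfolding A_def by (metis atLeastAtMost_iff)
        qed
        have Ab: "\<bar>s - a\<bar> < \<tau>" if "s \<in> A" for s
          using that uv by (auto simp: A_def min_def max_def split: if_splits)
        have bx: "x s \<in> cnbox m (x a) r" "y s \<in> cnbox m (x a) r" if "s \<in> A" for s
          using d1 d2 Ab[OF that] AJ that True nbox_sub_cnbox[of m "x a" r] by (auto simp: \<tau>_def)
        have "\<bar>(\<lambda>i. x v i - y v i) i\<bar> \<le> 2 * (0 + 2 * \<tau> * 0)" if i: "i < m" for i
        proof (rule gronwall_small[where w = "\<lambda>t i. x t i - y t i" and w' = "\<lambda>t i. V i (x t) - V i (y t)"
              and a = "min u v" and b = "max u v" and L = L and ?t0.0 = u and m = m])
          show "max u v - min u v \<le> 2 * \<tau>" using uv by (auto simp: min_def max_def)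
          fix s j assume s: "s \<in> {min u v..max u v}" and j: "j < m"
          have "((cp x j) has_real_derivative V j (x s)) (at s within A)"
               "((cp y j) has_real_derivative V j (y s)) (at s within A)"
            using ode_solD(2)[OF ode_sol_subset[OF x AJ]] ode_solD(2)[OF ode_sol_subset[OF y AJ]] s j by (auto simp: A_def)
          thus "((\<lambda>t. x t j - y t j) has_real_derivative V j (x s) - V j (y s)) (at s within {min u v..max u v})"
            unfolding A_def by (rule DERIV_diff)
          fix S assume "\<And>j. j < m \<Longrightarrow> \<bar>x s j - y s j\<bar> \<le> S"
          thus "\<bar>V j (x s) - V j (y s)\<bar> \<le> L * S + 0"
            using L(2)[rule_format, OF j bx(1) bx(2)] s by (auto simp: A_def)
        qed (use i uv L \<tau>L in auto)
        hence "x v i = y v i" if "i < m" for i using that by simp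
        moreover have "x v i = y v i" if "\<not> i < m" for i
        proof -
          have "x v \<in> R_n m" "y v \<in> R_n m" using ode_solD(1)[OF x uv(2)] ode_solD(1)[OF y uv(2)] UR by auto
          thus ?thesis using that by (simp add: R_n_iff)
        qed
        ultimately show ?thesis by blast
      qed
      show ?thesis
      proof (intro exI[of _ "J \<inter> ball a \<tau>"] conjI ballI impI)
        show "openin (top_of_set J) (J \<inter> ball a \<tau>)" by (auto simp: openin_open)
        show "a \<in> J \<inter> ball a \<tau>" using a \<tau> by simp
        fix u v assume "u \<in> J \<inter> ball a \<tau>" "v \<in> J \<inter> ball a \<tau>" "x u = y u"
        thus "x v = y v" by (intro main[of u v]) (auto simp: dist_real_def abs_minus_commute)
      qed
    qed
  qed (use t0 t in auto)
qed

text \<open>The metric induced from the reals is discrete on \<open>nat\<close>. It makes coordinate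
  index, time and initial value together a metric space, the domain of the bounded continuous
  functions to which the contraction principle is applied.\<close>

instantiation nat :: metric_space
begin

definition dist_nat :: "nat \<Rightarrow> nat \<Rightarrow> real" where "dist_nat m n = \<bar>real m - real n\<bar>"

definition uniformity_nat :: "(nat \<times> nat) filter" where
  "uniformity_nat = (INF e\<in>{0 <..}. principal {(x, y). dist x y < e})"

instance
proof
  fix U :: "nat set"
  have diag: "{(x, y). dist x y < (1::real)} = {(x, y :: nat). x = y}"
    by (auto simp: dist_nat_def)
  have "eventually (\<lambda>(x', y). x' = x \<longrightarrow> y \<in> U) uniformity" if "x \<in> U" for x
    unfolding uniformity_nat_def
    by (rule eventually_INF1[where i = 1]) (use that in \<open>auto simp: eventually_principal diag\<close>)
  thus "open U \<longleftrightarrow> (\<forall>x\<in>U. \<forall>\<^sub>F (x', y) in uniformity. x' = x \<longrightarrow> y \<in> U)"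
    by (auto simp: open_discrete)
qed (auto simp: dist_nat_def uniformity_nat_def)

end

text \<open>Clamping the argument to a box makes the vector field globally bounded and Lipschitz, so that
  the Picard operator contracts the bounded continuous functions of the coordinate index, the
  time and the initial value together; its fixed point depends continuously on all of them.\<close>

lemma continuous_on_nat_pair:
  fixes f :: "nat \<times> 'x::topological_space \<Rightarrow> real"
  assumes "\<And>i. continuous_on UNIV (\<lambda>x. f (i, x))"
  shows "continuous_on UNIV f"
proof -
  have "continuous_on (\<Union>i. {i} \<times> UNIV) f"
  proof (rule continuous_on_open_UN)
    fix i :: nat
    show "open ({i} \<times> (UNIV :: 'x set))" by (intro open_Times) (auto simp: open_discrete)
    have "continuous_on ({i} \<times> UNIV) (\<lambda>y. f (i, snd y))"
      by (rule continuous_on_compose2[OF assms]) (auto intro: continuous_intros)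
    thus "continuous_on ({i} \<times> UNIV) f"
      by (rule continuous_on_eq) auto
  qed
  moreover have "(\<Union>i. {i} \<times> UNIV) = (UNIV :: (nat \<times> 'x) set)" by auto
  ultimately show ?thesis by simp
qed

lemma picard:
  fixes V :: "nat \<Rightarrow> rvec \<Rightarrow> real"
  assumes z0: "z0 \<in> R_n m" and r: "0 < r"
    and cont: "\<And>i. i < m \<Longrightarrow> continuous_on (cnbox m z0 r) (V i)"
    and K: "0 \<le> K" "\<And>i x. i < m \<Longrightarrow> x \<in> cnbox m z0 r \<Longrightarrow> \<bar>V i x\<bar> \<le> K"
    and L: "0 \<le> L" "\<And>i x y S. i < m \<Longrightarrow> x \<in> cnbox m z0 r \<Longrightarrow> y \<in> cnbox m z0 r \<Longrightarrow>
       \<forall>j<m. \<bar>x j - y j\<bar> \<le> S \<Longrightarrow> \<bar>V i x - V i y\<bar> \<le> L * S"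
    and T: "0 < \<tau>" "\<tau> * L \<le> 1/2" "\<tau> * K \<le> r / 2"
  shows "\<exists>\<Phi>. (\<forall>z\<in>cnbox m z0 (r/2). \<Phi> 0 z = z \<and> ode_sol m V (cnbox m z0 r) {-\<tau>..\<tau>} (cp \<Phi> z)) \<and>
     (\<forall>t i. continuous_on UNIV (\<lambda>z. if i < m then \<Phi> t z i else 0))"
proof -
  define cl where "cl z = (\<lambda>i. if i < m then max (z0 i - r) (min (z0 i + r) (z i)) else 0)" for z :: rvec
  have cl_in: "cl z \<in> cnbox m z0 r" for z
    using r by (auto simp: cl_def cnbox_def R_n_iff abs_le_iff max_def min_def)
  have cl_id: "cl z = z" if "z \<in> cnbox m z0 r" for z
  proof
    fix i
    show "cl z i = z i"
    proof (cases "i < m")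
      case True
      hence "\<bar>z i - z0 i\<bar> \<le> r" using that by (simp add: cnbox_def)
      thus ?thesis using True by (simp add: cl_def abs_le_iff max_def min_def)
    next
      case False
      thus ?thesis using that by (simp add: cnbox_def R_n_iff cl_def)
    qed
  qed
  have cl_lip: "\<bar>cl x j - cl y j\<bar> \<le> \<bar>x j - y j\<bar>" for x y j
    by (simp add: cl_def max_def min_def)
  define W where "W i x = (if i < m then V i (cl x) else 0)" for i x
  have W_cont: "continuous_on UNIV (W i)" for i
  proof (cases "i < m")
    case True
    have "continuous_on UNIV cl"
    proof (rule continuous_on_coordinatewise_then_product)
      fix j
      show "continuous_on UNIV (cp cl j)"
        unfolding cl_def by (cases "j < m") (auto intro!: continuous_intros continuous_on_coord)
    qed
    hence "continuous_on UNIV (\<lambda>x. V i (cl x))"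
      by (rule continuous_on_compose2[OF cont[OF True]]) (use cl_in in auto)
    moreover have "W i = (\<lambda>x. V i (cl x))" using True by (auto simp: W_def)
    ultimately show ?thesis by simp
  next
    case False
    hence "W i = zero_n" by (auto simp: W_def)
    thus ?thesis by simp
  qed
  have W_K: "\<bar>W i x\<bar> \<le> K" for i x
    using K cl_in by (auto simp: W_def)
  have W_L: "\<bar>W i x - W i y\<bar> \<le> L * S" if "\<And>j. \<bar>x j - y j\<bar> \<le> S" for i x y S
  proof (cases "i < m")
    case True
    have "\<bar>V i (cl x) - V i (cl y)\<bar> \<le> L * S"
      by (rule L(2)[OF True cl_in cl_in]) (use that cl_lip order_trans in blast)
    thus ?thesis using True by (simp add: W_def)
  next
    case False
    have "0 \<le> S" using that[of 0] by linarith
    thus ?thesis using False L by (simp add: W_def)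
  qed
  define ct where "ct t = max (-\<tau>) (min \<tau> t)" for t
  have ct: "\<bar>ct t\<bar> \<le> \<tau>" for t using T by (auto simp: ct_def)
  have ct_id: "ct t = t" if "t \<in> {-\<tau>..\<tau>}" for t using that by (auto simp: ct_def)
  \<comment> \<open>The unknown Y is the displacement from the initial value, which stays bounded,
    unlike the solution itself. The substitution \<open>s * t\<close> moves the integral from [0, t]
    to the fixed interval [0, 1], on which it depends continuously on all parameters.\<close>
  define G :: "((nat \<times> real \<times> rvec) \<Rightarrow>\<^sub>C real) \<Rightarrow> nat \<Rightarrow> real \<times> rvec \<Rightarrow> real \<Rightarrow> real" where
    "G Y i x s = W i (\<lambda>j. snd x j + apply_bcontfun Y (j, s * ct (fst x), snd x))" for Y i x s
  have G_cont: "continuous_on (UNIV \<times> cbox 0 1) (\<lambda>(x, s). G Y i x s)" for Y i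
  proof -
    have "continuous_on UNIV (\<lambda>y::(real \<times> rvec) \<times> real. \<lambda>j. snd (fst y) j + apply_bcontfun Y (j, snd y * ct (fst (fst y)), snd (fst y)))"
    proof (rule continuous_on_coordinatewise_then_product)
      fix j :: nat
      have "continuous_on UNIV (\<lambda>y::(real \<times> rvec) \<times> real. (j, snd y * ct (fst (fst y)), snd (fst y)))"
        unfolding ct_def by (intro continuous_intros)
      hence "continuous_on UNIV (\<lambda>y::(real \<times> rvec) \<times> real. apply_bcontfun Y (j, snd y * ct (fst (fst y)), snd (fst y)))"
        by (rule continuous_on_compose2[OF continuous_on_apply_bcontfun[of UNIV]]) auto
      moreover have "continuous_on UNIV (\<lambda>y::(real \<times> rvec) \<times> real. snd (fst y) j)"
        by (rule continuous_on_compose2[OF continuous_on_coord[of UNIV j], OF continuous_on_snd[OF continuous_on_fst[OF continuous_on_id]]]) simp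
      ultimately show "continuous_on UNIV (\<lambda>y::(real \<times> rvec) \<times> real. snd (fst y) j + apply_bcontfun Y (j, snd y * ct (fst (fst y)), snd (fst y)))"
        by (intro continuous_on_add)
    qed
    from continuous_on_compose2[OF W_cont this, of i]
    have "continuous_on UNIV (\<lambda>y. G Y i (fst y) (snd y))" by (simp add: G_def)
    thus ?thesis
      unfolding case_prod_beta by (rule continuous_on_subset) simp
  qed
  have G_int: "G Y i x integrable_on {0..1}" for Y i x
  proof -
    have "continuous_on {0..1} (\<lambda>s. G Y i x s)"
    proof -
      have c: "continuous_on {0..1::real} (\<lambda>s. (x, s))" by (intro continuous_intros)
      have "continuous_on {0..1} (\<lambda>s. case (x, s) of (x, s) \<Rightarrow> G Y i x s)"
        by (rule continuous_on_compose2[OF G_cont[of Y i] c]) auto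
      thus ?thesis by simp
    qed
    thus ?thesis by (rule integrable_continuous_interval)
  qed
  define F0 where "F0 Y = (\<lambda>y. ct (fst (snd y)) * integral {0..1} (G Y (fst y) (snd y)))" for Y
  have F0_K: "\<bar>F0 Y y\<bar> \<le> \<tau> * K" for Y y
  proof -
    have "norm (integral {0..1} (G Y (fst y) (snd y))) \<le> integral {0..1::real} (\<lambda>_. K)"
      by (rule Henstock_Kurzweil_Integration.integral_norm_bound_integral) (use G_int W_K in \<open>auto simp: G_def\<close>)
    hence "\<bar>integral {0..1} (G Y (fst y) (snd y))\<bar> \<le> K" by simp
    thus ?thesis
      unfolding F0_def abs_mult using ct T K by (intro mult_mono) auto
  qed
  have F0_cont: "continuous_on UNIV (F0 Y)" for Y
  proof (rule continuous_on_nat_pair)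
    fix i
    have "continuous_on UNIV (\<lambda>x. integral (cbox 0 1) (G Y i x))"
      by (rule integral_continuous_on_param[OF G_cont])
    thus "continuous_on UNIV (\<lambda>x. F0 Y (i, x))"
      unfolding F0_def ct_def by (auto intro!: continuous_intros simp: cbox_interval)
  qed
  have F0_b: "F0 Y \<in> bcontfun" for Y
    unfolding bcontfun_def bounded_iff
    using F0_cont[of Y] F0_K[of Y] by (auto intro!: exI[of _ "\<tau> * K"])
  define F where "F Y = Bcontfun (F0 Y)" for Y
  have F: "apply_bcontfun (F Y) = F0 Y" for Y
    unfolding F_def by (rule Bcontfun_inverse[OF F0_b])
  have "dist (F Y) (F Y') \<le> 1/2 * dist Y Y'" for Y Y'
  proof (rule dist_bound)
    fix y
    have "norm (integral {0..1} (\<lambda>s. G Y (fst y) (snd y) s - G Y' (fst y) (snd y) s)) \<le> integral {0..1::real} (\<lambda>_. L * dist Y Y')"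
    proof (rule Henstock_Kurzweil_Integration.integral_norm_bound_integral)
      fix s :: real
      have "\<bar>apply_bcontfun Y u - apply_bcontfun Y' u\<bar> \<le> dist Y Y'" for u
        using dist_bounded[of Y u Y'] by (simp add: dist_real_def)
      thus "norm (G Y (fst y) (snd y) s - G Y' (fst y) (snd y) s) \<le> L * dist Y Y'"
        unfolding G_def real_norm_def by (intro W_L) simp
      show "(\<lambda>s. G Y (fst y) (snd y) s - G Y' (fst y) (snd y) s) integrable_on {0..1}"
        by (rule Henstock_Kurzweil_Integration.integrable_diff[OF G_int G_int])
    qed (rule integrable_const_ivl)
    hence "\<bar>integral {0..1} (G Y (fst y) (snd y)) - integral {0..1} (G Y' (fst y) (snd y))\<bar> \<le> L * dist Y Y'"
      using G_int by (simp add: Henstock_Kurzweil_Integration.integral_diff)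
    hence "\<bar>F0 Y y - F0 Y' y\<bar> \<le> \<tau> * (L * dist Y Y')"
      unfolding F0_def right_diff_distrib[symmetric] abs_mult using ct T L by (intro mult_mono) auto
    also have "\<dots> \<le> 1/2 * dist Y Y'"
      using mult_right_mono[OF T(2) zero_le_dist[of Y Y']] by (simp add: mult.assoc)
    finally show "dist (apply_bcontfun (F Y) y) (apply_bcontfun (F Y') y) \<le> 1/2 * dist Y Y'"
      by (simp add: F dist_real_def)
  qed
  hence lip: "\<forall>Y Y'. dist (F Y) (F Y') \<le> 1/2 * dist Y Y'" by simp
  have "\<exists>!Y. F Y = Y" by (rule banach_fix_type[where f = F and c = "1/2"]) (use lip in auto)
  then obtain Y where Y: "F Y = Y" by auto
  hence Yf: "apply_bcontfun Y y = F0 Y y" for y using F by metis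
  define \<Phi> where "\<Phi> t z = (\<lambda>i. if i < m then z i + apply_bcontfun Y (i, t, z) else 0)" for t z
  have \<Phi>0: "\<Phi> 0 z = z" if "z \<in> cnbox m z0 (r/2)" for z
  proof
    fix i
    have "ct 0 = 0" using T by (simp add: ct_def)
    thus "\<Phi> 0 z i = z i"
      using that unfolding \<Phi>_def Yf F0_def by (simp add: cnbox_def R_n_iff)
  qed
  have \<Phi>in: "\<Phi> t z \<in> cnbox m z0 r" if z: "z \<in> cnbox m z0 (r/2)" for t z
  proof -
    have "\<bar>\<Phi> t z i - z0 i\<bar> \<le> r" if i: "i < m" for i
    proof -
      have "\<bar>z i - z0 i\<bar> \<le> r/2" using z i by (simp add: cnbox_def)
      moreover have "\<bar>apply_bcontfun Y (i, t, z)\<bar> \<le> r/2" using F0_K[of Y "(i, t, z)"] T(3) Yf by simp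
      moreover have "\<Phi> t z i = z i + apply_bcontfun Y (i, t, z)" using i by (simp add: \<Phi>_def)
      ultimately show ?thesis by linarith
    qed
    thus ?thesis by (simp add: cnbox_def R_n_iff \<Phi>_def)
  qed
  have sol: "((\<lambda>t. \<Phi> t z i) has_real_derivative V i (\<Phi> t z)) (at t within {-\<tau>..\<tau>})"
    if z: "z \<in> cnbox m z0 (r/2)" and t: "t \<in> {-\<tau>..\<tau>}" and i: "i < m" for z t i
  proof -
    \<comment> \<open>For a fixed initial value the substitution is undone: with H a primitive of h,
      the fixed point equation says that the displacement is \<open>H t - H 0\<close>.\<close>
    define h where "h \<sigma> = W i (\<lambda>j. z j + apply_bcontfun Y (j, \<sigma>, z))" for \<sigma>
    have hc: "continuous_on UNIV h"
    proof -
      have "continuous_on UNIV (\<lambda>\<sigma> j. z j + apply_bcontfun Y (j, \<sigma>, z))"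
      proof (rule continuous_on_coordinatewise_then_product)
        fix j
        have "continuous_on UNIV (\<lambda>\<sigma>. apply_bcontfun Y (j, \<sigma>, z))"
          by (rule continuous_on_compose2[OF continuous_on_apply_bcontfun[of UNIV]]) (auto intro!: continuous_intros)
        thus "continuous_on UNIV (\<lambda>\<sigma>. z j + apply_bcontfun Y (j, \<sigma>, z))"
          by (intro continuous_intros)
      qed
      from continuous_on_compose2[OF W_cont this] show ?thesis by (simp add: h_def)
    qed
    have hV: "h \<sigma> = V i (\<Phi> \<sigma> z)" for \<sigma>
    proof -
      have "cl (\<lambda>j. z j + apply_bcontfun Y (j, \<sigma>, z)) = cl (\<Phi> \<sigma> z)"
        by (rule ext) (auto simp: cl_def \<Phi>_def)
      thus ?thesis using i cl_id[OF \<Phi>in[OF z]] by (simp add: h_def W_def)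
    qed
    define H where "H t = integral {-\<tau>..t} h" for t
    have dH: "(H has_real_derivative h t) (at t within {-\<tau>..\<tau>})" if "t \<in> {-\<tau>..\<tau>}" for t
      unfolding H_def by (rule integral_has_real_derivative) (use that continuous_on_subset[OF hc] in auto)
    have Y_eq: "apply_bcontfun Y (i, t, z) = H t - H 0" if t: "t \<in> {-\<tau>..\<tau>}" for t
    proof -
      have "((\<lambda>s. t * h (s * t)) has_integral (H (1 * t) - H (0 * t))) {0..1}"
      proof (rule fundamental_theorem_of_calculus)
        fix s :: real assume s: "s \<in> {0..1}"
        have st: "s * t \<in> {-\<tau>..\<tau>}" if "s \<in> {0..1}" for s
        proof -
          have "\<bar>s * t\<bar> \<le> 1 * \<tau>" unfolding abs_mult using that t T by (intro mult_mono) auto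
          thus ?thesis by auto
        qed
        have "((\<lambda>s. H (s * t)) has_real_derivative h (s * t) * t) (at s within {0..1})"
        proof (rule DERIV_image_chain[unfolded o_def, where f = H and g = "\<lambda>s. s * t"])
          show "(H has_real_derivative h (s * t)) (at (s * t) within (\<lambda>s. s * t) ` {0..1})"
            by (rule DERIV_subset[OF dH[OF st[OF s]]]) (use st in auto)
        qed (auto intro!: derivative_eq_intros)
        thus "((\<lambda>s. H (s * t)) has_vector_derivative t * h (s * t)) (at s within {0..1})"
          by (simp add: has_real_derivative_iff_has_vector_derivative mult.commute)
      qed simp
      from integral_unique[OF this] have "t * integral {0..1} (\<lambda>s. h (s * t)) = H t - H 0"
        by simp
      moreover have "F0 Y (i, t, z) = t * integral {0..1} (\<lambda>s. h (s * t))"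
      proof -
        have "G Y i (t, z) = (\<lambda>s. h (s * t))"
          by (rule ext) (simp add: G_def h_def ct_id[OF t])
        thus ?thesis using ct_id[OF t] by (simp add: F0_def)
      qed
      ultimately show ?thesis using Yf by simp
    qed
    have "((\<lambda>t. z i + (H t - H 0)) has_real_derivative h t) (at t within {-\<tau>..\<tau>})"
      using dH[OF t] by (auto intro!: derivative_eq_intros)
    hence "((\<lambda>t. \<Phi> t z i) has_real_derivative h t) (at t within {-\<tau>..\<tau>})"
      by (rule has_field_derivative_transform_within[where d = 1]) (use t Y_eq i in \<open>auto simp: \<Phi>_def\<close>)
    thus ?thesis using hV by simp
  qed
  have "continuous_on UNIV (\<lambda>z. if i < m then \<Phi> t z i else 0)" for t i
  proof (cases "i < m")
    case True
    have "continuous_on UNIV (\<lambda>z. apply_bcontfun Y (i, t, z))"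
      by (rule continuous_on_compose2[OF continuous_on_apply_bcontfun[of UNIV]]) (auto intro!: continuous_intros)
    thus ?thesis using True by (auto simp: \<Phi>_def intro!: continuous_intros continuous_on_coord)
  qed simp
  thus ?thesis
    using \<Phi>0 \<Phi>in sol by (intro exI[of _ \<Phi>]) (auto simp: ode_sol_def)
qed

section \<open>The first variation system on the doubled space and differentiability of
  flows\<close>

definition fst_n :: "nat \<Rightarrow> rvec \<Rightarrow> rvec" where "fst_n m w = (\<lambda>i. if i < m then w i else 0)"
definition snd_n :: "nat \<Rightarrow> rvec \<Rightarrow> rvec" where "snd_n m w = (\<lambda>i. if i < m then w (m + i) else 0)"

lemma fst_n_Rn: "fst_n m w \<in> R_n m" and snd_n_Rn: "snd_n m w \<in> R_n m"
  by (auto simp: fst_n_def snd_n_def R_n_iff)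

lemma join_Rn: "x \<in> R_n m \<Longrightarrow> y \<in> R_n k \<Longrightarrow> join m x y \<in> R_n (m + k)"
  by (auto simp: join_def R_n_iff)

lemma fst_n_join: "x \<in> R_n m \<Longrightarrow> fst_n m (join m x y) = x"
  and snd_n_join: "y \<in> R_n m \<Longrightarrow> snd_n m (join m x y) = y"
  by (auto simp: fst_n_def snd_n_def join_def R_n_iff fun_eq_iff)

lemma join_nth: "i < m \<Longrightarrow> join m x y i = x i" "join m x y (m + i) = y i"
  by (auto simp: join_def)

lemma join_nbox:
  assumes "x \<in> nbox m x0 e" "y \<in> nbox k y0 e"
  shows "join m x y \<in> nbox (m + k) (join m x0 y0) e"
  using assms by (auto simp: nbox_def join_Rn) (auto simp: join_def)

lemma openin_preimage_nbhd:
  assumes U: "open_n n U" and W: "open_n m W"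
    and c: "\<And>j. j < m \<Longrightarrow> continuous_on U (cp \<Phi> j)" and R: "\<And>z. z \<in> U \<Longrightarrow> \<Phi> z \<in> R_n m"
  shows "open_n n {z\<in>U. \<Phi> z \<in> W}"
proof -
  have "continuous_on U \<Phi>" using c R by (rule continuous_on_vec)
  moreover obtain V where V: "open V" "W = R_n m \<inter> V" using W by (auto simp: openin_Rn_open)
  ultimately have "openin (top_of_set U) (U \<inter> \<Phi> -` V)" by (simp add: continuous_openin_preimage_gen)
  moreover have "{z\<in>U. \<Phi> z \<in> W} = U \<inter> \<Phi> -` V" using R V(2) by auto
  ultimately have "openin (sub_n n U) {z\<in>U. \<Phi> z \<in> W}"
    by (simp add: subtopology_Rn[OF openin_Rn_sub[OF U]])
  thus ?thesis using U openin_trans_full by blast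
qed

definition tangent_open :: "nat \<Rightarrow> rvec set \<Rightarrow> rvec set" where
  "tangent_open m U = {w \<in> R_n (m + m). fst_n m w \<in> U}"

text \<open>The first variation system \<open>x' = V x\<close>, \<open>v' = DV(x) v\<close> on pairs
  (x, v): a solution of V together with a linearized perturbation of it.\<close>

definition tangent_field :: "nat \<Rightarrow> (nat \<Rightarrow> rvec \<Rightarrow> real) \<Rightarrow> nat \<Rightarrow> rvec \<Rightarrow> real" where
  "tangent_field m V i w = (if i < m then V i (fst_n m w) else \<Sum>j<m. pd j (V (i - m)) (fst_n m w) * w (m + j))"

lemma openin_Rn_top: "open_n n (R_n n)"
  by (rule openin_topspace)

lemma openin_tangent_open:
  assumes "open_n m U"
  shows "open_n (m + m) (tangent_open m U)"
  unfolding tangent_open_def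
  by (rule openin_preimage_nbhd[OF openin_Rn_top assms]) (auto simp: fst_n_Rn fst_n_def continuous_on_coord R_n_iff)

lemma Ck_on_smooth_pd:
  assumes "smooth_fun n U f" "i < n"
  shows "smooth_fun n U (pd i f)"
  using assms by (auto simp: smooth_fun_def) (metis Ck_simps(2))

lemma Ck_on_tangent_field:
  assumes U: "open_n m U" and V: "\<And>i. i < m \<Longrightarrow> smooth_fun m U (V i)" and i: "i < m + m"
  shows "smooth_fun (m + m) (tangent_open m U) (tangent_field m V i)"
  unfolding smooth_fun_def
proof
  fix k
  note O = openin_tangent_open[OF U]
  have comp: "Ck_on k (m + m) (tangent_open m U) (\<lambda>w. f (fst_n m w))" if "smooth_fun m U f" for f
  proof (rule Ck_on_compose[OF O U, where \<Phi> = "fst_n m"])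
    fix j assume "j < m"
    hence "(\<lambda>w. fst_n m w j) = (\<lambda>w. w j)" by (auto simp: fst_n_def)
    thus "Ck_on k (m + m) (tangent_open m U) (\<lambda>w. fst_n m w j)"
      using Ck_on_coord[OF O] by simp
  qed (use that in \<open>auto simp: tangent_open_def smooth_fun_def\<close>)
  show "Ck_on k (m + m) (tangent_open m U) (tangent_field m V i)"
  proof (cases "i < m")
    case True
    hence "tangent_field m V i = (\<lambda>w. V i (fst_n m w))" by (auto simp: tangent_field_def fun_eq_iff)
    thus ?thesis using comp[OF V[OF True]] by simp
  next
    case False
    hence im: "i - m < m" using i by simp
    have "Ck_on k (m + m) (tangent_open m U) (\<lambda>w. \<Sum>j<m. pd j (V (i - m)) (fst_n m w) * w (m + j))"
      by (rule Ck_on_sum[OF O], rule Ck_on_mult[OF O], rule comp, rule Ck_on_smooth_pd[OF V[OF im]])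
         (auto intro: Ck_on_coord[OF O])
    moreover have "tangent_field m V i = (\<lambda>w. \<Sum>j<m. pd j (V (i - m)) (fst_n m w) * w (m + j))"
      using False by (auto simp: tangent_field_def fun_eq_iff)
    ultimately show ?thesis by simp
  qed
qed

lemma smooth_fun_subset: "smooth_fun n U f \<Longrightarrow> V \<subseteq> U \<Longrightarrow> smooth_fun n V f"
  unfolding smooth_fun_def using Ck_on_subset by blast

lemma smooth_fun_Ck: "smooth_fun n U f \<Longrightarrow> Ck_on k n U f"
  by (simp add: smooth_fun_def)

definition local_flow ::
  "nat \<Rightarrow> rvec set \<Rightarrow> (nat \<Rightarrow> rvec \<Rightarrow> real) \<Rightarrow> rvec \<Rightarrow> real \<Rightarrow> real \<Rightarrow> (real \<Rightarrow> rvec \<Rightarrow> rvec) \<Rightarrow> bool" where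
  "local_flow m U V z0 \<delta> \<tau> \<Phi> \<longleftrightarrow> 0 < \<delta> \<and> 0 < \<tau> \<and>
     (\<forall>z\<in>nbox m z0 \<delta>. \<Phi> 0 z = z \<and> ode_sol m V U {-\<tau>..\<tau>} (cp \<Phi> z))"

abbreviation (input) Ck_flow :: "nat \<Rightarrow> nat \<Rightarrow> rvec set \<Rightarrow> (nat \<Rightarrow> rvec \<Rightarrow> real) \<Rightarrow> rvec \<Rightarrow> bool" where
  "Ck_flow k m U V z0 \<equiv> \<exists>\<delta> \<tau> \<Phi>. local_flow m U V z0 \<delta> \<tau> \<Phi> \<and>
    (\<forall>t\<in>{-\<tau>..\<tau>}. \<forall>i<m. Ck_on k m (nbox m z0 \<delta>) (\<lambda>z. \<Phi> t z i))"

lemma local_flow_C0: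
  assumes U: "open_n m U" and V: "\<And>i. i < m \<Longrightarrow> smooth_fun m U (V i)" and z0: "z0 \<in> U"
  shows "Ck_flow 0 m U V z0"
proof -
  note UR = openin_Rn_sub[OF U]
  obtain e where e: "e > 0" "nbox m z0 e \<subseteq> U" using z0 U by (auto simp: openin_Euclidean_iff)
  define r where "r = e / 2"
  have r: "0 < r" "cnbox m z0 r \<subseteq> U"
    using e cnbox_sub_nbox[of r e m z0] by (auto simp: r_def)
  have cont: "continuous_on (cnbox m z0 r) (V i)" if "i < m" for i
    using Ck_on_continuous[OF smooth_fun_Ck[OF V[OF that]] UR] r(2) continuous_on_subset by metis
  obtain K where K: "0 \<le> K" "\<And>i x. i < m \<Longrightarrow> x \<in> cnbox m z0 r \<Longrightarrow> \<bar>V i x\<bar> \<le> K"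
    using C0_bounded_cnbox[of m m z0 r V] cont by metis
  obtain L where L: "0 \<le> L" "\<forall>i<m. \<forall>x\<in>cnbox m z0 r. \<forall>y\<in>cnbox m z0 r. \<forall>S.
       (\<forall>j<m. \<bar>x j - y j\<bar> \<le> S) \<longrightarrow> \<bar>V i x - V i y\<bar> \<le> L * S"
    using C1_Lipschitz_cnbox[where k = m and f = V, OF U smooth_fun_Ck[OF V] r(2)] by auto
  \<comment> \<open>The first entry secures the contraction factor 1/2, the second keeps solutions
    starting in the half-size box inside the full one; the summands 1 keep the denominators
    positive.\<close>
  define \<tau> where "\<tau> = min (1 / (2 * (L + 1))) (r / (2 * (K + 1)))"
  have \<tau>: "0 < \<tau>" using r L K by (simp add: \<tau>_def)
  have "\<tau> * L \<le> 1 / (2 * (L + 1)) * L" using L by (intro mult_right_mono) (auto simp: \<tau>_def)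
  also have "\<dots> \<le> 1/2" using L by (simp add: field_simps)
  finally have \<tau>L: "\<tau> * L \<le> 1/2" .
  have "\<tau> * K \<le> r / (2 * (K + 1)) * K" using K by (intro mult_right_mono) (auto simp: \<tau>_def)
  also have "\<dots> \<le> r/2" using K r by (simp add: field_simps)
  finally have \<tau>K: "\<tau> * K \<le> r/2" .
  have z0R: "z0 \<in> R_n m" using z0 UR by auto
  have L2: "\<bar>V i x - V i y\<bar> \<le> L * S" if "i < m" "x \<in> cnbox m z0 r" "y \<in> cnbox m z0 r" "\<forall>j<m. \<bar>x j - y j\<bar> \<le> S" for i x y S
    using L(2) that by simp
  have "\<exists>\<Phi>. (\<forall>z\<in>cnbox m z0 (r/2). \<Phi> 0 z = z \<and> ode_sol m V (cnbox m z0 r) {-\<tau>..\<tau>} (cp \<Phi> z)) \<and>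
     (\<forall>t i. continuous_on UNIV (\<lambda>z. if i < m then \<Phi> t z i else 0))"
    by (rule picard[OF z0R r(1) cont K L(1) L2 \<tau> \<tau>L \<tau>K])
  then obtain \<Phi> where \<Phi>: "\<forall>z\<in>cnbox m z0 (r/2). \<Phi> 0 z = z \<and> ode_sol m V (cnbox m z0 r) {-\<tau>..\<tau>} (cp \<Phi> z)"
     "\<forall>t i. continuous_on UNIV (\<lambda>z. if i < m then \<Phi> t z i else 0)"
    by (elim exE conjE)
  show ?thesis
  proof (intro exI conjI ballI allI impI)
    show "local_flow m U V z0 (r/2) \<tau> \<Phi>"
      unfolding local_flow_def
    proof (intro conjI ballI)
      fix z assume "z \<in> nbox m z0 (r/2)"
      hence z: "z \<in> cnbox m z0 (r/2)" using nbox_sub_cnbox by blast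
      thus "\<Phi> 0 z = z" using \<Phi> by blast
      have "ode_sol m V (cnbox m z0 r) {-\<tau>..\<tau>} (cp \<Phi> z)" using z \<Phi> by blast
      thus "ode_sol m V U {-\<tau>..\<tau>} (cp \<Phi> z)" using r(2) unfolding ode_sol_def by blast
    qed (use r \<tau> in auto)
    fix t i assume "i < m"
    hence "continuous_on UNIV (\<lambda>z. \<Phi> t z i)" using \<Phi>(2)[rule_format, of i t] by simp
    thus "Ck_on 0 m (nbox m z0 (r/2)) (\<lambda>z. \<Phi> t z i)"
      using Ck_on_0[OF openin_Rn_sub[OF openin_nbox]] continuous_on_subset by blast
  qed
qed

text \<open>The candidate for the derivative in the initial value is read off the flow of
  \<open>tangent_field\<close>, which is of class k by the induction hypothesis; that hypothesis
  ranges over all dimensions because the tangent field lives in dimension \<open>m + m\<close>. The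
  remainder of the candidate solves a linear equation with quadratically small inhomogeneity, so
  \<open>gronwall_small\<close> bounds it by a multiple of \<open>h\<^sup>2\<close>.\<close>

lemma local_flow_Ck_Suc:
  assumes IH: "\<And>m U V z0. open_n m U \<Longrightarrow> (\<And>i. i < m \<Longrightarrow> smooth_fun m U (V i)) \<Longrightarrow> z0 \<in> U \<Longrightarrow>
      Ck_flow k m U V z0"
    and U: "open_n m U" and V: "\<And>i. i < m \<Longrightarrow> smooth_fun m U (V i)" and z0: "z0 \<in> U"
  shows "Ck_flow (Suc k) m U V z0"
proof -
  note UR = openin_Rn_sub[OF U]
  have z0R: "z0 \<in> R_n m" using z0 UR by auto
  obtain e where e: "e > 0" "nbox m z0 e \<subseteq> U" using z0 U by (auto simp: openin_Euclidean_iff)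
  define r where "r = e / 2"
  have r: "0 < r" "cnbox m z0 r \<subseteq> U"
    using e cnbox_sub_nbox[of r e m z0] by (auto simp: r_def)
  define U' where "U' = nbox m z0 r"
  have U': "open_n m U'" "U' \<subseteq> U" "U' \<subseteq> cnbox m z0 r"
    using openin_nbox nbox_sub_cnbox[of m z0 r] r by (simp_all add: U'_def)
  have V': "smooth_fun m U' (V i)" if "i < m" for i
    using V[OF that] U'(2) by (rule smooth_fun_subset)
  \<comment> \<open>The base point with zero variation: a box around it in the doubled space
    contains all pairs of a nearby point and a small vector.\<close>
  define w0 where "w0 = join m z0 zero_n"
  have zero_R: "zero_n \<in> R_n m" by (simp add: R_n_iff)
  have w0: "w0 \<in> tangent_open m U'"
    using z0R r by (auto simp: w0_def tangent_open_def fst_n_join join_Rn zero_R U'_def nbox_center)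
  have Vt: "smooth_fun (m + m) (tangent_open m U') (tangent_field m V i)" if "i < m + m" for i
    by (rule Ck_on_tangent_field[OF U'(1) V' that])
  from IH[where V = "tangent_field m V", OF openin_tangent_open[OF U'(1)] Vt w0]
  obtain \<delta> \<tau>0 \<Psi> where \<Psi>: "local_flow (m + m) (tangent_open m U') (tangent_field m V) w0 \<delta> \<tau>0 \<Psi>"
    "\<forall>t\<in>{-\<tau>0..\<tau>0}. \<forall>i<m+m. Ck_on k (m + m) (nbox (m + m) w0 \<delta>) (\<lambda>z. \<Psi> t z i)"
    by auto
  have \<delta>: "0 < \<delta>" "0 < \<tau>0" using \<Psi> by (auto simp: local_flow_def)
  obtain L1 where L1: "0 \<le> L1" "\<forall>i<m. \<forall>x\<in>cnbox m z0 r. \<forall>y\<in>cnbox m z0 r. \<forall>S.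
       (\<forall>j<m. \<bar>x j - y j\<bar> \<le> S) \<longrightarrow> \<bar>V i x - V i y\<bar> \<le> L1 * S"
    using C1_Lipschitz_cnbox[where k = m and f = V, OF U smooth_fun_Ck[OF V] r(2)] by auto
  have pdC: "Ck_on 1 m U (pd (l mod m) (V (l div m)))" if "l < m * m" for l
  proof -
    have "l mod m < m" "l div m < m" using that by (auto simp: less_mult_imp_div_less) (cases m; simp)
    thus ?thesis using smooth_fun_Ck[OF Ck_on_smooth_pd[OF V]] by blast
  qed
  obtain L2 where L2: "0 \<le> L2" "\<forall>l<m*m. \<forall>x\<in>cnbox m z0 r. \<forall>y\<in>cnbox m z0 r. \<forall>S.
       (\<forall>j<m. \<bar>x j - y j\<bar> \<le> S) \<longrightarrow> \<bar>pd (l mod m) (V (l div m)) x - pd (l mod m) (V (l div m)) y\<bar> \<le> L2 * S"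
    using C1_Lipschitz_cnbox[where k = "m*m" and f = "\<lambda>l. pd (l mod m) (V (l div m))", OF U pdC r(2)] by auto
  have "continuous_on (cnbox m z0 r) (pd (l mod m) (V (l div m)))" if "l < m * m" for l
    using Ck_on_continuous[OF pdC[OF that] UR] r(2) continuous_on_subset by metis
  then obtain B where B: "0 \<le> B" "\<And>l x. l < m * m \<Longrightarrow> x \<in> cnbox m z0 r \<Longrightarrow> \<bar>pd (l mod m) (V (l div m)) x\<bar> \<le> B"
    using C0_bounded_cnbox[of "m * m" m z0 r "\<lambda>l. pd (l mod m) (V (l div m))"] by metis
  have idx: "i * m + j < m * m" "(i * m + j) mod m = j" "(i * m + j) div m = i" if "i < m" "j < m" for i j
  proof -
    have "i * m + j < Suc i * m" using that by simp
    also have "\<dots> \<le> m * m" using that by (intro mult_le_mono1) simp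
    finally show "i * m + j < m * m" .
  qed (use that in auto)
  have B': "\<bar>pd j (V i) x\<bar> \<le> B" if "i < m" "j < m" "x \<in> cnbox m z0 r" for i j x
    using B(2)[OF idx(1)[OF that(1,2)] that(3)] unfolding idx[OF that(1,2)] .
  have L2': "\<bar>pd j (V i) x - pd j (V i) y\<bar> \<le> L2 * S"
    if "i < m" "j < m" "x \<in> cnbox m z0 r" "y \<in> cnbox m z0 r" "\<forall>j<m. \<bar>x j - y j\<bar> \<le> S" for i j x y S
    using L2(2)[rule_format, OF idx(1)[OF that(1,2)] that(3,4), of S] that(5) unfolding idx[OF that(1,2)] by simp
  \<comment> \<open>\<open>L1\<close> serves the difference of two solutions, \<open>m * B\<close>
    the linearized equation; a single \<tau> has to be short enough for both.\<close>
  define Lm where "Lm = L1 + m * B"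
  have Lm: "0 \<le> Lm" "L1 \<le> Lm" "m * B \<le> Lm" using L1 B by (auto simp: Lm_def)
  define \<tau> where "\<tau> = min \<tau>0 (1 / (4 * (Lm + 1)))"
  have \<tau>: "0 < \<tau>" "\<tau> \<le> \<tau>0" using \<delta> Lm by (auto simp: \<tau>_def)
  have "\<tau> * Lm \<le> 1 / (4 * (Lm + 1)) * Lm" using Lm by (intro mult_right_mono) (auto simp: \<tau>_def)
  also have "\<dots> \<le> 1/4" using Lm by (simp add: field_simps)
  finally have \<tau>Lm: "2 * \<tau> * Lm \<le> 1/2" by simp
  have \<tau>L: "2 * \<tau> * L1 \<le> 1/2" "2 * \<tau> * (m * B) \<le> 1/2"
    using \<tau>Lm mult_left_mono[OF Lm(2), of "2 * \<tau>"] mult_left_mono[OF Lm(3), of "2 * \<tau>"] \<tau> by linarith+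
  let ?J = "{-\<tau>..\<tau>}"
  have J: "?J \<subseteq> {-\<tau>0..\<tau>0}" using \<tau> by auto
  have start: "join m z \<xi> \<in> nbox (m + m) w0 \<delta>" if "z \<in> nbox m z0 \<delta>" "\<xi> \<in> nbox m zero_n \<delta>" for z \<xi>
    unfolding w0_def using that by (rule join_nbox)
  have sol: "ode_sol (m + m) (tangent_field m V) (tangent_open m U') ?J (cp \<Psi> w)"
    and ini: "\<Psi> 0 w = w" if "w \<in> nbox (m + m) w0 \<delta>" for w
    using \<Psi>(1) that ode_sol_subset[OF _ J] by (auto simp: local_flow_def)
  have sol1: "ode_sol m V U' ?J (\<lambda>t. fst_n m (\<Psi> t w))" if "w \<in> nbox (m + m) w0 \<delta>" for w
    unfolding ode_sol_def
  proof (intro ballI conjI allI impI)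
    fix t assume t: "t \<in> ?J"
    show "fst_n m (\<Psi> t w) \<in> U'"
      using ode_solD(1)[OF sol[OF that] t] by (simp add: tangent_open_def)
    fix i assume i: "i < m"
    hence "((\<lambda>t. \<Psi> t w i) has_real_derivative tangent_field m V i (\<Psi> t w)) (at t within ?J)"
      using ode_solD(2)[OF sol[OF that] t] by simp
    thus "((\<lambda>t. fst_n m (\<Psi> t w) i) has_real_derivative V i (fst_n m (\<Psi> t w))) (at t within ?J)"
      using i by (simp add: tangent_field_def fst_n_def)
  qed
  define \<Phi> where "\<Phi> t z = fst_n m (\<Psi> t (join m z zero_n))" for t z
  have zero_b: "zero_n \<in> nbox m zero_n \<delta>" using \<delta> zero_R by (intro nbox_center)
  have bR: "z \<in> R_n m" if "z \<in> nbox m z0 \<delta>" for z using that by (simp add: nbox_def)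
  have \<Phi>sol: "ode_sol m V U' ?J (cp \<Phi> z)" and \<Phi>0: "\<Phi> 0 z = z" if "z \<in> nbox m z0 \<delta>" for z
    using sol1[OF start[OF that zero_b]] ini[OF start[OF that zero_b]] bR[OF that] by (simp_all add: \<Phi>_def fst_n_join)
  have \<Phi>U: "\<Phi> t z \<in> cnbox m z0 r" if "z \<in> nbox m z0 \<delta>" "t \<in> ?J" for t z
    using ode_solD(1)[OF \<Phi>sol[OF that(1)] that(2)] U'(3) by auto
  \<comment> \<open>The base component solves V alone, so by uniqueness it does not depend on the
    initial vector \<xi>.\<close>
  have indep: "fst_n m (\<Psi> t (join m z \<xi>)) = \<Phi> t z"
    if z: "z \<in> nbox m z0 \<delta>" and \<xi>: "\<xi> \<in> nbox m zero_n \<delta>" and t: "t \<in> ?J" for z \<xi> t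
    by (rule ode_unique[OF U'(1) smooth_fun_Ck[OF V'] _ sol1[OF start[OF z \<xi>]] \<Phi>sol[OF z], of 0 t])
       (use t \<tau> ini[OF start[OF z \<xi>]] \<Phi>0[OF z] bR[OF z] in \<open>auto simp: fst_n_join is_interval_cc\<close>)
  define ev where "ev j = (\<lambda>i. if i = j then \<delta>/2 else 0)" for j :: nat
  have ev: "ev j \<in> nbox m zero_n \<delta>" if "j < m" for j
    using that \<delta> by (auto simp: ev_def nbox_def R_n_iff)
  define X where "X t z j i = 2 / \<delta> * \<Psi> t (join m z (ev j)) (m + i)" for t z j i
  have X0: "X 0 z j i = (if i = j then 1 else 0)" if "z \<in> nbox m z0 \<delta>" "i < m" "j < m" for z i j
    using ini[OF start[OF that(1) ev[OF that(3)]]] \<delta> by (simp add: X_def join_nth ev_def)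
  have Xder: "((\<lambda>t. X t z j i) has_real_derivative (\<Sum>l<m. pd l (V i) (\<Phi> t z) * X t z j l)) (at t within ?J)"
    if z: "z \<in> nbox m z0 \<delta>" and ij: "i < m" "j < m" and t: "t \<in> ?J" for z i j t
  proof -
    have "((\<lambda>t. \<Psi> t (join m z (ev j)) (m + i)) has_real_derivative
        tangent_field m V (m + i) (\<Psi> t (join m z (ev j)))) (at t within ?J)"
      using ode_solD(2)[OF sol[OF start[OF z ev[OF ij(2)]]] t, of "m + i"] ij by simp
    hence "((\<lambda>t. X t z j i) has_real_derivative 2 / \<delta> * tangent_field m V (m + i) (\<Psi> t (join m z (ev j)))) (at t within ?J)"
      unfolding X_def by (rule DERIV_cmult)
    moreover have "2 / \<delta> * tangent_field m V (m + i) (\<Psi> t (join m z (ev j))) = (\<Sum>l<m. pd l (V i) (\<Phi> t z) * X t z j l)"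
      by (simp add: tangent_field_def indep[OF z ev[OF ij(2)] t] X_def sum_distrib_left mult_ac)
    ultimately show ?thesis by simp
  qed
  have main: "((\<lambda>h. \<Phi> t (z(j := h)) i) has_real_derivative X t z j i) (at (z j))"
    if z: "z \<in> nbox m z0 \<delta>" and ij: "i < m" "j < m" and t: "t \<in> ?J" for z i j t
  proof -
    \<comment> \<open>The first Gronwall bound limits the difference of two solutions to
      \<open>2 * \<bar>h\<bar>\<close>. This enters the inhomogeneity twice, as displacement and as
      change of \<open>DV\<close>, whence the 4; the other factors come from the second Gronwall
      bound on an interval of length \<open>2 * \<tau>\<close>.\<close>
    define C where "C = 2 * (2 * \<tau> * (m * L2 * 4))"
    have est: "\<bar>\<Phi> t (z(j := z j + h)) i - \<Phi> t z i - h * X t z j i\<bar> \<le> C * h\<^sup>2"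
      if zh: "z(j := z j + h) \<in> nbox m z0 \<delta>" for h
    proof -
      define y where "y = z(j := z j + h)"
      note y = zh[folded y_def]
      have dder: "((\<lambda>t. \<Phi> t y l - \<Phi> t z l) has_real_derivative V l (\<Phi> s y) - V l (\<Phi> s z)) (at s within ?J)"
        if "s \<in> ?J" "l < m" for s l
        using ode_solD(2)[OF \<Phi>sol[OF y] that] ode_solD(2)[OF \<Phi>sol[OF z] that] by (rule DERIV_diff)
      have d: "\<bar>\<Phi> s y l - \<Phi> s z l\<bar> \<le> 2 * \<bar>h\<bar>" if "s \<in> ?J" "l < m" for s l
      proof -
        have "\<bar>(\<lambda>l. \<Phi> s y l - \<Phi> s z l) l\<bar> \<le> 2 * (\<bar>h\<bar> + 2 * \<tau> * 0)"
        proof (rule gronwall_small[where w = "\<lambda>s l. \<Phi> s y l - \<Phi> s z l" and w' = "\<lambda>s l. V l (\<Phi> s y) - V l (\<Phi> s z)"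
              and a = "-\<tau>" and b = \<tau> and ?t0.0 = 0 and L = L1 and m = m])
          fix s l S assume "s \<in> ?J" "l < m" and S: "\<And>j. j < m \<Longrightarrow> \<bar>\<Phi> s y j - \<Phi> s z j\<bar> \<le> S"
          thus "\<bar>V l (\<Phi> s y) - V l (\<Phi> s z)\<bar> \<le> L1 * S + 0"
            using L1(2)[rule_format, OF _ \<Phi>U[OF y] \<Phi>U[OF z]] by auto
        next
          show "\<bar>\<Phi> 0 y i - \<Phi> 0 z i\<bar> \<le> \<bar>h\<bar>" for i
            using \<Phi>0[OF y] \<Phi>0[OF z] by (simp add: y_def)
        qed (use dder that \<tau> \<tau>L L1 in auto)
        thus ?thesis by simp
      qed
      have "\<bar>(\<lambda>l. \<Phi> t y l - \<Phi> t z l - h * X t z j l) i\<bar> \<le> 2 * (0 + 2 * \<tau> * (m * (L2 * (2 * \<bar>h\<bar>) * (2 * \<bar>h\<bar>))))"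
      proof (rule gronwall_small[where w = "\<lambda>s l. \<Phi> s y l - \<Phi> s z l - h * X s z j l"
            and w' = "\<lambda>s l. V l (\<Phi> s y) - V l (\<Phi> s z) - h * (\<Sum>n<m. pd n (V l) (\<Phi> s z) * X s z j n)"
            and a = "-\<tau>" and b = \<tau> and ?t0.0 = 0 and L = "m * B" and m = m])
        fix s l assume sl: "s \<in> ?J" "l < m"
        show "((\<lambda>t. \<Phi> t y l - \<Phi> t z l - h * X t z j l) has_real_derivative
            V l (\<Phi> s y) - V l (\<Phi> s z) - h * (\<Sum>n<m. pd n (V l) (\<Phi> s z) * X s z j n)) (at s within ?J)"
          by (rule DERIV_diff[OF dder[OF sl] DERIV_cmult[OF Xder[OF z sl(2) ij(2) sl(1)]]])
        fix S assume S: "\<And>l. l < m \<Longrightarrow> \<bar>\<Phi> s y l - \<Phi> s z l - h * X s z j l\<bar> \<le> S"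
        obtain \<sigma> where \<sigma>: "0 < \<sigma>" "\<sigma> < 1" "V l (\<Phi> s y) - V l (\<Phi> s z) =
            (\<Sum>n<m. pd n (V l) (\<lambda>i. \<Phi> s z i + \<sigma> * (\<Phi> s y i - \<Phi> s z i)) * (\<Phi> s y n - \<Phi> s z n))"
          by (rule C1_MVT[OF U smooth_fun_Ck[OF V[OF sl(2)]], of "\<Phi> s z" "\<Phi> s y"])
             (use cnbox_segment[OF \<Phi>U[OF y sl(1)] \<Phi>U[OF z sl(1)]] r(2) in auto)
        define \<zeta> where "\<zeta> = (\<lambda>i. \<Phi> s z i + \<sigma> * (\<Phi> s y i - \<Phi> s z i))"
        have \<zeta>: "\<zeta> \<in> cnbox m z0 r"
          using cnbox_segment[OF \<Phi>U[OF y sl(1)] \<Phi>U[OF z sl(1)], of \<sigma>] \<sigma> by (simp add: \<zeta>_def)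
        have \<zeta>d: "\<forall>n<m. \<bar>\<zeta> n - \<Phi> s z n\<bar> \<le> 2 * \<bar>h\<bar>"
        proof (intro allI impI)
          fix n assume n: "n < m"
          have "\<bar>\<zeta> n - \<Phi> s z n\<bar> = \<sigma> * \<bar>\<Phi> s y n - \<Phi> s z n\<bar>" using \<sigma> by (simp add: \<zeta>_def abs_mult)
          also have "\<dots> \<le> 1 * (2 * \<bar>h\<bar>)" using \<sigma> d[OF sl(1) n] by (intro mult_mono) auto
          finally show "\<bar>\<zeta> n - \<Phi> s z n\<bar> \<le> 2 * \<bar>h\<bar>" by simp
        qed
        \<comment> \<open>A1 is the quadratic error from evaluating \<open>DV\<close> at the
          intermediate point \<zeta>; B1 is linear in the remainder and supplies the Lipschitz term
          of the Gronwall bound.\<close>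
        define A1 where "A1 = (\<Sum>n<m. (pd n (V l) \<zeta> - pd n (V l) (\<Phi> s z)) * (\<Phi> s y n - \<Phi> s z n))"
        define B1 where "B1 = (\<Sum>n<m. pd n (V l) (\<Phi> s z) * (\<Phi> s y n - \<Phi> s z n - h * X s z j n))"
        have eq: "V l (\<Phi> s y) - V l (\<Phi> s z) - h * (\<Sum>n<m. pd n (V l) (\<Phi> s z) * X s z j n) = A1 + B1"
          unfolding A1_def B1_def \<sigma>(3) \<zeta>_def[symmetric] sum_distrib_left sum.distrib[symmetric] sum_subtractf[symmetric]
          by (rule sum.cong) (auto simp: algebra_simps)
        have "\<bar>A1\<bar> \<le> (\<Sum>n<m. \<bar>(pd n (V l) \<zeta> - pd n (V l) (\<Phi> s z)) * (\<Phi> s y n - \<Phi> s z n)\<bar>)"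
          unfolding A1_def by (rule sum_abs)
        also have "\<dots> \<le> (\<Sum>n<m. L2 * (2 * \<bar>h\<bar>) * (2 * \<bar>h\<bar>))"
        proof (rule sum_mono)
          fix n assume "n \<in> {..<m}"
          hence n: "n < m" by simp
          show "\<bar>(pd n (V l) \<zeta> - pd n (V l) (\<Phi> s z)) * (\<Phi> s y n - \<Phi> s z n)\<bar> \<le> L2 * (2 * \<bar>h\<bar>) * (2 * \<bar>h\<bar>)"
            unfolding abs_mult
            by (rule mult_mono[OF L2'[OF sl(2) n \<zeta> \<Phi>U[OF z sl(1)] \<zeta>d] d[OF sl(1) n]]) (use L2 in auto)
        qed
        finally have A1: "\<bar>A1\<bar> \<le> m * (L2 * (2 * \<bar>h\<bar>) * (2 * \<bar>h\<bar>))" by simp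
        have "\<bar>B1\<bar> \<le> (\<Sum>n<m. \<bar>pd n (V l) (\<Phi> s z) * (\<Phi> s y n - \<Phi> s z n - h * X s z j n)\<bar>)"
          unfolding B1_def by (rule sum_abs)
        also have "\<dots> \<le> (\<Sum>n<m. B * S)"
        proof (rule sum_mono)
          fix n assume "n \<in> {..<m}"
          hence n: "n < m" by simp
          show "\<bar>pd n (V l) (\<Phi> s z) * (\<Phi> s y n - \<Phi> s z n - h * X s z j n)\<bar> \<le> B * S"
            unfolding abs_mult by (rule mult_mono[OF B'[OF sl(2) n \<Phi>U[OF z sl(1)]] S[OF n]]) (use B in auto)
        qed
        finally have B1: "\<bar>B1\<bar> \<le> m * B * S" by simp
        show "\<bar>V l (\<Phi> s y) - V l (\<Phi> s z) - h * (\<Sum>n<m. pd n (V l) (\<Phi> s z) * X s z j n)\<bar>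
            \<le> m * B * S + m * (L2 * (2 * \<bar>h\<bar>) * (2 * \<bar>h\<bar>))"
          unfolding eq using A1 B1 by linarith
      next
        fix l assume "l < m"
        thus "\<bar>\<Phi> 0 y l - \<Phi> 0 z l - h * X 0 z j l\<bar> \<le> 0"
          using \<Phi>0[OF y] \<Phi>0[OF z] X0[OF z _ ij(2)] by (simp add: y_def)
      qed (use t ij \<tau> \<tau>L L2 B in auto)
      thus ?thesis by (simp add: y_def C_def power2_eq_square mult_ac)
    qed
    have ev_in: "\<forall>\<^sub>F h in at 0. z(j := z j + h) \<in> nbox m z0 \<delta>"
    proof -
      have "\<forall>\<^sub>F s in nhds (z j). z(j := s) \<in> nbox m z0 \<delta>"
        by (rule eventually_fun_upd_mem[OF openin_nbox z ij(2)])
      moreover have "filterlim (\<lambda>h. z j + h) (nhds (z j)) (at 0)"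
        by (rule tendsto_eq_intros | simp)+
      ultimately show ?thesis by (rule eventually_compose_filterlim)
    qed
    have "((\<lambda>h. (\<Phi> t (z(j := z j + h)) i - \<Phi> t z i) / h - X t z j i) \<longlongrightarrow> 0) (at 0)"
    proof (rule Lim_null_comparison)
      show "\<forall>\<^sub>F h in at 0. norm ((\<Phi> t (z(j := z j + h)) i - \<Phi> t z i) / h - X t z j i) \<le> C * \<bar>h\<bar>"
        using ev_in eventually_neq_at_within[of 0]
      proof eventually_elim
        case (elim h)
        have "\<bar>(\<Phi> t (z(j := z j + h)) i - \<Phi> t z i) / h - X t z j i\<bar> = \<bar>\<Phi> t (z(j := z j + h)) i - \<Phi> t z i - h * X t z j i\<bar> / \<bar>h\<bar>"
          using elim(2) by (simp add: field_simps flip: abs_divide)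
        also have "\<dots> \<le> C * h\<^sup>2 / \<bar>h\<bar>"
          using est[OF elim(1)] by (rule divide_right_mono) simp
        also have "\<dots> = C * \<bar>h\<bar>" using elim(2) by (simp add: power2_eq_square field_simps abs_mult_self_eq)
        finally show ?case by simp
      qed
      have "((\<lambda>h. C * \<bar>h\<bar>) \<longlongrightarrow> C * \<bar>0\<bar>) (at 0)" by (intro tendsto_intros)
      thus "((\<lambda>h. C * \<bar>h\<bar>) \<longlongrightarrow> 0) (at 0)" by simp
    qed
    hence "((\<lambda>h. (\<Phi> t (z(j := z j + h)) i - \<Phi> t (z(j := z j)) i) / h) \<longlongrightarrow> X t z j i) (at 0)"
      by (simp add: LIM_zero_iff)
    thus ?thesis unfolding DERIV_def .
  qed
  have Ck: "Ck_on k m (nbox m z0 \<delta>) (\<lambda>z. \<Psi> t (join m z \<xi>) l)"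
    if \<xi>: "\<xi> \<in> nbox m zero_n \<delta>" and t: "t \<in> ?J" and l: "l < m + m" for \<xi> t l
  proof (rule Ck_on_compose[OF openin_nbox openin_nbox, where \<Phi> = "\<lambda>z. join m z \<xi>"])
    show "Ck_on k (m + m) (nbox (m + m) w0 \<delta>) (\<lambda>w. \<Psi> t w l)" using \<Psi>(2) t J l by blast
    fix j
    show "Ck_on k m (nbox m z0 \<delta>) (\<lambda>z. join m z \<xi> j)"
      by (cases "j < m") (auto simp: join_def Ck_on_coord Ck_on_const openin_nbox)
  qed (use start \<xi> in auto)
  have "Ck_on (Suc k) m (nbox m z0 \<delta>) (\<lambda>z. \<Phi> t z i)" if t: "t \<in> ?J" and i: "i < m" for t i
  proof (rule Ck_on_SucI[OF openin_nbox, where D = "\<lambda>j z. X t z j i"])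
    have "Ck_on k m (nbox m z0 \<delta>) (\<lambda>z. \<Phi> t z i)"
      using Ck[OF zero_b t, of i] i by (simp add: \<Phi>_def fst_n_def)
    thus "continuous_on (nbox m z0 \<delta>) (\<lambda>z. \<Phi> t z i)"
      by (rule Ck_on_continuous) (auto simp: nbox_def)
    show "((\<lambda>h. \<Phi> t (z(j := h)) i) has_real_derivative X t z j i) (at (z j))" if "j < m" "z \<in> nbox m z0 \<delta>" for j z
      by (rule main[OF that(2) i that(1) t])
    show "Ck_on k m (nbox m z0 \<delta>) (\<lambda>z. X t z j i)" if "j < m" for j
      unfolding X_def by (intro Ck_on_cmult[OF openin_nbox] Ck[OF ev[OF that] t]) (use i in simp)
  qed
  moreover have "local_flow m U V z0 \<delta> \<tau> \<Phi>"
    using \<delta> \<tau> \<Phi>0 \<Phi>sol U'(2) unfolding local_flow_def ode_sol_def by (meson subsetD)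
  ultimately show ?thesis by blast
qed

lemma local_flow_Ck:
  assumes "open_n m U" "\<And>i. i < m \<Longrightarrow> smooth_fun m U (V i)" "z0 \<in> U"
  shows "Ck_flow k m U V z0"
  using assms
proof (induction k arbitrary: m U V z0)
  case 0
  thus ?case by (rule local_flow_C0)
next
  case (Suc k)
  show ?case by (rule local_flow_Ck_Suc[OF Suc.IH Suc.prems])
qed

text \<open>The interval of smoothness obtained above shrinks with the order \<open>k\<close>; the group property of the
  flow propagates differentiability of order \<open>k\<close> along the whole orbit.\<close>

theorem local_flow_smooth:
  assumes U: "open_n m U" and V: "\<And>i. i < m \<Longrightarrow> smooth_fun m U (V i)" and z0: "z0 \<in> U"
  shows "\<exists>\<delta> \<tau> \<Phi>. local_flow m U V z0 \<delta> \<tau> \<Phi> \<and>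
    (\<forall>t\<in>{-\<tau>..\<tau>}. \<forall>i<m. smooth_fun m (nbox m z0 \<delta>) (\<lambda>z. \<Phi> t z i))"
proof -
  note UR = openin_Rn_sub[OF U]
  obtain \<delta> \<tau> \<Phi> where \<Phi>: "local_flow m U V z0 \<delta> \<tau> \<Phi>"
    using local_flow_C0[where V = V, OF U V z0] by auto
  have \<delta>: "0 < \<delta>" "0 < \<tau>" using \<Phi> by (auto simp: local_flow_def)
  have \<Phi>0: "\<Phi> 0 z = z" and sol: "ode_sol m V U {-\<tau>..\<tau>} (cp \<Phi> z)" if "z \<in> nbox m z0 \<delta>" for z
    using \<Phi> that by (auto simp: local_flow_def)
  have "smooth_fun m (nbox m z0 \<delta>) (\<lambda>z. \<Phi> t z i)" if t: "t \<in> {-\<tau>..\<tau>}" and i: "i < m" for t i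
    unfolding smooth_fun_def
  proof
    fix k
    show "Ck_on k m (nbox m z0 \<delta>) (\<lambda>z. \<Phi> t z i)"
    proof (rule Ck_on_nbhds)
      fix z assume z: "z \<in> nbox m z0 \<delta>"
      \<comment> \<open>The neighborhood B may depend on s, so P only has to be carried from one
        time to nearby ones.\<close>
      define P where "P s \<longleftrightarrow> (\<exists>B. open_n m B \<and> z \<in> B \<and> B \<subseteq> nbox m z0 \<delta> \<and>
        (\<forall>i<m. Ck_on k m B (\<lambda>z. \<Phi> s z i)))" for s
      have "P t"
      proof (rule connected_induction_simple[where S = "{-\<tau>..\<tau>}" and a = 0 and b = t])
        show "P 0"
          unfolding P_def
        proof (intro exI conjI allI impI)
          fix i show "Ck_on k m (nbox m z0 \<delta>) (\<lambda>z. \<Phi> 0 z i)"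
            by (rule Ck_on_cong[OF openin_nbox _ Ck_on_coord[OF openin_nbox]]) (simp add: \<Phi>0)
        qed (use z openin_nbox in auto)
        fix s0 assume s0: "s0 \<in> {-\<tau>..\<tau>}"
        obtain \<delta>' \<tau>' \<Psi> where \<Psi>: "local_flow m U V (\<Phi> s0 z) \<delta>' \<tau>' \<Psi>"
          "\<forall>t\<in>{-\<tau>'..\<tau>'}. \<forall>i<m. Ck_on k m (nbox m (\<Phi> s0 z) \<delta>') (\<lambda>z. \<Psi> t z i)"
          using local_flow_Ck[where V = V and k = k, OF U V ode_solD(1)[OF sol[OF z] s0]] by auto
        have \<delta>': "0 < \<delta>'" "0 < \<tau>'" using \<Psi> by (auto simp: local_flow_def)
        obtain d where d: "d > 0" "\<forall>s\<in>{-\<tau>..\<tau>}. \<bar>s - s0\<bar> < d \<longrightarrow> \<Phi> s z \<in> nbox m (\<Phi> s0 z) \<delta>'"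
          using ode_sol_near[OF sol[OF z] s0 UR \<delta>'(1)] by auto
        \<comment> \<open>Two times within e of \<open>s0\<close> differ by less than \<tau>', so
          the flow started near \<open>\<Phi> s0 z\<close> leads from one to the other.\<close>
        define e where "e = min d (\<tau>' / 2)"
        have e: "0 < e" using d \<delta>' by (simp add: e_def)
        have step: "P s'" if s: "s \<in> {-\<tau>..\<tau>}" "\<bar>s - s0\<bar> < e" and s': "s' \<in> {-\<tau>..\<tau>}" "\<bar>s' - s0\<bar> < e" and Ps: "P s" for s s'
        proof -
          obtain B where B: "open_n m B" "z \<in> B" "B \<subseteq> nbox m z0 \<delta>"
            "\<And>i. i < m \<Longrightarrow> Ck_on k m B (\<lambda>z. \<Phi> s z i)"
            using Ps unfolding P_def by auto
          define B' where "B' = {z'\<in>B. \<Phi> s z' \<in> nbox m (\<Phi> s0 z) \<delta>'}"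
          have B'o: "open_n m B'"
            unfolding B'_def
          proof (rule openin_preimage_nbhd[OF B(1) openin_nbox])
            show "continuous_on B (\<lambda>z. \<Phi> s z j)" if "j < m" for j
              by (rule Ck_on_continuous[OF B(4)[OF that] openin_Rn_sub[OF B(1)]])
            show "\<Phi> s z' \<in> R_n m" if "z' \<in> B" for z'
              using ode_solD(1)[OF sol s(1)] that B(3) UR by blast
          qed
          have eq: "\<Phi> s' z' = \<Psi> (s' - s) (\<Phi> s z')" if z': "z' \<in> B'" for z'
          proof -
            define J where "J = {min s s'..max s s'}"
            have J: "J \<subseteq> {-\<tau>..\<tau>}" "s \<in> J" "s' \<in> J" using s s' by (auto simp: J_def)
            have w: "\<Phi> s z' \<in> nbox m (\<Phi> s0 z) \<delta>'" and z'b: "z' \<in> nbox m z0 \<delta>"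
              using z' B(3) by (auto simp: B'_def)
            have sub: "(\<lambda>t. t - s) ` J \<subseteq> {-\<tau>'..\<tau>'}"
              using s s' unfolding J_def e_def by (auto simp: abs_if split: if_splits)
            have \<Psi>s: "ode_sol m V U {-\<tau>'..\<tau>'} (\<lambda>t. \<Psi> t (\<Phi> s z'))" "\<Psi> 0 (\<Phi> s z') = \<Phi> s z'"
              using \<Psi>(1) w by (auto simp: local_flow_def)
            have "ode_sol m V U J (\<lambda>t. \<Psi> (t - s) (\<Phi> s z'))"
              unfolding ode_sol_def
            proof (intro ballI conjI allI impI)
              fix t assume t: "t \<in> J"
              hence ts: "t - s \<in> {-\<tau>'..\<tau>'}" using sub by auto
              thus "\<Psi> (t - s) (\<Phi> s z') \<in> U" by (rule ode_solD(1)[OF \<Psi>s(1)])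
              fix i assume "i < m"
              from ode_solD(2)[OF \<Psi>s(1) ts this]
              have "((\<lambda>t. \<Psi> t (\<Phi> s z') i) has_real_derivative V i (\<Psi> (t - s) (\<Phi> s z'))) (at (t - s) within (\<lambda>t. t - s) ` J)"
                by (rule DERIV_subset) (rule sub)
              moreover have "((\<lambda>t. t - s) has_real_derivative 1) (at t within J)"
                by (auto intro!: derivative_eq_intros)
              ultimately show "((\<lambda>t. \<Psi> (t - s) (\<Phi> s z') i) has_real_derivative V i (\<Psi> (t - s) (\<Phi> s z'))) (at t within J)"
                using DERIV_image_chain[of "\<lambda>t. \<Psi> t (\<Phi> s z') i" _ "\<lambda>t. t - s" t J 1] by (simp add: o_def)
            qed
            thus ?thesis
              by (intro ode_unique[OF U smooth_fun_Ck[OF V] _ ode_sol_subset[OF sol[OF z'b] J(1)] _ J(2) _ J(3)])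
                 (auto simp: \<Psi>s(2) J_def is_interval_cc)
          qed
          have s's: "s' - s \<in> {-\<tau>'..\<tau>'}" using s s' unfolding e_def by (auto simp: abs_if split: if_splits)
          show "P s'"
            unfolding P_def
          proof (intro exI[of _ B'] conjI allI impI)
            fix i assume i: "i < m"
            have "Ck_on k m B' (\<lambda>z'. \<Psi> (s' - s) (\<Phi> s z') i)"
            proof (rule Ck_on_compose[OF B'o openin_nbox, where \<Phi> = "\<Phi> s"])
              show "Ck_on k m B' (\<lambda>z. \<Phi> s z j)" if "j < m" for j
                by (rule Ck_on_subset[OF B(4)[OF that]]) (auto simp: B'_def)
              show "Ck_on k m (nbox m (\<Phi> s0 z) \<delta>') (\<lambda>w. \<Psi> (s' - s) w i)" using \<Psi>(2) s's i by blast
            qed (auto simp: B'_def)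
            thus "Ck_on k m B' (\<lambda>z. \<Phi> s' z i)"
              by (rule Ck_on_cong[OF B'o, rotated]) (simp add: eq)
          qed (use B'o B d s in \<open>auto simp: B'_def e_def\<close>)
        qed
        show "\<exists>T. openin (top_of_set {-\<tau>..\<tau>}) T \<and> s0 \<in> T \<and> (\<forall>x\<in>T. \<forall>y\<in>T. P x \<longrightarrow> P y)"
        proof (intro exI[of _ "{-\<tau>..\<tau>} \<inter> ball s0 e"] conjI ballI impI)
          show "openin (top_of_set {-\<tau>..\<tau>}) ({-\<tau>..\<tau>} \<inter> ball s0 e)" by (auto simp: openin_open)
          show "s0 \<in> {-\<tau>..\<tau>} \<inter> ball s0 e" using s0 e by simp
          fix x y assume "x \<in> {-\<tau>..\<tau>} \<inter> ball s0 e" "y \<in> {-\<tau>..\<tau>} \<inter> ball s0 e" "P x"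
          thus "P y" by (intro step[of x y]) (auto simp: dist_real_def abs_minus_commute)
        qed
      qed (use t \<delta> in auto)
      thus "\<exists>V. open_n m V \<and> z \<in> V \<and> Ck_on k m V (\<lambda>z. \<Phi> t z i)"
        using i by (auto simp: P_def)
    qed (auto simp: nbox_def)
  qed
  with \<Phi> show ?thesis by blast
qed

section \<open>The inverse function theorem\<close>

lemma Ck_jacobian:
  assumes "\<And>i. i < m \<Longrightarrow> smooth_fun n U (cp \<Phi> i)" "i < m" "j < n"
  shows "smooth_fun n U (\<lambda>z. jacobian \<Phi> z i j)"
  using Ck_on_smooth_pd[OF assms(1)[OF assms(2)] assms(3)] by (simp add: jacobian_def)

lemma jacobian_injective_imp_det:
  assumes "\<And>v. v \<in> R_n n \<Longrightarrow> differential n \<Phi> z v = zero_n \<Longrightarrow> v = zero_n"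
  shows "det_n n (jacobian \<Phi> z) \<noteq> 0"
proof (rule det_n_nonzero)
  fix v assume v: "v \<in> R_n n" and z: "\<And>i. i < n \<Longrightarrow> (\<Sum>j<n. jacobian \<Phi> z i j * v j) = 0"
  show "v = zero_n"
    by (rule assms[OF v]) (use z in \<open>auto simp: differential_def\<close>)
qed

lemma finite_nbox_ball:
  fixes k :: nat
  assumes "\<And>i. i < k \<Longrightarrow> \<exists>d>0. \<forall>w\<in>nbox m z d. P i w"
  shows "\<exists>d>0. \<forall>i<k. \<forall>w\<in>nbox m z d. P i w"
  using assms
proof (induction k)
  case 0
  thus ?case by (auto intro!: exI[of _ 1])
next
  case (Suc k)
  have "\<exists>d>0. \<forall>i<k. \<forall>w\<in>nbox m z d. P i w" by (rule Suc.IH) (use Suc.prems in simp)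
  then obtain d1 where d1: "d1 > 0" "\<forall>i<k. \<forall>w\<in>nbox m z d1. P i w" by auto
  obtain d2 where d2: "d2 > 0" "\<forall>w\<in>nbox m z d2. P k w" using Suc.prems[of k] by auto
  show ?case
    using d1 d2 nbox_mono[of "min d1 d2" d1 m z] nbox_mono[of "min d1 d2" d2 m z]
    by (intro exI[of _ "min d1 d2"]) (auto simp: less_Suc_eq)
qed

text \<open>Multiplying E by the inverse B of its derivative at z0 gives a map H whose derivative is
  the identity there and differs from it by at most \<epsilon> in each entry on a small box. In the
  sup norm H then shrinks distances at most by half. This bounds the inverse of E, and the same
  estimate keeps the derivative of E injective.\<close>

lemma inverse_function_aux:
  assumes U: "open_n n U" and z0: "z0 \<in> U"
    and E: "\<And>i. i < n \<Longrightarrow> smooth_fun n U (cp E i)"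
    and det: "det_n n (jacobian E z0) \<noteq> 0"
  shows "\<exists>\<rho>>0. cnbox n z0 \<rho> \<subseteq> U \<and> (\<exists>C\<ge>0. \<forall>x\<in>cnbox n z0 \<rho>. \<forall>y\<in>cnbox n z0 \<rho>. \<forall>S.
      (\<forall>l<n. \<bar>E x l - E y l\<bar> \<le> S) \<longrightarrow> (\<forall>i<n. \<bar>x i - y i\<bar> \<le> C * S)) \<and>
     (\<forall>z\<in>cnbox n z0 \<rho>. det_n n (jacobian E z) \<noteq> 0)"
proof -
  note UR = openin_Rn_sub[OF U]
  define B where "B = mat_inverse n (jacobian E z0)"
  define H where "H i z = (\<Sum>l<n. B i l * E z l)" for i z
  have Ek: "Ck_on k n U (cp E l)" if "l < n" for k l using E[OF that] by (rule smooth_fun_Ck)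
  have HC: "Ck_on 1 n U (H i)" for i
    unfolding H_def by (rule Ck_on_sum[OF U]) (auto intro: Ck_on_cmult[OF U] Ek)
  have pdH: "pd j (H i) z = (\<Sum>l<n. B i l * jacobian E z l j)" if "z \<in> U" "j < n" for i j z
  proof (rule pd_unique)
    have "((\<lambda>t. E (z(j := t)) l) has_real_derivative jacobian E z l j) (at (z j))" if "l < n" for l
      using Ck_on_SucD(2)[OF Ek[OF that, of "Suc 0"] UR \<open>j < n\<close> \<open>z \<in> U\<close>] by (simp add: jacobian_def)
    thus "((\<lambda>t. H i (z(j := t))) has_real_derivative (\<Sum>l<n. B i l * jacobian E z l j)) (at (z j))"
      unfolding H_def by (auto intro!: DERIV_sum DERIV_cmult)
  qed
  have pdH0: "pd j (H i) z0 = (if i = j then 1 else 0)" if "i < n" "j < n" for i j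
    using pdH[OF z0 that(2)] mat_inverse(2)[OF det that] by (simp add: B_def)
  \<comment> \<open>Chosen with \<open>n * \<epsilon> \<le> 1/2\<close>: a row of n errors changes
    the largest coordinate by at most half of it.\<close>
  define \<epsilon> where "\<epsilon> = 1 / (2 * (real n + 1))"
  have \<epsilon>: "\<epsilon> > 0" "n * \<epsilon> \<le> 1/2" by (auto simp: \<epsilon>_def field_simps)
  obtain e where e: "e > 0" "nbox n z0 e \<subseteq> U" using U z0 by (auto simp: openin_Euclidean_iff)
  have "\<exists>d>0. \<forall>w\<in>nbox n z0 d. w \<in> U \<and> \<bar>pd j (H i) w - pd j (H i) z0\<bar> < \<epsilon>" if "j < n" for i j
  proof -
    have "continuous_on U (pd j (H i))"
      using Ck_on_SucD(3)[OF HC[unfolded One_nat_def] UR that] Ck_on_0[OF UR] by simp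
    then obtain d where "d > 0" "\<forall>w\<in>U \<inter> nbox n z0 d. \<bar>pd j (H i) w - pd j (H i) z0\<bar> < \<epsilon>"
      using z0 \<epsilon>(1) unfolding continuous_on_nbox_iff[OF UR] dist_real_def by blast
    thus ?thesis using e nbox_mono[of "min d e" d n z0] nbox_mono[of "min d e" e n z0]
      by (intro exI[of _ "min d e"]) auto
  qed
  hence "\<exists>d>0. \<forall>i<n. \<forall>w\<in>nbox n z0 d. \<forall>j<n. w \<in> U \<and> \<bar>pd j (H i) w - pd j (H i) z0\<bar> < \<epsilon>"
    using finite_nbox_ball[of n n z0 "\<lambda>j w. w \<in> U \<and> \<bar>pd j (H i) w - pd j (H i) z0\<bar> < \<epsilon>" for i]
    by (intro finite_nbox_ball) (metis (no_types, lifting))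
  then obtain D where D: "D > 0" "\<forall>i<n. \<forall>w\<in>nbox n z0 D. \<forall>j<n. w \<in> U \<and> \<bar>pd j (H i) w - pd j (H i) z0\<bar> < \<epsilon>" by blast
  define \<rho> where "\<rho> = min D e / 2"
  have \<rho>: "\<rho> > 0" "\<rho> < D" "\<rho> < e" using D e by (auto simp: \<rho>_def)
  have sub: "cnbox n z0 \<rho> \<subseteq> U" using cnbox_sub_nbox[OF \<rho>(3), of n z0] e by blast
  have close: "\<bar>pd j (H i) w - (if i = j then 1 else 0)\<bar> \<le> \<epsilon>" if w: "w \<in> cnbox n z0 \<rho>" and ij: "i < n" "j < n" for w i j
  proof -
    have "w \<in> nbox n z0 D" using w cnbox_sub_nbox[OF \<rho>(2), of n z0] by auto
    hence "\<bar>pd j (H i) w - pd j (H i) z0\<bar> < \<epsilon>" using D(2) ij by blast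
    thus ?thesis using pdH0[OF ij] by simp
  qed
  have contr: "\<bar>\<Sum>j<n. (a j - (if i = j then 1 else 0)) * v j\<bar> \<le> 1/2 * S"
    if "\<And>j. j < n \<Longrightarrow> \<bar>a j - (if i = j then 1 else 0)\<bar> \<le> \<epsilon>" "\<And>j. j < n \<Longrightarrow> \<bar>v j\<bar> \<le> S" "0 \<le> S" for a v S i
  proof -
    have "\<bar>\<Sum>j<n. (a j - (if i = j then 1 else 0)) * v j\<bar> \<le> (\<Sum>j<n. \<bar>(a j - (if i = j then 1 else 0)) * v j\<bar>)"
      by (rule sum_abs)
    also have "\<dots> \<le> (\<Sum>j<n. \<epsilon> * S)"
    proof (rule sum_mono)
      fix j assume "j \<in> {..<n}"
      thus "\<bar>(a j - (if i = j then 1 else 0)) * v j\<bar> \<le> \<epsilon> * S"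
        unfolding abs_mult using that(1)[of j] that(2)[of j] \<epsilon>(1) by (intro mult_mono) auto
    qed
    also have "\<dots> = n * \<epsilon> * S" by simp
    also have "\<dots> \<le> 1/2 * S" using \<epsilon>(2) that(3) by (rule mult_right_mono)
    finally show ?thesis .
  qed
  have delta: "(\<Sum>j<n. (a j - (if i = j then 1 else 0)) * v j) = (\<Sum>j<n. a j * v j) - v i" if "i < n" for a v :: "nat \<Rightarrow> real" and i
    using that by (simp add: left_diff_distrib sum_subtractf if_distrib[of "\<lambda>x. x * _"] cong: if_cong)
  have fin: "\<exists>S\<ge>0. (\<forall>j<n. \<bar>v j\<bar> \<le> S) \<and> (0 < n \<longrightarrow> (\<exists>i<n. \<bar>v i\<bar> = S))" for v :: rvec
  proof (cases "n = 0")
    case False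
    define S where "S = Max ((\<lambda>j. \<bar>v j\<bar>) ` {..<n})"
    have "S \<in> (\<lambda>j. \<bar>v j\<bar>) ` {..<n}" unfolding S_def using False by (intro Max_in) auto
    moreover have "\<forall>j<n. \<bar>v j\<bar> \<le> S" unfolding S_def by (auto intro!: Max_ge)
    ultimately show ?thesis by (intro exI[of _ S]) auto
  qed auto
  have lip: "\<forall>i<n. \<bar>x i - y i\<bar> \<le> (2 * (\<Sum>i<n. \<Sum>l<n. \<bar>B i l\<bar>)) * S"
    if x: "x \<in> cnbox n z0 \<rho>" and y: "y \<in> cnbox n z0 \<rho>" and S: "\<forall>l<n. \<bar>E x l - E y l\<bar> \<le> S" for x y S
  proof (cases "n = 0")
    case False
    obtain R where R: "R \<ge> 0" "\<forall>j<n. \<bar>x j - y j\<bar> \<le> R" "\<exists>i<n. \<bar>x i - y i\<bar> = R"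
      using fin[of "\<lambda>j. x j - y j"] False by auto
    then obtain i where i: "i < n" "\<bar>x i - y i\<bar> = R" by auto
    have S0: "0 \<le> S" using S False by (metis abs_ge_zero neq0_conv order_trans)
    obtain s where s: "0 < s" "s < 1" "H i x - H i y = (\<Sum>j<n. pd j (H i) (\<lambda>k. y k + s * (x k - y k)) * (x j - y j))"
      by (rule C1_MVT[OF U HC, of y x i]) (use cnbox_segment[OF x y] sub in auto)
    define w where "w = (\<lambda>k. y k + s * (x k - y k))"
    have w: "w \<in> cnbox n z0 \<rho>" using cnbox_segment[OF x y, of s] s by (simp add: w_def)
    have "\<bar>\<Sum>j<n. (pd j (H i) w - (if i = j then 1 else 0)) * (x j - y j)\<bar> \<le> 1/2 * R"
      by (rule contr) (use close[OF w i(1)] R in auto)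
    hence "\<bar>(H i x - H i y) - (x i - y i)\<bar> \<le> 1/2 * R"
      unfolding delta[OF i(1)] s(3) w_def .
    moreover have "\<bar>x i - y i\<bar> \<le> \<bar>(H i x - H i y) - (x i - y i)\<bar> + \<bar>H i x - H i y\<bar>"
      by arith
    ultimately have "R \<le> 2 * \<bar>H i x - H i y\<bar>" using i(2) by simp
    also have "\<bar>H i x - H i y\<bar> \<le> (\<Sum>l<n. \<bar>B i l\<bar> * S)"
    proof -
      have "H i x - H i y = (\<Sum>l<n. B i l * (E x l - E y l))"
        by (simp add: H_def sum_subtractf right_diff_distrib)
      also have "\<bar>\<dots>\<bar> \<le> (\<Sum>l<n. \<bar>B i l * (E x l - E y l)\<bar>)" by (rule sum_abs)
      also have "\<dots> \<le> (\<Sum>l<n. \<bar>B i l\<bar> * S)"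
        unfolding abs_mult using S by (intro sum_mono mult_left_mono) auto
      finally show ?thesis .
    qed
    also have "(\<Sum>l<n. \<bar>B i l\<bar> * S) \<le> (\<Sum>i<n. \<Sum>l<n. \<bar>B i l\<bar>) * S"
      unfolding sum_distrib_right[symmetric] using S0 i(1)
      by (intro mult_right_mono member_le_sum[of i "{..<n}" "\<lambda>i. \<Sum>l<n. \<bar>B i l\<bar>"]) (auto intro: sum_nonneg)
    finally have "R \<le> 2 * ((\<Sum>i<n. \<Sum>l<n. \<bar>B i l\<bar>) * S)" by simp
    thus ?thesis using R(2) by (auto simp: mult.assoc intro: order_trans)
  qed simp
  have dt: "det_n n (jacobian E z) \<noteq> 0" if z: "z \<in> cnbox n z0 \<rho>" for z
  proof (rule det_n_nonzero)
    fix v assume v: "v \<in> R_n n" and zz: "\<And>i. i < n \<Longrightarrow> (\<Sum>j<n. jacobian E z i j * v j) = 0"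
    have Hv: "(\<Sum>j<n. pd j (H i) z * v j) = 0" for i
    proof -
      have "(\<Sum>j<n. pd j (H i) z * v j) = (\<Sum>j<n. \<Sum>l<n. B i l * (jacobian E z l j * v j))"
        using z sub by (intro sum.cong) (auto simp: pdH sum_distrib_right mult.assoc)
      also have "\<dots> = (\<Sum>l<n. B i l * (\<Sum>j<n. jacobian E z l j * v j))"
        by (subst sum.swap) (simp add: sum_distrib_left)
      finally show ?thesis using zz by simp
    qed
    obtain S where "S \<ge> 0 \<and> (\<forall>j<n. \<bar>v j\<bar> \<le> S) \<and> (0 < n \<longrightarrow> (\<exists>i<n. \<bar>v i\<bar> = S))" using fin[of v] ..
    hence S: "S \<ge> 0" "\<forall>j<n. \<bar>v j\<bar> \<le> S" "0 < n \<longrightarrow> (\<exists>i<n. \<bar>v i\<bar> = S)" by simp_all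
    have "v i = 0" if i: "i < n" for i
    proof -
      obtain k where k: "k < n" "\<bar>v k\<bar> = S" using S(3) i by auto
      have "\<bar>\<Sum>j<n. (pd j (H k) z - (if k = j then 1 else 0)) * v j\<bar> \<le> 1/2 * S"
        by (rule contr) (use close[OF z k(1)] S in auto)
      hence "S \<le> 1/2 * S" unfolding delta[OF k(1)] Hv using k by simp
      hence "S = 0" using S(1) by simp
      thus ?thesis using S(2) i by auto
    qed
    thus "v = zero_n" using v by (auto simp: fun_eq_iff R_n_iff) (metis linorder_not_less)
  qed
  have "0 \<le> 2 * (\<Sum>i<n. \<Sum>l<n. \<bar>B i l\<bar>)" by (auto intro!: sum_nonneg)
  thus ?thesis
    using \<rho>(1) sub lip dt by (intro exI[of _ \<rho>] conjI exI[of _ "2 * (\<Sum>i<n. \<Sum>l<n. \<bar>B i l\<bar>)"]) auto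
qed

text \<open>Images are open by invariance of domain. The Lipschitz bound makes the inverse
  continuous with bounded difference quotients, and the formula for its derivative bootstraps
  smoothness. The conclusion covers every open subset S of the box, so that a chart can later be cut
  down to a smaller box or to a cylinder.\<close>

theorem inverse_function:
  assumes U: "open_n n U" and z0: "z0 \<in> U"
    and E: "\<And>i. i < n \<Longrightarrow> smooth_fun n U (cp E i)" and ER: "\<And>z. z \<in> U \<Longrightarrow> E z \<in> R_n n"
    and det: "det_n n (jacobian E z0) \<noteq> 0"
  shows "\<exists>\<rho>>0. nbox n z0 \<rho> \<subseteq> U \<and> inj_on E (nbox n z0 \<rho>) \<and>
     (\<forall>S\<subseteq>nbox n z0 \<rho>. open_n n S \<longrightarrow>
        open_n n (E ` S) \<and> (\<forall>i<n. smooth_fun n (E ` S) (cp (inv_into S E) i)))"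
proof -
  obtain \<rho> C where \<rho>: "\<rho> > 0" "cnbox n z0 \<rho> \<subseteq> U" and C: "C \<ge> 0"
    "\<forall>x\<in>cnbox n z0 \<rho>. \<forall>y\<in>cnbox n z0 \<rho>. \<forall>S. (\<forall>l<n. \<bar>E x l - E y l\<bar> \<le> S) \<longrightarrow> (\<forall>i<n. \<bar>x i - y i\<bar> \<le> C * S)"
    and dt: "\<forall>z\<in>cnbox n z0 \<rho>. det_n n (jacobian E z) \<noteq> 0"
    using inverse_function_aux[OF U z0 E det] by auto
  have bc: "nbox n z0 \<rho> \<subseteq> cnbox n z0 \<rho>" by (rule nbox_sub_cnbox)
  have Rc: "x \<in> R_n n" if "x \<in> nbox n z0 \<rho>" for x using that by (simp add: nbox_def)
  have inj: "inj_on E (nbox n z0 \<rho>)"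
  proof (rule inj_onI)
    fix x y assume xy: "x \<in> nbox n z0 \<rho>" "y \<in> nbox n z0 \<rho>" "E x = E y"
    hence "\<bar>x i - y i\<bar> \<le> C * 0" if "i < n" for i
      using C(2)[rule_format, of x y 0 i] bc that by auto
    hence eq: "x i = y i" if "i < n" for i using that by simp
    show "x = y"
    proof
      fix i show "x i = y i"
        using eq[of i] Rc[OF xy(1)] Rc[OF xy(2)] by (cases "i < n") (simp_all add: R_n_iff)
    qed
  qed
  have main: "open_n n (E ` S) \<and> (\<forall>i<n. smooth_fun n (E ` S) (cp (inv_into S E) i))"
    if S: "S \<subseteq> nbox n z0 \<rho>" "open_n n S" for S
  proof
    have SU: "S \<subseteq> U" using S bc \<rho> by blast
    have ES: "Ck_on k n S (cp E i)" if "i < n" for i k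
      using Ck_on_subset[OF smooth_fun_Ck[OF E[OF that]] SU] .
    have injS: "inj_on E S" using inj S(1) by (rule inj_on_subset)
    have "continuous_on S E"
      by (rule continuous_on_vec[of n]) (use Ck_on_continuous[OF ES openin_Rn_sub[OF S(2)]] ER SU in auto)
    hence "continuous_map (sub_n n S) (Euclidean_space n) E"
      using ER SU openin_Rn_sub[OF S(2)] by (auto simp: cm_Euclidean_space_iff_continuous_on Int_absorb1)
    thus O: "open_n n (E ` S)"
      by (rule invariance_of_domain_Euclidean_space[OF S(2) _ injS])
    define D where "D = inv_into S E"
    have D: "D w \<in> S" "E (D w) = w" if "w \<in> E ` S" for w
      using that by (auto simp: D_def inv_into_into f_inv_into_f)
    have Dlip: "\<bar>D w i - D w' i\<bar> \<le> C * R" if "w \<in> E ` S" "w' \<in> E ` S" "\<forall>l<n. \<bar>w l - w' l\<bar> \<le> R" "i < n" for w w' R i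
    proof -
      have "D w \<in> cnbox n z0 \<rho>" "D w' \<in> cnbox n z0 \<rho>" using D that(1,2) S(1) bc by blast+
      moreover have "\<forall>l<n. \<bar>E (D w) l - E (D w') l\<bar> \<le> R" using D that by simp
      ultimately show ?thesis using C(2) that(4) by blast
    qed
    have Dcont: "continuous_on (E ` S) (cp D i)" if "i < n" for i
      unfolding continuous_on_nbox_iff[OF openin_Rn_sub[OF O]]
    proof (intro ballI allI impI)
      fix w e assume w: "w \<in> E ` S" and e: "0 < (e::real)"
      show "\<exists>d>0. \<forall>w'\<in>E ` S \<inter> nbox n w d. dist (D w' i) (D w i) < e"
      proof (intro exI[of _ "e / (C + 1)"] conjI ballI)
        show "0 < e / (C + 1)" using e C by simp
        fix w' assume w': "w' \<in> E ` S \<inter> nbox n w (e / (C + 1))"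
        hence "\<bar>D w' i - D w i\<bar> \<le> C * (e / (C + 1))"
          by (intro Dlip) (use w that in \<open>auto simp: nbox_def intro: less_imp_le\<close>)
        also have "\<dots> < e" using e C by (simp add: field_simps)
        finally show "dist (D w' i) (D w i) < e" by (simp add: dist_real_def)
      qed
    qed
    have Dder: "((\<lambda>t. D (w(j := t)) i) has_real_derivative mat_inverse n (jacobian E (D w)) i j) (at (w j))"
      if w: "w \<in> E ` S" and ij: "i < n" "j < n" for w i j
    proof -
      define y where "y = D w"
      have y: "y \<in> S" "E y = w" using D[OF w] by (auto simp: y_def)
      define x where "x h = D (w(j := w j + h))" for h
      have "\<forall>l. \<exists>q. l < n \<longrightarrow> (\<forall>x\<in>R_n n. E x l - E y l = (\<Sum>i<n. q i x * (x i - y i))) \<and>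
          (\<forall>i<n. \<forall>e>0. \<exists>d>0. \<forall>x\<in>nbox n y d. \<bar>q i x - pd i (cp E l) y\<bar> < e)"
        using C1_increment[OF S(2) ES y(1)] by blast
      from choice[OF this] obtain Q where Q0: "\<forall>l. l < n \<longrightarrow> (\<forall>x\<in>R_n n. E x l - E y l = (\<Sum>i<n. Q l i x * (x i - y i))) \<and>
          (\<forall>i<n. \<forall>e>0. \<exists>d>0. \<forall>x\<in>nbox n y d. \<bar>Q l i x - pd i (cp E l) y\<bar> < e)"
        by auto
      have Q: "E x l - E y l = (\<Sum>i<n. Q l i x * (x i - y i))" if "l < n" "x \<in> R_n n" for l x
        using Q0 that by simp
      have Q2: "\<exists>d>0. \<forall>x\<in>nbox n y d. \<bar>Q l i x - jacobian E y l i\<bar> < e" if "l < n" "i < n" "e > 0" for l i e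
        using Q0 that by (simp add: jacobian_def)
      define J where "J = jacobian E y"
      define Bi where "Bi = mat_inverse n J"
      have dJ: "det_n n J \<noteq> 0" using dt y(1) S(1) bc by (auto simp: J_def)
      have ev: "\<forall>\<^sub>F h in at 0. w(j := w j + h) \<in> E ` S"
      proof -
        have "\<forall>\<^sub>F s in nhds (w j). w(j := s) \<in> E ` S"
          by (rule eventually_fun_upd_mem[OF O w ij(2)])
        moreover have "filterlim (\<lambda>h. w j + h) (nhds (w j)) (at 0)"
          by (rule tendsto_eq_intros | simp)+
        ultimately show ?thesis by (rule eventually_compose_filterlim)
      qed
      have bound: "\<bar>x h k - y k\<bar> \<le> C * \<bar>h\<bar>" if "w(j := w j + h) \<in> E ` S" "k < n" for h k
        unfolding x_def y_def by (rule Dlip[OF that(1) w _ that(2)]) auto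
      have xlim: "\<forall>\<^sub>F h in at 0. x h \<in> nbox n y d" if "d > 0" for d
      proof (rule eventually_nbox_curve[OF _ _ that])
        fix k assume k: "k < n"
        have "((\<lambda>h. x h k - y k) \<longlongrightarrow> 0) (at 0)"
        proof (rule Lim_null_comparison)
          show "\<forall>\<^sub>F h in at 0. norm (x h k - y k) \<le> C * \<bar>h\<bar>"
            using ev by eventually_elim (use bound k in auto)
          have "((\<lambda>h. C * \<bar>h\<bar>) \<longlongrightarrow> C * \<bar>0\<bar>) (at 0)" by (intro tendsto_intros)
          thus "((\<lambda>h. C * \<bar>h\<bar>) \<longlongrightarrow> 0) (at 0)" by simp
        qed
        thus "((cp x k) \<longlongrightarrow> y k) (at 0)" by (simp add: LIM_zero_iff)
      next
        show "\<forall>\<^sub>F h in at 0. x h \<in> R_n n"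
          using ev by eventually_elim (use D openin_Rn_sub[OF S(2)] in \<open>auto simp: x_def\<close>)
      qed
      have Qlim: "((\<lambda>h. J l k - Q l k (x h)) \<longlongrightarrow> 0) (at 0)" if lk: "l < n" "k < n" for l k
      proof (rule tendstoI)
        fix e :: real assume e: "e > 0"
        obtain d where d: "d > 0" "\<forall>x\<in>nbox n y d. \<bar>Q l k x - jacobian E y l k\<bar> < e"
          using Q2[OF lk e] by auto
        show "\<forall>\<^sub>F h in at 0. dist (J l k - Q l k (x h)) 0 < e"
          using xlim[OF d(1)] by eventually_elim (use d(2) in \<open>auto simp: J_def abs_minus_commute\<close>)
      qed
      define r where "r h k = (x h k - y k) / h" for h k
      \<comment> \<open>The increment formula is exact but its coefficients Q vary with h. Replacing
        them by their limit J costs \<open>(J - Q) * r\<close>, which tends to 0 because the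
        quotients r are bounded by C.\<close>
      have term_lim: "((\<lambda>h. (J l k - Q l k (x h)) * r h k) \<longlongrightarrow> 0) (at 0)" if lk: "l < n" "k < n" for l k
      proof (rule Lim_null_comparison)
        show "\<forall>\<^sub>F h in at 0. norm ((J l k - Q l k (x h)) * r h k) \<le> \<bar>J l k - Q l k (x h)\<bar> * C"
          using ev eventually_neq_at_within[of 0]
        proof eventually_elim
          case (elim h)
          have "\<bar>r h k\<bar> \<le> C" using bound[OF elim(1) lk(2)] elim(2) by (simp add: r_def abs_divide field_simps)
          thus ?case by (simp add: abs_mult mult_left_mono)
        qed
        show "((\<lambda>h. \<bar>J l k - Q l k (x h)\<bar> * C) \<longlongrightarrow> 0) (at 0)"
          using tendsto_mult_right[OF tendsto_rabs[OF Qlim[OF lk]], of C] by simp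
      qed
      have "((\<lambda>h. \<Sum>l<n. Bi i l * (\<Sum>k<n. (J l k - Q l k (x h)) * r h k)) \<longlongrightarrow> (\<Sum>l<n. Bi i l * (\<Sum>k<n. 0))) (at 0)"
        by (intro tendsto_sum tendsto_mult tendsto_const term_lim) auto
      hence lim0: "((\<lambda>h. \<Sum>l<n. Bi i l * (\<Sum>k<n. (J l k - Q l k (x h)) * r h k)) \<longlongrightarrow> 0) (at 0)" by simp
      have "\<forall>\<^sub>F h in at 0. (\<Sum>l<n. Bi i l * (\<Sum>k<n. (J l k - Q l k (x h)) * r h k)) = r h i - Bi i j"
        using ev eventually_neq_at_within[of 0]
      proof eventually_elim
        case (elim h)
        have xS: "x h \<in> S" "E (x h) = w(j := w j + h)" using D[OF elim(1)] by (auto simp: x_def)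
        have Qr: "(\<Sum>k<n. Q l k (x h) * r h k) = (if l = j then 1 else 0)" if l: "l < n" for l
        proof -
          have "(\<Sum>k<n. Q l k (x h) * r h k) = (E (x h) l - E y l) / h"
            using Q[OF l, of "x h"] xS(1) openin_Rn_sub[OF S(2)] by (auto simp: r_def sum_divide_distrib)
          thus ?thesis using xS(2) y(2) elim(2) by auto
        qed
        have "(\<Sum>l<n. Bi i l * (\<Sum>k<n. J l k * r h k)) = (\<Sum>k<n. (\<Sum>l<n. Bi i l * J l k) * r h k)"
          unfolding sum_distrib_left sum_distrib_right by (subst sum.swap) (simp add: mult.assoc)
        also have "\<dots> = (\<Sum>k<n. (if i = k then 1 else 0) * r h k)"
          by (intro sum.cong refl) (simp add: Bi_def mat_inverse(2)[OF dJ ij(1)])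
        also have "\<dots> = r h i" using ij(1) by (simp add: if_distrib[of "\<lambda>x. x * _"] cong: if_cong)
        finally have 1: "(\<Sum>l<n. Bi i l * (\<Sum>k<n. J l k * r h k)) = r h i" .
        have 2: "(\<Sum>l<n. Bi i l * (\<Sum>k<n. Q l k (x h) * r h k)) = Bi i j"
          using ij(2) by (simp add: Qr if_distrib[of "\<lambda>x. _ * x"] cong: if_cong)
        show ?case
          unfolding 1[symmetric] 2[symmetric]
          by (simp add: left_diff_distrib sum_subtractf right_diff_distrib)
      qed
      with lim0 have "((\<lambda>h. r h i - Bi i j) \<longlongrightarrow> 0) (at 0)" by (rule Lim_transform_eventually)
      hence "((\<lambda>h. (D (w(j := w j + h)) i - D (w(j := w j)) i) / h) \<longlongrightarrow> Bi i j) (at 0)"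
        by (simp add: LIM_zero_iff r_def x_def y_def)
      thus ?thesis unfolding DERIV_def by (simp add: Bi_def J_def y_def)
    qed
    \<comment> \<open>Bootstrapping: the derivative of D at w is the inverse Jacobian at
      \<open>D w\<close>, of class k as soon as D is.\<close>
    have "\<forall>i<n. Ck_on k n (E ` S) (cp D i)" for k
    proof (induction k)
      case 0
      thus ?case using Ck_on_0[OF openin_Rn_sub[OF O]] Dcont by blast
    next
      case (Suc k)
      show ?case
      proof (intro allI impI)
        fix i assume i: "i < n"
        show "Ck_on (Suc k) n (E ` S) (cp D i)"
        proof (rule Ck_on_SucI[OF O Dcont[OF i] Dder[OF _ i]])
          fix j assume j: "j < n"
          have "Ck_on k n (E ` S) (\<lambda>w. jacobian E (D w) a b)" if "a < n" "b < n" for a b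
            by (rule Ck_on_compose[OF O S(2), where \<Phi> = D])
               (use Suc.IH D smooth_fun_Ck[OF smooth_fun_subset[OF Ck_jacobian[OF E that] SU]] in auto)
          thus "Ck_on k n (E ` S) (\<lambda>w. mat_inverse n (jacobian E (D w)) i j)"
          proof (rule Ck_on_mat_inverse[OF O])
            fix w assume "w \<in> E ` S"
            hence "D w \<in> cnbox n z0 \<rho>" using D(1) S(1) bc by blast
            thus "det_n n (\<lambda>i j. jacobian E (D w) i j) \<noteq> 0" using dt by simp
          qed
        qed
      qed
    qed
    thus "\<forall>i<n. smooth_fun n (E ` S) (cp (inv_into S E) i)"
      by (auto simp: smooth_fun_def D_def)
  qed
  show ?thesis
    using \<rho>(1) bc \<rho>(2) inj main by (intro exI[of _ \<rho>] conjI) auto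
qed

section \<open>Covariance of the geodesic equation\<close>

text \<open>For symmetric G this is the Euler-Lagrange expression of the energy
  \<open>G(v, v) / 2\<close> at position x, velocity v and acceleration w, that is, the geodesic
  equation with lowered index. With the three arguments separated, its transformation law is an
  algebraic identity.\<close>

definition el :: "nat \<Rightarrow> (nat \<Rightarrow> nat \<Rightarrow> rvec \<Rightarrow> real) \<Rightarrow> rvec \<Rightarrow> rvec \<Rightarrow> rvec \<Rightarrow> nat \<Rightarrow> real" where
  "el n G x v w l = (\<Sum>k<n. G l k x * w k)
     + (\<Sum>i<n. \<Sum>j<n. (pd i (G j l) x + pd j (G i l) x - pd l (G i j) x) / 2 * v i * v j)"

lemma sum_contract:
  fixes F :: "nat \<Rightarrow> nat \<Rightarrow> nat \<Rightarrow> nat \<Rightarrow> real"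
  shows "(\<Sum>i<n. \<Sum>j<n. (\<Sum>a<n. \<Sum>b<n. F a b i j) * v i * w j) = (\<Sum>a<n. \<Sum>b<n. \<Sum>i<n. \<Sum>j<n. F a b i j * v i * w j)"
proof -
  have "(\<Sum>i<n. \<Sum>j<n. (\<Sum>a<n. \<Sum>b<n. F a b i j) * v i * w j) = (\<Sum>i<n. \<Sum>j<n. \<Sum>a<n. \<Sum>b<n. F a b i j * v i * w j)"
    by (simp add: sum_distrib_right)
  also have "\<dots> = (\<Sum>i<n. \<Sum>a<n. \<Sum>j<n. \<Sum>b<n. F a b i j * v i * w j)"
    by (intro sum.cong refl sum.swap)
  also have "\<dots> = (\<Sum>a<n. \<Sum>i<n. \<Sum>j<n. \<Sum>b<n. F a b i j * v i * w j)" by (rule sum.swap)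
  also have "\<dots> = (\<Sum>a<n. \<Sum>i<n. \<Sum>b<n. \<Sum>j<n. F a b i j * v i * w j)"
    by (intro sum.cong refl sum.swap)
  also have "\<dots> = (\<Sum>a<n. \<Sum>b<n. \<Sum>i<n. \<Sum>j<n. F a b i j * v i * w j)"
    by (intro sum.cong refl sum.swap)
  finally show ?thesis .
qed

lemma sum_prod_factor:
  fixes A B :: "nat \<Rightarrow> real"
  shows "(\<Sum>i<n. \<Sum>j<n. c * (A i * B j)) = c * ((\<Sum>i<n. A i) * (\<Sum>j<n. B j))"
  unfolding sum_product by (simp add: sum_distrib_left)

text \<open>With the free index lowered, the expression transforms like a covector, by the
  transposed Jacobian of \<psi>. The last vector on the right is the acceleration of the image
  curve, with its quadratic term in the velocity.\<close>

lemma el_covariant: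
  assumes U: "open_n n U" and W: "open_n n W" and x: "x \<in> U"
    and \<psi>: "\<And>a. a < n \<Longrightarrow> Ck_on 2 n U (cp \<psi> a)" "\<And>z. z \<in> U \<Longrightarrow> \<psi> z \<in> W"
    and Gt: "\<And>a b. a < n \<Longrightarrow> b < n \<Longrightarrow> Ck_on 1 n W (Gt a b)"
    and sym: "\<And>a b. a < n \<Longrightarrow> b < n \<Longrightarrow> Gt a b (\<psi> x) = Gt b a (\<psi> x)"
    and G: "\<And>i j z. i < n \<Longrightarrow> j < n \<Longrightarrow> z \<in> U \<Longrightarrow>
       G i j z = (\<Sum>a<n. \<Sum>b<n. pd i (cp \<psi> a) z * pd j (cp \<psi> b) z * Gt a b (\<psi> z))"
    and l: "l < n"
  shows "el n G x v w l = (\<Sum>a<n. pd l (cp \<psi> a) x * el n Gt (\<psi> x)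
      (\<lambda>a. \<Sum>i<n. pd i (cp \<psi> a) x * v i)
      (\<lambda>a. (\<Sum>i<n. pd i (cp \<psi> a) x * w i) + (\<Sum>i<n. \<Sum>j<n. pd i (pd j (cp \<psi> a)) x * v i * v j)) a)"
proof -
  note UR = openin_Rn_sub[OF U]
  define P where "P a i = pd i (cp \<psi> a) x" for a i
  define H where "H a i j = pd i (pd j (cp \<psi> a)) x" for a i j
  define D where "D c a b = pd c (Gt a b) (\<psi> x)" for a b c
  define E where "E a b i = (\<Sum>c<n. D c a b * P c i)" for a b i
  define g where "g a b = Gt a b (\<psi> x)" for a b
  define V where "V a = (\<Sum>i<n. P a i * v i)" for a
  define h where "h a = (\<Sum>i<n. \<Sum>j<n. H a i j * v i * v j)" for a
  define K where "K a = (\<Sum>i<n. H a l i * v i)" for a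
  define Q where "Q a = (\<Sum>i<n. P a i * w i)" for a
  have Hs: "H a i j = H a j i" if "a < n" "i < n" "j < n" for a i j
    unfolding H_def by (rule pd_symmetric[OF U \<psi>(1)[OF that(1)] x that(3,2)])
  have gs: "g a b = g b a" if "a < n" "b < n" for a b using sym that by (simp add: g_def)
  have d1: "((\<lambda>t. pd j (cp \<psi> a) (x(i := t))) has_real_derivative H a i j) (at (x i))" if "a < n" "i < n" "j < n" for a i j
    using Ck_on_SucD(2)[OF Ck_on_SucD(3)[OF \<psi>(1)[OF that(1), unfolded numeral_2_eq_2] UR that(3)] UR that(2) x]
    by (simp add: H_def)
  have \<psi>1: "Ck_on 1 n U (cp \<psi> a)" if "a < n" for a
    by (rule Ck_on_le[OF \<psi>(1)[OF that]]) simp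
  have d2: "((\<lambda>t. Gt a b (\<psi> (x(i := t)))) has_real_derivative E a b i) (at (x i))" if "a < n" "b < n" "i < n" for a b i
    unfolding E_def D_def P_def by (rule pd_compose[OF U W \<psi>1 \<psi>(2) Gt[OF that(1,2)] that(3) x])
  have pdG: "pd i (G j k) x = (\<Sum>a<n. \<Sum>b<n. (H a i j * P b k + P a j * H b i k) * g a b + P a j * P b k * E a b i)"
    if ijk: "i < n" "j < n" "k < n" for i j k
  proof (rule pd_unique)
    let ?f = "\<lambda>a b t. pd j (cp \<psi> a) (x(i := t)) * pd k (cp \<psi> b) (x(i := t)) * Gt a b (\<psi> (x(i := t)))"
    have "((\<lambda>t. \<Sum>a<n. \<Sum>b<n. ?f a b t)
       has_real_derivative (\<Sum>a<n. \<Sum>b<n. (H a i j * P b k + P a j * H b i k) * g a b + P a j * P b k * E a b i)) (at (x i))"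
    proof (intro DERIV_sum)
      fix a b assume ab: "a \<in> {..<n}" "b \<in> {..<n}"
      have "((\<lambda>t. ?f a b t)
         has_real_derivative ((H a i j * pd k (cp \<psi> b) (x(i := x i)) + H b i k * pd j (cp \<psi> a) (x(i := x i))) * Gt a b (\<psi> (x(i := x i)))
           + E a b i * (pd j (cp \<psi> a) (x(i := x i)) * pd k (cp \<psi> b) (x(i := x i))))) (at (x i))"
        by (intro DERIV_mult d1 d2) (use ab ijk in auto)
      thus "((\<lambda>t. ?f a b t)
         has_real_derivative (H a i j * P b k + P a j * H b i k) * g a b + P a j * P b k * E a b i) (at (x i))"
        by (simp add: P_def[symmetric] g_def[symmetric] algebra_simps)
    qed
    thus "((\<lambda>t. G j k (x(i := t))) has_real_derivative
       (\<Sum>a<n. \<Sum>b<n. (H a i j * P b k + P a j * H b i k) * g a b + P a j * P b k * E a b i)) (at (x i))"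
      by (subst has_derivative_cong_on[OF U x ijk(1), where f = "G j k"]) (rule G[OF ijk(2,3)])
  qed
  define S1 where "S1 = (\<Sum>i<n. \<Sum>j<n. pd i (G j l) x * v i * v j)"
  define S2 where "S2 = (\<Sum>i<n. \<Sum>j<n. pd l (G i j) x * v i * v j)"
  \<comment> \<open>X collects the terms with a second derivative of \<psi> in direction l. It
    occurs once in S1 and twice in S2, and cancels in \<open>S1 - S2 / 2\<close>.\<close>
  define X where "X = (\<Sum>a<n. \<Sum>b<n. V a * K b * g a b)"
  define T1 where "T1 = (\<Sum>a<n. \<Sum>b<n. P a l * g a b * Q b)"
  define T2 where "T2 = (\<Sum>a<n. \<Sum>b<n. P a l * g a b * h b)"
  define Y1 where "Y1 = (\<Sum>a<n. \<Sum>c<n. \<Sum>d<n. P a l * D c d a * V c * V d)"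
  define Y2 where "Y2 = (\<Sum>a<n. \<Sum>c<n. \<Sum>d<n. P a l * D a c d * V c * V d)"
  have dot: "(\<Sum>i<n. E a b i * v i) = (\<Sum>c<n. D c a b * V c)" for a b
    unfolding E_def V_def sum_distrib_left sum_distrib_right by (subst sum.swap) (simp add: mult.assoc)
  have S1: "S1 = T2 + X + Y1"
  proof -
    let ?F = "\<lambda>a b i j. (H a i j * P b l + P a j * H b i l) * g a b + P a j * P b l * E a b i"
    have "S1 = (\<Sum>i<n. \<Sum>j<n. (\<Sum>a<n. \<Sum>b<n. ?F a b i j) * v i * v j)"
      unfolding S1_def by (intro sum.cong refl) (simp add: pdG l)
    also have "\<dots> = (\<Sum>a<n. \<Sum>b<n. \<Sum>i<n. \<Sum>j<n. ?F a b i j * v i * v j)"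
      by (rule sum_contract)
    also have "\<dots> = (\<Sum>a<n. \<Sum>b<n. P b l * g a b * h a + V a * K b * g a b + P b l * (\<Sum>c<n. D c a b * V c) * V a)"
    proof (intro sum.cong refl)
      fix a b assume ab: "a \<in> {..<n}" "b \<in> {..<n}"
      have "(\<Sum>i<n. \<Sum>j<n. ?F a b i j * v i * v j)
        = (\<Sum>i<n. \<Sum>j<n. P b l * g a b * (H a i j * v i * v j)) + (\<Sum>i<n. \<Sum>j<n. g a b * ((H b l i * v i) * (P a j * v j)))
          + (\<Sum>i<n. \<Sum>j<n. P b l * ((E a b i * v i) * (P a j * v j)))"
        unfolding sum.distrib[symmetric]
      proof (intro sum.cong refl)
        fix i j assume ij: "i \<in> {..<n}" "j \<in> {..<n}"
        thus "?F a b i j * v i * v j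
          = P b l * g a b * (H a i j * v i * v j) + g a b * ((H b l i * v i) * (P a j * v j)) + P b l * ((E a b i * v i) * (P a j * v j))"
          using Hs[of b i l] ab l by (simp add: algebra_simps)
      qed
      also have "\<dots> = P b l * g a b * h a + g a b * (K b * V a) + P b l * ((\<Sum>c<n. D c a b * V c) * V a)"
        unfolding sum_prod_factor dot by (simp add: h_def K_def V_def sum_distrib_left)
      finally show "(\<Sum>i<n. \<Sum>j<n. ?F a b i j * v i * v j)
        = P b l * g a b * h a + V a * K b * g a b + P b l * (\<Sum>c<n. D c a b * V c) * V a"
        by (simp add: algebra_simps)
    qed
    also have "\<dots> = (\<Sum>a<n. \<Sum>b<n. P b l * g a b * h a) + X + (\<Sum>a<n. \<Sum>b<n. P b l * (\<Sum>c<n. D c a b * V c) * V a)"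
      by (simp add: sum.distrib X_def)
    also have "(\<Sum>a<n. \<Sum>b<n. P b l * g a b * h a) = T2"
      unfolding T2_def by (subst sum.swap) (intro sum.cong refl, simp add: gs)
    also have "(\<Sum>a<n. \<Sum>b<n. P b l * (\<Sum>c<n. D c a b * V c) * V a) = (\<Sum>b<n. \<Sum>a<n. \<Sum>c<n. P b l * D c a b * V c * V a)"
      by (subst sum.swap) (simp add: sum_distrib_left sum_distrib_right mult.assoc)
    also have "\<dots> = Y1"
      unfolding Y1_def by (intro sum.cong refl sum.swap)
    finally show ?thesis .
  qed
  have S2: "S2 = 2 * X + Y2"
  proof -
    let ?F = "\<lambda>a b i j. (H a l i * P b j + P a i * H b l j) * g a b + P a i * P b j * E a b l"
    have "S2 = (\<Sum>i<n. \<Sum>j<n. (\<Sum>a<n. \<Sum>b<n. ?F a b i j) * v i * v j)"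
      unfolding S2_def by (intro sum.cong refl) (simp add: pdG l)
    also have "\<dots> = (\<Sum>a<n. \<Sum>b<n. \<Sum>i<n. \<Sum>j<n. ?F a b i j * v i * v j)"
      by (rule sum_contract)
    also have "\<dots> = (\<Sum>a<n. \<Sum>b<n. K a * V b * g a b + V a * K b * g a b + V a * V b * E a b l)"
    proof (intro sum.cong refl)
      fix a b
      have "(\<Sum>i<n. \<Sum>j<n. ?F a b i j * v i * v j)
        = (\<Sum>i<n. \<Sum>j<n. g a b * ((H a l i * v i) * (P b j * v j))) + (\<Sum>i<n. \<Sum>j<n. g a b * ((P a i * v i) * (H b l j * v j)))
          + (\<Sum>i<n. \<Sum>j<n. E a b l * ((P a i * v i) * (P b j * v j)))"
        unfolding sum.distrib[symmetric] by (intro sum.cong refl) (simp add: algebra_simps)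
      also have "\<dots> = g a b * (K a * V b) + g a b * (V a * K b) + E a b l * (V a * V b)"
        unfolding sum_prod_factor by (simp add: K_def V_def)
      finally show "(\<Sum>i<n. \<Sum>j<n. ?F a b i j * v i * v j)
        = K a * V b * g a b + V a * K b * g a b + V a * V b * E a b l"
        by (simp add: algebra_simps)
    qed
    also have "\<dots> = (\<Sum>a<n. \<Sum>b<n. K a * V b * g a b) + X + (\<Sum>a<n. \<Sum>b<n. V a * V b * E a b l)"
      by (simp add: sum.distrib X_def)
    also have "(\<Sum>a<n. \<Sum>b<n. K a * V b * g a b) = X"
      unfolding X_def by (subst sum.swap) (intro sum.cong refl, simp add: gs)
    also have "(\<Sum>a<n. \<Sum>b<n. V a * V b * E a b l) = (\<Sum>a<n. \<Sum>b<n. \<Sum>c<n. P c l * D c a b * V a * V b)"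
      by (simp add: E_def sum_distrib_left mult_ac)
    also have "\<dots> = (\<Sum>a<n. \<Sum>c<n. \<Sum>b<n. P c l * D c a b * V a * V b)"
      by (intro sum.cong refl sum.swap)
    also have "\<dots> = Y2" unfolding Y2_def by (rule sum.swap)
    finally show ?thesis by simp
  qed
  have S1': "(\<Sum>i<n. \<Sum>j<n. pd j (G i l) x * v i * v j) = S1"
    unfolding S1_def by (subst sum.swap) (simp add: mult_ac)
  have "(\<Sum>k<n. G l k x * w k) = (\<Sum>k<n. \<Sum>a<n. \<Sum>b<n. P a l * g a b * (P b k * w k))"
    by (intro sum.cong refl) (simp add: G[OF l _ x] P_def[symmetric] g_def[symmetric] sum_distrib_right sum_distrib_left mult_ac)
  also have "\<dots> = (\<Sum>a<n. \<Sum>k<n. \<Sum>b<n. P a l * g a b * (P b k * w k))" by (rule sum.swap)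
  also have "\<dots> = (\<Sum>a<n. \<Sum>b<n. \<Sum>k<n. P a l * g a b * (P b k * w k))" by (intro sum.cong refl sum.swap)
  also have "\<dots> = T1" by (simp add: T1_def Q_def sum_distrib_left)
  finally have T1: "(\<Sum>k<n. G l k x * w k) = T1" .
  have "(\<Sum>i<n. \<Sum>j<n. (pd i (G j l) x + pd j (G i l) x - pd l (G i j) x) / 2 * v i * v j)
     = (\<Sum>i<n. \<Sum>j<n. (1/2) * (pd i (G j l) x * v i * v j) + (1/2) * (pd j (G i l) x * v i * v j) - (1/2) * (pd l (G i j) x * v i * v j))"
    by (intro sum.cong refl) (simp add: field_simps)
  also have "\<dots> = (1/2) * S1 + (1/2) * S1 - (1/2) * S2"
    unfolding sum.distrib sum_subtractf sum_distrib_left[symmetric] S1' unfolding S1_def S2_def ..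
  also have "\<dots> = T2 + Y1 - (1/2) * Y2" unfolding S1 S2 by (simp add: field_simps)
  finally have L: "el n G x v w l = T1 + T2 + Y1 - (1/2) * Y2" unfolding el_def T1 by simp
  let ?R = "\<lambda>a. (\<Sum>b<n. P a l * g a b * Q b) + (\<Sum>b<n. P a l * g a b * h b)
         + (1/2) * (\<Sum>c<n. \<Sum>d<n. P a l * D c d a * V c * V d) + (1/2) * (\<Sum>c<n. \<Sum>d<n. P a l * D d c a * V c * V d)
         - (1/2) * (\<Sum>c<n. \<Sum>d<n. P a l * D a c d * V c * V d)"
  have "(\<Sum>a<n. P a l * el n Gt (\<psi> x) V (\<lambda>a. Q a + h a) a)
     = (\<Sum>a<n. ?R a)"
  proof (intro sum.cong refl)
    fix a
    have Z: "(\<Sum>c<n. \<Sum>d<n. (D c d a + D d c a - D a c d) / 2 * V c * V d) * P a l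
      = (\<Sum>c<n. \<Sum>d<n. (1/2) * (P a l * D c d a * V c * V d) + (1/2) * (P a l * D d c a * V c * V d) - (1/2) * (P a l * D a c d * V c * V d))"
      unfolding sum_distrib_right by (intro sum.cong refl) (simp add: field_simps)
    have Z2: "\<dots> = (1/2) * (\<Sum>c<n. \<Sum>d<n. P a l * D c d a * V c * V d) + (1/2) * (\<Sum>c<n. \<Sum>d<n. P a l * D d c a * V c * V d)
         - (1/2) * (\<Sum>c<n. \<Sum>d<n. P a l * D a c d * V c * V d)"
      unfolding sum.distrib sum_subtractf sum_distrib_left[symmetric] ..
    show "P a l * el n Gt (\<psi> x) V (\<lambda>a. Q a + h a) a = ?R a"
    proof -
      have 1: "P a l * (\<Sum>b<n. g a b * (Q b + h b)) = (\<Sum>b<n. P a l * g a b * Q b) + (\<Sum>b<n. P a l * g a b * h b)"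
        by (simp add: distrib_left sum.distrib sum_distrib_left mult.assoc)
      have "P a l * el n Gt (\<psi> x) V (\<lambda>a. Q a + h a) a = P a l * (\<Sum>b<n. g a b * (Q b + h b))
          + (\<Sum>c<n. \<Sum>d<n. (D c d a + D d c a - D a c d) / 2 * V c * V d) * P a l"
        unfolding el_def D_def[symmetric] g_def[symmetric] by (simp only: distrib_left mult.commute)
      thus ?thesis unfolding 1 Z Z2 by simp
    qed
  qed
  also have "\<dots> = T1 + T2 + (1/2) * Y1 + (1/2) * (\<Sum>a<n. \<Sum>c<n. \<Sum>d<n. P a l * D d c a * V c * V d) - (1/2) * Y2"
    unfolding sum.distrib sum_subtractf sum_distrib_left[symmetric] T1_def T2_def Y1_def Y2_def ..
  also have "(\<Sum>a<n. \<Sum>c<n. \<Sum>d<n. P a l * D d c a * V c * V d) = Y1"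
    unfolding Y1_def by (rule sum.cong[OF refl], subst sum.swap) (simp add: mult_ac)
  finally show ?thesis
    unfolding L unfolding V_def Q_def h_def unfolding P_def H_def by simp
qed

section \<open>Charts, tangent vectors and the metric in coordinates\<close>

lemma is_chartD:
  assumes "is_chart n X c"
  shows "openin X (fst c)" "fst c \<subseteq> topspace X" "open_n n (snd c ` fst c)"
    "inj_on (snd c) (fst c)"
    "continuous_map (subtopology X (fst c)) (Euclidean_space n) (snd c)"
    "\<And>W. openin X W \<Longrightarrow> W \<subseteq> fst c \<Longrightarrow> open_n n (snd c ` W)"
proof -
  have h: "homeomorphic_map (subtopology X (fst c)) (sub_n n (snd c ` fst c)) (snd c)"
    using assms by (simp add: is_chart_def)
  show o: "openin X (fst c)" and oi: "open_n n (snd c ` fst c)" using assms by (auto simp: is_chart_def)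
  show s: "fst c \<subseteq> topspace X" using o by (rule openin_subset)
  hence t: "topspace (subtopology X (fst c)) = fst c" by auto
  show "inj_on (snd c) (fst c)" using homeomorphic_imp_injective_map[OF h] t by simp
  show "continuous_map (subtopology X (fst c)) (Euclidean_space n) (snd c)"
    using homeomorphic_imp_continuous_map[OF h] by (simp add: continuous_map_in_subtopology)
  fix W assume "openin X W" "W \<subseteq> fst c"
  hence "openin (subtopology X (fst c)) W" by (auto simp: openin_open_subtopology[OF o])
  hence "openin (sub_n n (snd c ` fst c)) (snd c ` W)"
    using homeomorphic_imp_open_map[OF h] by (simp add: open_map_def)
  thus "open_n n (snd c ` W)" using oi openin_trans_full by blast
qed

lemma chart_inv:
  assumes "is_chart n X c"
  shows "x \<in> fst c \<Longrightarrow> chart_inv c (snd c x) = x"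
    "z \<in> snd c ` fst c \<Longrightarrow> snd c (chart_inv c z) = z"
    "z \<in> snd c ` fst c \<Longrightarrow> chart_inv c z \<in> fst c"
  using is_chartD(4)[OF assms] by (auto simp: chart_inv_def inv_into_into f_inv_into_f)

lemma chart_Rn: "is_chart n X c \<Longrightarrow> x \<in> fst c \<Longrightarrow> snd c x \<in> R_n n"
  using openin_Rn_sub[OF is_chartD(3)] by blast

lemma continuous_map_chart_inv:
  assumes "is_chart n X c"
  shows "continuous_map (sub_n n (snd c ` fst c)) X (chart_inv c)"
proof -
  have oi: "open_n n (snd c ` fst c)" by (rule is_chartD(3)[OF assms])
  have t: "topspace (sub_n n (snd c ` fst c)) = snd c ` fst c"
    using openin_subset[OF oi] by auto
  show ?thesis
    unfolding continuous_map t
  proof (intro conjI allI impI)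
    show "chart_inv c ` snd c ` fst c \<subseteq> topspace X"
      using chart_inv(1)[OF assms] is_chartD(2)[OF assms] by auto
    fix U assume U: "openin X U"
    have "{z \<in> snd c ` fst c. chart_inv c z \<in> U} = snd c ` (U \<inter> fst c)"
      using chart_inv(1)[OF assms] by auto
    moreover have "open_n n (snd c ` (U \<inter> fst c))"
      using U is_chartD(1)[OF assms] by (intro is_chartD(6)[OF assms]) auto
    ultimately show "openin (sub_n n (snd c ` fst c)) {z \<in> snd c ` fst c. chart_inv c z \<in> U}"
      by (simp add: openin_open_subtopology[OF oi] image_mono)
  qed
qed

lemma openin_chart_preimage:
  assumes c: "is_chart n X c" and S: "open_n n S"
  shows "openin X {x \<in> fst c. snd c x \<in> S}"
proof -
  have "openin (subtopology X (fst c)) {x \<in> topspace (subtopology X (fst c)). snd c x \<in> S}"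
    using is_chartD(5)[OF c] S by (rule openin_continuous_map_preimage)
  hence "openin (subtopology X (fst c)) {x \<in> fst c. snd c x \<in> S}"
    using is_chartD(2)[OF c] by (simp add: Int_absorb1)
  thus ?thesis using is_chartD(1)[OF c] openin_trans_full by blast
qed

lemma transition_chart: "is_chart n X c \<Longrightarrow> x \<in> fst c \<Longrightarrow> transition c d (snd c x) = snd d x"
  by (simp add: transition_def chart_inv)

abbreviation (input) overlap :: "'a chart \<Rightarrow> 'a chart \<Rightarrow> rvec set" where
  "overlap c d \<equiv> snd c ` (fst c \<inter> fst d)"

abbreviation (input) crd :: "'a chart \<Rightarrow> (real \<Rightarrow> 'a) \<Rightarrow> nat \<Rightarrow> real \<Rightarrow> real" where
  "crd c \<gamma> k \<equiv> \<lambda>\<tau>. snd c (\<gamma> \<tau>) k"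

locale smooth_mfd =
  fixes n :: nat and M :: "'a topology" and A :: "'a chart set"
  assumes manifold: "smooth_manifold n M A"
begin

abbreviation (input) "SC \<equiv> smooth_charts n M A"
abbreviation (input) "tv \<equiv> tvec_of n A"
abbreviation (input) "dtr c d \<equiv> differential n (transition c d)"

lemma SC_chart: "c \<in> SC \<Longrightarrow> is_chart n M c"
  by (simp add: smooth_charts_def)

lemma A_SC: "c \<in> A \<Longrightarrow> c \<in> SC"
  using manifold by (auto simp: smooth_charts_def smooth_manifold_def)

lemma A_cover: "x \<in> topspace M \<Longrightarrow> \<exists>c\<in>A. x \<in> fst c"
  using manifold by (auto simp: smooth_manifold_def)

lemma SC_top: "c \<in> SC \<Longrightarrow> x \<in> fst c \<Longrightarrow> x \<in> topspace M"
  using is_chartD(2)[OF SC_chart] by blast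

lemma overlap_open:
  assumes "c \<in> SC" "d \<in> SC" "e \<in> SC"
  shows "open_n n (overlap c d)"
    "open_n n (snd c ` (fst c \<inter> fst d \<inter> fst e))"
proof -
  have "openin M (fst c)" "openin M (fst d)" "openin M (fst e)"
    using is_chartD(1)[OF SC_chart] assms by blast+
  hence "openin M (fst c \<inter> fst d)" "openin M (fst c \<inter> fst d \<inter> fst e)"
    by (auto intro!: openin_Int)
  thus "open_n n (overlap c d)"
    "open_n n (snd c ` (fst c \<inter> fst d \<inter> fst e))"
    using is_chartD(6)[OF SC_chart[OF assms(1)]] by auto
qed

text \<open>Charts of the maximal atlas are compatible with those of A by definition, but not with
  each other; near each point their transition factors through a chart of A.\<close>

lemma transition_smooth:
  assumes c: "c \<in> SC" and d: "d \<in> SC" and l: "l < n"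
  shows "smooth_fun n (overlap c d) (cp (transition c d) l)"
  unfolding smooth_fun_def
proof
  fix k
  show "Ck_on k n (overlap c d) (cp (transition c d) l)"
  proof (rule Ck_on_nbhds)
    show "overlap c d \<subseteq> R_n n" using chart_Rn[OF SC_chart[OF c]] by auto
    fix z assume "z \<in> overlap c d"
    then obtain x where x: "x \<in> fst c" "x \<in> fst d" "z = snd c x" by auto
    obtain e where e: "e \<in> A" "x \<in> fst e" using A_cover SC_top[OF c x(1)] by blast
    note eS = A_SC[OF e(1)]
    define V where "V = snd c ` (fst c \<inter> fst d \<inter> fst e)"
    have V: "open_n n V" unfolding V_def by (rule overlap_open[OF c d eS])
    have tr: "smooth_transition n c e" "smooth_transition n e d"
      using c d e(1) by (auto simp: smooth_charts_def)
    have "Ck_on k n V (\<lambda>z. transition e d (transition c e z) l)"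
    proof (rule Ck_on_compose[OF V overlap_open(1)[OF eS d d], where \<Phi> = "transition c e"])
      show "Ck_on k n V (cp (transition c e) j)" if "j < n" for j
        by (rule Ck_on_subset[of _ _ "overlap c e"])
           (use tr(1) that in \<open>auto simp: smooth_transition_def smooth_fun_def V_def\<close>)
      show "transition c e z \<in> overlap e d" if "z \<in> V" for z
        using that by (auto simp: V_def transition_chart[OF SC_chart[OF c]])
      show "Ck_on k n (overlap e d) (cp (transition e d) l)"
        using tr(2) l by (auto simp: smooth_transition_def smooth_fun_def)
    qed
    hence "Ck_on k n V (cp (transition c d) l)"
      by (rule Ck_on_cong[OF V, rotated])
         (auto simp: V_def transition_chart[OF SC_chart[OF c]] transition_chart[OF SC_chart[OF eS]])
    thus "\<exists>V. open_n n V \<and> z \<in> V \<and> Ck_on k n V (cp (transition c d) l)"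
      using V x e by (intro exI[of _ V]) (auto simp: V_def)
  qed
qed

lemma transition_C:
  assumes "c \<in> SC" "d \<in> SC" "l < n"
  shows "Ck_on k n (overlap c d) (cp (transition c d) l)"
  using transition_smooth[OF assms] by (rule smooth_fun_Ck)

lemma jacobian_chain:
  assumes c: "c \<in> SC" and d: "d \<in> SC" and e: "e \<in> SC" and x: "x \<in> fst c" "x \<in> fst d" "x \<in> fst e"
    and ik: "i < n" "k < n"
  shows "jacobian (transition c e) (snd c x) i k =
    (\<Sum>j<n. jacobian (transition d e) (snd d x) i j * jacobian (transition c d) (snd c x) j k)"
proof -
  define V where "V = snd c ` (fst c \<inter> fst d \<inter> fst e)"
  have V: "open_n n V" unfolding V_def by (rule overlap_open[OF c d e])
  have xV: "snd c x \<in> V" using x by (auto simp: V_def)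
  have "pd k (cp (transition c e) i) (snd c x) = pd k (\<lambda>z. transition d e (transition c d z) i) (snd c x)"
    by (rule pd_cong_on[OF V xV ik(2)])
       (auto simp: V_def transition_chart[OF SC_chart[OF c]] transition_chart[OF SC_chart[OF d]])
  also have "\<dots> = (\<Sum>j<n. pd j (cp (transition d e) i) (transition c d (snd c x)) * pd k (cp (transition c d) j) (snd c x))"
  proof (rule pd_unique, rule pd_compose[OF V overlap_open(1)[OF d e e], where \<Phi> = "transition c d"])
    show "Ck_on 1 n V (cp (transition c d) j)" if "j < n" for j
      by (rule Ck_on_subset[OF transition_C[OF c d that]]) (auto simp: V_def)
    show "transition c d z \<in> overlap d e" if "z \<in> V" for z
      using that by (auto simp: V_def transition_chart[OF SC_chart[OF c]])
  qed (use ik xV transition_C[OF d e] in auto)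
  finally show ?thesis by (simp add: jacobian_def transition_chart[OF SC_chart[OF c] x(1)])
qed

lemma jacobian_transition_id:
  assumes c: "c \<in> SC" and x: "x \<in> fst c" and k: "k < n"
  shows "jacobian (transition c c) (snd c x) i k = (if i = k then 1 else 0)"
  unfolding jacobian_def
proof -
  have "pd k (cp (transition c c) i) (snd c x) = pd k (\<lambda>z. z i) (snd c x)"
    by (rule pd_cong_on[OF is_chartD(3)[OF SC_chart[OF c]]])
       (use x k in \<open>auto simp: transition_chart[OF SC_chart[OF c]]\<close>)
  also have "\<dots> = (if i = k then 1 else 0)"
    by (rule pd_unique) auto
  finally show "pd k (cp (transition c c) i) (snd c x) = (if i = k then 1 else 0)" .
qed

lemma differential_Rn: "differential n \<Phi> z u \<in> R_n n"
  by (auto simp: differential_def R_n_iff)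

lemma differential_chain:
  assumes c: "c \<in> SC" and d: "d \<in> SC" and e: "e \<in> SC" and x: "x \<in> fst c" "x \<in> fst d" "x \<in> fst e"
  shows "dtr d e (snd d x) (dtr c d (snd c x) u) =
    dtr c e (snd c x) u"
proof
  fix i
  show "dtr d e (snd d x) (dtr c d (snd c x) u) i =
    dtr c e (snd c x) u i"
  proof (cases "i < n")
    case True
    have "(\<Sum>j<n. jacobian (transition d e) (snd d x) i j * (\<Sum>k<n. jacobian (transition c d) (snd c x) j k * u k))
      = (\<Sum>k<n. (\<Sum>j<n. jacobian (transition d e) (snd d x) i j * jacobian (transition c d) (snd c x) j k) * u k)"
      unfolding sum_distrib_left sum_distrib_right by (subst sum.swap) (simp add: mult.assoc)
    also have "\<dots> = (\<Sum>k<n. jacobian (transition c e) (snd c x) i k * u k)"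
      by (intro sum.cong refl) (simp add: jacobian_chain[OF c d e x True])
    finally show ?thesis using True by (simp add: differential_def)
  qed (simp add: differential_def)
qed

lemma differential_id:
  assumes c: "c \<in> SC" and x: "x \<in> fst c" and u: "u \<in> R_n n"
  shows "dtr c c (snd c x) u = u"
proof
  fix i
  show "dtr c c (snd c x) u i = u i"
    using u by (auto simp: differential_def jacobian_transition_id[OF c x] R_n_iff if_distrib[of "\<lambda>x. x * _"] cong: if_cong)
qed

lemma differential_linear:
  "differential n \<Phi> z (\<lambda>i. r * u i + s * v i) = (\<lambda>i. r * differential n \<Phi> z u i + s * differential n \<Phi> z v i)"
  by (auto simp: differential_def fun_eq_iff sum.distrib sum_distrib_left algebra_simps)

lemma differential_inverse:
  assumes c: "c \<in> SC" and d: "d \<in> SC" and x: "x \<in> fst c" "x \<in> fst d" and u: "u \<in> R_n n"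
  shows "dtr d c (snd d x) (dtr c d (snd c x) u) = u"
  using differential_chain[OF c d c x x(1)] differential_id[OF c x(1) u] by simp

lemma tvec_of_change:
  assumes c: "c \<in> SC" and d: "d \<in> SC" and x: "x \<in> fst c" "x \<in> fst d"
  shows "tv d x (dtr c d (snd c x) u) = tv c x u"
  by (rule ext) (use differential_chain[OF c d A_SC x] in \<open>auto simp: tvec_of_def\<close>)

lemma tvec_of_in:
  assumes c: "c \<in> SC" and x: "x \<in> fst c"
  shows "tv c x u \<in> tangent_space n A x"
  unfolding tangent_space_def
  using differential_chain[OF c A_SC A_SC x] by (auto simp: tvec_of_def differential_Rn[simplified])

lemma tangent_space_tvec:
  assumes c: "c \<in> A" "x \<in> fst c" and v: "v \<in> tangent_space n A x"
  shows "v = tv c x (v c)" "v c \<in> R_n n"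
  using assms by (auto simp: tangent_space_def tvec_of_def fun_eq_iff)

lemma tvec_of_linear:
  "tv c x (\<lambda>i. r * u i + s * v i) = (\<lambda>d i. r * tv c x u d i + s * tv c x v d i)"
  by (auto simp: tvec_of_def differential_linear fun_eq_iff)

lemma tvec_of_surj:
  assumes c: "c \<in> SC" and x: "x \<in> fst c" and v: "v \<in> tangent_space n A x"
  shows "\<exists>u\<in>R_n n. v = tv c x u"
proof -
  obtain d where d: "d \<in> A" "x \<in> fst d" using A_cover SC_top[OF c x] by blast
  have "v = tv d x (v d)" by (rule tangent_space_tvec[OF d v])
  thus ?thesis
    using tvec_of_change[OF A_SC[OF d(1)] c d(2) x, of "v d"] differential_Rn by metis
qed

lemma tvec_of_eq_0:
  assumes c: "c \<in> SC" and x: "x \<in> fst c" and u: "u \<in> R_n n" and z: "tv c x u = zero_tvec"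
  shows "u = zero_n"
proof -
  obtain d where d: "d \<in> A" "x \<in> fst d" using A_cover SC_top[OF c x] by blast
  have "dtr c d (snd c x) u = zero_n"
  proof -
    have "dtr c d (snd c x) u = tv c x u d" using d by (simp add: tvec_of_def)
    thus ?thesis unfolding z by (simp add: zero_tvec_def)
  qed
  hence "u = dtr d c (snd d x) zero_n"
    using differential_inverse[OF c A_SC[OF d(1)] x d(2) u] by simp
  thus ?thesis by (simp add: differential_def fun_eq_iff)
qed

lemma tvec_of_lincomb:
  "tv c x (\<lambda>l. \<Sum>i<k. a i * u i l) = lincomb k a (\<lambda>i. tv c x (u i))"
proof (induction k)
  case 0
  thus ?case by (auto simp: tvec_of_def lincomb_def differential_def fun_eq_iff)
next
  case (Suc k)
  have "tv c x (\<lambda>l. \<Sum>i<Suc k. a i * u i l) = tv c x (\<lambda>l. 1 * (\<Sum>i<k. a i * u i l) + a k * u k l)"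
    by simp
  also have "\<dots> = lincomb (Suc k) a (\<lambda>i. tv c x (u i))"
    unfolding tvec_of_linear Suc.IH by (simp add: lincomb_def)
  finally show ?case .
qed

lemma tangent_space_linear:
  assumes x: "x \<in> topspace M" and uv: "u \<in> tangent_space n A x" "v \<in> tangent_space n A x"
  shows "(\<lambda>c i. r * u c i + s * v c i) \<in> tangent_space n A x"
proof -
  obtain d where d: "d \<in> A" "x \<in> fst d" using A_cover x by blast
  have "(\<lambda>c i. r * u c i + s * v c i) = tv d x (\<lambda>i. r * u d i + s * v d i)"
    unfolding tvec_of_linear using tangent_space_tvec(1)[OF d uv(1)] tangent_space_tvec(1)[OF d uv(2)] by simp
  thus ?thesis using tvec_of_in[OF A_SC[OF d(1)] d(2)] by simp
qed

lemma lincomb_in: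
  assumes x: "x \<in> topspace M" and e: "\<And>i. i < k \<Longrightarrow> e i \<in> tangent_space n A x"
  shows "lincomb k a e \<in> tangent_space n A x"
  using e
proof (induction k)
  case 0
  show ?case by (auto simp: lincomb_def tangent_space_def differential_def R_n_iff)
next
  case (Suc k)
  have "lincomb (Suc k) a e = (\<lambda>c i. 1 * lincomb k a e c i + a k * e k c i)"
    by (simp add: lincomb_def)
  thus ?case using tangent_space_linear[OF x Suc.IH Suc.prems[of k], of 1 "a k"] Suc.prems by simp
qed

lemma bilinear_lincomb:
  assumes x: "x \<in> topspace M" and b: "bilinear_form (tangent_space n A x) b"
    and e: "\<And>i. i < k \<Longrightarrow> e i \<in> tangent_space n A x" and w: "w \<in> tangent_space n A x"
  shows "b (lincomb k a e) w = (\<Sum>i<k. a i * b (e i) w)" "b w (lincomb k a e) = (\<Sum>i<k. a i * b w (e i))"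
proof -
  have zero: "lincomb 0 a e = (\<lambda>c i. 0 * w c i + 0 * w c i)" by (simp add: lincomb_def)
  have z: "b (lincomb 0 a e) w = 0" "b w (lincomb 0 a e) = 0"
    unfolding zero using b[unfolded bilinear_form_def, rule_format, OF w w w, of 0 0] by simp_all
  have "b (lincomb k a e) w = (\<Sum>i<k. a i * b (e i) w) \<and> b w (lincomb k a e) = (\<Sum>i<k. a i * b w (e i))"
    using e
  proof (induction k)
    case 0
    thus ?case using z by simp
  next
    case (Suc k)
    have eq: "lincomb (Suc k) a e = (\<lambda>c i. 1 * lincomb k a e c i + a k * e k c i)"
      by (simp add: lincomb_def)
    have l: "lincomb k a e \<in> tangent_space n A x" by (rule lincomb_in[OF x]) (use Suc.prems in simp)
    have ek: "e k \<in> tangent_space n A x" using Suc.prems by simp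
    have IH: "b (lincomb k a e) w = (\<Sum>i<k. a i * b (e i) w)" "b w (lincomb k a e) = (\<Sum>i<k. a i * b w (e i))"
      using Suc.IH Suc.prems by simp_all
    have "b (\<lambda>c i. 1 * lincomb k a e c i + a k * e k c i) w = 1 * b (lincomb k a e) w + a k * b (e k) w \<and>
       b w (\<lambda>c i. 1 * lincomb k a e c i + a k * e k c i) = 1 * b w (lincomb k a e) + a k * b w (e k)"
      using b[unfolded bilinear_form_def, rule_format, OF l ek w] by blast
    thus ?case unfolding eq IH by simp
  qed
  thus "b (lincomb k a e) w = (\<Sum>i<k. a i * b (e i) w)" "b w (lincomb k a e) = (\<Sum>i<k. a i * b w (e i))" by auto
qed

end

section \<open>The metric in coordinates\<close>

locale pseudo_riemannian = smooth_mfd "p + q" M A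
  for p q :: nat and M :: "'a topology" and A :: "'a chart set" +
  fixes g :: "'a metr"
  assumes metric: "pseudo_riemannian_metric p q M A g"
begin

abbreviation n where "n \<equiv> p + q"
abbreviation "gco \<equiv> metric_comp n A g"

lemma g_bilinear: "x \<in> topspace M \<Longrightarrow> bilinear_form (tangent_space n A x) (g x)"
  and g_sym: "x \<in> topspace M \<Longrightarrow> u \<in> tangent_space n A x \<Longrightarrow> v \<in> tangent_space n A x \<Longrightarrow> g x u v = g x v u"
  and orthonormal_ex: "x \<in> topspace M \<Longrightarrow> \<exists>e. orthonormal_basis p q A g x e"
  and gco_smooth_A: "c \<in> A \<Longrightarrow> i < n \<Longrightarrow> j < n \<Longrightarrow> smooth_fun n (snd c ` fst c) (gco c i j)"
  using metric by (auto simp: pseudo_riemannian_metric_def)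

lemma unit_decomp: "u \<in> R_n k \<Longrightarrow> u = (\<lambda>l. \<Sum>i<k. u i * Defs.unit_vec i l)"
  by (auto simp: Defs.unit_vec_def fun_eq_iff R_n_iff if_distrib[of "\<lambda>x. _ * x"] cong: if_cong)

lemma gco_chart: "c \<in> SC \<Longrightarrow> x \<in> fst c \<Longrightarrow>
    gco c i j (snd c x) = g x (tv c x (Defs.unit_vec i)) (tv c x (Defs.unit_vec j))"
  by (simp add: metric_comp_def Let_def chart_inv(1)[OF SC_chart])

lemma g_expand:
  assumes c: "c \<in> SC" and x: "x \<in> fst c" and u: "u \<in> R_n n" and v: "v \<in> R_n n"
  shows "g x (tv c x u) (tv c x v) = (\<Sum>i<n. \<Sum>j<n. u i * v j * gco c i j (snd c x))"
proof -
  note xt = SC_top[OF c x]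
  have un: "tv c x w = lincomb n w (\<lambda>i. tv c x (Defs.unit_vec i))" if "w \<in> R_n n" for w
    using tvec_of_lincomb[where k = n and a = w and u = Defs.unit_vec] unit_decomp[OF that] by simp
  have t: "tv c x w \<in> tangent_space n A x" for w by (rule tvec_of_in[OF c x])
  have "g x (tv c x u) (tv c x v) = (\<Sum>i<n. u i * g x (tv c x (Defs.unit_vec i)) (tv c x v))"
    by (subst un[OF u]) (rule bilinear_lincomb(1)[OF xt g_bilinear[OF xt] t t])
  also have "\<dots> = (\<Sum>i<n. u i * (\<Sum>j<n. v j * g x (tv c x (Defs.unit_vec i)) (tv c x (Defs.unit_vec j))))"
    by (subst un[OF v]) (simp only: bilinear_lincomb(2)[OF xt g_bilinear[OF xt] t t])
  also have "\<dots> = (\<Sum>i<n. \<Sum>j<n. u i * v j * gco c i j (snd c x))"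
    by (simp add: gco_chart[OF c x] sum_distrib_left mult.assoc)
  finally show ?thesis .
qed

lemma gco_sym: "c \<in> SC \<Longrightarrow> x \<in> fst c \<Longrightarrow> gco c i j (snd c x) = gco c j i (snd c x)"
  unfolding gco_chart by (rule g_sym) (auto intro: SC_top tvec_of_in)

lemma unit_vec_Rn: "i < k \<Longrightarrow> Defs.unit_vec i \<in> R_n k"
  by (auto simp: Defs.unit_vec_def R_n_iff)

lemma differential_unit: "k < n \<Longrightarrow> i < n \<Longrightarrow> differential n \<Phi> z (Defs.unit_vec k) i = jacobian \<Phi> z i k"
  by (simp add: differential_def Defs.unit_vec_def if_distrib[of "\<lambda>x. _ * x"] cong: if_cong)

lemma gco_change:
  assumes c: "c \<in> SC" and d: "d \<in> SC" and x: "x \<in> fst c" "x \<in> fst d" and ij: "i < n" "j < n"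
  shows "gco c i j (snd c x) = (\<Sum>a<n. \<Sum>b<n. jacobian (transition c d) (snd c x) a i * jacobian (transition c d) (snd c x) b j * gco d a b (snd d x))"
proof -
  have "gco c i j (snd c x) = g x (tv d x (dtr c d (snd c x) (Defs.unit_vec i)))
       (tv d x (dtr c d (snd c x) (Defs.unit_vec j)))"
    unfolding gco_chart[OF c x(1)] tvec_of_change[OF c d x] ..
  also have "\<dots> = (\<Sum>a<n. \<Sum>b<n. dtr c d (snd c x) (Defs.unit_vec i) a *
       dtr c d (snd c x) (Defs.unit_vec j) b * gco d a b (snd d x))"
    by (rule g_expand[OF d x(2) differential_Rn differential_Rn])
  finally show ?thesis using ij by (simp add: differential_unit)
qed

text \<open>Smoothness of the metric is assumed in the charts of A; the transformation law carries
  it to the maximal atlas, which contains the normal charts.\<close>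

lemma gco_smooth:
  assumes c: "c \<in> SC" and ij: "i < n" "j < n"
  shows "smooth_fun n (snd c ` fst c) (gco c i j)"
  unfolding smooth_fun_def
proof
  fix k
  show "Ck_on k n (snd c ` fst c) (gco c i j)"
  proof (rule Ck_on_nbhds)
    show "snd c ` fst c \<subseteq> R_n n" using chart_Rn[OF SC_chart[OF c]] by auto
    fix z assume "z \<in> snd c ` fst c"
    then obtain x where x: "x \<in> fst c" "z = snd c x" by auto
    obtain d where d: "d \<in> A" "x \<in> fst d" using A_cover SC_top[OF c x(1)] by blast
    note dS = A_SC[OF d(1)]
    define V where "V = overlap c d"
    have V: "open_n n V" unfolding V_def by (rule overlap_open(1)[OF c dS dS])
    have J: "Ck_on k n V (\<lambda>z. jacobian (transition c d) z a b)" if "a < n" "b < n" for a b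
      unfolding V_def by (rule smooth_fun_Ck[OF Ck_jacobian[OF transition_smooth[OF c dS] that]])
    have G: "Ck_on k n V (\<lambda>z. gco d a b (transition c d z))" if "a < n" "b < n" for a b
      by (rule Ck_on_compose[OF V is_chartD(3)[OF SC_chart[OF dS]], where \<Phi> = "transition c d"])
         (use transition_C[OF c dS] smooth_fun_Ck[OF gco_smooth_A[OF d(1) that]] in
           \<open>auto simp: V_def transition_chart[OF SC_chart[OF c]]\<close>)
    have "Ck_on k n V (\<lambda>z. \<Sum>a<n. \<Sum>b<n. jacobian (transition c d) z a i * jacobian (transition c d) z b j * gco d a b (transition c d z))"
      by (rule Ck_on_sum[OF V], rule Ck_on_sum[OF V], rule Ck_on_mult[OF V], rule Ck_on_mult[OF V])
         (use J G ij in auto)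
    hence "Ck_on k n V (gco c i j)"
      by (rule Ck_on_cong[OF V, rotated])
         (use gco_change[OF c dS _ _ ij] in \<open>auto simp: V_def transition_chart[OF SC_chart[OF c]]\<close>)
    thus "\<exists>V. open_n n V \<and> z \<in> V \<and> Ck_on k n V (gco c i j)"
      using V x d by (intro exI[of _ V]) (auto simp: V_def)
  qed
qed

lemma orthonormal_in:
  assumes x: "x \<in> topspace M" and e: "orthonormal_basis p q A g x e" and i: "i < n"
  shows "e i \<in> tangent_space n A x"
proof -
  have "lincomb n (Defs.unit_vec i) e = e i"
    using i by (auto simp: lincomb_def Defs.unit_vec_def fun_eq_iff if_distrib[of "\<lambda>x. x * _"] cong: if_cong)
  moreover have "lincomb n (Defs.unit_vec i) e \<in> tangent_space n A x"
    using e unit_vec_Rn[OF i] by (auto simp: orthonormal_basis_def is_basis_def bij_betw_def)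
  ultimately show ?thesis by simp
qed

definition eta :: "nat \<Rightarrow> real" where "eta i = (if i < p then 1 else - 1)"

lemma g_orthonormal:
  assumes x: "x \<in> topspace M" and e: "orthonormal_basis p q A g x e" and u: "u \<in> R_n n" "v \<in> R_n n"
  shows "g x (lincomb n u e) (lincomb n v e) = (\<Sum>i<n. eta i * u i * v i)"
proof -
  note t = orthonormal_in[OF x e]
  have "g x (lincomb n u e) (lincomb n v e) = (\<Sum>i<n. u i * (\<Sum>j<n. v j * g x (e i) (e j)))"
    using bilinear_lincomb(1)[OF x g_bilinear[OF x] t lincomb_in[OF x t]]
      bilinear_lincomb(2)[OF x g_bilinear[OF x] t t] by simp
  also have "\<dots> = (\<Sum>i<n. u i * (\<Sum>j<n. v j * (if i = j then eta i else 0)))"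
    using e by (intro sum.cong refl arg_cong2[where f = "(*)"]) (auto simp: orthonormal_basis_def eta_def)
  also have "\<dots> = (\<Sum>i<n. eta i * u i * v i)"
    by (intro sum.cong refl) (simp add: if_distrib[of "\<lambda>x. _ * x"] cong: if_cong)
  finally show ?thesis .
qed

text \<open>Nondegeneracy, read off an orthonormal basis: the coefficients of a vector in that basis
  are, up to sign, its products with the basis vectors.\<close>

lemma gco_det:
  assumes c: "c \<in> SC" and x: "x \<in> fst c"
  shows "det_n n (\<lambda>i j. gco c i j (snd c x)) \<noteq> 0"
proof (rule det_n_nonzero)
  note xt = SC_top[OF c x]
  obtain e where e: "orthonormal_basis p q A g x e" using orthonormal_ex[OF xt] by blast
  fix v assume v: "v \<in> R_n n" and z: "\<And>i. i < n \<Longrightarrow> (\<Sum>j<n. gco c i j (snd c x) * v j) = 0"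
  have g0: "g x (tv c x u) (tv c x v) = 0" if u: "u \<in> R_n n" for u
  proof -
    have "g x (tv c x u) (tv c x v) = (\<Sum>i<n. u i * (\<Sum>j<n. gco c i j (snd c x) * v j))"
      unfolding g_expand[OF c x u v] by (simp add: sum_distrib_left mult_ac)
    thus ?thesis using z by simp
  qed
  have "tv c x v \<in> (\<lambda>a. lincomb n a e) ` R_n n"
    using e tvec_of_in[OF c x, of v] by (auto simp: orthonormal_basis_def is_basis_def bij_betw_def)
  then obtain a where a: "a \<in> R_n n" "tv c x v = lincomb n a e" by auto
  have "a i = 0" if i: "i < n" for i
  proof -
    have u: "Defs.unit_vec i \<in> R_n n" by (rule unit_vec_Rn[OF i])
    obtain w where w: "w \<in> R_n n" "lincomb n (Defs.unit_vec i) e = tv c x w"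
      using tvec_of_surj[OF c x lincomb_in[where e = e and k = n, OF xt orthonormal_in[OF xt e]]] by auto
    have "(\<Sum>k<n. eta k * Defs.unit_vec i k * a k) = 0"
      using g0[OF w(1)] g_orthonormal[OF xt e u a(1)] a(2) w(2) by simp
    hence "eta i * a i = 0"
      using i by (simp add: Defs.unit_vec_def if_distrib[of "\<lambda>x. x * _"] if_distrib[of "\<lambda>x. _ * x"] cong: if_cong)
    thus ?thesis by (simp add: eta_def split: if_splits)
  qed
  hence "lincomb n a e = zero_tvec" by (simp add: lincomb_def zero_tvec_def)
  thus "v = zero_n" using tvec_of_eq_0[OF c x v] a(2) by simp
qed

end

section \<open>Geodesics and the exponential map\<close>

text \<open>Derivatives are carried as explicit witnesses rather than as iterated
  \<open>deriv\<close>, so that the chain rule yields formulas. \<open>u1\<close> must be the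
  derivative on a whole neighborhood, since it is differentiated again.\<close>

definition twice_diff :: "nat \<Rightarrow> (real \<Rightarrow> rvec) \<Rightarrow> (real \<Rightarrow> rvec) \<Rightarrow> rvec \<Rightarrow> real \<Rightarrow> bool" where
  "twice_diff n u u1 u2 t \<longleftrightarrow>
     (\<forall>\<^sub>F s in nhds t. \<forall>k<n. ((cp u k) has_real_derivative u1 s k) (at s)) \<and>
     (\<forall>k<n. ((cp u1 k) has_real_derivative u2 k) (at t))"

lemma twice_diff_deriv:
  assumes "twice_diff n u u1 u2 t" "k < n"
  shows "((cp u k) has_real_derivative u1 t k) (at t)"
    "\<forall>\<^sub>F s in nhds t. deriv (cp u k) s = u1 s k"
    "(deriv (cp u k) has_real_derivative u2 k) (at t)"
proof -
  have ev: "\<forall>\<^sub>F s in nhds t. ((cp u k) has_real_derivative u1 s k) (at s)"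
    using assms unfolding twice_diff_def by (auto elim: eventually_mono)
  thus "((cp u k) has_real_derivative u1 t k) (at t)" by (rule eventually_nhds_x_imp_x)
  show d: "\<forall>\<^sub>F s in nhds t. deriv (cp u k) s = u1 s k"
    using ev by (rule eventually_mono) (rule DERIV_imp_deriv)
  have "((cp u1 k) has_real_derivative u2 k) (at t)" using assms by (simp add: twice_diff_def)
  thus "(deriv (cp u k) has_real_derivative u2 k) (at t)"
    by (subst DERIV_cong_ev[OF refl d refl])
qed

lemma twice_diff_unique:
  assumes "twice_diff n u u1 u2 t" "twice_diff n u v1 v2 t" "k < n"
  shows "u1 t k = v1 t k" "u2 k = v2 k"
  using DERIV_unique[OF twice_diff_deriv(1)[OF assms(1,3)] twice_diff_deriv(1)[OF assms(2,3)]]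
    DERIV_unique[OF twice_diff_deriv(3)[OF assms(1,3)] twice_diff_deriv(3)[OF assms(2,3)]] by auto

lemma twice_diff_cong:
  assumes "twice_diff n u u1 u2 t" "\<forall>\<^sub>F s in nhds t. \<forall>k<n. v s k = u s k"
  shows "twice_diff n v u1 u2 t"
proof -
  have "\<forall>\<^sub>F s in nhds t. \<forall>\<^sub>F r in nhds s. \<forall>k<n. v r k = u r k"
    using assms(2) by (simp add: eventually_eventually)
  moreover have "\<forall>\<^sub>F s in nhds t. \<forall>k<n. ((cp u k) has_real_derivative u1 s k) (at s)"
    using assms(1) by (simp add: twice_diff_def)
  ultimately have "\<forall>\<^sub>F s in nhds t. \<forall>k<n. ((cp v k) has_real_derivative u1 s k) (at s)"
  proof eventually_elim
    case (elim s)
    show ?case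
    proof (intro allI impI)
      fix k assume k: "k < n"
      have ev: "\<forall>\<^sub>F r in nhds s. v r k = u r k" using elim(1) k by (auto elim: eventually_mono)
      show "((cp v k) has_real_derivative u1 s k) (at s)"
        by (subst DERIV_cong_ev[OF refl ev refl]) (use elim(2) k in blast)
    qed
  qed
  thus ?thesis using assms(1) by (simp add: twice_diff_def)
qed

lemma eventually_at_nhds: "\<forall>\<^sub>F s in nhds t. P s \<Longrightarrow> \<forall>\<^sub>F s in at t within S. P s"
  by (auto simp: eventually_at_filter elim: eventually_mono)

text \<open>The term quadratic in the velocity is the one by which accelerations fail to transform
  like vectors; \<open>el_covariant\<close> is stated with exactly this term.\<close>

lemma twice_diff_compose:
  assumes U: "open_n n U" and \<psi>: "\<And>a. a < m \<Longrightarrow> Ck_on 2 n U (cp \<psi> a)"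
    and u: "twice_diff n u u1 u2 t" and uU: "\<forall>\<^sub>F s in nhds t. u s \<in> U"
  shows "twice_diff m (\<lambda>s. \<psi> (u s)) (\<lambda>s a. \<Sum>i<n. pd i (cp \<psi> a) (u s) * u1 s i)
     (\<lambda>a. (\<Sum>i<n. pd i (cp \<psi> a) (u t) * u2 i) + (\<Sum>i<n. \<Sum>j<n. pd i (pd j (cp \<psi> a)) (u t) * u1 t i * u1 t j)) t"
proof -
  note UR = openin_Rn_sub[OF U]
  have R: "\<forall>\<^sub>F r in nhds s. u r \<in> R_n n" if "\<forall>\<^sub>F r in nhds s. u r \<in> U" for s
    using that by (rule eventually_mono) (use UR in auto)
  have 1: "\<forall>\<^sub>F s in nhds t. \<forall>\<^sub>F r in nhds s. u r \<in> U" using uU by (simp add: eventually_eventually)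
  have 2: "\<forall>\<^sub>F s in nhds t. \<forall>k<n. ((cp u k) has_real_derivative u1 s k) (at s)"
    using u by (simp add: twice_diff_def)
  have "\<forall>\<^sub>F s in nhds t. \<forall>a<m. ((\<lambda>\<tau>. \<psi> (u \<tau>) a) has_real_derivative (\<Sum>i<n. pd i (cp \<psi> a) (u s) * u1 s i)) (at s)"
    using 1 2
  proof eventually_elim
    case (elim s)
    show ?case
    proof (intro allI impI)
      fix a assume a: "a < m"
      show "((\<lambda>\<tau>. \<psi> (u \<tau>) a) has_real_derivative (\<Sum>i<n. pd i (cp \<psi> a) (u s) * u1 s i)) (at s)"
        by (rule C1_chain[OF U Ck_on_le[OF \<psi>[OF a]]])
           (use elim R[OF elim(1)] eventually_nhds_x_imp_x[OF elim(1)] in \<open>auto intro: eventually_at_nhds\<close>)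
    qed
  qed
  moreover have "((\<lambda>s. \<Sum>j<n. pd j (cp \<psi> a) (u s) * u1 s j) has_real_derivative
     (\<Sum>i<n. pd i (cp \<psi> a) (u t) * u2 i) + (\<Sum>i<n. \<Sum>j<n. pd i (pd j (cp \<psi> a)) (u t) * u1 t i * u1 t j)) (at t)"
    if a: "a < m" for a
  proof -
    have "((\<lambda>s. pd j (cp \<psi> a) (u s)) has_real_derivative (\<Sum>i<n. pd i (pd j (cp \<psi> a)) (u t) * u1 t i)) (at t)"
      if j: "j < n" for j
      by (rule C1_chain[OF U])
         (use Ck_on_SucD(3)[OF \<psi>[OF a, unfolded numeral_2_eq_2] UR j] twice_diff_deriv(1)[OF u] uU R[OF uU] eventually_nhds_x_imp_x[OF uU]
           in \<open>auto intro: eventually_at_nhds\<close>)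
    hence "((\<lambda>s. pd j (cp \<psi> a) (u s) * u1 s j) has_real_derivative
        (\<Sum>i<n. pd i (pd j (cp \<psi> a)) (u t) * u1 t i) * u1 t j + u2 j * pd j (cp \<psi> a) (u t)) (at t)"
      if j: "j < n" for j
      using u j by (intro DERIV_mult) (auto simp: twice_diff_def)
    hence "((\<lambda>s. \<Sum>j<n. pd j (cp \<psi> a) (u s) * u1 s j) has_real_derivative
        (\<Sum>j<n. (\<Sum>i<n. pd i (pd j (cp \<psi> a)) (u t) * u1 t i) * u1 t j + u2 j * pd j (cp \<psi> a) (u t))) (at t)"
      by (intro DERIV_sum) auto
    moreover have "(\<Sum>j<n. (\<Sum>i<n. pd i (pd j (cp \<psi> a)) (u t) * u1 t i) * u1 t j) = (\<Sum>i<n. \<Sum>j<n. pd i (pd j (cp \<psi> a)) (u t) * u1 t i * u1 t j)"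
      unfolding sum_distrib_right by (rule sum.swap)
    ultimately show ?thesis by (simp add: sum.distrib mult.commute add.commute)
  qed
  ultimately show ?thesis by (simp add: twice_diff_def)
qed

lemma twice_diff_scale:
  assumes "twice_diff n u u1 u2 (s * t)"
  shows "twice_diff n (\<lambda>\<tau>. u (s * \<tau>)) (\<lambda>\<tau> k. s * u1 (s * \<tau>) k) (\<lambda>k. s * (s * u2 k)) t"
proof -
  have lim: "filterlim (\<lambda>\<tau>. s * \<tau>) (nhds (s * t)) (nhds t)"
    by (intro tendsto_intros filterlim_ident)
  have chain: "((\<lambda>\<tau>. f (s * \<tau>)) has_real_derivative s * D) (at r)" if "(f has_real_derivative D) (at (s * r))" for f D r
  proof -
    have "((\<lambda>\<tau>. s * \<tau>) has_real_derivative s) (at r)" by (auto intro!: derivative_eq_intros)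
    from DERIV_chain2[OF that this] show ?thesis by (simp add: mult.commute)
  qed
  have "\<forall>\<^sub>F r in nhds (s * t). \<forall>k<n. ((cp u k) has_real_derivative u1 r k) (at r)"
    using assms by (simp add: twice_diff_def)
  hence "\<forall>\<^sub>F r in nhds t. \<forall>k<n. ((cp u k) has_real_derivative u1 (s * r) k) (at (s * r))"
    using lim by (rule eventually_compose_filterlim)
  hence "\<forall>\<^sub>F r in nhds t. \<forall>k<n. ((\<lambda>\<tau>. u (s * \<tau>) k) has_real_derivative s * u1 (s * r) k) (at r)"
    by (rule eventually_mono) (auto intro: chain)
  moreover have "((\<lambda>\<tau>. s * u1 (s * \<tau>) k) has_real_derivative s * (s * u2 k)) (at t)" if "k < n" for k
    using assms that by (intro DERIV_cmult chain) (simp add: twice_diff_def)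
  ultimately show ?thesis by (simp add: twice_diff_def)
qed

lemma el_cong: "(\<And>k. k < n \<Longrightarrow> v k = v' k) \<Longrightarrow> (\<And>k. k < n \<Longrightarrow> w k = w' k) \<Longrightarrow> el n G x v w l = el n G x v' w' l"
  unfolding el_def by (auto intro!: arg_cong2[where f = "(+)"] sum.cong)

lemma el_scale: "el n G x (\<lambda>k. s * v k) (\<lambda>k. s * (s * w k)) l = s * (s * el n G x v w l)"
  unfolding el_def by (simp add: distrib_left sum_distrib_left mult_ac)

section \<open>Geodesics in charts, the spray, and uniqueness\<close>

context smooth_mfd
begin

lemma curve_in_open:
  assumes "continuous_map (top_of_set J) M \<gamma>" "open J" "t \<in> J" "openin M W" "\<gamma> t \<in> W"
  shows "\<forall>\<^sub>F s in nhds t. s \<in> J \<and> \<gamma> s \<in> W"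
proof -
  have "openin (top_of_set J) {s \<in> topspace (top_of_set J). \<gamma> s \<in> W}"
    by (rule openin_continuous_map_preimage[OF assms(1,4)])
  hence "open {s \<in> J. \<gamma> s \<in> W}" using assms(2) by (simp add: openin_open_eq)
  thus ?thesis using assms(3,5) by (auto simp: eventually_nhds)
qed

end

context pseudo_riemannian
begin

definition geo_at :: "'a chart \<Rightarrow> (real \<Rightarrow> 'a) \<Rightarrow> real \<Rightarrow> bool" where
  "geo_at c \<gamma> t \<longleftrightarrow> (\<exists>u1 u2. twice_diff n (\<lambda>\<tau>. snd c (\<gamma> \<tau>)) u1 u2 t \<and>
     (\<forall>l<n. el n (gco c) (snd c (\<gamma> t)) (u1 t) u2 l = 0))"

lemma geodesic_on_iff:
  assumes J: "open J"
  shows "geodesic_on n M A g J \<gamma> \<longleftrightarrow> continuous_map (top_of_set J) M \<gamma> \<and>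
    (\<forall>c\<in>A. \<forall>t\<in>J. \<gamma> t \<in> fst c \<longrightarrow> geo_at c \<gamma> t)"
proof (intro iffI conjI ballI impI)
  assume G: "geodesic_on n M A g J \<gamma>"
  thus cont: "continuous_map (top_of_set J) M \<gamma>" by (simp add: geodesic_on_def)
  fix c t assume c: "c \<in> A" and t: "t \<in> J" "\<gamma> t \<in> fst c"
  note o = is_chartD(1)[OF SC_chart[OF A_SC[OF c]]]
  have ev: "\<forall>\<^sub>F s in nhds t. s \<in> J \<and> \<gamma> s \<in> fst c" by (rule curve_in_open[OF cont J t(1) o t(2)])
  have G': "(\<forall>k<n. (crd c \<gamma> k) field_differentiable (at s) \<and> deriv (crd c \<gamma> k) field_differentiable (at s)) \<and>
     (\<forall>l<n. el n (gco c) (snd c (\<gamma> s)) (\<lambda>k. deriv (crd c \<gamma> k) s) (\<lambda>k. deriv (deriv (crd c \<gamma> k)) s) l = 0)"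
    if "s \<in> J" "\<gamma> s \<in> fst c" for s
    using G c that by (simp add: geodesic_on_def Let_def el_def christoffel_def)
  have "twice_diff n (\<lambda>\<tau>. snd c (\<gamma> \<tau>)) (\<lambda>s k. deriv (crd c \<gamma> k) s) (\<lambda>k. deriv (deriv (crd c \<gamma> k)) t) t"
    unfolding twice_diff_def
  proof
    show "\<forall>\<^sub>F s in nhds t. \<forall>k<n. ((crd c \<gamma> k) has_real_derivative deriv (crd c \<gamma> k) s) (at s)"
      using ev by (rule eventually_mono) (use G' in \<open>auto simp: DERIV_deriv_iff_field_differentiable\<close>)
  qed (use G'[OF t] in \<open>auto simp: DERIV_deriv_iff_field_differentiable\<close>)
  thus "geo_at c \<gamma> t"
    unfolding geo_at_def using G'[OF t] by blast
next
  assume R: "continuous_map (top_of_set J) M \<gamma> \<and> (\<forall>c\<in>A. \<forall>t\<in>J. \<gamma> t \<in> fst c \<longrightarrow> geo_at c \<gamma> t)"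
  show "geodesic_on n M A g J \<gamma>"
    unfolding geodesic_on_def Let_def
  proof (intro conjI ballI impI)
    show "continuous_map (top_of_set J) M \<gamma>" using R by simp
    fix c t assume ct: "c \<in> A" "t \<in> J" "\<gamma> t \<in> fst c"
    hence "geo_at c \<gamma> t" using R by blast
    then obtain u1 u2 where u: "twice_diff n (\<lambda>\<tau>. snd c (\<gamma> \<tau>)) u1 u2 t"
      "\<And>l. l < n \<Longrightarrow> el n (gco c) (snd c (\<gamma> t)) (u1 t) u2 l = 0"
      unfolding geo_at_def by blast
    show "\<forall>k<n. (crd c \<gamma> k) field_differentiable (at t) \<and> deriv (crd c \<gamma> k) field_differentiable (at t)"
      using twice_diff_deriv[OF u(1)] by (auto simp: field_differentiable_def)
    have "el n (gco c) (snd c (\<gamma> t)) (\<lambda>k. deriv (crd c \<gamma> k) t) (\<lambda>k. deriv (deriv (crd c \<gamma> k)) t) l = 0" if "l < n" for l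
      using u(2)[OF that] el_cong[of n "\<lambda>k. deriv (crd c \<gamma> k) t" "u1 t" "\<lambda>k. deriv (deriv (crd c \<gamma> k)) t" u2]
        DERIV_imp_deriv[OF twice_diff_deriv(1)[OF u(1)]] DERIV_imp_deriv[OF twice_diff_deriv(3)[OF u(1)]] by metis
    thus "\<forall>l<n. (\<Sum>k<n. gco c l k (snd c (\<gamma> t)) * deriv (deriv (crd c \<gamma> k)) t)
              + (\<Sum>i<n. \<Sum>j<n. christoffel n A g c l i j (snd c (\<gamma> t))
                                  * deriv (crd c \<gamma> i) t * deriv (crd c \<gamma> j) t) = 0"
      by (simp add: el_def christoffel_def)
  qed
qed

lemma geo_at_cong:
  assumes "geo_at c \<gamma> t" "\<forall>\<^sub>F s in nhds t. \<gamma>' s = \<gamma> s"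
  shows "geo_at c \<gamma>' t"
proof -
  have "\<gamma>' t = \<gamma> t" using assms(2) by (rule eventually_nhds_x_imp_x)
  moreover have "\<forall>\<^sub>F s in nhds t. \<forall>k<n. snd c (\<gamma>' s) k = snd c (\<gamma> s) k"
    using assms(2) by (rule eventually_mono) simp
  ultimately show ?thesis
    using assms(1) twice_diff_cong[of n "\<lambda>s. snd c (\<gamma> s)" _ _ t "\<lambda>s. snd c (\<gamma>' s)"] unfolding geo_at_def by auto
qed

text \<open>The curve is differentiated in d through the transition and then transformed back to c.
  Uniqueness of derivatives identifies the result of this round trip with the original velocity and
  acceleration; \<open>el_covariant\<close> for the transition from d to c then expresses the
  equation in d by the one in c.\<close>

lemma geo_at_change:
  assumes c: "c \<in> SC" and d: "d \<in> SC" and ev: "\<forall>\<^sub>F s in nhds t. \<gamma> s \<in> fst c \<inter> fst d" and G: "geo_at c \<gamma> t"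
  shows "geo_at d \<gamma> t"
proof -
  have x: "\<gamma> t \<in> fst c" "\<gamma> t \<in> fst d" using eventually_nhds_x_imp_x[OF ev] by auto
  obtain u1 u2 where u: "twice_diff n (\<lambda>\<tau>. snd c (\<gamma> \<tau>)) u1 u2 t"
    "\<And>l. l < n \<Longrightarrow> el n (gco c) (snd c (\<gamma> t)) (u1 t) u2 l = 0"
    using G unfolding geo_at_def by blast
  define v1 where "v1 s a = (\<Sum>i<n. pd i (cp (transition c d) a) (snd c (\<gamma> s)) * u1 s i)" for s a
  have evU: "\<forall>\<^sub>F s in nhds t. snd c (\<gamma> s) \<in> overlap c d"
    using ev by (rule eventually_mono) auto
  note tw = twice_diff_compose[where m = n and \<psi> = "transition c d", OF overlap_open(1)[OF c d d] transition_C[OF c d] u(1) evU]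
  obtain v2 where "twice_diff n (\<lambda>s. transition c d (snd c (\<gamma> s))) v1 v2 t"
    using tw unfolding v1_def by blast
  hence v: "twice_diff n (\<lambda>s. snd d (\<gamma> s)) v1 v2 t"
    by (rule twice_diff_cong) (rule eventually_mono[OF ev], simp add: transition_chart[OF SC_chart[OF c]])
  define \<psi> where "\<psi> = transition d c"
  let ?w1 = "\<lambda>s a. \<Sum>i<n. pd i (cp \<psi> a) (snd d (\<gamma> s)) * v1 s i"
  let ?w2 = "\<lambda>a. (\<Sum>i<n. pd i (cp \<psi> a) (snd d (\<gamma> t)) * v2 i) + (\<Sum>i<n. \<Sum>j<n. pd i (pd j (cp \<psi> a)) (snd d (\<gamma> t)) * v1 t i * v1 t j)"
  note O = overlap_open(1)[OF d c c]
  have evd: "\<forall>\<^sub>F s in nhds t. snd d (\<gamma> s) \<in> overlap d c"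
    using ev by (rule eventually_mono) auto
  have "twice_diff n (\<lambda>s. \<psi> (snd d (\<gamma> s))) ?w1 ?w2 t"
    unfolding \<psi>_def by (rule twice_diff_compose[OF O transition_C[OF d c] v evd])
  hence "twice_diff n (\<lambda>s. snd c (\<gamma> s)) ?w1 ?w2 t"
    by (rule twice_diff_cong) (rule eventually_mono[OF ev], simp add: \<psi>_def transition_chart[OF SC_chart[OF d]])
  note eq = twice_diff_unique[OF u(1) this]
  have "el n (gco d) (snd d (\<gamma> t)) (v1 t) v2 l = 0" if l: "l < n" for l
  proof -
    have "el n (gco d) (snd d (\<gamma> t)) (v1 t) v2 l = (\<Sum>a<n. pd l (cp \<psi> a) (snd d (\<gamma> t)) * el n (gco c) (\<psi> (snd d (\<gamma> t)))
      (\<lambda>a. \<Sum>i<n. pd i (cp \<psi> a) (snd d (\<gamma> t)) * v1 t i)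
      ?w2 a)"
    proof (rule el_covariant[OF O is_chartD(3)[OF SC_chart[OF c]] _ _ _ _ _ _ l])
      show "snd d (\<gamma> t) \<in> overlap d c" using x by auto
      show "Ck_on 2 n (overlap d c) (cp \<psi> a)" if "a < n" for a
        unfolding \<psi>_def by (rule transition_C[OF d c that])
      show "\<psi> z \<in> snd c ` fst c" if "z \<in> overlap d c" for z
        using that by (auto simp: \<psi>_def transition_chart[OF SC_chart[OF d]])
      show "Ck_on 1 n (snd c ` fst c) (gco c a b)" if "a < n" "b < n" for a b
        by (rule smooth_fun_Ck[OF gco_smooth[OF c that]])
      show "gco c a b (\<psi> (snd d (\<gamma> t))) = gco c b a (\<psi> (snd d (\<gamma> t)))" for a b
        unfolding \<psi>_def transition_chart[OF SC_chart[OF d] x(2)] by (rule gco_sym[OF c x(1)])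
      fix i j z assume ij: "i < n" "j < n" and "z \<in> overlap d c"
      then obtain y where y: "y \<in> fst d" "y \<in> fst c" "z = snd d y" by auto
      show "gco d i j z = (\<Sum>a<n. \<Sum>b<n. pd i (cp \<psi> a) z * pd j (cp \<psi> b) z * gco c a b (\<psi> z))"
        using gco_change[OF d c y(1,2) ij] by (simp add: y(3) \<psi>_def transition_chart[OF SC_chart[OF d] y(1)] jacobian_def)
    qed
    also have "\<dots> = (\<Sum>a<n. pd l (cp \<psi> a) (snd d (\<gamma> t)) * el n (gco c) (snd c (\<gamma> t)) (u1 t) u2 a)"
      unfolding \<psi>_def transition_chart[OF SC_chart[OF d] x(2)]
      by (intro sum.cong refl arg_cong2[where f = "(*)"] el_cong) (use eq in \<open>auto simp: \<psi>_def\<close>)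
    finally show ?thesis using u(2) by simp
  qed
  thus ?thesis unfolding geo_at_def using v by blast
qed

definition chr :: "'a chart \<Rightarrow> nat \<Rightarrow> rvec \<Rightarrow> rvec \<Rightarrow> real" where
  "chr c l x v = (\<Sum>i<n. \<Sum>j<n. (pd i (gco c j l) x + pd j (gco c i l) x - pd l (gco c i j) x) / 2 * v i * v j)"

text \<open>The geodesic spray: on pairs of position and velocity the geodesic equation becomes
  first order, with the acceleration solved for by means of the inverse metric.\<close>

definition gfield :: "'a chart \<Rightarrow> nat \<Rightarrow> rvec \<Rightarrow> real" where
  "gfield c i w = (if i < n then w (n + i)
     else - (\<Sum>l<n. mat_inverse n (\<lambda>a b. gco c a b (fst_n n w)) (i - n) l * chr c l (fst_n n w) (snd_n n w)))"

abbreviation gdom :: "'a chart \<Rightarrow> rvec set" where "gdom c \<equiv> tangent_open n (snd c ` fst c)"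

lemma gdom_open: "c \<in> SC \<Longrightarrow> open_n (n + n) (gdom c)"
  by (rule openin_tangent_open[OF is_chartD(3)[OF SC_chart]])

lemma gfield_smooth:
  assumes c: "c \<in> SC" and i: "i < n + n"
  shows "smooth_fun (n + n) (gdom c) (gfield c i)"
  unfolding smooth_fun_def
proof
  fix k
  note O = gdom_open[OF c]
  have comp: "Ck_on k (n + n) (gdom c) (\<lambda>w. f (fst_n n w))" if "smooth_fun n (snd c ` fst c) f" for f
  proof (rule Ck_on_compose[OF O is_chartD(3)[OF SC_chart[OF c]], where \<Phi> = "fst_n n"])
    fix j assume "j < n"
    hence "(\<lambda>w. fst_n n w j) = (\<lambda>w. w j)" by (auto simp: fst_n_def)
    thus "Ck_on k (n + n) (gdom c) (\<lambda>w. fst_n n w j)"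
      using Ck_on_coord[OF O] by simp
  qed (use that in \<open>auto simp: tangent_open_def smooth_fun_def\<close>)
  have sn: "Ck_on k (n + n) (gdom c) (\<lambda>w. snd_n n w j)" for j
    by (cases "j < n") (auto simp: snd_n_def Ck_on_const[OF O] Ck_on_coord[OF O])
  have pdG: "smooth_fun n (snd c ` fst c) (pd a (gco c i j))" if "a < n" "i < n" "j < n" for a i j
    by (rule Ck_on_smooth_pd[OF gco_smooth[OF c that(2,3)] that(1)])
  have chr: "Ck_on k (n + n) (gdom c) (\<lambda>w. chr c l (fst_n n w) (snd_n n w))" if "l < n" for l
    unfolding chr_def
    by (rule Ck_on_sum[OF O], rule Ck_on_sum[OF O], rule Ck_on_mult[OF O _ sn], rule Ck_on_mult[OF O _ sn],
        rule Ck_on_divide[OF O _ Ck_on_const[OF O]], rule Ck_on_diff[OF O], rule Ck_on_add[OF O])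
       (use that in \<open>auto intro!: comp pdG\<close>)
  show "Ck_on k (n + n) (gdom c) (gfield c i)"
  proof (cases "i < n")
    case True
    hence "gfield c i = (\<lambda>w. w (n + i))" by (auto simp: gfield_def)
    thus ?thesis using Ck_on_coord[OF O] by simp
  next
    case False
    have inv: "Ck_on k (n + n) (gdom c) (\<lambda>w. mat_inverse n (\<lambda>a b. gco c a b (fst_n n w)) (i - n) l)" for l
    proof (rule Ck_on_mat_inverse[OF O, where a = "\<lambda>a b w. gco c a b (fst_n n w)"])
      fix w assume "w \<in> gdom c"
      then obtain x where "x \<in> fst c" "fst_n n w = snd c x" by (auto simp: tangent_open_def)
      thus "det_n n (\<lambda>i j. gco c i j (fst_n n w)) \<noteq> 0" using gco_det[OF c] by simp
    qed (rule comp[OF gco_smooth[OF c]])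
    have "Ck_on k (n + n) (gdom c) (\<lambda>w. (-1) * (\<Sum>l<n. mat_inverse n (\<lambda>a b. gco c a b (fst_n n w)) (i - n) l * chr c l (fst_n n w) (snd_n n w)))"
      by (rule Ck_on_cmult[OF O], rule Ck_on_sum[OF O], rule Ck_on_mult[OF O inv chr]) simp
    moreover have "gfield c i = (\<lambda>w. (-1) * (\<Sum>l<n. mat_inverse n (\<lambda>a b. gco c a b (fst_n n w)) (i - n) l * chr c l (fst_n n w) (snd_n n w)))"
      using False by (auto simp: gfield_def)
    ultimately show ?thesis by simp
  qed
qed

lemma el_gfield:
  assumes c: "c \<in> SC" and w: "w \<in> gdom c"
  shows "(\<forall>l<n. el n (gco c) (fst_n n w) (snd_n n w) a l = 0) \<longleftrightarrow> (\<forall>k<n. a k = gfield c (n + k) w)"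
proof -
  obtain x where x: "x \<in> fst c" "fst_n n w = snd c x" using w by (auto simp: tangent_open_def)
  define G where "G = (\<lambda>i j. gco c i j (fst_n n w))"
  define C where "C l = chr c l (fst_n n w) (snd_n n w)" for l
  have dG: "det_n n G \<noteq> 0" using gco_det[OF c x(1)] by (simp add: G_def x(2))
  have el: "el n (gco c) (fst_n n w) (snd_n n w) a l = (\<Sum>k<n. G l k * a k) + C l" for l
    by (simp add: el_def G_def C_def chr_def)
  have gf: "gfield c (n + k) w = - (\<Sum>l<n. mat_inverse n G k l * C l)" for k
    by (simp add: gfield_def G_def C_def)
  show ?thesis
    unfolding el gf
  proof (intro iffI allI impI)
    fix k assume z: "\<forall>l<n. (\<Sum>k<n. G l k * a k) + C l = 0" and k: "k < n"
    have "(\<Sum>l<n. mat_inverse n G k l * C l) = (\<Sum>l<n. mat_inverse n G k l * - (\<Sum>i<n. G l i * a i))"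
      using z by (intro sum.cong refl) (auto simp: add_eq_0_iff)
    also have "\<dots> = - (\<Sum>l<n. \<Sum>i<n. mat_inverse n G k l * G l i * a i)"
      by (simp add: sum_distrib_left sum_negf mult.assoc)
    also have "\<dots> = - (\<Sum>i<n. (\<Sum>l<n. mat_inverse n G k l * G l i) * a i)"
      by (subst sum.swap) (simp add: sum_distrib_right)
    also have "\<dots> = - (\<Sum>i<n. (if k = i then 1 else 0) * a i)"
      by (simp add: mat_inverse(2)[OF dG k])
    also have "\<dots> = - a k" using k by (simp add: if_distrib[of "\<lambda>x. x * _"] cong: if_cong)
    finally show "a k = - (\<Sum>l<n. mat_inverse n G k l * C l)" by simp
  next
    fix l assume a: "\<forall>k<n. a k = - (\<Sum>l<n. mat_inverse n G k l * C l)" and l: "l < n"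
    have "(\<Sum>k<n. G l k * a k) = - (\<Sum>k<n. \<Sum>m<n. G l k * mat_inverse n G k m * C m)"
      using a by (simp add: sum_distrib_left sum_negf mult.assoc)
    also have "\<dots> = - (\<Sum>m<n. (\<Sum>k<n. G l k * mat_inverse n G k m) * C m)"
      by (subst sum.swap) (simp add: sum_distrib_right)
    also have "\<dots> = - (\<Sum>m<n. (if l = m then 1 else 0) * C m)"
      by (simp add: mat_inverse(1)[OF dG l])
    also have "\<dots> = - C l" using l by (simp add: if_distrib[of "\<lambda>x. x * _"] cong: if_cong)
    finally show "(\<Sum>k<n. G l k * a k) + C l = 0" by simp
  qed
qed

text \<open>The definition of a geodesic asks for the equation in every chart that the curve meets;
  a solution computed in one chart satisfies it in the others by
  \<open>geo_at_change\<close>.\<close>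

lemma geodesic_of_sol:
  assumes c: "c \<in> A" and J: "open J" and X: "ode_sol (n + n) (gfield c) (gdom c) J X"
  defines "\<gamma> \<equiv> \<lambda>t. chart_inv c (fst_n n (X t))"
  shows "geodesic_on n M A g J \<gamma>"
    "\<And>t. t \<in> J \<Longrightarrow> \<gamma> t \<in> fst c \<and> snd c (\<gamma> t) = fst_n n (X t)"
    "\<And>t k. t \<in> J \<Longrightarrow> k < n \<Longrightarrow> ((\<lambda>t. snd c (\<gamma> t) k) has_real_derivative X t (n + k)) (at t)"
proof -
  note cS = A_SC[OF c]
  have XD: "X t \<in> gdom c" "i < n + n \<Longrightarrow> ((cp X i) has_real_derivative gfield c i (X t)) (at t)" if "t \<in> J" for t i
    using ode_solD[OF X that] at_within_open[OF that J] by auto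
  show mem: "\<gamma> t \<in> fst c \<and> snd c (\<gamma> t) = fst_n n (X t)" if "t \<in> J" for t
    using XD(1)[OF that] chart_inv(2,3)[OF SC_chart[OF cS]] by (auto simp: \<gamma>_def tangent_open_def)
  have evJ: "\<forall>\<^sub>F s in nhds t. s \<in> J" if "t \<in> J" for t using that J by (auto simp: eventually_nhds)
  have f: "((\<lambda>t. fst_n n (X t) k) has_real_derivative snd_n n (X t) k) (at t)" if "t \<in> J" "k < n" for t k
    using XD(2)[OF that(1), of k] that by (simp add: fst_n_def gfield_def snd_n_def)
  have td: "twice_diff n (\<lambda>t. fst_n n (X t)) (\<lambda>t. snd_n n (X t)) (\<lambda>k. gfield c (n + k) (X t)) t" if t: "t \<in> J" for t
    unfolding twice_diff_def
  proof (intro conjI allI impI)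
    show "\<forall>\<^sub>F s in nhds t. \<forall>k<n. ((\<lambda>t. fst_n n (X t) k) has_real_derivative snd_n n (X s) k) (at s)"
      using evJ[OF t] by (rule eventually_mono) (use f in auto)
    show "((\<lambda>t. snd_n n (X t) k) has_real_derivative gfield c (n + k) (X t)) (at t)" if "k < n" for k
      using XD(2)[OF t, of "n + k"] that by (simp add: snd_n_def)
  qed
  have td\<gamma>: "twice_diff n (\<lambda>t. snd c (\<gamma> t)) (\<lambda>t. snd_n n (X t)) (\<lambda>k. gfield c (n + k) (X t)) t" if t: "t \<in> J" for t
    using td[OF t] by (rule twice_diff_cong) (use evJ[OF t] mem in \<open>auto elim!: eventually_mono\<close>)
  thus "((\<lambda>t. snd c (\<gamma> t) k) has_real_derivative X t (n + k)) (at t)" if "t \<in> J" "k < n" for t k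
    using twice_diff_deriv(1)[OF td\<gamma>[OF that(1)] that(2)] that(2) by (simp add: snd_n_def)
  have geo: "geo_at c \<gamma> t" if t: "t \<in> J" for t
    unfolding geo_at_def
    using td\<gamma>[OF t] el_gfield[OF cS XD(1)[OF t], of "\<lambda>k. gfield c (n + k) (X t)"] mem[OF t] by auto
  have "continuous_on J (\<lambda>t. fst_n n (X t))"
  proof (rule continuous_on_vec[of n])
    fix j assume "j < n"
    thus "continuous_on J (\<lambda>t. fst_n n (X t) j)"
      using f J by (intro DERIV_continuous_on) (auto intro: has_field_derivative_at_within)
  qed (rule fst_n_Rn)
  hence "continuous_map (top_of_set J) (sub_n n (snd c ` fst c)) (\<lambda>t. fst_n n (X t))"
    using XD(1) by (auto simp: subtopology_Rn[OF openin_Rn_sub[OF is_chartD(3)[OF SC_chart[OF cS]]]] tangent_open_def)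
  from continuous_map_compose[OF this continuous_map_chart_inv[OF SC_chart[OF cS]]]
  have cont: "continuous_map (top_of_set J) M \<gamma>" by (simp add: \<gamma>_def o_def)
  show "geodesic_on n M A g J \<gamma>"
    unfolding geodesic_on_iff[OF J]
  proof (intro conjI ballI impI cont)
    fix d t assume d: "d \<in> A" and t: "t \<in> J" "\<gamma> t \<in> fst d"
    have "\<forall>\<^sub>F s in nhds t. s \<in> J \<and> \<gamma> s \<in> fst d"
      by (rule curve_in_open[OF cont J t(1) is_chartD(1)[OF SC_chart[OF A_SC[OF d]]] t(2)])
    hence "\<forall>\<^sub>F s in nhds t. \<gamma> s \<in> fst c \<inter> fst d" by (rule eventually_mono) (use mem in auto)
    from geo_at_change[OF cS A_SC[OF d] this geo[OF t(1)]] show "geo_at d \<gamma> t" .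
  qed
qed

abbreviation (input) phase :: "'a chart \<Rightarrow> (real \<Rightarrow> 'a) \<Rightarrow> real \<Rightarrow> rvec" where
  "phase c \<gamma> \<equiv> \<lambda>t. join n (snd c (\<gamma> t)) (\<lambda>k. if k < n then deriv (crd c \<gamma> k) t else 0)"

lemma sol_of_geodesic:
  assumes c: "c \<in> A" and J: "open J" and \<gamma>: "geodesic_on n M A g J \<gamma>" and mem: "\<And>t. t \<in> J \<Longrightarrow> \<gamma> t \<in> fst c"
  shows "ode_sol (n + n) (gfield c) (gdom c) J
    (phase c \<gamma>)"
  unfolding ode_sol_def
proof (intro ballI conjI allI impI)
  fix t assume t: "t \<in> J"
  note cS = A_SC[OF c]
  define X where "X t = phase c \<gamma> t" for t
  have vR: "(\<lambda>k. if k < n then deriv (crd c \<gamma> k) t else 0) \<in> R_n n" for t by (simp add: R_n_iff)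
  have xR: "snd c (\<gamma> t) \<in> R_n n" by (rule chart_Rn[OF SC_chart[OF cS] mem[OF t]])
  show dom: "phase c \<gamma> t \<in> gdom c"
    using xR vR mem[OF t] by (auto simp: tangent_open_def join_Rn fst_n_join)
  have "geo_at c \<gamma> t" using \<gamma> c t mem[OF t] unfolding geodesic_on_iff[OF J] by blast
  then obtain u1 u2 where u: "twice_diff n (\<lambda>\<tau>. snd c (\<gamma> \<tau>)) u1 u2 t"
    "\<And>l. l < n \<Longrightarrow> el n (gco c) (snd c (\<gamma> t)) (u1 t) u2 l = 0"
    unfolding geo_at_def by blast
  note D = twice_diff_deriv[OF u(1)]
  have fX: "fst_n n (X t) = snd c (\<gamma> t)" using xR by (simp add: X_def fst_n_join)
  have sX: "snd_n n (X t) k = u1 t k" if "k < n" for k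
    using DERIV_imp_deriv[OF D(1)[OF that]] that by (simp add: X_def snd_n_join[OF vR])
  have "\<forall>l<n. el n (gco c) (fst_n n (X t)) (snd_n n (X t)) u2 l = 0"
    using u(2) el_cong[of n "snd_n n (X t)" "u1 t" u2 u2, OF sX refl] unfolding fX by simp
  hence u2: "u2 k = gfield c (n + k) (X t)" if "k < n" for k
    using el_gfield[OF cS dom[folded X_def]] that by blast
  fix i assume i: "i < n + n"
  have "((cp X i) has_real_derivative gfield c i (X t)) (at t)"
  proof (cases "i < n")
    case True
    hence "(cp X i) = (\<lambda>t. snd c (\<gamma> t) i)" by (simp add: X_def join_def)
    moreover have "gfield c i (X t) = u1 t i" using sX[OF True] True by (simp add: gfield_def snd_n_def)
    ultimately show ?thesis using D(1)[OF True] by simp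
  next
    case False
    hence k: "i - n < n" "i = n + (i - n)" using i by auto
    have "(cp X i) = deriv (\<lambda>\<tau>. snd c (\<gamma> \<tau>) (i - n))" using k False by (auto simp: X_def join_def)
    thus ?thesis using D(3)[OF k(1)] u2[OF k(1)] k(2) by simp
  qed
  thus "((\<lambda>t. phase c \<gamma> t i) has_real_derivative
     gfield c i (phase c \<gamma> t)) (at t within J)"
    unfolding X_def by (rule has_field_derivative_at_within)
qed

lemma geodesic_scale:
  assumes J: "open J" and J': "open J'" and \<gamma>: "geodesic_on n M A g J \<gamma>" and sub: "\<And>t. t \<in> J' \<Longrightarrow> s * t \<in> J"
  shows "geodesic_on n M A g J' (\<lambda>t. \<gamma> (s * t))"
  unfolding geodesic_on_iff[OF J']
proof (intro conjI ballI impI)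
  have "continuous_map (top_of_set J') (top_of_set J) (\<lambda>t. s * t)"
    using sub by (auto intro!: continuous_intros)
  moreover have "continuous_map (top_of_set J) M \<gamma>" using \<gamma> unfolding geodesic_on_iff[OF J] by blast
  ultimately show "continuous_map (top_of_set J') M (\<lambda>t. \<gamma> (s * t))"
    by (rule continuous_map_compose[unfolded o_def])
  fix c t assume ct: "c \<in> A" "t \<in> J'" "\<gamma> (s * t) \<in> fst c"
  hence "geo_at c \<gamma> (s * t)" using \<gamma> sub unfolding geodesic_on_iff[OF J] by blast
  then obtain u1 u2 where u: "twice_diff n (\<lambda>\<tau>. snd c (\<gamma> \<tau>)) u1 u2 (s * t)"
    "\<And>l. l < n \<Longrightarrow> el n (gco c) (snd c (\<gamma> (s * t))) (u1 (s * t)) u2 l = 0"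
    unfolding geo_at_def by blast
  have "el n (gco c) (snd c (\<gamma> (s * t))) (\<lambda>k. s * u1 (s * t) k) (\<lambda>k. s * (s * u2 k)) l = 0" if "l < n" for l
    unfolding el_scale u(2)[OF that] by simp
  thus "geo_at c (\<lambda>t. \<gamma> (s * t)) t"
    unfolding geo_at_def
    by (intro exI[of _ "\<lambda>\<tau> k. s * u1 (s * \<tau>) k"] exI[of _ "\<lambda>k. s * (s * u2 k)"] conjI twice_diff_scale[OF u(1)]) simp
qed

text \<open>A velocity has to be right in all charts around the point; the chain rule through the
  transition reduces this to one of them.\<close>

lemma has_velocity_chart:
  assumes c: "c \<in> A" and J: "open J" and cont: "continuous_map (top_of_set J) M \<gamma>" and t: "t \<in> J" "\<gamma> t \<in> fst c"
    and u: "u \<in> R_n n" and der: "\<And>k. k < n \<Longrightarrow> ((crd c \<gamma> k) has_real_derivative u k) (at t)"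
  shows "has_velocity n A \<gamma> t (tv c (\<gamma> t) u)"
  unfolding has_velocity_def
proof (intro conjI ballI impI allI)
  note cS = A_SC[OF c]
  show "tv c (\<gamma> t) u \<in> tangent_space n A (\<gamma> t)" by (rule tvec_of_in[OF cS t(2)])
  fix d k assume d: "d \<in> A" "\<gamma> t \<in> fst d" and k: "k < n"
  note dS = A_SC[OF d(1)]
  have o: "openin M (fst c \<inter> fst d)" using is_chartD(1)[OF SC_chart] cS dS by blast
  have ev: "\<forall>\<^sub>F s in nhds t. s \<in> J \<and> \<gamma> s \<in> fst c \<inter> fst d"
    by (rule curve_in_open[OF cont J t(1) o]) (use t d in auto)
  have "((\<lambda>\<tau>. transition c d (snd c (\<gamma> \<tau>)) k) has_real_derivative
      (\<Sum>i<n. pd i (cp (transition c d) k) (snd c (\<gamma> t)) * u i)) (at t)"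
  proof (rule C1_chain[OF overlap_open(1)[OF cS dS dS] transition_C[OF cS dS k] _ _ der])
    show "snd c (\<gamma> t) \<in> overlap c d" using t d by auto
    show "\<forall>\<^sub>F s in at t. snd c (\<gamma> s) \<in> R_n n"
      by (rule eventually_at_nhds, rule eventually_mono[OF ev]) (use chart_Rn[OF SC_chart[OF cS]] in blast)
  qed
  moreover have eq: "\<forall>\<^sub>F s in nhds t. snd d (\<gamma> s) k = transition c d (snd c (\<gamma> s)) k"
    by (rule eventually_mono[OF ev]) (simp add: transition_chart[OF SC_chart[OF cS]])
  ultimately have "((crd d \<gamma> k) has_real_derivative
      (\<Sum>i<n. pd i (cp (transition c d) k) (snd c (\<gamma> t)) * u i)) (at t)"
    by (subst DERIV_cong_ev[OF refl eq refl])
  thus "((crd d \<gamma> k) has_real_derivative tv c (\<gamma> t) u d k) (at t)"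
    using d k by (simp add: tvec_of_def differential_def jacobian_def)
qed

text \<open>Agreement of position and velocity together is propagated along the interval. Where the
  positions differ, the Hausdorff property keeps them apart nearby; where they agree, both curves
  run in one chart for a while, and uniqueness for the spray applies.\<close>

lemma geodesic_unique:
  assumes J: "open J" "is_interval J" and \<gamma>: "geodesic_on n M A g J \<gamma>1" "geodesic_on n M A g J \<gamma>2"
    and st: "s \<in> J" "t \<in> J" and eq: "\<gamma>1 s = \<gamma>2 s" and v: "has_velocity n A \<gamma>1 s v" "has_velocity n A \<gamma>2 s v"
  shows "\<gamma>1 t = \<gamma>2 t"
proof -
  \<comment> \<open>Velocities are compared in every chart around the point, so that P survives a
    change of the chart in which the spray is used.\<close>
  define P where "P t \<longleftrightarrow> \<gamma>1 t = \<gamma>2 t \<and> (\<forall>c\<in>A. \<gamma>1 t \<in> fst c \<longrightarrow>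
     (\<forall>k<n. deriv (crd c \<gamma>1 k) t = deriv (crd c \<gamma>2 k) t))" for t
  have cont: "continuous_map (top_of_set J) M \<gamma>1" "continuous_map (top_of_set J) M \<gamma>2"
    using \<gamma> by (auto simp: geodesic_on_def)
  have "P t"
  proof (rule connected_induction_simple[where S = J and P = P and a = s and b = t])
    show "connected J" using J(2) by (rule is_interval_connected)
    show "P s"
      unfolding P_def
    proof (intro conjI ballI impI allI eq)
      fix c k assume c: "c \<in> A" "\<gamma>1 s \<in> fst c" "k < n"
      have "((crd c \<gamma>1 k) has_real_derivative v c k) (at s)" "((crd c \<gamma>2 k) has_real_derivative v c k) (at s)"
        using v c eq by (auto simp: has_velocity_def)
      thus "deriv (crd c \<gamma>1 k) s = deriv (crd c \<gamma>2 k) s"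
        by (simp add: DERIV_imp_deriv)
    qed
    fix a assume a: "a \<in> J"
    have top: "\<gamma>1 a \<in> topspace M" "\<gamma>2 a \<in> topspace M"
      using continuous_map_image_subset_topspace[OF cont(1)] continuous_map_image_subset_topspace[OF cont(2)] a by auto
    show "\<exists>T. openin (top_of_set J) T \<and> a \<in> T \<and> (\<forall>x\<in>T. \<forall>y\<in>T. P x \<longrightarrow> P y)"
    proof (cases "\<gamma>1 a = \<gamma>2 a")
      case False
      have "Hausdorff_space M" using manifold by (simp add: smooth_manifold_def)
      then obtain U V where UV: "openin M U" "openin M V" "\<gamma>1 a \<in> U" "\<gamma>2 a \<in> V" "disjnt U V"
        unfolding Hausdorff_space_def using False top by blast
      have "\<forall>\<^sub>F s in nhds a. (s \<in> J \<and> \<gamma>1 s \<in> U) \<and> (s \<in> J \<and> \<gamma>2 s \<in> V)"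
        by (rule eventually_conj[OF curve_in_open[OF cont(1) J(1) a UV(1,3)] curve_in_open[OF cont(2) J(1) a UV(2,4)]])
      then obtain T where T: "open T" "a \<in> T" "\<forall>s\<in>T. (s \<in> J \<and> \<gamma>1 s \<in> U) \<and> (s \<in> J \<and> \<gamma>2 s \<in> V)"
        unfolding eventually_nhds by blast
      have "openin (top_of_set J) T" using T by (auto simp: openin_open intro!: exI[of _ T])
      moreover have "\<not> P x" if "x \<in> T" for x using T(3) that UV(5) by (auto simp: P_def disjnt_iff)
      ultimately show ?thesis using T(2) by blast
    next
      case True
      obtain c where c: "c \<in> A" "\<gamma>1 a \<in> fst c" using A_cover top by blast
      note cS = A_SC[OF c(1)]
      note o = is_chartD(1)[OF SC_chart[OF cS]]
      have "\<forall>\<^sub>F s in nhds a. (s \<in> J \<and> \<gamma>1 s \<in> fst c) \<and> (s \<in> J \<and> \<gamma>2 s \<in> fst c)"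
        by (rule eventually_conj[OF curve_in_open[OF cont(1) J(1) a o] curve_in_open[OF cont(2) J(1) a o]]) (use c True in auto)
      then obtain r where r: "r > 0" "\<forall>s. dist s a < r \<longrightarrow> (s \<in> J \<and> \<gamma>1 s \<in> fst c) \<and> (s \<in> J \<and> \<gamma>2 s \<in> fst c)"
        unfolding eventually_nhds_metric by blast
      define I where "I = {a - r<..<a + r}"
      have I: "open I" "is_interval I" "a \<in> I" "I \<subseteq> J" "\<And>s. s \<in> I \<Longrightarrow> \<gamma>1 s \<in> fst c" "\<And>s. s \<in> I \<Longrightarrow> \<gamma>2 s \<in> fst c"
        using r by (auto simp: I_def is_interval_oo dist_real_def abs_less_iff)
      have g: "geodesic_on n M A g I \<gamma>1" "geodesic_on n M A g I \<gamma>2"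
        using geodesic_scale[OF J(1) I(1) \<gamma>(1), of 1] geodesic_scale[OF J(1) I(1) \<gamma>(2), of 1] I(4) by auto
      note sol = sol_of_geodesic[OF c(1) I(1) g(1) I(5)] sol_of_geodesic[OF c(1) I(1) g(2) I(6)]
      have step: "P y" if xy: "x \<in> I" "y \<in> I" and Px: "P x" for x y
      proof -
        have all: "\<gamma>1 z = \<gamma>2 z" if z: "z \<in> I" for z
        proof -
          have "phase c \<gamma>1 z
             = phase c \<gamma>2 z"
            by (rule ode_unique[OF gdom_open[OF cS] smooth_fun_Ck[OF gfield_smooth[OF cS]] I(2) sol xy(1) _ z])
               (use Px c I(5)[OF xy(1)] in \<open>auto simp: P_def fun_eq_iff join_def\<close>)
          hence "fst_n n (phase c \<gamma>1 z)
             = fst_n n (phase c \<gamma>2 z)" by simp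
          hence "snd c (\<gamma>1 z) = snd c (\<gamma>2 z)"
            using chart_Rn[OF SC_chart[OF cS]] I(5,6)[OF z] by (simp add: fst_n_join)
          thus ?thesis using is_chartD(4)[OF SC_chart[OF cS]] I(5,6)[OF z] by (auto dest: inj_onD)
        qed
        have "deriv (crd d \<gamma>1 k) y = deriv (crd d \<gamma>2 k) y" for d :: "'a chart" and k
        proof (rule deriv_cong_ev)
          have "\<forall>\<^sub>F s in nhds y. s \<in> I" using xy(2) I(1) by (auto simp: eventually_nhds)
          thus "\<forall>\<^sub>F s in nhds y. snd d (\<gamma>1 s) k = snd d (\<gamma>2 s) k"
            by (rule eventually_mono) (simp add: all)
        qed simp
        thus ?thesis using all[OF xy(2)] by (simp add: P_def)
      qed
      have "openin (top_of_set J) I" using I(1,4) by (auto simp: openin_open intro!: exI[of _ I])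
      thus ?thesis using I(3) step by blast
    qed
  qed (use st in auto)
  thus ?thesis by (simp add: P_def)
qed

text \<open>Makes the definite description in \<open>exp_map\<close> denote.\<close>

lemma exp_related_unique:
  assumes "exp_related n M A g x v y1" "exp_related n M A g x v y2"
  shows "y1 = y2"
proof -
  obtain \<gamma>1 s1 t1 where 1: "s1 < 0" "1 < t1" "geodesic_on n M A g {s1<..<t1} \<gamma>1" "\<gamma>1 0 = x" "has_velocity n A \<gamma>1 0 v" "\<gamma>1 1 = y1"
    using assms(1) unfolding exp_related_def by blast
  obtain \<gamma>2 s2 t2 where 2: "s2 < 0" "1 < t2" "geodesic_on n M A g {s2<..<t2} \<gamma>2" "\<gamma>2 0 = x" "has_velocity n A \<gamma>2 0 v" "\<gamma>2 1 = y2"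
    using assms(2) unfolding exp_related_def by blast
  define J where "J = {max s1 s2<..<min t1 t2}"
  have "geodesic_on n M A g J \<gamma>1" "geodesic_on n M A g J \<gamma>2"
    using geodesic_scale[OF _ _ 1(3), of J 1] geodesic_scale[OF _ _ 2(3), of J 1] by (auto simp: J_def)
  from geodesic_unique[OF _ _ this, of 0 1 v] show ?thesis using 1 2 by (auto simp: J_def is_interval_oo)
qed

lemma exp_map_eq:
  assumes "exp_related n M A g x v y"
  shows "v \<in> exp_dom n M A g x" "exp_map n M A g x v = y"
  using assms exp_related_unique by (auto simp: exp_dom_def exp_map_def)

text \<open>By homogeneity the geodesic with velocity v at parameter t is the one with velocity v /
  \<sigma> at parameter \<sigma> t; for small v this stays within the short times and small
  velocities for which the spray has a smooth flow. The final conjunct records that rays through the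
  origin are geodesics, the input of the Gauss lemma.\<close>

lemma exp_local:
  assumes x0: "x0 \<in> topspace M" and e: "orthonormal_basis p q A g x0 e" and c: "c \<in> A" "x0 \<in> fst c"
  shows "\<exists>\<rho>>0. \<exists>E. E zero_n = snd c x0 \<and>
     (\<forall>i<n. smooth_fun n (nbox n zero_n \<rho>) (cp E i)) \<and>
     (\<forall>i<n. \<forall>j<n. jacobian E zero_n i j = e j c i) \<and>
     (\<forall>u\<in>nbox n zero_n \<rho>. E u \<in> snd c ` fst c \<and> exp_related n M A g x0 (lincomb n u e) (chart_inv c (E u)) \<and>
        geo_at c (\<lambda>s. chart_inv c (E (\<lambda>i. s * u i))) 1)"
proof -
  note cS = A_SC[OF c(1)]
  note cc = SC_chart[OF cS]
  define z0 where "z0 = snd c x0"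
  have z0R: "z0 \<in> R_n n" unfolding z0_def by (rule chart_Rn[OF cc c(2)])
  have zR: "zero_n \<in> R_n n" by (simp add: R_n_iff)
  have w0: "join n z0 zero_n \<in> gdom c"
    using z0R zR c(2) by (auto simp: tangent_open_def join_Rn fst_n_join z0_def)
  obtain \<delta> \<tau> \<Phi> where \<Phi>: "local_flow (n + n) (gdom c) (gfield c) (join n z0 zero_n) \<delta> \<tau> \<Phi>"
    "\<forall>t\<in>{-\<tau>..\<tau>}. \<forall>i<n+n. smooth_fun (n + n) (nbox (n + n) (join n z0 zero_n) \<delta>) (\<lambda>z. \<Phi> t z i)"
    using local_flow_smooth[where V = "gfield c", OF gdom_open[OF cS] gfield_smooth[OF cS] w0] by auto
  have \<delta>: "0 < \<delta>" "0 < \<tau>" using \<Phi> by (auto simp: local_flow_def)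
  \<comment> \<open>Half of \<tau>, so that the rescaled curves live on (-2, 2), an open interval
    around [0, 1] as \<open>exp_related\<close> requires.\<close>
  define \<sigma> where "\<sigma> = \<tau> / 2"
  have \<sigma>: "0 < \<sigma>" "\<sigma> \<le> \<tau>" using \<delta> by (auto simp: \<sigma>_def)
  define B where "B u = (\<lambda>l. \<Sum>i<n. u i * e i c l)" for u :: rvec
  have lin: "lincomb n u e \<in> tangent_space n A x0" for u
    by (rule lincomb_in[OF x0 orthonormal_in[OF x0 e]])
  have Bl: "lincomb n u e = tv c x0 (B u)" "B u \<in> R_n n" for u
  proof -
    have "lincomb n u e c = B u" by (simp add: B_def lincomb_def)
    thus "lincomb n u e = tv c x0 (B u)" "B u \<in> R_n n"
      using tangent_space_tvec[OF c lin[of u]] by simp_all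
  qed
  define S where "S = (\<Sum>i<n. \<Sum>l<n. \<bar>e i c l\<bar>)"
  have S: "0 \<le> S" by (auto simp: S_def intro!: sum_nonneg)
  \<comment> \<open>Small enough that \<open>B u / \<sigma>\<close> has coordinates below \<delta>
    for u in the box of radius \<rho>; S bounds the entries of the basis.\<close>
  define \<rho> where "\<rho> = \<delta> * \<sigma> / (S + 1)"
  have \<rho>: "0 < \<rho>" using \<delta> \<sigma> S by (simp add: \<rho>_def)
  define w where "w u = join n z0 (\<lambda>l. B u l / \<sigma>)" for u
  have w: "w u \<in> nbox (n + n) (join n z0 zero_n) \<delta>" if u: "u \<in> nbox n zero_n \<rho>" for u
  proof -
    have "\<bar>B u l / \<sigma>\<bar> < \<delta>" if l: "l < n" for l
    proof -
      have "\<bar>B u l\<bar> \<le> (\<Sum>i<n. \<bar>u i * e i c l\<bar>)" unfolding B_def by (rule sum_abs)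
      also have "\<dots> \<le> (\<Sum>i<n. \<rho> * \<bar>e i c l\<bar>)"
        unfolding abs_mult using u by (intro sum_mono mult_right_mono) (auto simp: nbox_def intro: less_imp_le)
      also have "\<dots> \<le> (\<Sum>i<n. \<rho> * (\<Sum>l<n. \<bar>e i c l\<bar>))"
        using \<rho> l by (intro sum_mono mult_left_mono member_le_sum) auto
      also have "\<dots> = \<rho> * S" by (simp add: S_def sum_distrib_left)
      also have "\<dots> < \<delta> * \<sigma>" using \<delta> \<sigma> S by (simp add: \<rho>_def field_simps)
      finally show ?thesis using \<sigma> by (simp add: abs_divide pos_divide_less_eq)
    qed
    hence "(\<lambda>l. B u l / \<sigma>) \<in> nbox n zero_n \<delta>" using Bl(2)[of u] by (auto simp: nbox_def R_n_iff)
    thus ?thesis unfolding w_def using z0R \<delta> by (intro join_nbox nbox_center)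
  qed
  let ?I = "{-\<tau><..<\<tau>}"
  have flow: "ode_sol (n + n) (gfield c) (gdom c) ?I (\<lambda>t. \<Phi> t (w u))" "\<Phi> 0 (w u) = w u" if "u \<in> nbox n zero_n \<rho>" for u
  proof -
    have "?I \<subseteq> {-\<tau>..\<tau>}" by auto
    moreover have "ode_sol (n + n) (gfield c) (gdom c) {-\<tau>..\<tau>} (\<lambda>t. \<Phi> t (w u))" and "\<Phi> 0 (w u) = w u"
      using \<Phi>(1) w[OF that] by (auto simp: local_flow_def)
    ultimately show "ode_sol (n + n) (gfield c) (gdom c) ?I (\<lambda>t. \<Phi> t (w u))" "\<Phi> 0 (w u) = w u"
      using ode_sol_subset by auto
  qed
  define \<Gamma> where "\<Gamma> u t = fst_n n (\<Phi> (\<sigma> * t) (w u))" for u t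
  define E where "E u = \<Gamma> u 1" for u
  let ?J = "{-2<..<2::real}"
  have sJ: "\<sigma> * t \<in> ?I" if "t \<in> ?J" for t
  proof -
    have "\<bar>\<sigma> * t\<bar> < \<sigma> * 2" unfolding abs_mult using that \<sigma> by (auto intro!: mult_strict_left_mono simp: abs_less_iff)
    thus ?thesis by (auto simp: \<sigma>_def abs_less_iff)
  qed
  have geo: "geodesic_on n M A g ?J (\<lambda>t. chart_inv c (\<Gamma> u t))"
    and mem: "\<And>t. t \<in> ?J \<Longrightarrow> chart_inv c (\<Gamma> u t) \<in> fst c \<and> snd c (chart_inv c (\<Gamma> u t)) = \<Gamma> u t"
    and der0: "\<And>k. k < n \<Longrightarrow> ((\<lambda>t. \<Gamma> u t k) has_real_derivative B u k) (at 0)"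
    and G0: "chart_inv c (\<Gamma> u 0) = x0" "\<Gamma> u 0 = z0"
    and vel: "has_velocity n A (\<lambda>t. chart_inv c (\<Gamma> u t)) 0 (lincomb n u e)"
    if u: "u \<in> nbox n zero_n \<rho>" for u
  proof -
    note gs = geodesic_of_sol[OF c(1) _ flow(1)[OF u], simplified]
    show g: "geodesic_on n M A g ?J (\<lambda>t. chart_inv c (\<Gamma> u t))"
      unfolding \<Gamma>_def by (rule geodesic_scale[OF _ _ gs(1) sJ]) auto
    show m: "chart_inv c (\<Gamma> u t) \<in> fst c \<and> snd c (chart_inv c (\<Gamma> u t)) = \<Gamma> u t" if "t \<in> ?J" for t
      using gs(2)[of "\<sigma> * t"] sJ[OF that] by (simp add: \<Gamma>_def)
    show z: "\<Gamma> u 0 = z0" using flow(2)[OF u] z0R by (simp add: \<Gamma>_def w_def fst_n_join)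
    thus x: "chart_inv c (\<Gamma> u 0) = x0" using chart_inv(1)[OF cc c(2)] by (simp add: z0_def)
    show d: "((\<lambda>t. \<Gamma> u t k) has_real_derivative B u k) (at 0)" if k: "k < n" for k
    proof -
      have "((\<lambda>t. \<Phi> t (w u) k) has_real_derivative gfield c k (\<Phi> 0 (w u))) (at 0)"
        using ode_solD(2)[OF flow(1)[OF u], of 0 k] k \<delta> by (simp add: at_within_open[of 0 ?I])
      hence "((\<lambda>t. \<Phi> t (w u) k) has_real_derivative B u k / \<sigma>) (at (\<sigma> * 0))"
        using k flow(2)[OF u] by (simp add: gfield_def w_def join_nth)
      moreover have "((\<lambda>t. \<sigma> * t) has_real_derivative \<sigma>) (at 0)" by (auto intro!: derivative_eq_intros)
      ultimately have "((\<lambda>t. \<Phi> (\<sigma> * t) (w u) k) has_real_derivative B u k / \<sigma> * \<sigma>) (at 0)" by (rule DERIV_chain2)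
      thus ?thesis using k \<sigma> by (simp add: \<Gamma>_def fst_n_def)
    qed
    have "has_velocity n A (\<lambda>t. chart_inv c (\<Gamma> u t)) 0 (tv c (chart_inv c (\<Gamma> u 0)) (B u))"
    proof (rule has_velocity_chart[OF c(1), of ?J])
      show "continuous_map (top_of_set ?J) M (\<lambda>t. chart_inv c (\<Gamma> u t))" using g by (simp add: geodesic_on_def)
      fix k assume k: "k < n"
      have "\<forall>\<^sub>F t in nhds 0. t \<in> ?J" by (auto simp: eventually_nhds intro!: exI[of _ ?J])
      hence ev: "\<forall>\<^sub>F t in nhds 0. snd c (chart_inv c (\<Gamma> u t)) k = \<Gamma> u t k"
        by (rule eventually_mono) (simp add: m)
      show "((\<lambda>\<tau>. snd c (chart_inv c (\<Gamma> u \<tau>)) k) has_real_derivative B u k) (at 0)"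
        by (subst DERIV_cong_ev[OF refl ev refl]) (rule d[OF k])
    qed (use Bl(2) c x in auto)
    thus "has_velocity n A (\<lambda>t. chart_inv c (\<Gamma> u t)) 0 (lincomb n u e)" unfolding x Bl(1) .
  qed
  have rel: "exp_related n M A g x0 (lincomb n (\<lambda>i. s * u i) e) (chart_inv c (\<Gamma> u s))"
    if u: "u \<in> nbox n zero_n \<rho>" and s: "s \<in> ?J" for u s
  proof -
    \<comment> \<open>Larger than 1 because \<open>\<bar>s\<bar> < 2\<close>, and such that
      \<open>s * t\<close> stays in (-2, 2) for \<open>\<bar>t\<bar> < r\<close>.\<close>
    define r where "r = 2 / max 1 \<bar>s\<bar>"
    have r: "1 < r" using s by (auto simp: r_def field_simps max_def)
    have sub: "s * t \<in> ?J" if "t \<in> {-r<..<r}" for t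
    proof -
      have "\<bar>s * t\<bar> \<le> max 1 \<bar>s\<bar> * \<bar>t\<bar>" unfolding abs_mult by (intro mult_right_mono) auto
      also have "\<dots> < max 1 \<bar>s\<bar> * r" using that by (intro mult_strict_left_mono) auto
      also have "\<dots> = 2" by (simp add: r_def)
      finally show ?thesis by (auto simp: abs_less_iff)
    qed
    have g: "geodesic_on n M A g {-r<..<r} (\<lambda>t. chart_inv c (\<Gamma> u (s * t)))"
      by (rule geodesic_scale[OF _ _ geo[OF u] sub]) auto
    have "has_velocity n A (\<lambda>t. chart_inv c (\<Gamma> u (s * t))) 0 (tv c (chart_inv c (\<Gamma> u (s * 0))) (\<lambda>k. s * B u k))"
    proof (rule has_velocity_chart[OF c(1), of "{-r<..<r}"])
      show "continuous_map (top_of_set {-r<..<r}) M (\<lambda>t. chart_inv c (\<Gamma> u (s * t)))" using g by (simp add: geodesic_on_def)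
      fix k assume k: "k < n"
      have "\<forall>\<^sub>F t in nhds 0. t \<in> {-r<..<r}" using r by (auto simp: eventually_nhds intro!: exI[of _ "{-r<..<r}"])
      hence ev: "\<forall>\<^sub>F t in nhds 0. snd c (chart_inv c (\<Gamma> u (s * t))) k = \<Gamma> u (s * t) k"
        by (rule eventually_mono) (use mem[OF u sub] in auto)
      have "((\<lambda>t. \<Gamma> u t k) has_real_derivative B u k) (at (s * 0))" using der0[OF u k] by simp
      moreover have "((\<lambda>t. s * t) has_real_derivative s) (at 0)" by (auto intro!: derivative_eq_intros)
      ultimately have "((\<lambda>t. \<Gamma> u (s * t) k) has_real_derivative B u k * s) (at 0)" by (rule DERIV_chain2)
      hence "((\<lambda>t. \<Gamma> u (s * t) k) has_real_derivative s * B u k) (at 0)" by (simp add: mult.commute)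
      thus "((\<lambda>\<tau>. snd c (chart_inv c (\<Gamma> u (s * \<tau>))) k) has_real_derivative s * B u k) (at 0)"
        by (subst DERIV_cong_ev[OF refl ev refl])
    qed (use Bl(2)[of u] c G0[OF u] r in \<open>auto simp: R_n_iff\<close>)
    moreover have "tv c x0 (\<lambda>k. s * B u k) = lincomb n (\<lambda>i. s * u i) e"
      unfolding Bl(1) by (simp add: B_def sum_distrib_left mult.assoc)
    ultimately have vel: "has_velocity n A (\<lambda>t. chart_inv c (\<Gamma> u (s * t))) 0 (lincomb n (\<lambda>i. s * u i) e)"
      using G0[OF u] by simp
    show ?thesis
      unfolding exp_related_def
      by (intro exI[of _ "\<lambda>t. chart_inv c (\<Gamma> u (s * t))"] exI[of _ "-r"] exI[of _ r])
         (use r g vel G0[OF u] in auto)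
  qed
  \<comment> \<open>Uniqueness of geodesics turns homogeneity into a statement about E: the ray
    through u is mapped to the geodesic with initial velocity u.\<close>
  have hom: "E (\<lambda>i. s * u i) = \<Gamma> u s" if u: "u \<in> nbox n zero_n \<rho>" and s: "s \<in> ?J" and su: "(\<lambda>i. s * u i) \<in> nbox n zero_n \<rho>" for u s
  proof -
    have "exp_related n M A g x0 (lincomb n (\<lambda>i. s * u i) e) (chart_inv c (\<Gamma> (\<lambda>i. s * u i) 1))"
      using rel[OF su, of 1] by simp
    from exp_related_unique[OF this rel[OF u s]]
    have "chart_inv c (E (\<lambda>i. s * u i)) = chart_inv c (\<Gamma> u s)" by (simp add: E_def)
    hence "snd c (chart_inv c (E (\<lambda>i. s * u i))) = snd c (chart_inv c (\<Gamma> u s))" by simp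
    thus ?thesis using mem[OF su, of 1] mem[OF u s] by (simp add: E_def)
  qed
  have zb: "zero_n \<in> nbox n zero_n \<rho>" using zR \<rho> by (rule nbox_center)
  show ?thesis
  proof (intro exI[of _ \<rho>] exI[of _ E] conjI ballI allI impI \<rho>)
    show E0: "E zero_n = snd c x0"
      using hom[OF zb, of 0] zb G0(2)[OF zb] by (simp add: z0_def)
    show "smooth_fun n (nbox n zero_n \<rho>) (cp E i)" if i: "i < n" for i
      unfolding smooth_fun_def
    proof
      fix k
      have "Ck_on k n (nbox n zero_n \<rho>) (\<lambda>u. \<Phi> \<sigma> (w u) i)"
      proof (rule Ck_on_compose[OF openin_nbox openin_nbox, where \<Phi> = w])
        show "Ck_on k (n + n) (nbox (n + n) (join n z0 zero_n) \<delta>) (\<lambda>z. \<Phi> \<sigma> z i)"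
          using \<Phi>(2) \<sigma> i by (auto intro!: smooth_fun_Ck)
        fix j
        show "Ck_on k n (nbox n zero_n \<rho>) (cp w j)"
        proof (cases "j < n")
          case True
          thus ?thesis by (simp add: w_def join_def Ck_on_const openin_nbox)
        next
          case False
          have "Ck_on k n (nbox n zero_n \<rho>) (\<lambda>u. (1 / \<sigma>) * (\<Sum>i<n. e i c (j - n) * u i))"
            by (intro Ck_on_cmult Ck_on_sum openin_nbox Ck_on_coord)
          thus ?thesis using False by (simp add: w_def join_def B_def mult.commute)
        qed
      qed (rule w)
      thus "Ck_on k n (nbox n zero_n \<rho>) (cp E i)" using i by (simp add: E_def \<Gamma>_def fst_n_def)
    qed
    fix i j assume ij: "i < n" "j < n"
    \<comment> \<open>A multiple of the basis vector j that fits into the box; the factor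
      \<open>2 / \<rho>\<close> undoes the scaling.\<close>
    define u where "u = (\<lambda>i. if i = j then \<rho> / 2 else (0::real))"
    have u: "u \<in> nbox n zero_n \<rho>" using ij \<rho> by (auto simp: u_def nbox_def R_n_iff)
    have "((\<lambda>t. \<Gamma> u t i) has_real_derivative B u i) (at (2 / \<rho> * 0))" using der0[OF u ij(1)] by simp
    moreover have "((\<lambda>t. 2 / \<rho> * t) has_real_derivative 2 / \<rho>) (at 0)"
      by (rule derivative_eq_intros refl | simp)+
    ultimately have "((\<lambda>t. \<Gamma> u (2 / \<rho> * t) i) has_real_derivative B u i * (2 / \<rho>)) (at 0)" by (rule DERIV_chain2)
    moreover have "B u i * (2 / \<rho>) = e j c i"
      using ij \<rho> by (simp add: B_def u_def if_distrib[of "\<lambda>x. x * _"] cong: if_cong)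
    ultimately have d: "((\<lambda>t. \<Gamma> u (2 / \<rho> * t) i) has_real_derivative e j c i) (at 0)" by simp
    have ev0: "\<forall>\<^sub>F t in nhds 0. \<bar>t\<bar> < \<rho>" using \<rho> by (auto simp: eventually_nhds_metric dist_real_def)
    have ev: "\<forall>\<^sub>F t in nhds 0. E (zero_n(j := t)) i = \<Gamma> u (2 / \<rho> * t) i"
      using ev0
    proof (rule eventually_mono)
      fix t :: real assume t: "\<bar>t\<bar> < \<rho>"
      have eq: "(\<lambda>i. (2 / \<rho> * t) * u i) = zero_n(j := t)" using \<rho> by (auto simp: u_def fun_eq_iff)
      have "zero_n(j := t) \<in> nbox n zero_n \<rho>" using t ij \<rho> by (auto simp: nbox_def R_n_iff)
      moreover have "2 / \<rho> * t \<in> ?J" using t \<rho> by (auto simp: abs_less_iff field_simps)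
      ultimately show "E (zero_n(j := t)) i = \<Gamma> u (2 / \<rho> * t) i"
        using hom[OF u, of "2 / \<rho> * t"] unfolding eq by simp
    qed
    have "((\<lambda>t. E (zero_n(j := t)) i) has_real_derivative e j c i) (at 0)"
      by (subst DERIV_cong_ev[OF refl ev refl]) (rule d)
    thus "jacobian E zero_n i j = e j c i"
      unfolding jacobian_def by (intro pd_unique) simp
  next
    fix u assume u: "u \<in> nbox n zero_n \<rho>"
    show "E u \<in> snd c ` fst c" using mem[OF u, of 1] by (auto simp: E_def intro: image_eqI[OF sym])
    show "exp_related n M A g x0 (lincomb n u e) (chart_inv c (E u))" using rel[OF u, of 1] by (simp add: E_def)
    have g1: "geo_at c (\<lambda>t. chart_inv c (\<Gamma> u t)) 1"
      using geo[OF u] c mem[OF u, of 1] by (simp add: geodesic_on_iff)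
    obtain e' where e': "e' > 0" "nbox n u e' \<subseteq> nbox n zero_n \<rho>"
      using u openin_nbox[of n "\<lambda>_. 0" \<rho>] unfolding openin_Euclidean_iff by blast
    have "\<forall>\<^sub>F s in nhds 1. (\<lambda>i. s * u i) \<in> nbox n u e'"
    proof (rule eventually_nbox_curve[OF _ _ e'(1)])
      show "((\<lambda>s. s * u i) \<longlongrightarrow> u i) (nhds 1)" for i
        by (rule tendsto_eq_intros filterlim_ident refl | simp)+
      show "\<forall>\<^sub>F s in nhds 1. (\<lambda>i. s * u i) \<in> R_n n"
        using u by (auto simp: nbox_def R_n_iff)
    qed
    moreover have "\<forall>\<^sub>F s in nhds 1. s \<in> ?J" by (auto simp: eventually_nhds intro!: exI[of _ ?J])
    ultimately have "\<forall>\<^sub>F s in nhds 1. chart_inv c (E (\<lambda>i. s * u i)) = chart_inv c (\<Gamma> u s)"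
      by eventually_elim (use hom[OF u] e'(2) in auto)
    thus "geo_at c (\<lambda>s. chart_inv c (E (\<lambda>i. s * u i))) 1"
      by (rule geo_at_cong[OF g1])
  qed
qed

end

section \<open>Normal coordinates and cylindrical neighborhoods\<close>

text \<open>The chart c followed by the inverse of a local diffeomorphism E on S; for E the
  exponential map in coordinates this is a normal chart.\<close>

definition reparam :: "'a chart \<Rightarrow> (rvec \<Rightarrow> rvec) \<Rightarrow> rvec set \<Rightarrow> 'a chart" where
  "reparam c E S = (chart_inv c ` E ` S, \<lambda>m. inv_into S E (snd c m))"

context smooth_mfd
begin

context
  fixes c E S
  assumes c: "c \<in> SC" and S: "open_n n S" and inj: "inj_on E S" and E: "E ` S \<subseteq> snd c ` fst c"
    and ES: "open_n n (E ` S)"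
    and Es: "\<And>i. i < n \<Longrightarrow> smooth_fun n S (cp E i)"
    and Ds: "\<And>i. i < n \<Longrightarrow> smooth_fun n (E ` S) (cp (inv_into S E) i)"
begin

lemma reparam_point:
  assumes "z \<in> S"
  shows "chart_inv c (E z) \<in> fst (reparam c E S)" "chart_inv c (E z) \<in> fst c" "snd c (chart_inv c (E z)) = E z"
    "snd (reparam c E S) (chart_inv c (E z)) = z"
proof -
  have "E z \<in> snd c ` fst c" using assms E by auto
  thus 1: "chart_inv c (E z) \<in> fst c" and 2: "snd c (chart_inv c (E z)) = E z"
    using chart_inv(2,3)[OF SC_chart[OF c]] by auto
  show "chart_inv c (E z) \<in> fst (reparam c E S)" using assms by (simp add: reparam_def)
  show "snd (reparam c E S) (chart_inv c (E z)) = z" using 2 inv_into_f_f[OF inj assms] by (simp add: reparam_def)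
qed

lemma reparam_dom: "fst (reparam c E S) = {m \<in> fst c. snd c m \<in> E ` S}"
proof (intro equalityI subsetI)
  fix m assume "m \<in> fst (reparam c E S)"
  thus "m \<in> {m \<in> fst c. snd c m \<in> E ` S}" using reparam_point by (auto simp: reparam_def)
next
  fix m assume "m \<in> {m \<in> fst c. snd c m \<in> E ` S}"
  hence "snd c m \<in> E ` S" "chart_inv c (snd c m) = m" using chart_inv(1)[OF SC_chart[OF c]] by auto
  thus "m \<in> fst (reparam c E S)" unfolding reparam_def fst_conv by (metis imageI)
qed

lemma reparam_obtain:
  assumes "m \<in> fst (reparam c E S)"
  obtains z where "z \<in> S" "m = chart_inv c (E z)"
  using assms by (auto simp: reparam_def)

lemma reparam_image: "snd (reparam c E S) ` fst (reparam c E S) = S"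
  using reparam_point by (force simp: reparam_def)

lemma reparam_chart: "is_chart n M (reparam c E S)"
proof -
  let ?k = "reparam c E S"
  have o: "openin M (fst ?k)" unfolding reparam_dom by (rule openin_chart_preimage[OF SC_chart[OF c] ES])
  have top: "topspace (subtopology M (fst ?k)) = fst ?k" using openin_subset[OF o] by auto
  note SR = openin_Rn_sub[OF S]
  have "homeomorphic_maps (subtopology M (fst ?k)) (sub_n n S) (snd ?k) (\<lambda>z. chart_inv c (E z))"
    unfolding homeomorphic_maps_def
  proof (intro conjI ballI)
    have c1: "continuous_map (subtopology M (fst ?k)) (sub_n n (E ` S)) (snd c)"
      unfolding continuous_map_in_subtopology
    proof
      show "continuous_map (subtopology M (fst ?k)) (Euclidean_space n) (snd c)"
        by (rule continuous_map_from_subtopology_mono[OF is_chartD(5)[OF SC_chart[OF c]]]) (auto simp: reparam_dom)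
    qed (auto simp: reparam_dom)
    have "continuous_on (E ` S) (inv_into S E)"
      by (rule continuous_on_vec[of n])
         (use Ck_on_continuous[OF smooth_fun_Ck[OF Ds] openin_Rn_sub[OF ES]] inv_into_into[of _ E S] SR in auto)
    hence "continuous_map (sub_n n (E ` S)) (sub_n n S) (inv_into S E)"
      unfolding subtopology_Rn[OF openin_Rn_sub[OF ES]] subtopology_Rn[OF SR] by (auto simp: inv_into_into)
    from continuous_map_compose[OF c1 this]
    show "continuous_map (subtopology M (fst ?k)) (sub_n n S) (snd ?k)"
      by (simp add: reparam_def o_def)
    have ER: "E z \<in> R_n n" if "z \<in> S" for z using that E openin_Rn_sub[OF is_chartD(3)[OF SC_chart[OF c]]] by blast
    have "continuous_on S E"
      by (rule continuous_on_vec[of n]) (use Ck_on_continuous[OF smooth_fun_Ck[OF Es] SR] ER in auto)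
    hence "continuous_map (sub_n n S) (sub_n n (snd c ` fst c)) E"
      unfolding subtopology_Rn[OF openin_Rn_sub[OF is_chartD(3)[OF SC_chart[OF c]]]] subtopology_Rn[OF SR] using E by auto
    from continuous_map_compose[OF this continuous_map_chart_inv[OF SC_chart[OF c]]]
    show "continuous_map (sub_n n S) (subtopology M (fst ?k)) (\<lambda>z. chart_inv c (E z))"
      using reparam_point(1) SR by (auto simp: continuous_map_in_subtopology o_def)
  qed (use reparam_point SR top in \<open>auto elim!: reparam_obtain\<close>)
  hence "homeomorphic_map (subtopology M (fst ?k)) (sub_n n S) (snd ?k)"
    by (auto simp: homeomorphic_map_maps)
  thus ?thesis using o S by (simp add: is_chart_def reparam_image)
qed

lemma reparam_chart_inv: "z \<in> S \<Longrightarrow> chart_inv (reparam c E S) z = chart_inv c (E z)"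
  using chart_inv(1)[OF reparam_chart reparam_point(1)] reparam_point(4) by metis

lemma reparam_transition: "z \<in> S \<Longrightarrow> transition (reparam c E S) d z = transition c d (E z)"
  by (simp add: transition_def reparam_chart_inv)

lemma reparam_transition_self: "z \<in> S \<Longrightarrow> transition (reparam c E S) c z = E z"
  by (simp add: transition_def reparam_chart_inv reparam_point)

lemma reparam_SC: "reparam c E S \<in> SC"
  unfolding smooth_charts_def
proof (intro CollectI conjI ballI)
  let ?k = "reparam c E S"
  show "is_chart n M ?k" by (rule reparam_chart)
  fix d assume dA: "d \<in> A"
  note d = A_SC[OF dA]
  have oM: "openin M (fst ?k \<inter> fst d)"
    using is_chartD(1)[OF reparam_chart] is_chartD(1)[OF SC_chart[OF d]] by blast
  show "smooth_transition n ?k d"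
    unfolding smooth_transition_def smooth_fun_def
  proof (intro allI impI)
    fix l k assume l: "l < n"
    have U: "open_n n (overlap ?k d)"
      using oM by (intro is_chartD(6)[OF reparam_chart]) auto
    have US: "overlap ?k d \<subseteq> S" using reparam_image by blast
    have "Ck_on k n (overlap ?k d) (\<lambda>z. transition c d (E z) l)"
    proof (rule Ck_on_compose[OF U overlap_open(1)[OF c d d], where \<Phi> = E])
      show "Ck_on k n (overlap ?k d) (cp E j)" if "j < n" for j
        by (rule Ck_on_subset[OF smooth_fun_Ck[OF Es[OF that]] US])
      fix z assume "z \<in> overlap ?k d"
      then obtain m where m: "m \<in> fst ?k" "m \<in> fst d" "z = snd ?k m" by auto
      then obtain z' where z': "z' \<in> S" "m = chart_inv c (E z')" using reparam_obtain by blast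
      hence "z = z'" using m(3) reparam_point(4) by simp
      thus "E z \<in> overlap c d"
        using m z' reparam_point(2,3)[OF z'(1)] by (auto intro!: image_eqI[where x = m])
    qed (rule transition_C[OF c d l])
    thus "Ck_on k n (overlap ?k d) (cp (transition ?k d) l)"
      by (rule Ck_on_cong[OF U, rotated]) (simp add: reparam_transition[OF subsetD[OF US]])
  qed
  show "smooth_transition n d ?k"
    unfolding smooth_transition_def smooth_fun_def
  proof (intro allI impI)
    fix l k assume l: "l < n"
    have U: "open_n n (overlap d ?k)"
      using oM by (intro is_chartD(6)[OF SC_chart[OF d]]) (auto simp: Int_commute)
    have mem: "m \<in> fst c" "snd c m \<in> E ` S" if "m \<in> fst ?k" for m
      using that reparam_dom by auto
    have "Ck_on k n (overlap d ?k) (\<lambda>z. inv_into S E (transition d c z) l)"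
    proof (rule Ck_on_compose[OF U ES, where \<Phi> = "transition d c"])
      show "Ck_on k n (overlap d ?k) (cp (transition d c) j)" if "j < n" for j
        by (rule Ck_on_subset[OF transition_C[OF d c that]]) (use mem in auto)
      show "transition d c z \<in> E ` S" if "z \<in> overlap d ?k" for z
        using that mem(2) by (auto simp: transition_chart[OF SC_chart[OF d]])
    qed (rule smooth_fun_Ck[OF Ds[OF l]])
    thus "Ck_on k n (overlap d ?k) (cp (transition d ?k) l)"
      by (rule Ck_on_cong[OF U, rotated]) (auto simp: transition_chart[OF SC_chart[OF d]] reparam_def)
  qed
qed

lemma reparam_tvec:
  assumes z: "z \<in> S"
  shows "tv (reparam c E S) (chart_inv c (E z)) u = tv c (chart_inv c (E z)) (differential n E z u)"
proof -
  let ?k = "reparam c E S"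
  have "jacobian (transition ?k c) z i j = jacobian E z i j" if "j < n" for i j
    unfolding jacobian_def by (rule pd_cong_on[OF S z that]) (simp add: reparam_transition_self)
  hence "dtr ?k c z u = differential n E z u"
    by (auto simp: differential_def fun_eq_iff)
  thus ?thesis
    using tvec_of_change[OF reparam_SC c reparam_point(1,2)[OF z], of u] reparam_point(4)[OF z] by simp
qed

end

end

section \<open>The Gauss lemma and normal cylinders\<close>

lemma star_nbox:
  assumes "u \<in> nbox n zero_n r" "0 \<le> t" "t \<le> 1"
  shows "(\<lambda>i. t * u i) \<in> nbox n zero_n r"
proof -
  have "\<bar>t * u i\<bar> \<le> 1 * \<bar>u i\<bar>" for i unfolding abs_mult using assms by (intro mult_right_mono) auto
  thus ?thesis using assms by (auto simp: nbox_def R_n_iff intro: le_less_trans)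
qed

context pseudo_riemannian
begin

lemma sum_pq: "(\<Sum>i<n. f i) = (\<Sum>i<p. f i) + (\<Sum>j<q. f (p + j))" for f :: "nat \<Rightarrow> real"
proof -
  have "(\<Sum>j<q. f (p + j)) = sum f {p..<n}"
    by (rule sum.reindex_bij_witness[where j = "\<lambda>j. p + j" and i = "\<lambda>i. i - p"]) auto
  moreover have "{..<n} = {..<p} \<union> {p..<n}" "{..<p} \<inter> {p..<n} = {}" by auto
  ultimately show ?thesis using sum.union_disjoint[of "{..<p}" "{p..<n}" f] by simp
qed

abbreviation (input) "sqx u \<equiv> \<Sum>i<p. (u i)\<^sup>2" for u :: rvec
abbreviation (input) "sqy u \<equiv> \<Sum>j<q. (u (p + j))\<^sup>2" for u :: rvec

text \<open>Gauss lemma: against the position vector, the metric in normal coordinates pairs like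
  the flat one. That rays are geodesics means that \<open>el\<close> vanishes at position u,
  velocity u and acceleration zero. This makes the energy constant along rays. Differentiating the
  resulting identity in u and inserting the ray equation again leaves a linear first-order equation
  along each ray, whose solution regular at 0 is the flat value.\<close>

lemma ray_el_imp_gauss:
  assumes G: "\<And>i j. i < n \<Longrightarrow> j < n \<Longrightarrow> Ck_on 1 n (nbox n zero_n r) (G i j)"
    and sym: "\<And>i j z. z \<in> nbox n zero_n r \<Longrightarrow> G i j z = G j i z"
    and G0: "\<And>i j. i < n \<Longrightarrow> j < n \<Longrightarrow> G i j zero_n = (if i = j then eta i else 0)"
    and el: "\<And>u l. u \<in> nbox n zero_n r \<Longrightarrow> l < n \<Longrightarrow> el n G u u zero_n l = 0"
    and u: "u \<in> nbox n zero_n r" and l: "l < n"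
  shows "(\<Sum>j<n. G l j u * u j) = eta l * u l"
proof -
  let ?P = "\<lambda>l (u::rvec) z. \<Sum>i<n. \<Sum>j<n. pd l (G i j) z * u i * u j"
    and ?R = "\<lambda>l (u::rvec) z. \<Sum>i<n. \<Sum>j<n. pd i (G j l) z * u i * u j"
  let ?S = "nbox n zero_n r"
  note SR = openin_Rn_sub[OF openin_nbox]
  have chr: "(\<Sum>i<n. \<Sum>j<n. (pd i (G j l) (\<lambda>k. t * u k) + pd j (G i l) (\<lambda>k. t * u k) - pd l (G i j) (\<lambda>k. t * u k)) / 2 * u i * u j) = 0"
    if u: "u \<in> ?S" and t: "0 < t" "t \<le> 1" and l: "l < n" for u t l
  proof -
    have "el n G (\<lambda>k. t * u k) (\<lambda>k. t * u k) (\<lambda>_. t * (t * 0)) l = 0"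
      using el[OF star_nbox[OF u, of t] l] t by simp
    hence "t * (t * el n G (\<lambda>k. t * u k) u zero_n l) = 0" unfolding el_scale .
    thus ?thesis using t by (simp add: el_def)
  qed
  have symP: "pd k (G i j) z = pd k (G j i) z" if "z \<in> ?S" "k < n" for i j k z
    by (rule pd_cong_on[OF openin_nbox that]) (rule sym)
  \<comment> \<open>The first two Christoffel terms coincide once contracted with u twice, so the
    ray equation relates only two contractions.\<close>
  have half: "(?R l u (\<lambda>k. t * u k)) = (1/2) * (?P l u (\<lambda>k. t * u k))"
    if u: "u \<in> ?S" and t: "0 < t" "t \<le> 1" and l: "l < n" for u t l
  proof -
    let ?z = "\<lambda>k. t * u k"
    have sw: "(\<Sum>i<n. \<Sum>j<n. pd j (G i l) ?z * u i * u j) = (?R l u ?z)"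
      by (subst sum.swap) (simp add: mult_ac)
    have "(\<Sum>i<n. \<Sum>j<n. (pd i (G j l) ?z + pd j (G i l) ?z - pd l (G i j) ?z) / 2 * u i * u j)
      = (\<Sum>i<n. \<Sum>j<n. (1/2) * (pd i (G j l) ?z * u i * u j) + (1/2) * (pd j (G i l) ?z * u i * u j) - (1/2) * (pd l (G i j) ?z * u i * u j))"
      by (intro sum.cong refl) (simp add: field_simps)
    also have "\<dots> = (1/2) * (?R l u ?z) + (1/2) * (\<Sum>i<n. \<Sum>j<n. pd j (G i l) ?z * u i * u j) - (1/2) * (?P l u ?z)"
      unfolding sum.distrib sum_subtractf sum_distrib_left[symmetric] ..
    finally show ?thesis using chr[OF u t l] unfolding sw by simp
  qed
  have dG: "((\<lambda>t. G i j (\<lambda>k. t * u k)) has_real_derivative (\<Sum>k<n. pd k (G i j) (\<lambda>k. t * u k) * u k)) (at t)"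
    if u: "u \<in> ?S" and t: "0 \<le> t" "t \<le> 1" and ij: "i < n" "j < n" for u t i j
  proof (rule C1_chain[OF openin_nbox G[OF ij]])
    show "(\<lambda>k. t * u k) \<in> ?S" by (rule star_nbox[OF u t])
    show "\<forall>\<^sub>F t in at t. (\<lambda>k. t * u k) \<in> R_n n" using u by (auto simp: nbox_def R_n_iff)
    show "((\<lambda>t. t * u k) has_real_derivative u k) (at t)" for k by (auto intro!: derivative_eq_intros)
  qed
  \<comment> \<open>Constancy of the energy: contracting the ray equation with u shows that the
    radial derivative equals its own double, hence vanishes.\<close>
  have Qu: "(\<Sum>i<n. \<Sum>j<n. G i j u * u i * u j) = (\<Sum>i<n. eta i * (u i)\<^sup>2)" if u: "u \<in> ?S" for u
  proof -
    define F where "F t = (\<Sum>i<n. \<Sum>j<n. G i j (\<lambda>k. t * u k) * u i * u j)" for t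
    have dF: "(F has_real_derivative (\<Sum>i<n. \<Sum>j<n. (\<Sum>k<n. pd k (G i j) (\<lambda>k. t * u k) * u k) * u i * u j)) (at t)"
      if "0 \<le> t" "t \<le> 1" for t
      unfolding F_def by (intro DERIV_sum DERIV_cmult_right) (use dG[OF u that] in auto)
    have F0: "(\<Sum>i<n. \<Sum>j<n. (\<Sum>k<n. pd k (G i j) (\<lambda>k. t * u k) * u k) * u i * u j) = 0" (is "?L = 0") if t: "0 < t" "t \<le> 1" for t
    proof -
      let ?z = "\<lambda>k. t * u k"
      have "?L = (\<Sum>k<n. u k * (?P k u ?z))"
      proof -
        have "?L = (\<Sum>i<n. \<Sum>j<n. \<Sum>k<n. u k * (pd k (G i j) ?z * u i * u j))"
          by (simp add: sum_distrib_left sum_distrib_right mult_ac)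
        also have "\<dots> = (\<Sum>i<n. \<Sum>k<n. \<Sum>j<n. u k * (pd k (G i j) ?z * u i * u j))"
          by (intro sum.cong[OF refl] sum.swap)
        also have "\<dots> = (\<Sum>k<n. \<Sum>i<n. \<Sum>j<n. u k * (pd k (G i j) ?z * u i * u j))" by (rule sum.swap)
        finally show ?thesis by (simp add: sum_distrib_left)
      qed
      also have "\<dots> = (\<Sum>k<n. u k * (2 * (?R k u ?z)))"
      proof (intro sum.cong refl arg_cong2[where f = "(*)"])
        fix k assume "k \<in> {..<n}"
        hence "k < n" by simp
        from half[OF u t this] show "(?P k u ?z) = 2 * (?R k u ?z)"
          by linarith
      qed
      also have "\<dots> = 2 * (\<Sum>k<n. \<Sum>i<n. \<Sum>j<n. pd i (G j k) ?z * u i * u j * u k)"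
        by (simp add: sum_distrib_left mult_ac)
      also have "(\<Sum>k<n. \<Sum>i<n. \<Sum>j<n. pd i (G j k) ?z * u i * u j * u k) = (\<Sum>i<n. \<Sum>k<n. \<Sum>j<n. pd i (G j k) ?z * u i * u j * u k)"
        by (rule sum.swap)
      also have "\<dots> = (\<Sum>i<n. u i * (\<Sum>k<n. \<Sum>j<n. pd i (G k j) ?z * u k * u j))"
        unfolding sum_distrib_left using symP[OF star_nbox[OF u, of t]] t
        by (intro sum.cong refl) (auto simp: mult_ac)
      also have "\<dots> = ?L"
        using \<open>?L = (\<Sum>k<n. u k * (?P k u ?z))\<close> by simp
      finally show ?thesis by simp
    qed
    have "F 1 = F 0"
    proof (rule DERIV_isconst_end[where f = F and a = 0 and b = 1])
      show "continuous_on {0..1} F" using dF by (intro DERIV_continuous_on) (auto intro: has_field_derivative_at_within)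
      show "(F has_real_derivative 0) (at t)" if "0 < t" "t < 1" for t
        using dF[of t] F0[of t] that by simp
    qed simp
    moreover have "F 0 = (\<Sum>i<n. \<Sum>j<n. (if i = j then eta i else 0) * u i * u j)"
      unfolding F_def by (intro sum.cong refl) (simp add: G0)
    moreover have "\<dots> = (\<Sum>i<n. eta i * (u i)\<^sup>2)"
      by (intro sum.cong refl) (simp add: if_distrib[of "\<lambda>x. x * _"] power2_eq_square mult.assoc cong: if_cong)
    ultimately show ?thesis by (simp add: F_def)
  qed
  \<comment> \<open>The identity \<open>Qu\<close> holds on an open set, so it may be differentiated
    in direction l.\<close>
  have dQ: "(\<Sum>i<n. \<Sum>j<n. pd l (G i j) z * z i * z j) + 2 * (\<Sum>j<n. G l j z * z j) = 2 * eta l * z l" if z: "z \<in> ?S" for z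
  proof -
    let ?D = "\<lambda>i j. (pd l (G i j) z * z i + (if i = l then 1 else 0) * G i j z) * z j + (if j = l then 1 else 0) * (G i j z * z i)" and ?y = "\<lambda>i j s. G i j (z(l := s)) * (z(l := s)) i * (z(l := s)) j"
    have d1: "((\<lambda>s. \<Sum>i<n. \<Sum>j<n. ?y i j s) has_real_derivative
      (\<Sum>i<n. \<Sum>j<n. ?D i j)) (at (z l))"
    proof (intro DERIV_sum)
      fix i j assume ij: "i \<in> {..<n}" "j \<in> {..<n}"
      have "((\<lambda>s. G i j (z(l := s))) has_real_derivative pd l (G i j) z) (at (z l))"
        using Ck_on_SucD(2)[OF G[unfolded One_nat_def] SR l z] ij by simp
      moreover have "((\<lambda>s. (z(l := s)) k) has_real_derivative (if k = l then 1 else 0)) (at (z l))" for k by auto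
      ultimately have "((\<lambda>s. ?y i j s) has_real_derivative
         (pd l (G i j) z * (z(l := z l)) i + (if i = l then 1 else 0) * G i j (z(l := z l))) * (z(l := z l)) j + (if j = l then 1 else 0) * (G i j (z(l := z l)) * (z(l := z l)) i)) (at (z l))"
        by (intro DERIV_mult)
      thus "((\<lambda>s. ?y i j s) has_real_derivative
        ?D i j) (at (z l))" by simp
    qed
    have d2: "((\<lambda>s. \<Sum>i<n. eta i * ((z(l := s)) i)\<^sup>2) has_real_derivative (\<Sum>i<n. if i = l then 2 * eta l * z l else 0)) (at (z l))"
    proof (intro DERIV_sum)
      fix i
      show "((\<lambda>s. eta i * ((z(l := s)) i)\<^sup>2) has_real_derivative (if i = l then 2 * eta l * z l else 0)) (at (z l))"
        by (cases "i = l") (auto intro!: derivative_eq_intros)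
    qed
    have ev: "\<forall>\<^sub>F s in nhds (z l). (\<Sum>i<n. \<Sum>j<n. ?y i j s) = (\<Sum>i<n. eta i * ((z(l := s)) i)\<^sup>2)"
      using eventually_fun_upd_mem[OF openin_nbox z l] by (rule eventually_mono) (rule Qu)
    have "(\<Sum>i<n. \<Sum>j<n. ?D i j)
       = (\<Sum>i<n. if i = l then 2 * eta l * z l else 0)"
      by (rule DERIV_unique[OF d1]) (subst DERIV_cong_ev[OF refl ev refl], rule d2)
    moreover have "(\<Sum>i<n. \<Sum>j<n. ?D i j)
       = (\<Sum>i<n. \<Sum>j<n. pd l (G i j) z * z i * z j) + (\<Sum>i<n. \<Sum>j<n. (if i = l then 1 else 0) * (G i j z * z j)) + (\<Sum>i<n. \<Sum>j<n. (if j = l then 1 else 0) * (G i j z * z i))"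
      unfolding sum.distrib[symmetric] by (intro sum.cong refl) (simp add: algebra_simps)
    moreover have "(\<Sum>i<n. \<Sum>j<n. (if i = l then 1 else 0) * (G i j z * z j)) = (\<Sum>j<n. G l j z * z j)"
      unfolding sum_distrib_left[symmetric] using l by (simp add: if_distrib[of "\<lambda>x. x * _"] cong: if_cong)
    moreover have "(\<Sum>i<n. \<Sum>j<n. (if j = l then 1 else 0) * (G i j z * z i)) = (\<Sum>j<n. G l j z * z j)"
      using l sym[OF z] by (simp add: if_distrib[of "\<lambda>x. x * _"] cong: if_cong)
    ultimately show ?thesis using l by simp
  qed
  define k where "k t = (\<Sum>j<n. G j l (\<lambda>i. t * u i) * u j)" for t
  have dk: "(k has_real_derivative (\<Sum>j<n. (\<Sum>i<n. pd i (G j l) (\<lambda>k. t * u k) * u i) * u j)) (at t)" if "0 \<le> t" "t \<le> 1" for t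
    unfolding k_def by (intro DERIV_sum DERIV_cmult_right) (use dG[OF u that] l in auto)
  have tk: "t * (\<Sum>j<n. (\<Sum>i<n. pd i (G j l) (\<lambda>k. t * u k) * u i) * u j) = eta l * u l - k t" if t: "0 < t" "t \<le> 1" for t
  proof -
    let ?z = "\<lambda>k. t * u k"
    have "(\<Sum>j<n. (\<Sum>i<n. pd i (G j l) ?z * u i) * u j) = (?R l u ?z)"
      unfolding sum_distrib_right by (rule sum.swap)
    also have "\<dots> = (1/2) * (?P l u ?z)" by (rule half[OF u t l])
    finally have 1: "(\<Sum>j<n. (\<Sum>i<n. pd i (G j l) ?z * u i) * u j) = (1/2) * (?P l u ?z)" .
    have z: "?z \<in> ?S" using star_nbox[OF u] t by simp
    have 2: "(\<Sum>i<n. \<Sum>j<n. pd l (G i j) ?z * ?z i * ?z j) = t * (t * (?P l u ?z))"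
      by (simp add: sum_distrib_left mult_ac)
    have 3: "(\<Sum>j<n. G l j ?z * ?z j) = t * k t"
      unfolding k_def sum_distrib_left by (intro sum.cong refl) (simp add: sym[OF z, of l] mult_ac)
    have "t * (t * (?P l u ?z)) + 2 * (t * k t) = 2 * eta l * (t * u l)"
      using dQ[OF z] unfolding 2 3 .
    hence "t * (t * (?P l u ?z) + 2 * k t - 2 * eta l * u l) = 0"
      by (simp add: algebra_simps)
    thus ?thesis unfolding 1 using t by simp
  qed
  \<comment> \<open>By \<open>tk\<close>, the derivative \<open>k + t * k'\<close> of
    \<open>t * k\<close> is the constant \<open>eta l * u l\<close>, so h has derivative zero. It
    vanishes at 0, and its value at 1 gives the claim.\<close>
  define h where "h t = t * k t - t * (eta l * u l)" for t
  have dh: "(h has_real_derivative (1 * k t + (\<Sum>j<n. (\<Sum>i<n. pd i (G j l) (\<lambda>k. t * u k) * u i) * u j) * t - 1 * (eta l * u l))) (at t)" if "0 \<le> t" "t \<le> 1" for t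
    unfolding h_def by (intro DERIV_diff DERIV_mult DERIV_cmult_right DERIV_ident dk that)
  have "h 1 = h 0"
  proof (rule DERIV_isconst_end[where f = h and a = 0 and b = 1])
    show "continuous_on {0..1} h" using dh by (intro DERIV_continuous_on) (auto intro: has_field_derivative_at_within)
    show "(h has_real_derivative 0) (at t)" if "0 < t" "t < 1" for t
      using dh[of t] tk[of t] that by (simp add: mult.commute)
  qed simp
  hence "k 1 = eta l * u l" by (simp add: h_def)
  moreover have "k 1 = (\<Sum>j<n. G l j u * u j)" by (simp add: k_def sym[OF u, of _ l])
  ultimately show ?thesis by simp
qed

lemma eventually_scale_nbox:
  assumes u: "u \<in> nbox m zero_n r"
  shows "\<forall>\<^sub>F s in nhds 1. (\<lambda>i. s * u i) \<in> nbox m zero_n r"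
proof -
  obtain e where e: "e > 0" "nbox m u e \<subseteq> nbox m zero_n r"
    using u openin_nbox[of m "\<lambda>_. 0" r] unfolding openin_Euclidean_iff by blast
  have "\<forall>\<^sub>F s in nhds 1. (\<lambda>i. s * u i) \<in> nbox m u e"
  proof (rule eventually_nbox_curve[OF _ _ e(1)])
    show "((\<lambda>s. s * u i) \<longlongrightarrow> u i) (nhds 1)" for i
      by (rule tendsto_eq_intros filterlim_ident refl | simp)+
    show "\<forall>\<^sub>F s in nhds 1. (\<lambda>i. s * u i) \<in> R_n m"
      using u by (auto simp: nbox_def R_n_iff)
  qed
  thus ?thesis by (rule eventually_mono) (use e in auto)
qed

text \<open>An error of a tenth of \<open>X + Y\<close> gives
  \<open>9 * X - 11 * Y \<le> 10 * G \<le> 11 * X - 9 * Y\<close>, and the ratios 9/11 and 11/9 lie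
  strictly between 1/2 and 3/2. This is how the tolerance 1/10 and the choice of 1/2 for \<epsilon>
  fit together.\<close>

lemma quad_bounds:
  assumes GX: "\<bar>G - (X - Y)\<bar> \<le> (X + Y) / 10" and XY: "0 \<le> X" "0 \<le> Y" "0 < X + Y"
  shows "G \<le> 0 \<Longrightarrow> X - (1 + 1/2) * Y < (0::real)" "X - (1 - 1/2) * Y \<le> 0 \<Longrightarrow> G < 0" "G \<le> 0 \<Longrightarrow> 0 < Y"
proof -
  have 1: "G - (X - Y) \<le> (X + Y) / 10" using GX by (rule abs_le_D1)
  have 2: "- (G - (X - Y)) \<le> (X + Y) / 10" using GX by (rule abs_le_D2)
  have 3: "10 * G \<le> 11 * X - 9 * Y" "9 * X - 11 * Y \<le> 10 * G" using 1 2 by (simp_all add: field_simps)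
  show "X - (1 + 1/2) * Y < 0" if "G \<le> 0" using that 3 XY by simp
  show "G < 0" if "X - (1 - 1/2) * Y \<le> 0" using that 3 XY by simp
  show "0 < Y" if "G \<le> 0" using that 3 XY by linarith
qed

lemma openin_cylinder: "open_n n (cylinder p q a b)"
  and cylinder_sub: "b \<le> a \<Longrightarrow> 0 < b \<Longrightarrow> cylinder p q a b \<subseteq> nbox n zero_n a"
proof -
  have eq: "cylinder p q a b = {z \<in> R_n n. (\<forall>i<p. \<bar>z i\<bar> < a) \<and> sqy z < b\<^sup>2}"
  proof (intro equalityI subsetI)
    fix z assume "z \<in> cylinder p q a b"
    thus "z \<in> {z \<in> R_n n. (\<forall>i<p. \<bar>z i\<bar> < a) \<and> sqy z < b\<^sup>2}"
      by (auto simp: cylinder_def cube_def disc_def join_Rn join_nth)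
  next
    fix z assume z: "z \<in> {z \<in> R_n n. (\<forall>i<p. \<bar>z i\<bar> < a) \<and> sqy z < b\<^sup>2}"
    define y where "y j = z (p + j)" for j
    have "z = join p (fst_n p z) y" by (auto simp: join_def fst_n_def y_def fun_eq_iff)
    moreover have "fst_n p z \<in> cube p a" using z by (auto simp: cube_def fst_n_Rn[simplified] fst_n_def R_n_iff)
    moreover have "y \<in> disc q b" using z by (auto simp: disc_def y_def R_n_iff)
    ultimately show "z \<in> cylinder p q a b" by (auto simp: cylinder_def)
  qed
  have "open {z::rvec. (\<forall>i\<in>{..<p}. \<bar>z i\<bar> < a) \<and> sqy z < b\<^sup>2}"
  proof (intro open_Collect_conj)
    show "open {z::rvec. \<forall>i\<in>{..<p}. \<bar>z i\<bar> < a}"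
    proof -
      have "open (\<Inter>i\<in>{..<p}. {w::rvec. \<bar>w i\<bar> < a})"
        by (intro open_INT ballI open_Collect_less continuous_intros continuous_on_coord) simp
      moreover have "(\<Inter>i\<in>{..<p}. {w::rvec. \<bar>w i\<bar> < a}) = {z::rvec. \<forall>i\<in>{..<p}. \<bar>z i\<bar> < a}" by auto
      ultimately show ?thesis by simp
    qed
    show "open {z::rvec. sqy z < b\<^sup>2}"
      by (intro open_Collect_less continuous_intros continuous_on_coord)
  qed
  thus "open_n n (cylinder p q a b)"
    unfolding eq openin_Rn_open by (intro exI conjI) (assumption, auto)
  assume ab: "b \<le> a" "0 < b"
  show "cylinder p q a b \<subseteq> nbox n zero_n a"
  proof
    fix z assume "z \<in> cylinder p q a b"
    hence z: "z \<in> R_n n" "\<forall>i<p. \<bar>z i\<bar> < a" "sqy z < b\<^sup>2"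
      unfolding eq by auto
    have "\<bar>z i\<bar> < a" if i: "i < n" for i
    proof (cases "i < p")
      case False
      hence j: "i - p < q" "p + (i - p) = i" using i by auto
      have "(z (p + (i - p)))\<^sup>2 \<le> sqy z"
        by (rule member_le_sum) (use j in auto)
      hence "\<bar>z i\<bar>\<^sup>2 < b\<^sup>2" using z(3) j(2) by simp
      hence "\<bar>z i\<bar> < b" by (rule power2_less_imp_less) (use ab in simp)
      thus ?thesis using ab by simp
    qed (use z in auto)
    thus "z \<in> nbox n zero_n a" using z(1) by (auto simp: nbox_def)
  qed
qed

abbreviation (input) gauss_chart :: "'a chart \<Rightarrow> bool" where
  "gauss_chart \<kappa> \<equiv> \<forall>m\<in>fst \<kappa>. \<forall>v\<in>R_n n. g m (tv \<kappa> m (snd \<kappa> m)) (tv \<kappa> m v) = (\<Sum>i<n. eta i * snd \<kappa> m i * v i)"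

text \<open>Contrapositive form: at every point of the chart, a nonzero vector without y-component
  is spacelike.\<close>

abbreviation (input) horizontal_spacelike :: "'a chart \<Rightarrow> bool" where
  "horizontal_spacelike \<kappa> \<equiv> \<forall>m\<in>fst \<kappa>. \<forall>v\<in>R_n n. v \<noteq> zero_n \<and> g m (tv \<kappa> m v) (tv \<kappa> m v) \<le> 0 \<longrightarrow> 0 < sqy v"

text \<open>One normal chart on a box of radius r is fixed, and every cylinder with
  \<open>b < a \<le> r\<close> arises from it by restriction. The size b can thus be chosen later,
  depending on the leaf, while the Gauss lemma and the spacelike horizontal directions hold on the
  whole box.\<close>

theorem normal_cylinders:
  assumes x0: "x0 \<in> topspace M"
  shows "\<exists>r>0. \<exists>\<kappa>\<in>SC. x0 \<in> fst \<kappa> \<and> snd \<kappa> x0 = zero_n \<and> snd \<kappa> ` fst \<kappa> = nbox n zero_n r \<and>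
     gauss_chart \<kappa> \<and>
     horizontal_spacelike \<kappa> \<and>
     (\<forall>a b. 0 < b \<and> b < a \<and> a \<le> r \<longrightarrow> (\<exists>\<kappa>'. cylindrical_nbhd p q M A g x0 a b \<kappa>' \<and>
        fst \<kappa>' = {m \<in> fst \<kappa>. snd \<kappa> m \<in> cylinder p q a b} \<and> (\<forall>m\<in>fst \<kappa>'. snd \<kappa>' m = snd \<kappa> m)))"
proof -
  obtain e where e: "orthonormal_basis p q A g x0 e" using orthonormal_ex[OF x0] by blast
  obtain c where c: "c \<in> A" "x0 \<in> fst c" using A_cover[OF x0] by blast
  note cS = A_SC[OF c(1)]
  let ?o = "zero_n :: rvec"
  have zR: "?o \<in> R_n n" by (simp add: R_n_iff)
  obtain \<rho> E where \<rho>: "\<rho> > 0" and E0: "E ?o = snd c x0"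
    and Es: "\<forall>i<n. smooth_fun n (nbox n ?o \<rho>) (cp E i)"
    and JE: "\<forall>i<n. \<forall>j<n. jacobian E ?o i j = e j c i"
    and Eu: "\<forall>u\<in>nbox n ?o \<rho>. E u \<in> snd c ` fst c \<and> exp_related n M A g x0 (lincomb n u e) (chart_inv c (E u)) \<and>
        geo_at c (\<lambda>s. chart_inv c (E (\<lambda>i. s * u i))) 1"
    using exp_local[OF x0 e c] by blast
  have lin: "lincomb n u e \<in> tangent_space n A x0" for u
    by (rule lincomb_in[OF x0 orthonormal_in[OF x0 e]])
  have dE: "differential n E ?o v = lincomb n v e c" for v
  proof
    fix l
    have "lincomb n v e c \<in> R_n n" using tangent_space_tvec(2)[OF c lin] .
    thus "differential n E ?o v l = lincomb n v e c l"
      using JE by (auto simp: differential_def lincomb_def R_n_iff mult.commute)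
  qed
  have det: "det_n n (jacobian E ?o) \<noteq> 0"
  proof (rule jacobian_injective_imp_det)
    fix v assume v: "v \<in> R_n n" "differential n E ?o v = zero_n"
    have "lincomb n v e = lincomb n ?o e"
      using tangent_space_tvec(1)[OF c lin[of v]] tangent_space_tvec(1)[OF c lin[of ?o]] v(2)
      by (simp add: dE) (simp add: lincomb_def)
    thus "v = ?o"
      using e v(1) zR by (auto simp: orthonormal_basis_def is_basis_def bij_betw_def dest: inj_onD)
  qed
  have ER: "E z \<in> R_n n" if "z \<in> nbox n ?o \<rho>" for z
    using Eu that openin_Rn_sub[OF is_chartD(3)[OF SC_chart[OF cS]]] by blast
  obtain r0 where r0: "r0 > 0" "nbox n ?o r0 \<subseteq> nbox n ?o \<rho>" "inj_on E (nbox n ?o r0)"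
    "\<forall>S\<subseteq>nbox n ?o r0. open_n n S \<longrightarrow>
        open_n n (E ` S) \<and> (\<forall>i<n. smooth_fun n (E ` S) (cp (inv_into S E) i))"
    using inverse_function[where E = E, OF openin_nbox nbox_center[OF zR \<rho>] _ ER det] Es by auto
  have RP: "inj_on E S" "E ` S \<subseteq> snd c ` fst c" "open_n n (E ` S)"
      "\<And>i. i < n \<Longrightarrow> smooth_fun n S (cp E i)" "\<And>i. i < n \<Longrightarrow> smooth_fun n (E ` S) (cp (inv_into S E) i)"
    if "S \<subseteq> nbox n ?o r0" "open_n n S" for S
  proof -
    have S\<rho>: "S \<subseteq> nbox n ?o \<rho>" using that(1) r0(2) by (rule subset_trans)
    show "inj_on E S" by (rule inj_on_subset[OF r0(3) that(1)])
    show "E ` S \<subseteq> snd c ` fst c" using S\<rho> Eu by auto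
    have "open_n n (E ` S) \<and> (\<forall>i<n. smooth_fun n (E ` S) (cp (inv_into S E) i))"
      using r0(4) that by simp
    thus "open_n n (E ` S)" "\<And>i. i < n \<Longrightarrow> smooth_fun n (E ` S) (cp (inv_into S E) i)" by auto
    show "\<And>i. i < n \<Longrightarrow> smooth_fun n S (cp E i)"
      using Es smooth_fun_subset[of n "nbox n ?o \<rho>" _ S] S\<rho> that(2) openin_nbox by auto
  qed
  define S0 where "S0 = nbox n ?o r0"
  have S0: "S0 \<subseteq> nbox n ?o r0" "open_n n S0" "?o \<in> S0"
    using openin_nbox nbox_center[OF zR r0(1)] by (auto simp: S0_def)
  define \<kappa>0 where "\<kappa>0 = reparam c E S0"
  note rp0 = cS S0(2) RP[OF S0(1,2)]
  have \<kappa>0: "\<kappa>0 \<in> SC" unfolding \<kappa>0_def by (rule reparam_SC[OF rp0])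
  define G where "G = gco \<kappa>0"
  have pt: "chart_inv c (E z) \<in> fst \<kappa>0" "snd \<kappa>0 (chart_inv c (E z)) = z" "chart_inv c (E z) \<in> fst c" if "z \<in> S0" for z
    using reparam_point[OF rp0 that] by (auto simp: \<kappa>0_def)
  have x0E: "chart_inv c (E ?o) = x0" using E0 chart_inv(1)[OF SC_chart[OF cS] c(2)] by simp
  have tv0: "tv \<kappa>0 x0 v = lincomb n v e" for v
    using reparam_tvec[OF rp0 S0(3), of v] tangent_space_tvec(1)[OF c lin[of v]] by (simp add: \<kappa>0_def x0E dE)
  have Gsm: "smooth_fun n S0 (G i j)" if "i < n" "j < n" for i j
    using gco_smooth[OF \<kappa>0 that] reparam_image[OF rp0] by (simp add: G_def \<kappa>0_def)
  have Gsym: "G i j z = G j i z" if "z \<in> S0" for i j z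
    using gco_sym[OF \<kappa>0 pt(1)[OF that]] pt(2)[OF that] by (simp add: G_def)
  have G0: "G i j ?o = (if i = j then eta i else 0)" if "i < n" "j < n" for i j
  proof -
    have "G i j ?o = g x0 (lincomb n (Defs.unit_vec i) e) (lincomb n (Defs.unit_vec j) e)"
      using gco_chart[OF \<kappa>0 pt(1)[OF S0(3)], of i j] pt(2)[OF S0(3)] by (simp add: G_def x0E tv0)
    also have "\<dots> = (\<Sum>k<n. eta k * Defs.unit_vec i k * Defs.unit_vec j k)"
      by (rule g_orthonormal[OF x0 e unit_vec_Rn[OF that(1)] unit_vec_Rn[OF that(2)]])
    also have "\<dots> = (\<Sum>k<n. if k = i then (if i = j then eta i else 0) else 0)"
      by (rule sum.cong) (auto simp: Defs.unit_vec_def)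
    finally show ?thesis using that by simp
  qed
  \<comment> \<open>In the normal chart the ray is \<open>s * u\<close>, with velocity u and
    acceleration zero; its geodesic equation at parameter 1 is the claim.\<close>
  have el0: "el n G u u ?o l = 0" if u: "u \<in> S0" and l: "l < n" for u l
  proof -
    define \<gamma> where "\<gamma> s = chart_inv c (E (\<lambda>i. s * u i))" for s
    have ev: "\<forall>\<^sub>F s in nhds 1. (\<lambda>i. s * u i) \<in> S0" using eventually_scale_nbox u by (simp add: S0_def)
    have "geo_at c \<gamma> 1" using Eu u r0(2) unfolding \<gamma>_def S0_def by blast
    moreover have "\<forall>\<^sub>F s in nhds 1. \<gamma> s \<in> fst c \<inter> fst \<kappa>0"
      using ev by (rule eventually_mono) (use pt in \<open>auto simp: \<gamma>_def\<close>)
    ultimately have "geo_at \<kappa>0 \<gamma> 1" using geo_at_change[OF cS \<kappa>0] by blast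
    then obtain u1 u2 where w: "twice_diff n (\<lambda>s. snd \<kappa>0 (\<gamma> s)) u1 u2 1"
      "\<And>l. l < n \<Longrightarrow> el n G (snd \<kappa>0 (\<gamma> 1)) (u1 1) u2 l = 0"
      unfolding geo_at_def G_def by blast
    have "twice_diff n (\<lambda>s i. s * u i) (\<lambda>_. u) ?o 1"
      unfolding twice_diff_def by (auto intro!: derivative_eq_intros always_eventually)
    hence "twice_diff n (\<lambda>s. snd \<kappa>0 (\<gamma> s)) (\<lambda>_. u) ?o 1"
      by (rule twice_diff_cong) (rule eventually_mono[OF ev], simp add: \<gamma>_def pt)
    note eq = twice_diff_unique[OF w(1) this]
    have "snd \<kappa>0 (\<gamma> 1) = u" using pt(2)[OF u] by (simp add: \<gamma>_def)
    thus ?thesis using w(2)[OF l] el_cong[of n "u1 1" u u2 ?o, OF eq] by simp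
  qed
  have gauss: "(\<Sum>j<n. G l j u * u j) = eta l * u l" if "u \<in> S0" "l < n" for u l
    by (rule ray_el_imp_gauss[of r0 G]) (use Gsm Gsym G0 el0 that in \<open>auto simp: S0_def intro: smooth_fun_Ck\<close>)
  \<comment> \<open>Summing the errors of the entries costs a factor n, so the metric deviates from
    its value at the centre by at most a tenth of the Euclidean square.\<close>
  define \<delta> where "\<delta> = 1 / (10 * (real n + 1))"
  have \<delta>: "0 < \<delta>" "n * \<delta> \<le> 1/10" by (auto simp: \<delta>_def field_simps)
  have "\<exists>d>0. \<forall>j<n. \<forall>w\<in>nbox n ?o d. w \<in> S0 \<and> \<bar>G i j w - G i j ?o\<bar> < \<delta>" if i: "i < n" for i
  proof (rule finite_nbox_ball)
    fix j assume j: "j < n"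
    obtain d where d: "d > 0" "\<forall>w\<in>S0 \<inter> nbox n ?o d. dist (G i j w) (G i j ?o) < \<delta>"
      using Ck_on_continuous[OF smooth_fun_Ck[OF Gsm[OF i j]] openin_Rn_sub[OF S0(2)]] S0(3) \<delta>(1)
      unfolding continuous_on_nbox_iff[OF openin_Rn_sub[OF S0(2)]] by blast
    show "\<exists>d>0. \<forall>w\<in>nbox n ?o d. w \<in> S0 \<and> \<bar>G i j w - G i j ?o\<bar> < \<delta>"
      using d r0(1) nbox_mono[of "min d r0" d n ?o] nbox_mono[of "min d r0" r0 n ?o]
      by (intro exI[of _ "min d r0"]) (auto simp: S0_def dist_real_def)
  qed
  hence "\<exists>d>0. \<forall>i<n. \<forall>w\<in>nbox n ?o d. \<forall>j<n. w \<in> S0 \<and> \<bar>G i j w - G i j ?o\<bar> < \<delta>"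
    by (intro finite_nbox_ball) (metis (no_types, lifting))
  then obtain d where d: "d > 0" "\<forall>i<n. \<forall>w\<in>nbox n ?o d. \<forall>j<n. w \<in> S0 \<and> \<bar>G i j w - G i j ?o\<bar> < \<delta>" by blast
  define r where "r = min d r0"
  define S where "S = nbox n ?o r"
  have r: "r > 0" using d r0 by (simp add: r_def)
  have SS: "S \<subseteq> S0" "S \<subseteq> nbox n ?o d" "open_n n S" "?o \<in> S"
    using nbox_mono[of r r0 n ?o] nbox_mono[of r d n ?o] openin_nbox nbox_center[OF zR r]
    by (auto simp: S_def S0_def r_def)
  have SS0: "S \<subseteq> nbox n ?o r0" using SS(1) by (simp add: S0_def)
  have tvS: "tv (reparam c E S') (chart_inv c (E z)) v = tv \<kappa>0 (chart_inv c (E z)) v"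
    if "S' \<subseteq> S0" "open_n n S'" "z \<in> S'" for S' z v
  proof -
    have "S' \<subseteq> nbox n ?o r0" using that(1) by (simp add: S0_def)
    note rp = cS that(2) RP[OF this that(2)]
    show ?thesis using reparam_tvec[OF rp that(3)] reparam_tvec[OF rp0, of z v] that by (auto simp: \<kappa>0_def)
  qed
  have gG: "g (chart_inv c (E z)) (tv \<kappa>0 (chart_inv c (E z)) u) (tv \<kappa>0 (chart_inv c (E z)) v)
      = (\<Sum>i<n. \<Sum>j<n. u i * v j * G i j z)" if "z \<in> S0" "u \<in> R_n n" "v \<in> R_n n" for z u v
    using g_expand[OF \<kappa>0 pt(1)[OF that(1)] that(2,3)] pt(2)[OF that(1)] by (simp add: G_def)
  have near: "\<bar>(\<Sum>i<n. \<Sum>j<n. u i * u j * G i j z) - (sqx u - sqy u)\<bar>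
      \<le> (sqx u + sqy u) / 10" if z: "z \<in> S" for z u
  proof -
    have e1: "(\<Sum>i<n. \<Sum>j<n. u i * u j * (if i = j then eta i else 0)) = sqx u - sqy u"
    proof -
      have "(\<Sum>i<n. \<Sum>j<n. u i * u j * (if i = j then eta i else 0)) = (\<Sum>i<n. eta i * (u i)\<^sup>2)"
        by (intro sum.cong refl) (simp add: if_distrib[of "\<lambda>x. _ * x"] power2_eq_square mult_ac cong: if_cong)
      also have "\<dots> = sqx u - sqy u"
        unfolding sum_pq by (simp add: eta_def sum_negf)
      finally show ?thesis .
    qed
    have "(\<Sum>i<n. \<Sum>j<n. u i * u j * G i j z) - (sqx u - sqy u)
       = (\<Sum>i<n. \<Sum>j<n. u i * u j * (G i j z - (if i = j then eta i else 0)))"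
      unfolding e1[symmetric] by (simp add: sum_subtractf right_diff_distrib)
    \<comment> \<open>The bound of a product by half the sum of the squares, for each pair of
      indices, reduces the double sum to n copies of the Euclidean square.\<close>
    also have "\<bar>\<dots>\<bar> \<le> (\<Sum>i<n. \<Sum>j<n. ((u i)\<^sup>2 + (u j)\<^sup>2) / 2 * \<delta>)"
    proof (rule order_trans[OF sum_abs], rule sum_mono, rule order_trans[OF sum_abs], rule sum_mono)
      fix i j assume ij: "i \<in> {..<n}" "j \<in> {..<n}"
      have 1: "\<bar>u i * u j\<bar> \<le> ((u i)\<^sup>2 + (u j)\<^sup>2) / 2"
        using sum_squares_bound[of "\<bar>u i\<bar>" "\<bar>u j\<bar>"] by (simp add: abs_mult)
      have "z \<in> nbox n ?o d" using z SS(2) by blast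
      hence "\<bar>G i j z - G i j ?o\<bar> < \<delta>" using d(2) ij by simp
      hence 2: "\<bar>G i j z - (if i = j then eta i else 0)\<bar> \<le> \<delta>" using G0[of i j] ij by simp
      show "\<bar>u i * u j * (G i j z - (if i = j then eta i else 0))\<bar> \<le> ((u i)\<^sup>2 + (u j)\<^sup>2) / 2 * \<delta>"
        unfolding abs_mult[of "u i * u j"] by (rule mult_mono[OF 1 2]) auto
    qed
    also have "\<dots> = n * \<delta> * (\<Sum>i<n. (u i)\<^sup>2)"
    proof -
      have "(\<Sum>i<n. \<Sum>j<n. ((u i)\<^sup>2 + (u j)\<^sup>2) / 2 * \<delta>) = (\<Sum>i<n. \<Sum>j<n. \<delta> / 2 * (u i)\<^sup>2) + (\<Sum>i<n. \<Sum>j<n. \<delta> / 2 * (u j)\<^sup>2)"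
        unfolding sum.distrib[symmetric] by (intro sum.cong refl) (simp add: field_simps)
      also have "\<dots> = n * (\<delta> / 2 * (\<Sum>i<n. (u i)\<^sup>2)) + n * (\<delta> / 2 * (\<Sum>i<n. (u i)\<^sup>2))"
        by (simp add: sum_distrib_left)
      finally show ?thesis by (simp add: field_simps)
    qed
    also have "\<dots> \<le> 1/10 * (\<Sum>i<n. (u i)\<^sup>2)"
      by (rule mult_right_mono[OF \<delta>(2)]) (simp add: sum_nonneg)
    finally show ?thesis unfolding sum_pq by simp
  qed
  have pos: "0 < sqx u + sqy u" if u: "u \<in> R_n n" "u \<noteq> ?o" for u
  proof -
    obtain i where i: "u i \<noteq> 0" using u(2) by (auto simp: fun_eq_iff)
    hence "i < n" using u(1) by (auto simp: R_n_iff not_less[symmetric])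
    hence "0 < (\<Sum>i<n. (u i)\<^sup>2)" using i by (intro sum_pos2[of _ i]) auto
    thus ?thesis unfolding sum_pq .
  qed
  have nn: "0 \<le> sqx u" "0 \<le> sqy u" for u :: rvec
    by (simp_all add: sum_nonneg)
  have ml: "metric_less n (quad p q (1 + 1/2)) (\<lambda>u. \<Sum>i<n. \<Sum>j<n. u i * u j * G i j z)"
    "metric_less n (\<lambda>u. \<Sum>i<n. \<Sum>j<n. u i * u j * G i j z) (quad p q (1 - 1/2))" if z: "z \<in> S" for z
    unfolding metric_less_def quad_def
    by (intro ballI impI; elim conjE; rule quad_bounds(1)[OF near[OF z] nn pos]; assumption)
      (intro ballI impI; elim conjE; rule quad_bounds(2)[OF near[OF z] nn pos]; assumption)
  define \<kappa> where "\<kappa> = reparam c E S"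
  note rp = cS SS(3) RP[OF SS0 SS(3)]
  have ptS: "chart_inv c (E z) \<in> fst \<kappa>" "snd \<kappa> (chart_inv c (E z)) = z" if "z \<in> S" for z
    using reparam_point[OF rp that] by (auto simp: \<kappa>_def)
  have obt: "\<exists>z\<in>S. m = chart_inv c (E z) \<and> snd \<kappa> m = z" if m: "m \<in> fst \<kappa>" for m
    using reparam_obtain[OF rp m[unfolded \<kappa>_def]] ptS(2) by metis
  have tv: "tv \<kappa> (chart_inv c (E z)) v = tv \<kappa>0 (chart_inv c (E z)) v" if "z \<in> S" for z v
    unfolding \<kappa>_def by (rule tvS[OF SS(1,3) that])
  show ?thesis
  proof (intro exI[of _ r] bexI[of _ \<kappa>] conjI ballI allI impI)
    show "0 < r" by (rule r)
    show "\<kappa> \<in> SC" unfolding \<kappa>_def by (rule reparam_SC[OF rp])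
    show "x0 \<in> fst \<kappa>" "snd \<kappa> x0 = ?o" using ptS[OF SS(4)] by (simp_all add: x0E)
    show "snd \<kappa> ` fst \<kappa> = nbox n ?o r" using reparam_image[OF rp] by (simp add: \<kappa>_def S_def)
  next
    fix m v assume m: "m \<in> fst \<kappa>" and v: "v \<in> R_n n"
    obtain z where z: "z \<in> S" "m = chart_inv c (E z)" "snd \<kappa> m = z" using obt[OF m] by blast
    have z0: "z \<in> S0" "z \<in> R_n n" using z(1) SS(1) openin_Rn_sub[OF SS(3)] by auto
    have "g m (tv \<kappa> m z) (tv \<kappa> m v) = (\<Sum>i<n. \<Sum>j<n. z i * v j * G i j z)"
      unfolding z(2) tv[OF z(1)] by (rule gG[OF z0 v])
    also have "\<dots> = (\<Sum>j<n. \<Sum>i<n. z i * v j * G i j z)" by (rule sum.swap)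
    also have "\<dots> = (\<Sum>j<n. v j * (\<Sum>i<n. G j i z * z i))"
      by (simp add: sum_distrib_left Gsym[OF z0(1)] mult_ac)
    also have "\<dots> = (\<Sum>j<n. eta j * z j * v j)"
      by (intro sum.cong refl) (simp add: gauss[OF z0(1)])
    finally show "g m (tv \<kappa> m (snd \<kappa> m)) (tv \<kappa> m v) = (\<Sum>i<n. eta i * snd \<kappa> m i * v i)"
      using z(3) by simp
  next
    fix m v assume m: "m \<in> fst \<kappa>" and v: "v \<in> R_n n" and H: "v \<noteq> ?o \<and> g m (tv \<kappa> m v) (tv \<kappa> m v) \<le> 0"
    obtain z where z: "z \<in> S" "m = chart_inv c (E z)" using obt[OF m] by blast
    have "(\<Sum>i<n. \<Sum>j<n. v i * v j * G i j z) \<le> 0"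
      using H gG[of z v v] v z SS(1) tv[OF z(1)] by auto
    thus "0 < sqy v"
      using quad_bounds(3)[OF near[OF z(1)] nn pos[OF v]] H by simp
  next
    fix a b assume ab: "0 < b \<and> b < a \<and> a \<le> r"
    define C where "C = cylinder p q a b"
    have C: "open_n n C" "C \<subseteq> S"
      using openin_cylinder cylinder_sub[of b a] ab nbox_mono[of a r n ?o] by (auto simp: C_def S_def)
    have CS0: "C \<subseteq> nbox n ?o r0" "C \<subseteq> S0" using C(2) SS0 SS(1) by auto
    note rc = cS C(1) RP[OF CS0(1) C(1)]
    define \<kappa>' where "\<kappa>' = reparam c E C"
    have ptC: "chart_inv c (E z) \<in> fst \<kappa>'" "snd \<kappa>' (chart_inv c (E z)) = z" if "z \<in> C" for z
      using reparam_point[OF rc that] by (auto simp: \<kappa>'_def)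
    show "\<exists>\<kappa>'. cylindrical_nbhd p q M A g x0 a b \<kappa>' \<and>
        fst \<kappa>' = {m \<in> fst \<kappa>. snd \<kappa> m \<in> cylinder p q a b} \<and> (\<forall>m\<in>fst \<kappa>'. snd \<kappa>' m = snd \<kappa> m)"
    proof (intro exI[of _ \<kappa>'] conjI ballI)
      show "fst \<kappa>' = {m \<in> fst \<kappa>. snd \<kappa> m \<in> cylinder p q a b}"
      proof (intro equalityI subsetI)
        fix m assume "m \<in> fst \<kappa>'"
        then obtain z where "z \<in> C" "m = chart_inv c (E z)" using reparam_obtain[OF rc] unfolding \<kappa>'_def by metis
        thus "m \<in> {m \<in> fst \<kappa>. snd \<kappa> m \<in> cylinder p q a b}" using ptS[of z] C(2) by (auto simp: C_def)
      next
        fix m assume m: "m \<in> {m \<in> fst \<kappa>. snd \<kappa> m \<in> cylinder p q a b}"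
        then obtain z where "z \<in> S" "m = chart_inv c (E z)" "snd \<kappa> m = z" using obt by blast
        thus "m \<in> fst \<kappa>'" using ptC(1)[of z] m by (simp add: C_def)
      qed
      show "snd \<kappa>' m = snd \<kappa> m" if "m \<in> fst \<kappa>'" for m
      proof -
        obtain z where "z \<in> C" "m = chart_inv c (E z)" by (rule reparam_obtain[OF rc \<open>m \<in> fst \<kappa>'\<close>[unfolded \<kappa>'_def]])
        thus ?thesis using ptC(2)[of z] ptS(2)[of z] C(2) by auto
      qed
      show "cylindrical_nbhd p q M A g x0 a b \<kappa>'"
        unfolding cylindrical_nbhd_def
      proof (intro conjI)
        show "0 < b" "b < a" using ab by auto
        show "\<kappa>' \<in> SC" unfolding \<kappa>'_def by (rule reparam_SC[OF rc])
        show "snd \<kappa>' ` fst \<kappa>' = cylinder p q a b" using reparam_image[OF rc] by (simp add: \<kappa>'_def C_def)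
        show "\<exists>e. orthonormal_basis p q A g x0 e \<and>
           (\<forall>u\<in>cylinder p q a b. lincomb n u e \<in> exp_dom n M A g x0 \<and> exp_map n M A g x0 (lincomb n u e) = chart_inv \<kappa>' u)"
        proof (intro exI[of _ e] conjI ballI e)
          fix u assume "u \<in> cylinder p q a b"
          hence u: "u \<in> C" by (simp add: C_def)
          hence rel: "exp_related n M A g x0 (lincomb n u e) (chart_inv c (E u))" using Eu CS0(1) r0(2) by blast
          show "lincomb n u e \<in> exp_dom n M A g x0" by (rule exp_map_eq(1)[OF rel])
          show "exp_map n M A g x0 (lincomb n u e) = chart_inv \<kappa>' u"
            using exp_map_eq(2)[OF rel] reparam_chart_inv[OF rc u] by (simp add: \<kappa>'_def)
        qed
        show "\<exists>\<epsilon>>0. \<forall>m\<in>fst \<kappa>'. metric_less n (quad p q (1 + \<epsilon>)) (\<lambda>u. g m (tv \<kappa>' m u) (tv \<kappa>' m u)) \<and>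
            metric_less n (\<lambda>u. g m (tv \<kappa>' m u) (tv \<kappa>' m u)) (quad p q (1 - \<epsilon>))"
        proof (intro exI[of _ "1/2"] conjI ballI)
          fix m assume "m \<in> fst \<kappa>'"
          then obtain z where z: "z \<in> C" "m = chart_inv c (E z)" using reparam_obtain[OF rc] unfolding \<kappa>'_def by metis
          have zS: "z \<in> S" using z C(2) by blast
          have "g m (tv \<kappa>' m u) (tv \<kappa>' m u) = (\<Sum>i<n. \<Sum>j<n. u i * u j * G i j z)" if "u \<in> R_n n" for u
            using tvS[OF CS0(2) C(1) z(1)] gG[of z u u] that zS SS(1) z(2) by (auto simp: \<kappa>'_def)
          thus "metric_less n (quad p q (1 + 1/2)) (\<lambda>u. g m (tv \<kappa>' m u) (tv \<kappa>' m u))"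
            "metric_less n (\<lambda>u. g m (tv \<kappa>' m u) (tv \<kappa>' m u)) (quad p q (1 - 1/2))"
            using ml[OF zS] by (auto simp: metric_less_def)
        qed simp
      qed
    qed
  qed
qed

end

section \<open>Causal foliations\<close>

definition drop_n :: "nat \<Rightarrow> rvec \<Rightarrow> rvec" where "drop_n p z = (\<lambda>j. z (p + j))"

lemma join_drop: "join p z (drop_n p z) = z"
  by (auto simp: join_def drop_n_def fun_eq_iff)

lemma drop_join: "drop_n p (join p z w) = w"
  by (auto simp: join_def drop_n_def fun_eq_iff)

lemma drop_Rn: "z \<in> R_n (p + q) \<Longrightarrow> drop_n p z \<in> R_n q"
  by (auto simp: R_n_iff drop_n_def)

lemma join_slice_Rn: "z \<in> R_n (p + q) \<Longrightarrow> w \<in> R_n q \<Longrightarrow> join p z w \<in> R_n (p + q)"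
  by (auto simp: R_n_iff join_def)

lemma join_fst_n: "join p (fst_n p z) w = join p z w"
  by (auto simp: join_def fst_n_def fun_eq_iff)

lemma join_cong: "(\<And>i. i < p \<Longrightarrow> z i = z' i) \<Longrightarrow> join p z w = join p z' w"
  by (auto simp: join_def fun_eq_iff)

definition slice :: "nat \<Rightarrow> nat \<Rightarrow> rvec \<Rightarrow> rvec set \<Rightarrow> rvec set" where
  "slice p q z U = {w \<in> R_n q. join p z w \<in> U}"

lemma Ck_join:
  assumes "open_n q V"
  shows "Ck_on k q V (\<lambda>w. join p z w i)"
  using Ck_on_const[OF assms, of k "z i"] Ck_on_coord[OF assms, of k "i - p"] by (cases "i < p") (simp_all add: join_def)

lemma openin_slice:
  assumes U: "open_n (p + q) U" and z: "z \<in> R_n (p + q)"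
  shows "open_n q (slice p q z U)"
  unfolding slice_def
  by (rule openin_preimage_nbhd[OF openin_Rn_top U])
    (use Ck_on_continuous[OF Ck_join[OF openin_Rn_top] subset_refl] join_slice_Rn[OF z] in auto)

lemma smooth_slice:
  assumes U: "open_n (p + q) U" and z: "z \<in> R_n (p + q)" and f: "smooth_fun (p + q) U f"
  shows "smooth_fun q (slice p q z U) (\<lambda>w. f (join p z w))"
  unfolding smooth_fun_def
proof
  fix k
  show "Ck_on k q (slice p q z U) (\<lambda>w. f (join p z w))"
    by (rule Ck_on_compose[where \<Phi> = "join p z", OF openin_slice[OF U z] U Ck_join[OF openin_slice[OF U z]] _ smooth_fun_Ck[OF f]])
      (simp add: slice_def)
qed

lemma pd_slice: "pd j (\<lambda>w. f (join p z w)) w = pd (p + j) f (join p z w)"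
proof -
  have "join p z (w(j := t)) = (join p z w)(p + j := t)" for t by (auto simp: join_def fun_eq_iff)
  thus ?thesis by (simp add: pd_def join_nth)
qed

text \<open>If \<open>f 1\<close> were positive, the nonincreasing quotient \<open>f t / t\<close>
  would be at least \<open>f 1\<close> arbitrarily near 0, against its limit there.\<close>

lemma ray_nonpos:
  fixes f f' :: "real \<Rightarrow> real"
  assumes d: "\<And>t. 0 \<le> t \<Longrightarrow> t \<le> 1 \<Longrightarrow> (f has_real_derivative f' t) (at t within {0..1})"
    and le: "\<And>t. 0 \<le> t \<Longrightarrow> t \<le> 1 \<Longrightarrow> t * f' t \<le> f t" and 0: "f 0 = 0" "f' 0 = 0"
  shows "f 1 \<le> 0"
proof (rule ccontr)
  assume "\<not> f 1 \<le> 0"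
  hence pos: "0 < f 1" by simp
  have "((\<lambda>t. (f t - f 0) / (t - 0)) \<longlongrightarrow> 0) (at 0 within {0..1})"
    using d[of 0] 0(2) by (simp add: has_field_derivative_iff)
  hence "\<forall>\<^sub>F t in at 0 within {0..1}. dist ((f t - f 0) / (t - 0)) 0 < f 1" using pos by (rule tendstoD)
  then obtain e where e: "e > 0" "\<forall>t\<in>{0..1}. t \<noteq> 0 \<and> dist t 0 < e \<longrightarrow> \<bar>f t / t\<bar> < f 1"
    unfolding eventually_at by (auto simp: 0(1))
  define s where "s = min (e / 2) 1"
  have s: "0 < s" "s \<le> 1" "s < e" using e(1) by (auto simp: s_def)
  have "f 1 / 1 \<le> f s / s"
  proof (rule DERIV_nonpos_imp_decreasing_open[OF s(2)])
    fix t assume t: "s < t" "t < 1"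
    have "(f has_real_derivative f' t) (at t)"
      using d[of t] t s by (simp add: at_within_Icc_at)
    hence "((\<lambda>t. f t / t) has_real_derivative (f' t * t - f t) / (t * t)) (at t)"
      using t s by (auto intro!: derivative_eq_intros)
    moreover have "(f' t * t - f t) / (t * t) \<le> 0"
      using le[of t] t s by (intro divide_nonpos_nonneg) (auto simp: mult.commute)
    ultimately show "\<exists>y. ((\<lambda>t. f t / t) has_real_derivative y) (at t) \<and> y \<le> 0" by auto
  next
    have "continuous_on {0..1} f" using d by (auto intro!: DERIV_continuous_on)
    thus "continuous_on {s..1} (\<lambda>t. f t / t)"
      using s by (intro continuous_intros) (auto elim: continuous_on_subset)
  qed
  moreover have "\<bar>f s / s\<bar> < f 1" using e(2) s by auto
  ultimately show False using abs_ge_self[of "f s / s"] by linarith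
qed

lemma openin_disc: "open_n q (disc q b)"
proof -
  have "open {z::rvec. (\<Sum>j<q. (z j)\<^sup>2) < b\<^sup>2}"
    by (intro open_Collect_less continuous_intros continuous_on_coord)
  thus ?thesis unfolding openin_Rn_open disc_def by auto
qed

lemma disc_coord:
  assumes w: "w \<in> disc q b" and b: "0 < b" and i: "i < q"
  shows "\<bar>w i\<bar> < b"
proof -
  have "(w i)\<^sup>2 \<le> (\<Sum>j<q. (w j)\<^sup>2)" by (rule member_le_sum) (use i in auto)
  hence "\<bar>w i\<bar>\<^sup>2 < b\<^sup>2" using w by (simp add: disc_def)
  thus ?thesis by (rule power2_less_imp_less) (use b in simp)
qed

lemma disc_scale:
  assumes "w \<in> disc q b" "0 \<le> t" "t \<le> 1"
  shows "(\<lambda>i. t * w i) \<in> disc q b"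
proof -
  have "(\<Sum>j<q. (t * w j)\<^sup>2) = t\<^sup>2 * (\<Sum>j<q. (w j)\<^sup>2)" by (simp add: power_mult_distrib sum_distrib_left)
  also have "\<dots> \<le> 1 * (\<Sum>j<q. (w j)\<^sup>2)"
    using assms by (intro mult_right_mono) (auto simp: power_le_one sum_nonneg)
  finally show ?thesis using assms by (auto simp: disc_def R_n_iff)
qed

locale causal_foliation = pseudo_riemannian p q M A g
  for p q :: nat and M :: "'a topology" and A :: "'a chart set" and g :: "'a metr" +
  fixes F :: "'a chart set"
  assumes fol: "foliation p q M A F"
    and leaves_causal: "\<forall>L\<in>leaves p M F. causal_leaf p q A g F L"
begin

lemma F_SC: "c \<in> F \<Longrightarrow> c \<in> SC"
  and F_cover: "x \<in> topspace M \<Longrightarrow> \<exists>c\<in>F. x \<in> fst c"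
  and F_image: "c \<in> F \<Longrightarrow> snd c ` fst c = nbox n zero_n 1"
  and F_jacobian: "c \<in> F \<Longrightarrow> d \<in> F \<Longrightarrow> z \<in> overlap c d \<Longrightarrow> i < p \<Longrightarrow> p \<le> j \<Longrightarrow> j < n \<Longrightarrow>
     jacobian (transition c d) z i j = 0"
  using fol by (auto simp: foliation_def cube_def nbox_def)

lemma F_chart: "c \<in> F \<Longrightarrow> is_chart n M c" using F_SC SC_chart by auto

lemma leaf_causal:
  assumes c: "c \<in> F" and m: "m \<in> fst c" and w: "w \<in> R_n q"
  shows "g m (tv c m (join p zero_n w)) (tv c m (join p zero_n w)) \<le> 0"
proof -
  have "m \<in> topspace M" using SC_top[OF F_SC[OF c] m] .
  hence L: "{y. (same_plaque p F)\<^sup>*\<^sup>* m y} \<in> leaves p M F" by (auto simp: leaves_def)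
  have "causal_leaf p q A g F {y. (same_plaque p F)\<^sup>*\<^sup>* m y}" by (rule bspec[OF leaves_causal L])
  hence "causal_subspace g m (leaf_tangent p q A F m)" by (simp add: causal_leaf_def)
  moreover have "tv c m (join p zero_n w) \<in> leaf_tangent p q A F m"
    unfolding leaf_tangent_def using c m w by blast
  ultimately show ?thesis by (simp add: causal_subspace_def)
qed

lemma g_diff_square:
  assumes k: "\<kappa> \<in> SC" and m: "m \<in> fst \<kappa>"
  defines "G \<equiv> \<lambda>u v. g m (tv \<kappa> m u) (tv \<kappa> m v)"
  shows "G (\<lambda>i. t * v i - z i) (\<lambda>i. t * v i - z i) = t\<^sup>2 * G v v - 2 * t * G z v + G z z"
proof -
  have top: "m \<in> topspace M" by (rule SC_top[OF k m])
  note tin = tvec_of_in[OF k m]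
  have bl: "G (\<lambda>i. r * u i + s * v i) w = r * G u w + s * G v w" "G w (\<lambda>i. r * u i + s * v i) = r * G w u + s * G w v" for r s u v w
    using g_bilinear[OF top] tin unfolding bilinear_form_def G_def tvec_of_linear by auto
  have sym: "G u w = G w u" for u w using g_sym[OF top tin tin] by (simp add: G_def)
  have eq: "(\<lambda>i. t * v i - z i) = (\<lambda>i. t * v i + (-1) * z i)" by simp
  show ?thesis unfolding eq bl by (simp add: sym[of v z] power2_eq_square algebra_simps)
qed

text \<open>The ray argument: along the image of a radial segment, the difference between \<open>t c'\<close> and the
  position vector \<open>c\<close> is horizontal, hence not causal, while \<open>c'\<close> is causal; by the Gauss lemma this gives
  \<open>t f' \<le> f\<close> for \<open>f = quad (c t)\<close>.\<close>

lemma leaf_graph_causal: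
  assumes k: "\<kappa> \<in> SC"
    and gauss: "gauss_chart \<kappa>"
    and hor: "horizontal_spacelike \<kappa>"
    and m: "\<And>t. 0 \<le> t \<Longrightarrow> t \<le> 1 \<Longrightarrow> m t \<in> fst \<kappa>"
    and cR: "\<And>t. 0 \<le> t \<Longrightarrow> t \<le> 1 \<Longrightarrow> c' t \<in> R_n n"
    and der: "\<And>t i. 0 \<le> t \<Longrightarrow> t \<le> 1 \<Longrightarrow> i < n \<Longrightarrow> ((\<lambda>t. snd \<kappa> (m t) i) has_real_derivative c' t i) (at t within {0..1})"
    and caus: "\<And>t. 0 \<le> t \<Longrightarrow> t \<le> 1 \<Longrightarrow> g (m t) (tv \<kappa> (m t) (c' t)) (tv \<kappa> (m t) (c' t)) \<le> 0"
    and y: "\<And>t j. 0 \<le> t \<Longrightarrow> t \<le> 1 \<Longrightarrow> j < q \<Longrightarrow> snd \<kappa> (m t) (p + j) = t * w j"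
    and m0: "snd \<kappa> (m 0) = zero_n"
  shows "quad p q 1 (snd \<kappa> (m 1)) \<le> 0"
proof -
  define c where "c t = snd \<kappa> (m t)" for t
  define f where "f t = (\<Sum>i<n. eta i * c t i * c t i)" for t
  define f' where "f' t = 2 * (\<Sum>i<n. eta i * c t i * c' t i)" for t
  have ctR: "c t \<in> R_n n" if "0 \<le> t" "t \<le> 1" for t
    using chart_Rn[OF SC_chart[OF k] m[OF that]] by (simp add: c_def)
  \<comment> \<open>Derivatives within [0, 1] are unique, also at the end points. This identifies
    the y-components of c' with w and makes the vector h below horizontal.\<close>
  have y': "c' t (p + j) = w j" if t: "0 \<le> t" "t \<le> 1" and j: "j < q" for t j
  proof -
    have "((\<lambda>t. c t (p + j)) has_real_derivative c' t (p + j)) (at t within {0..1})"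
      using der[OF t, of "p + j"] j by (simp add: c_def)
    hence 1: "((\<lambda>t. t * w j) has_real_derivative c' t (p + j)) (at t within {0..1})"
      by (rule has_field_derivative_transform_within[of _ _ _ _ 1]) (use t j y in \<open>auto simp: c_def\<close>)
    have 2: "((\<lambda>t. t * w j) has_real_derivative w j) (at t within {0..1})"
      by (auto intro!: derivative_eq_intros)
    have "at t within {0..1} \<noteq> bot" using t by (simp add: trivial_limit_within islimpt_Icc)
    thus ?thesis using has_field_derivative_unique[OF 1 2] by blast
  qed
  have "f 1 \<le> 0"
  proof (rule ray_nonpos)
    fix t :: real assume t: "0 \<le> t" "t \<le> 1"
    show "(f has_real_derivative f' t) (at t within {0..1})"
      unfolding f_def f'_def sum_distrib_left
      by (rule derivative_eq_intros refl der[OF t, folded c_def] | simp add: algebra_simps)+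
    define G where "G u v = g (m t) (tv \<kappa> (m t) u) (tv \<kappa> (m t) v)" for u v
    define h where "h i = t * c' t i - c t i" for i
    have hR: "h \<in> R_n n" using cR[OF t] ctR[OF t] by (auto simp: h_def R_n_iff)
    have "sqy h = 0" by (rule sum.neutral) (auto simp: h_def y'[OF t] y[OF t, folded c_def])
    hence "0 \<le> G h h"
    proof (cases "h = zero_n")
      case True
      have "G h h = 0"
        using g_diff_square[OF k m[OF t], of 1 h h] unfolding True G_def by simp
      thus ?thesis by simp
    next
      case False
      thus ?thesis using hor m[OF t] hR \<open>sqy h = 0\<close> unfolding G_def by fastforce
    qed
    \<comment> \<open>Dropping the nonpositive term with c' twice from \<open>0 \<le> G h h\<close>
      leaves \<open>2 * t * G c c' \<le> G c c\<close>; the Gauss lemma evaluates the two sides as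
      \<open>t * f'\<close> and f.\<close>
    moreover have "G h h = t\<^sup>2 * G (c' t) (c' t) - 2 * t * G (c t) (c' t) + G (c t) (c t)"
      unfolding G_def h_def by (rule g_diff_square[OF k m[OF t]])
    moreover have "t\<^sup>2 * G (c' t) (c' t) \<le> 0" using caus[OF t] by (simp add: G_def mult_nonneg_nonpos)
    moreover have "G (c t) v = (\<Sum>i<n. eta i * c t i * v i)" if "v \<in> R_n n" for v
      using gauss m[OF t] that by (simp add: G_def c_def)
    ultimately show "t * f' t \<le> f t" using cR[OF t] ctR[OF t] by (simp add: f_def f'_def)
  qed (auto simp: f_def f'_def c_def m0)
  moreover have "f 1 = quad p q 1 (c 1)"
    unfolding f_def quad_def sum_pq by (simp add: eta_def power2_eq_square sum_negf)
  ultimately show ?thesis by (simp add: c_def)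
qed

lemma differential_slice:
  assumes j: "l < n"
  shows "differential n \<Phi> z (join p zero_n v) l = (\<Sum>k<q. jacobian \<Phi> z l (p + k) * v k)"
  using j by (simp add: differential_def sum_pq join_def)

text \<open>Leaf vectors are causal and horizontal ones spacelike, so the y-coordinates of the
  normal chart restrict to a local diffeomorphism on the plaque of x, whose inverse exhibits a piece
  of the plaque as a graph over a disc. Causality of the graph bounds \<phi> at w by the norm of w,
  hence by b, which places the graph in the cube. The last two conjuncts say that the graph is
  parametrized continuously, and with open image, in leaf coordinates.\<close>

theorem leaf_causal_graph:
  assumes d: "d \<in> F" and x: "x \<in> fst d"
  shows "\<exists>a b \<kappa> \<phi> s. cylindrical_nbhd p q M A g x a b \<kappa> \<and> continuous_on (disc q b) \<phi> \<and> \<phi> ` disc q b \<subseteq> cube p a \<and>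
    (\<forall>w\<in>disc q b. quad p q 1 (join p (\<phi> w) w) \<le> 0) \<and> s zero_n = x \<and>
    (\<forall>w\<in>disc q b. s w \<in> fst \<kappa> \<and> snd \<kappa> (s w) = join p (\<phi> w) w \<and> s w \<in> fst d \<and> (\<forall>i<p. snd d (s w) i = snd d x i)) \<and>
    continuous_on (disc q b) (\<lambda>w. drop_n p (snd d (s w))) \<and>
    open_n q ((\<lambda>w. drop_n p (snd d (s w))) ` disc q b)"
proof -
  let ?o = "zero_n :: rvec"
  note dS = F_SC[OF d]
  have top: "x \<in> topspace M" by (rule SC_top[OF dS x])
  obtain r \<kappa> where r: "r > 0" and k: "\<kappa> \<in> SC" "x \<in> fst \<kappa>" "snd \<kappa> x = ?o" "snd \<kappa> ` fst \<kappa> = nbox n ?o r"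
    and gauss: "gauss_chart \<kappa>"
    and hor: "horizontal_spacelike \<kappa>"
    and cyl: "\<forall>a b. 0 < b \<and> b < a \<and> a \<le> r \<longrightarrow> (\<exists>\<kappa>'. cylindrical_nbhd p q M A g x a b \<kappa>' \<and>
        fst \<kappa>' = {m \<in> fst \<kappa>. snd \<kappa> m \<in> cylinder p q a b} \<and> (\<forall>m\<in>fst \<kappa>'. snd \<kappa>' m = snd \<kappa> m))"
    using normal_cylinders[OF top] by (elim exE bexE conjE) auto
  define z where "z = snd d x"
  have zR: "z \<in> R_n n" using chart_Rn[OF F_chart[OF d] x] by (simp add: z_def)
  define W where "W = overlap d \<kappa>"
  have W: "open_n n W" using overlap_open(1)[OF dS k(1) k(1)] by (simp add: W_def)
  have tr: "smooth_fun n W (cp (transition d \<kappa>) l)" if "l < n" for l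
    using transition_smooth[OF dS k(1) that] by (simp add: W_def)
  \<comment> \<open>The leaf coordinates of that part of the plaque of x which lies in the normal
    chart.\<close>
  define U where "U = slice p q z W"
  have U: "open_n q U" unfolding U_def by (rule openin_slice[OF W zR])
  define y where "y = drop_n p z"
  have jy: "join p z y = z" by (simp add: y_def join_drop)
  have yU: "y \<in> U" using jy drop_Rn[OF zR] x k(2) by (auto simp: U_def slice_def y_def W_def z_def)
  define \<rho> where "\<rho> w = transition d \<kappa> (join p z w)" for w
  have mU: "chart_inv d (join p z w) \<in> fst d" "chart_inv d (join p z w) \<in> fst \<kappa>"
     "snd d (chart_inv d (join p z w)) = join p z w" "snd \<kappa> (chart_inv d (join p z w)) = \<rho> w" "\<rho> w \<in> R_n n" if "w \<in> U" for w
  proof -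
    have "join p z w \<in> overlap d \<kappa>" using that by (simp add: U_def slice_def W_def)
    then obtain m where m: "m \<in> fst d" "m \<in> fst \<kappa>" "join p z w = snd d m" by blast
    have "chart_inv d (join p z w) = m" using chart_inv(1)[OF F_chart[OF d] m(1)] m(3) by simp
    thus "chart_inv d (join p z w) \<in> fst d" "chart_inv d (join p z w) \<in> fst \<kappa>"
     "snd d (chart_inv d (join p z w)) = join p z w" "snd \<kappa> (chart_inv d (join p z w)) = \<rho> w" "\<rho> w \<in> R_n n"
      using m chart_Rn[OF SC_chart[OF k(1)] m(2)] by (simp_all add: \<rho>_def transition_def)
  qed
  have \<rho>s: "smooth_fun q U (cp \<rho> l)" if "l < n" for l
    unfolding \<rho>_def U_def by (rule smooth_slice[OF W zR tr[OF that]])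
  define Y where "Y w = drop_n p (\<rho> w)" for w
  have Ys: "smooth_fun q U (cp Y j)" if "j < q" for j
    using \<rho>s[of "p + j"] that by (simp add: Y_def drop_n_def)
  have YR: "Y w \<in> R_n q" if "w \<in> U" for w unfolding Y_def by (rule drop_Rn[OF mU(5)[OF that]])
  have causal_hor: "g m (tv \<kappa> m V) (tv \<kappa> m V) \<le> 0"
    if "w \<in> U" "m = chart_inv d (join p z w)" "V = dtr d \<kappa> (join p z w) (join p ?o v)" "v \<in> R_n q" for w m v V
    using leaf_causal[OF d mU(1)[OF that(1)] that(4)]
      tvec_of_change[OF dS k(1) mU(1,2)[OF that(1)], of "join p ?o v", unfolded mU(3)[OF that(1)]] that(2,3) by simp
  \<comment> \<open>A kernel vector of the derivative of Y comes from a leaf vector without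
    y-component, causal and horizontal at once, hence zero.\<close>
  have det: "det_n q (jacobian Y y) \<noteq> 0"
  proof (rule jacobian_injective_imp_det)
    fix v assume v: "v \<in> R_n q" "differential q Y y v = ?o"
    define V where "V = dtr d \<kappa> (join p z y) (join p ?o v)"
    have V0: "V (p + j) = 0" if j: "j < q" for j
    proof -
      have "V (p + j) = (\<Sum>k<q. jacobian (transition d \<kappa>) (join p z y) (p + j) (p + k) * v k)"
        unfolding V_def by (rule differential_slice) (use j in simp)
      also have "\<dots> = differential q Y y v j"
        using j by (simp add: differential_def jacobian_def Y_def drop_n_def \<rho>_def pd_slice[of _ "\<lambda>w. transition d \<kappa> w (p + j)"])
      finally show ?thesis using v(2) by simp
    qed
    have jR: "join p ?o v \<in> R_n n" using v(1) by (auto simp: R_n_iff join_def)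
    have "V = ?o"
    proof (rule ccontr)
      assume "V \<noteq> ?o"
      hence "0 < sqy V"
        using hor mU(2)[OF yU] causal_hor[OF yU refl V_def v(1)] differential_Rn by (auto simp: V_def)
      thus False using V0 by simp
    qed
    hence "join p ?o v = dtr \<kappa> d (snd \<kappa> (chart_inv d (join p z y))) ?o"
      using differential_inverse[OF dS k(1) mU(1,2)[OF yU] jR] mU(3)[OF yU] by (simp add: V_def)
    hence "join p ?o v = ?o" by (auto simp: differential_def fun_eq_iff)
    hence "drop_n p (join p ?o v) = ?o" by (simp add: drop_n_def)
    thus "v = ?o" by (simp add: drop_join)
  qed
  obtain \<rho>0 where \<rho>0: "\<rho>0 > 0" "nbox q y \<rho>0 \<subseteq> U" "inj_on Y (nbox q y \<rho>0)"
     "\<forall>S\<subseteq>nbox q y \<rho>0. open_n q S \<longrightarrow>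
        open_n q (Y ` S) \<and> (\<forall>i<q. smooth_fun q (Y ` S) (cp (inv_into S Y) i))"
    using inverse_function[where E = Y, OF U yU Ys YR det] by auto
  define S where "S = nbox q y \<rho>0"
  have S: "S \<subseteq> U" "inj_on Y S" "open_n q S" "open_n q (Y ` S)"
      "\<And>i. i < q \<Longrightarrow> smooth_fun q (Y ` S) (cp (inv_into S Y) i)" "y \<in> S"
    using \<rho>0 openin_nbox nbox_center[OF drop_Rn[OF zR]] by (auto simp: S_def y_def)
  define \<theta> where "\<theta> = inv_into S Y"
  have xy: "chart_inv d (join p z y) = x" unfolding jy unfolding z_def by (rule chart_inv(1)[OF F_chart[OF d] x])
  have Y0: "Y y = ?o" using mU(4)[OF yU] k(3) by (simp add: Y_def xy drop_n_def fun_eq_iff)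
  have "?o \<in> Y ` S" using S(6) Y0 by (metis imageI)
  then obtain b0 where b0: "b0 > 0" "nbox q ?o b0 \<subseteq> Y ` S"
    using S(4) unfolding openin_Euclidean_iff by auto
  \<comment> \<open>Below \<open>b0\<close> the disc lies in the image of Y; below r the cylinder
    with \<open>a = r\<close> is provided by \<open>normal_cylinders\<close>.\<close>
  define b where "b = min b0 r / 2"
  have b: "0 < b" "b < r" "b < b0" using b0 r by (auto simp: b_def min_def)
  have disc_sub: "disc q b \<subseteq> nbox q ?o b0"
    using disc_coord[OF _ b(1)] b(3) by (fastforce simp: nbox_def disc_def)
  have DS: "disc q b \<subseteq> Y ` S" using disc_sub b0 by blast
  have \<theta>: "\<theta> w \<in> S" "Y (\<theta> w) = w" "\<theta> w \<in> U" if "w \<in> Y ` S" for w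
    using that S(1) inv_into_into[of w Y S] f_inv_into_f[of w Y S] by (auto simp: \<theta>_def)
  have \<theta>Y: "\<theta> (Y w) = w" if "w \<in> S" for w using S(2) that by (simp add: \<theta>_def)
  have \<theta>s: "smooth_fun q (Y ` S) (cp \<theta> i)" if "i < q" for i using S(5)[OF that] by (simp add: \<theta>_def)
  note YSR = openin_Rn_sub[OF S(4)]
  have \<theta>c: "continuous_on (Y ` S) \<theta>"
    by (rule continuous_on_vec[where m = q])
      (use Ck_on_continuous[OF smooth_fun_Ck[OF \<theta>s] YSR] \<theta>(3) openin_Rn_sub[OF U] in auto)
  define \<phi> where "\<phi> w = fst_n p (\<rho> (\<theta> w))" for w
  define s where "s w = chart_inv d (join p z (\<theta> w))" for w
  have jo: "join p (\<phi> w) w = \<rho> (\<theta> w)" if "w \<in> Y ` S" for w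
    using \<theta>(2)[OF that] join_drop[of p "\<rho> (\<theta> w)"] by (simp add: \<phi>_def join_fst_n Y_def)
  have s: "s w \<in> fst \<kappa>" "snd \<kappa> (s w) = join p (\<phi> w) w" "s w \<in> fst d" "snd d (s w) = join p z (\<theta> w)" if "w \<in> Y ` S" for w
    using mU[OF \<theta>(3)[OF that]] jo[OF that] by (simp_all add: s_def)
  have s0: "s ?o = x"
    using \<theta>Y[OF S(6)] Y0 xy by (simp add: s_def)
  \<comment> \<open>The radial segments of the disc, lifted to the leaf by s, satisfy the hypotheses
    of \<open>leaf_graph_causal\<close>: their y-coordinates are \<open>t * w\<close> since \<theta>
    inverts Y.\<close>
  have quad: "quad p q 1 (join p (\<phi> w) w) \<le> 0" if w: "w \<in> disc q b" for w
  proof -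
    let ?t = "\<lambda>t i. t * w i"
    have tw: "?t t \<in> Y ` S" if "0 \<le> t" "t \<le> 1" for t using disc_scale[OF w that] DS by blast
    define v where "v t = (\<lambda>i. if i < q then \<Sum>k<q. pd k (cp \<theta> i) (?t t) * w k else 0)" for t
    define c' where "c' t = dtr d \<kappa> (join p z (\<theta> (?t t))) (join p ?o (v t))" for t
    have vR: "v t \<in> R_n q" for t by (auto simp: v_def R_n_iff)
    have "quad p q 1 (snd \<kappa> (s (?t 1))) \<le> 0"
    proof (rule leaf_graph_causal[OF k(1) gauss hor, where m = "\<lambda>t. s (?t t)" and c' = c' and w = w])
      fix t :: real assume t: "0 \<le> t" "t \<le> 1"
      show "s (?t t) \<in> fst \<kappa>" using s(1)[OF tw[OF t]] .
      show "c' t \<in> R_n n" unfolding c'_def by (rule differential_Rn)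
      show "g (s (?t t)) (tv \<kappa> (s (?t t)) (c' t)) (tv \<kappa> (s (?t t)) (c' t)) \<le> 0"
        by (rule causal_hor[OF \<theta>(3)[OF tw[OF t]] s_def c'_def vR])
      show "snd \<kappa> (s (?t t)) (p + j) = t * w j" if "j < q" for j
        using s(2)[OF tw[OF t]] by (simp add: join_nth)
      fix i assume i: "i < n"
      have dw: "((\<lambda>t. t * w i) has_real_derivative w i) (at t within {0..1})" for i
        by (auto intro!: derivative_eq_intros)
      have "((\<lambda>t. \<theta> (?t t) j) has_real_derivative v t j) (at t within {0..1})" if j: "j < q" for j
        using C1_chain[where u = "?t" and u' = w and ?t0.0 = t and S = "{0..1}", OF S(4) smooth_fun_Ck[OF \<theta>s[OF j]] tw[OF t] _ dw] w j
        by (auto simp: v_def disc_def R_n_iff intro!: always_eventually)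
      hence dj: "((\<lambda>t. join p z (\<theta> (?t t)) l) has_real_derivative join p ?o (v t) l) (at t within {0..1})" if "l < n" for l
        using that by (cases "l < p") (auto simp: join_def)
      have tin: "join p z (\<theta> (?t t)) \<in> W" using \<theta>(3)[OF tw[OF t]] by (simp add: U_def slice_def)
      have jR: "\<forall>\<^sub>F t in at t within {0..1}. join p z (\<theta> (?t t)) \<in> R_n n"
        unfolding eventually_at_filter
        using join_slice_Rn[OF zR] \<theta>(3)[OF tw] openin_Rn_sub[OF U] by (intro always_eventually) auto
      have "((\<lambda>t. transition d \<kappa> (join p z (\<theta> (?t t))) i) has_real_derivative c' t i) (at t within {0..1})"
        using C1_chain[where u = "\<lambda>t. join p z (\<theta> (?t t))" and u' = "join p ?o (v t)" and ?t0.0 = t and S = "{0..1}",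
            OF W smooth_fun_Ck[OF tr[OF i]] tin jR dj] i
        by (simp add: c'_def differential_def jacobian_def)
      thus "((\<lambda>t. snd \<kappa> (s (?t t)) i) has_real_derivative c' t i) (at t within {0..1})"
        by (simp add: s_def transition_def)
    next
      show "snd \<kappa> (s (?t 0)) = ?o" by (simp add: s0 k(3))
    qed
    thus ?thesis using s(2) w DS by auto
  qed
  have cub: "\<phi> w \<in> cube p r" if w: "w \<in> disc q b" for w
  proof -
    have "(\<phi> w i)\<^sup>2 < b\<^sup>2" if i: "i < p" for i
    proof -
      have "(\<phi> w i)\<^sup>2 \<le> (\<Sum>j<p. (\<phi> w j)\<^sup>2)" by (rule member_le_sum) (use i in auto)
      also have "\<dots> \<le> (\<Sum>j<q. (w j)\<^sup>2)" using quad[OF w] by (simp add: quad_def join_nth)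
      finally show ?thesis using w by (simp add: disc_def)
    qed
    hence "\<bar>\<phi> w i\<bar>\<^sup>2 < b\<^sup>2" if "i < p" for i using that by simp
    hence "\<bar>\<phi> w i\<bar> < b" if "i < p" for i using that b(1) by (meson power2_less_imp_less less_imp_le)
    thus ?thesis using b(2) fst_n_Rn by (fastforce simp: cube_def \<phi>_def)
  qed
  have "\<exists>\<kappa>'. cylindrical_nbhd p q M A g x r b \<kappa>' \<and>
        fst \<kappa>' = {m \<in> fst \<kappa>. snd \<kappa> m \<in> cylinder p q r b} \<and> (\<forall>m\<in>fst \<kappa>'. snd \<kappa>' m = snd \<kappa> m)"
    using cyl b(1,2) by simp
  then obtain \<kappa>' where k': "cylindrical_nbhd p q M A g x r b \<kappa>'" "fst \<kappa>' = {m \<in> fst \<kappa>. snd \<kappa> m \<in> cylinder p q r b}"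
      "\<forall>m\<in>fst \<kappa>'. snd \<kappa>' m = snd \<kappa> m"
    by (elim exE conjE)
  have sk: "s w \<in> fst \<kappa>'" "snd \<kappa>' (s w) = join p (\<phi> w) w" if w: "w \<in> disc q b" for w
  proof -
    have wY: "w \<in> Y ` S" using w DS by blast
    have "join p (\<phi> w) w \<in> cylinder p q r b" using cub[OF w] w by (auto simp: cylinder_def)
    thus "s w \<in> fst \<kappa>'" using s(1,2)[OF wY] k'(2) by simp
    thus "snd \<kappa>' (s w) = join p (\<phi> w) w" using k'(3) s(2)[OF wY] by simp
  qed
  have ds: "drop_n p (snd d (s w)) = \<theta> w" if "w \<in> disc q b" for w
    using s(4)[of w] that DS by (auto simp: drop_join)
  \<comment> \<open>In leaf coordinates the graph is the preimage of the disc under Y, which is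
    visibly open.\<close>
  have dim: "(\<lambda>w. drop_n p (snd d (s w))) ` disc q b = {w \<in> S. Y w \<in> disc q b}"
  proof (intro equalityI subsetI)
    fix v assume "v \<in> (\<lambda>w. drop_n p (snd d (s w))) ` disc q b"
    then obtain w where w: "w \<in> disc q b" "v = \<theta> w" using ds by auto
    hence "w \<in> Y ` S" using DS by blast
    thus "v \<in> {w \<in> S. Y w \<in> disc q b}" using \<theta>[of w] w by auto
  next
    fix v assume "v \<in> {w \<in> S. Y w \<in> disc q b}"
    thus "v \<in> (\<lambda>w. drop_n p (snd d (s w))) ` disc q b"
      by (intro image_eqI[of _ _ "Y v"]) (auto simp: ds \<theta>Y)
  qed
  have o: "open_n q {w \<in> S. Y w \<in> disc q b}"
    by (rule openin_preimage_nbhd[OF S(3) openin_disc])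
      (use S(1) YR Ck_on_continuous[OF smooth_fun_Ck[OF smooth_fun_subset[OF Ys S(1)]] openin_Rn_sub[OF S(3)]] in auto)
  have \<phi>c: "continuous_on (disc q b) \<phi>"
  proof (rule continuous_on_vec[where m = p])
    fix i assume i: "i < p"
    have "continuous_on U (cp \<rho> i)"
      using Ck_on_continuous[OF smooth_fun_Ck[OF \<rho>s] openin_Rn_sub[OF U]] i by simp
    hence "continuous_on (disc q b) (\<lambda>w. \<rho> (\<theta> w) i)"
      by (rule continuous_on_compose2[OF _ continuous_on_subset[OF \<theta>c DS]]) (use \<theta>(3) DS in auto)
    thus "continuous_on (disc q b) (cp \<phi> i)" using i by (simp add: \<phi>_def fst_n_def)
  qed (simp only: \<phi>_def fst_n_Rn)
  show ?thesis
  proof (intro exI conjI ballI)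
    show "cylindrical_nbhd p q M A g x r b \<kappa>'" "continuous_on (disc q b) \<phi>" "s ?o = x" by (fact k'(1) \<phi>c s0)+
    show "\<phi> ` disc q b \<subseteq> cube p r" using cub by blast
    show "open_n q ((\<lambda>w. drop_n p (snd d (s w))) ` disc q b)" unfolding dim by (rule o)
    show "continuous_on (disc q b) (\<lambda>w. drop_n p (snd d (s w)))"
      by (rule continuous_on_eq[OF continuous_on_subset[OF \<theta>c DS]]) (simp add: ds)
    fix w assume w: "w \<in> disc q b"
    show "quad p q 1 (join p (\<phi> w) w) \<le> 0" by (rule quad[OF w])
    show "s w \<in> fst \<kappa>'" "snd \<kappa>' (s w) = join p (\<phi> w) w" by (fact sk[OF w])+
    show "s w \<in> fst d" using s(3) w DS by blast
    show "\<forall>i<p. snd d (s w) i = snd d x i" using s(4) w DS by (auto simp: join_nth z_def)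
  qed
qed

end

section \<open>The leaf topology\<close>

text \<open>A point is coded by which members of a countable base contain it; the Hausdorff property
  makes this code injective.\<close>

lemma second_countable_inj:
  fixes X :: "'a topology"
  assumes "second_countable X" "Hausdorff_space X"
  shows "\<exists>\<iota> :: 'a \<Rightarrow> nat \<Rightarrow> real. inj_on \<iota> (topspace X)"
proof -
  obtain B where B: "countable B" "\<forall>V\<in>B. openin X V" "\<forall>U x. openin X U \<and> x \<in> U \<longrightarrow> (\<exists>V\<in>B. x \<in> V \<and> V \<subseteq> U)"
    using assms(1) unfolding second_countable_def by blast
  define \<iota> :: "'a \<Rightarrow> nat \<Rightarrow> real" where "\<iota> x k = (if x \<in> from_nat_into B k then 1 else 0)" for x k
  have "inj_on \<iota> (topspace X)"
  proof (rule inj_onI, rule ccontr)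
    fix x y assume xy: "x \<in> topspace X" "y \<in> topspace X" "\<iota> x = \<iota> y" "x \<noteq> y"
    then obtain U V where U: "openin X U" "x \<in> U" "y \<notin> U"
      using assms(2) unfolding Hausdorff_space_def disjnt_def by (metis disjoint_iff)
    then obtain V where V: "V \<in> B" "x \<in> V" "V \<subseteq> U" using B(3) by blast
    then obtain k where k: "V = from_nat_into B k" using from_nat_into_surj[OF B(1) V(1)] by metis
    have "\<iota> x k = \<iota> y k" using xy(3) by simp
    thus False using V U k by (auto simp: \<iota>_def split: if_splits)
  qed
  thus ?thesis by blast
qed

lemma smooth_fun_cong:
  assumes "open_n k U" "\<And>z. z \<in> U \<Longrightarrow> f z = g z" "smooth_fun k U f"
  shows "smooth_fun k U g"
  using assms Ck_on_cong[OF assms(1,2)] by (auto simp: smooth_fun_def)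

text \<open>Serves to compute the component in the definition of a causal map by exhibiting a
  connected set that is both open and closed.\<close>

lemma connected_component_clopen:
  assumes "connectedin X C" "openin X C" "closedin X C" "y \<in> C"
  shows "connected_component_of_set X y = C"
proof
  show "C \<subseteq> connected_component_of_set X y" by (rule connected_component_of_maximal[OF assms(1,4)])
  have "y \<in> topspace X" using assms(2,4) openin_subset by blast
  hence "y \<in> connected_component_of_set X y" by (simp add: connected_component_of_refl)
  thus "connected_component_of_set X y \<subseteq> C"
    using connectedin_clopen_cases[OF connectedin_connected_component_of assms(3,2), of y] assms(4) by (auto simp: disjnt_def)
qed

lemma is_chart_subtopology:
  assumes c: "is_chart k X c" and L: "fst c \<subseteq> L"
  shows "is_chart k (subtopology X L) c"
proof -
  have "L \<inter> fst c = fst c" using L by blast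
  thus ?thesis using c L by (auto simp: is_chart_def subtopology_subtopology openin_subtopology)
qed

text \<open>Cauchy time functions are tested on manifolds with points of type
  \<open>nat \<Rightarrow> real\<close>. Relabelling the points of a leaf by an injection leaves all
  transition maps unchanged.\<close>

lemma transport_manifold:
  fixes \<iota> :: "'a \<Rightarrow> 'c"
  assumes m: "connected_smooth_manifold k X B" and \<iota>: "inj_on \<iota> (topspace X)"
  defines "j \<equiv> inv_into (topspace X) \<iota>"
  defines "X0 \<equiv> pullback_topology (\<iota> ` topspace X) j X"
  shows "homeomorphic_map X0 X j" "homeomorphic_map X X0 \<iota>" "\<exists>A0. connected_smooth_manifold k X0 A0"
proof -
  have j\<iota>: "j (\<iota> x) = x" if "x \<in> topspace X" for x using that \<iota> by (simp add: j_def)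
  have X0: "openin X0 W \<longleftrightarrow> (\<exists>U. openin X U \<and> W = \<iota> ` U)" for W
  proof -
    have "j -` U \<inter> \<iota> ` topspace X = \<iota> ` U" if "openin X U" for U
      using openin_subset[OF that] j\<iota> by (auto simp: image_iff)
    thus ?thesis unfolding X0_def openin_pullback_topology by metis
  qed
  have top0: "topspace X0 = \<iota> ` topspace X"
    using j\<iota> by (auto simp: X0_def topspace_pullback_topology)
  have "homeomorphic_map X X0 \<iota>"
  proof (rule bijective_open_imp_homeomorphic_map)
    show "continuous_map X X0 \<iota>"
      unfolding continuous_map_def
    proof (intro conjI allI impI)
      show "\<iota> \<in> topspace X \<rightarrow> topspace X0" by (auto simp: top0)
      fix W assume "openin X0 W"
      then obtain U where U: "openin X U" "W = \<iota> ` U" unfolding X0 by blast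
      have "{x \<in> topspace X. \<iota> x \<in> W} = U"
        using openin_subset[OF U(1)] \<iota> U(2) by (auto dest: inj_onD)
      thus "openin X {x \<in> topspace X. \<iota> x \<in> W}" using U by simp
    qed
    show "open_map X X0 \<iota>" unfolding open_map_def X0 by blast
  qed (use top0 \<iota> in auto)
  thus h: "homeomorphic_map X X0 \<iota>" .
  have hm: "homeomorphic_maps X X0 \<iota> j"
    unfolding homeomorphic_maps_def
  proof (intro conjI ballI)
    show "continuous_map X X0 \<iota>" using h by (rule homeomorphic_imp_continuous_map)
    have "{y \<in> topspace X0. j y \<in> U} = \<iota> ` U" if "openin X U" for U
      using openin_subset[OF that] j\<iota> by (auto simp: top0)
    thus "continuous_map X0 X j" using j\<iota> by (auto simp: continuous_map_def X0 top0)
  qed (use j\<iota> top0 in auto)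
  thus hj: "homeomorphic_map X0 X j" using homeomorphic_maps_map homeomorphic_maps_sym by blast
  have hs: "X homeomorphic_space X0" using hm by (auto simp: homeomorphic_space_def)
  have X: "Hausdorff_space X" "second_countable X" "\<forall>c\<in>B. is_chart k X c" "(\<Union>c\<in>B. fst c) = topspace X"
      "\<forall>c\<in>B. \<forall>d\<in>B. smooth_transition k c d" "connected_space X" "topspace X \<noteq> {}"
    using m by (auto simp: connected_smooth_manifold_def smooth_manifold_def)
  define tr where "tr c = (\<iota> ` fst c, snd c \<circ> j)" for c :: "'a chart"
  have dom: "fst c \<subseteq> topspace X" if "c \<in> B" for c using is_chartD(2) X(3) that by blast
  have im: "snd (tr c) ` \<iota> ` W = snd c ` W" if "W \<subseteq> topspace X" for c W
  proof -
    have "snd (tr c) ` \<iota> ` W = (\<lambda>x. snd c (j (\<iota> x))) ` W" by (simp add: tr_def image_image)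
    also have "\<dots> = snd c ` W" by (rule image_cong) (use j\<iota> that in auto)
    finally show ?thesis .
  qed
  have chart: "is_chart k X0 (tr c)" if c: "c \<in> B" for c
  proof -
    have ic: "is_chart k X c" using X(3) c by blast
    have "homeomorphic_map (subtopology X0 (\<iota> ` fst c)) (subtopology X (fst c)) j"
    proof (rule homeomorphic_map_subtopologies[OF hj])
      show "j ` (topspace X0 \<inter> \<iota> ` fst c) = topspace X \<inter> fst c"
      proof -
        have "topspace X0 \<inter> \<iota> ` fst c = \<iota> ` fst c" using dom[OF c] by (auto simp: top0)
        moreover have "j ` \<iota> ` fst c = (\<lambda>x. x) ` fst c"
          unfolding image_image by (rule image_cong) (use dom[OF c] j\<iota> in auto)
        ultimately show ?thesis using dom[OF c] by auto
      qed
    qed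
    hence "homeomorphic_map (subtopology X0 (\<iota> ` fst c)) (sub_n k (snd c ` fst c)) (snd c \<circ> j)"
      using ic by (auto simp: is_chart_def intro: homeomorphic_map_compose)
    moreover have "openin X0 (\<iota> ` fst c)" using ic by (auto simp: X0 is_chart_def)
    moreover have "snd (tr c) ` fst (tr c) = snd c ` fst c" using im[OF dom[OF c], of c] by (simp add: tr_def)
    ultimately show ?thesis using ic by (simp add: is_chart_def) (simp add: tr_def)
  qed
  have trans: "smooth_transition k (tr c) (tr d)" if c: "c \<in> B" and d: "d \<in> B" for c d
  proof -
    have ic: "is_chart k X c" "is_chart k X d" using X(3) c d by auto
    have "\<iota> ` fst c \<inter> \<iota> ` fst d = \<iota> ` (fst c \<inter> fst d)"
      using inj_on_image_Int[OF \<iota> dom[OF c] dom[OF d]] by simp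
    hence D: "snd (tr c) ` (fst (tr c) \<inter> fst (tr d)) = overlap c d"
      using im[of "fst c \<inter> fst d" c] dom[OF c] by (auto simp: tr_def)
    have eq: "transition (tr c) (tr d) z = transition c d z" if z: "z \<in> overlap c d" for z
    proof -
      obtain x where x: "x \<in> fst c" "x \<in> fst d" "z = snd c x" using z by blast
      have "\<iota> x \<in> fst (tr c)" "snd (tr c) (\<iota> x) = z" using x dom[OF c] j\<iota> by (auto simp: tr_def)
      hence "chart_inv (tr c) z = \<iota> x" using chart_inv(1)[OF chart[OF c]] by metis
      thus ?thesis using chart_inv(1)[OF ic(1) x(1)] x dom[OF c] j\<iota> by (auto simp: transition_def tr_def)
    qed
    have o: "open_n k (overlap c d)"
      using is_chartD(6)[OF ic(1), of "fst c \<inter> fst d"] is_chartD(1)[OF ic(1)] is_chartD(1)[OF ic(2)] by auto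
    have "smooth_fun k (overlap c d) (cp (transition c d) i)" if "i < k" for i
      using X(5) c d that by (auto simp: smooth_transition_def)
    hence "smooth_fun k (overlap c d) (\<lambda>z. transition (tr c) (tr d) z i)" if "i < k" for i
      using that by (rule_tac smooth_fun_cong[OF o]) (simp_all add: eq)
    thus ?thesis unfolding smooth_transition_def D by blast
  qed
  have "(\<Union>c\<in>tr ` B. fst c) = topspace X0"
  proof -
    have "(\<Union>c\<in>tr ` B. fst c) = \<iota> ` (\<Union>c\<in>B. fst c)" by (auto simp: tr_def)
    thus ?thesis by (simp only: X(4) top0)
  qed
  hence "smooth_manifold k X0 (tr ` B)"
    using chart trans homeomorphic_Hausdorff_space[OF hs] homeomorphic_space_second_countability[OF hs] X(1,2)
    by (auto simp: smooth_manifold_def)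
  moreover have "connected_space X0" using homeomorphic_connected_space[OF hs] X(6) by simp
  moreover have "topspace X0 \<noteq> {}" using X(7) top0 by simp
  ultimately show "\<exists>A0. connected_smooth_manifold k X0 A0" by (auto simp: connected_smooth_manifold_def)
qed

section \<open>Plaques and charts of the leaf topology\<close>

context causal_foliation
begin

definition plaque :: "'a chart \<Rightarrow> rvec \<Rightarrow> rvec set \<Rightarrow> 'a set" where
  "plaque c z V = {m \<in> fst c. (\<forall>i<p. snd c m i = z i) \<and> drop_n p (snd c m) \<in> V}"

abbreviation plq :: "'a chart \<Rightarrow> 'a \<Rightarrow> real \<Rightarrow> 'a set" where
  "plq c m e \<equiv> plaque c (snd c m) (nbox q (drop_n p (snd c m)) e)"

text \<open>A single topology on all of M, in which every leaf turns out to be open and connected.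
  By \<open>plq_change\<close> the condition at m in one foliated chart implies it in all
  others.\<close>

definition leaf_top :: "'a topology" where
  "leaf_top = topology (\<lambda>S. S \<subseteq> topspace M \<and> (\<forall>m\<in>S. \<forall>c\<in>F. m \<in> fst c \<longrightarrow> (\<exists>e>0. plq c m e \<subseteq> S)))"

lemma F_Rn: "c \<in> F \<Longrightarrow> m \<in> fst c \<Longrightarrow> snd c m \<in> R_n n"
  using chart_Rn[OF F_chart] .

lemma plq_mem:
  assumes "0 < e" "c \<in> F"
  shows "m' \<in> plq c m e \<longleftrightarrow> m' \<in> fst c \<and> (\<forall>i<p. snd c m' i = snd c m i) \<and> snd c m' \<in> nbox n (snd c m) e"
proof (cases "m' \<in> fst c \<and> (\<forall>i<p. snd c m' i = snd c m i)")
  case True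
  hence R: "snd c m' \<in> R_n n" using F_Rn assms by blast
  have "(\<forall>j<q. \<bar>snd c m' (p + j) - snd c m (p + j)\<bar> < e) \<longleftrightarrow> (\<forall>i<n. \<bar>snd c m' i - snd c m i\<bar> < e)"
  proof (intro iffI allI impI)
    fix i assume *: "\<forall>j<q. \<bar>snd c m' (p + j) - snd c m (p + j)\<bar> < e" "i < n"
    show "\<bar>snd c m' i - snd c m i\<bar> < e"
      using True assms(1) *(2) *(1)[rule_format, of "i - p"] by (cases "i < p") auto
  qed auto
  thus ?thesis using True drop_Rn[OF R] R by (simp add: plaque_def nbox_def drop_n_def)
qed (auto simp: plaque_def)

lemma plq_mono: "d \<le> e \<Longrightarrow> plq c m d \<subseteq> plq c m e"
  using nbox_mono[of d e q] by (fastforce simp: plaque_def)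

lemma openin_leaf_top:
  "openin leaf_top S \<longleftrightarrow> S \<subseteq> topspace M \<and> (\<forall>m\<in>S. \<forall>c\<in>F. m \<in> fst c \<longrightarrow> (\<exists>e>0. plq c m e \<subseteq> S))"
proof -
  let ?O = "\<lambda>S. S \<subseteq> topspace M \<and> (\<forall>m\<in>S. \<forall>c\<in>F. m \<in> fst c \<longrightarrow> (\<exists>e>0. plq c m e \<subseteq> S))"
  have "istopology ?O"
    unfolding istopology_def
  proof (intro conjI allI impI ballI)
    fix S T m c
    assume S: "?O S"
      and T: "?O T"
    show "S \<inter> T \<subseteq> topspace M" using S by blast
    assume m: "m \<in> S \<inter> T" "c \<in> F" "m \<in> fst c"
    obtain e1 where e1: "e1 > 0" "plq c m e1 \<subseteq> S" using S m by blast
    obtain e2 where e2: "e2 > 0" "plq c m e2 \<subseteq> T" using T m by blast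
    show "\<exists>e>0. plq c m e \<subseteq> S \<inter> T"
      using e1 e2 plq_mono[of "min e1 e2" e1 c m] plq_mono[of "min e1 e2" e2 c m]
      by (intro exI[of _ "min e1 e2"]) auto
  next
    fix \<K> m c
    assume K: "\<forall>S\<in>\<K>. ?O S"
    show "\<Union>\<K> \<subseteq> topspace M" using K by blast
    assume m: "m \<in> \<Union>\<K>" "c \<in> F" "m \<in> fst c"
    then obtain S where S: "S \<in> \<K>" "m \<in> S" by blast
    then obtain e where "e > 0" "plq c m e \<subseteq> S" using K m by blast
    thus "\<exists>e>0. plq c m e \<subseteq> \<Union>\<K>" using S by blast
  qed
  thus ?thesis by (simp add: leaf_top_def)
qed

lemma topspace_leaf_top: "topspace leaf_top = topspace M"
proof
  show "topspace leaf_top \<subseteq> topspace M" using openin_leaf_top openin_topspace by blast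
  have "openin leaf_top (topspace M)"
    unfolding openin_leaf_top using SC_top[OF F_SC] by (auto simp: plaque_def intro: exI[of _ 1])
  thus "topspace M \<subseteq> topspace leaf_top" by (rule openin_subset)
qed

lemma openin_leaf_of_openin:
  assumes S: "openin M S"
  shows "openin leaf_top S"
  unfolding openin_leaf_top
proof (intro conjI ballI impI)
  show "S \<subseteq> topspace M" using S by (rule openin_subset)
  fix m c assume m: "m \<in> S" and c: "c \<in> F" "m \<in> fst c"
  have "open_n n (snd c ` (fst c \<inter> S))"
    using is_chartD(6)[OF F_chart[OF c(1)], of "fst c \<inter> S"] is_chartD(1)[OF F_chart[OF c(1)]] S by auto
  then obtain e where e: "e > 0" "nbox n (snd c m) e \<subseteq> snd c ` (fst c \<inter> S)"
    unfolding openin_Euclidean_iff using m c(2) by blast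
  have "plq c m e \<subseteq> S"
  proof
    fix m' assume "m' \<in> plq c m e"
    hence m': "m' \<in> fst c" "snd c m' \<in> snd c ` (fst c \<inter> S)" using plq_mem[OF e(1) c(1)] e(2) by auto
    thus "m' \<in> S" using is_chartD(4)[OF F_chart[OF c(1)]] by (auto dest: inj_onD)
  qed
  thus "\<exists>e>0. plq c m e \<subseteq> S" using e(1) by blast
qed

lemma continuous_leaf_id: "continuous_map leaf_top M (\<lambda>m. m)"
proof -
  have "{x \<in> topspace M. x \<in> U} = U" if "openin M U" for U using openin_subset[OF that] by blast
  thus ?thesis using openin_leaf_of_openin by (auto simp: continuous_map_def topspace_leaf_top)
qed

text \<open>Two points of a plaque in a box are joined by a segment along which only leaf
  coordinates move, and in these directions the transverse transition functions have zero
  derivative. The mean value theorem turns this infinitesimal condition into equality of the new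
  transverse coordinates.\<close>

lemma plq_change:
  assumes c: "c \<in> F" and d: "d \<in> F" and m: "m \<in> fst c" "m \<in> fst d" and e: "0 < e"
  shows "\<exists>\<delta>>0. plq c m \<delta> \<subseteq> plq d m e"
proof -
  define W where "W = overlap c d"
  have W: "open_n n W" unfolding W_def by (rule overlap_open(1)[OF F_SC[OF c] F_SC[OF d] F_SC[OF d]])
  have mW: "snd c m \<in> W" using m by (auto simp: W_def)
  have tC: "Ck_on 1 n W (cp (transition c d) i)" if "i < n" for i
    using transition_C[OF F_SC[OF c] F_SC[OF d] that] by (simp add: W_def)
  have "open_n n {z \<in> W. transition c d z \<in> nbox n (snd d m) e}"
  proof (rule openin_preimage_nbhd[OF W openin_nbox])
    show "continuous_on W (cp (transition c d) i)" if "i < n" for i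
      by (rule Ck_on_continuous[OF tC[OF that] openin_Rn_sub[OF W]])
    show "transition c d z \<in> R_n n" if "z \<in> W" for z
    proof -
      obtain x where "x \<in> fst c" "x \<in> fst d" "z = snd c x" using \<open>z \<in> W\<close> by (auto simp: W_def)
      thus ?thesis using transition_chart[OF F_chart[OF c], of x d] F_Rn[OF d, of x] by simp
    qed
  qed
  moreover have "snd c m \<in> {z \<in> W. transition c d z \<in> nbox n (snd d m) e}"
    using mW transition_chart[OF F_chart[OF c] m(1)] nbox_center[OF F_Rn[OF d m(2)] e] by simp
  ultimately obtain \<delta> where \<delta>: "\<delta> > 0" "nbox n (snd c m) \<delta> \<subseteq> {z \<in> W. transition c d z \<in> nbox n (snd d m) e}"
    unfolding openin_Euclidean_iff by blast
  have "plq c m \<delta> \<subseteq> plq d m e"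
  proof
    fix m' assume "m' \<in> plq c m \<delta>"
    hence m': "m' \<in> fst c" "\<forall>i<p. snd c m' i = snd c m i" "snd c m' \<in> nbox n (snd c m) \<delta>"
      using plq_mem[OF \<delta>(1) c] by auto
    hence w: "snd c m' \<in> W" "transition c d (snd c m') \<in> nbox n (snd d m) e" using \<delta>(2) by auto
    have md: "m' \<in> fst d" using w(1) m'(1) is_chartD(4)[OF F_chart[OF c]] by (auto simp: W_def dest: inj_onD)
    have t: "transition c d (snd c m') = snd d m'" "transition c d (snd c m) = snd d m"
      using transition_chart[OF F_chart[OF c]] m'(1) m(1) by auto
    have "snd d m' i = snd d m i" if i: "i < p" for i
    proof -
      have seg: "(\<lambda>i. snd c m i + s * (snd c m' i - snd c m i)) \<in> W" if s: "0 \<le> s" "s \<le> 1" for s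
      proof -
        have "s * \<bar>snd c m' i - snd c m i\<bar> < \<delta>" if "i < n" for i
          using m'(3) s that mult_left_le_one_le[of "\<bar>snd c m' i - snd c m i\<bar>" s] by (fastforce simp: nbox_def)
        hence "(\<lambda>i. snd c m i + s * (snd c m' i - snd c m i)) \<in> nbox n (snd c m) \<delta>"
          using F_Rn[OF c m(1)] F_Rn[OF c m'(1)] s by (auto simp: nbox_def R_n_iff abs_mult)
        thus ?thesis using \<delta>(2) by blast
      qed
      have i': "i < n" using i by simp
      obtain s where s: "0 < s" "s < 1" "transition c d (snd c m') i - transition c d (snd c m) i
          = (\<Sum>j<n. pd j (cp (transition c d) i) (\<lambda>i. snd c m i + s * (snd c m' i - snd c m i)) * (snd c m' j - snd c m j))"
        by (rule C1_MVT[OF W tC[OF i'] seg])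
      have "pd j (cp (transition c d) i) (\<lambda>i. snd c m i + s * (snd c m' i - snd c m i)) * (snd c m' j - snd c m j) = 0" if "j < n" for j
      proof (cases "j < p")
        case False
        thus ?thesis
          using F_jacobian[OF c d seg[unfolded W_def] i, of s j] s that by (simp add: jacobian_def)
      qed (use m'(2) in simp)
      hence "transition c d (snd c m') i - transition c d (snd c m) i = 0"
        unfolding s(3) by (intro sum.neutral) blast
      thus ?thesis by (simp add: t)
    qed
    thus "m' \<in> plq d m e" using plq_mem[OF e d] md w(2) t(1) by simp
  qed
  thus ?thesis using \<delta>(1) by blast
qed

lemma openin_plaque:
  assumes c: "c \<in> F" and V: "open_n q V"
  shows "openin leaf_top (plaque c z V)"
  unfolding openin_leaf_top
proof (intro conjI ballI impI)
  show "plaque c z V \<subseteq> topspace M" using SC_top[OF F_SC[OF c]] by (auto simp: plaque_def)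
  fix m d assume m: "m \<in> plaque c z V" and d: "d \<in> F" "m \<in> fst d"
  have mc: "m \<in> fst c" "drop_n p (snd c m) \<in> V" using m by (auto simp: plaque_def)
  obtain e where e: "e > 0" "nbox q (drop_n p (snd c m)) e \<subseteq> V"
    using V mc unfolding openin_Euclidean_iff by blast
  have "plq c m e \<subseteq> plaque c z V" using m e(2) by (auto simp: plaque_def)
  thus "\<exists>e>0. plq d m e \<subseteq> plaque c z V" using plq_change[OF d(1) c d(2) mc(1) e(1)] by blast
qed

definition leaf_chart :: "'a chart \<Rightarrow> rvec \<Rightarrow> 'a chart" where
  "leaf_chart c z = (plaque c z (R_n q), \<lambda>m. drop_n p (snd c m))"

lemma leaf_chart_join: "m \<in> fst (leaf_chart c z) \<Longrightarrow> join p z (snd (leaf_chart c z) m) = snd c m"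
  using join_cong[of p z "snd c m" "drop_n p (snd c m)"] by (simp add: leaf_chart_def plaque_def join_drop)

lemma leaf_chart_mem:
  assumes "c \<in> F" "m \<in> fst c"
  shows "m \<in> fst (leaf_chart c z) \<longleftrightarrow> (\<forall>i<p. snd c m i = z i)"
  using assms drop_Rn[OF F_Rn[OF assms]] by (simp add: leaf_chart_def plaque_def)

lemma leaf_chart_image:
  assumes c: "c \<in> F" and m: "m \<in> fst c"
  shows "snd (leaf_chart c (snd c m)) ` fst (leaf_chart c (snd c m)) = nbox q zero_n 1"
proof (intro equalityI subsetI)
  fix w assume "w \<in> snd (leaf_chart c (snd c m)) ` fst (leaf_chart c (snd c m))"
  then obtain m' where m': "m' \<in> fst c" "w = drop_n p (snd c m')" by (auto simp: leaf_chart_def plaque_def)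
  have "snd c m' \<in> nbox n zero_n 1" using F_image[OF c] m'(1) by blast
  thus "w \<in> nbox q zero_n 1" using drop_Rn[OF F_Rn[OF c m'(1)]] m'(2) by (auto simp: nbox_def drop_n_def)
next
  fix w assume w: "w \<in> nbox q zero_n 1"
  have mb: "snd c m \<in> nbox n zero_n 1" using F_image[OF c] m by blast
  have "\<bar>join p (snd c m) w i\<bar> < 1" if "i < n" for i
    using that mb w by (cases "i < p") (auto simp: nbox_def join_def)
  hence "join p (snd c m) w \<in> snd c ` fst c"
    using join_slice_Rn[OF F_Rn[OF c m], of w] w unfolding F_image[OF c] by (simp add: nbox_def)
  then obtain m' where m': "m' \<in> fst c" "snd c m' = join p (snd c m) w" by (metis imageE)
  hence "m' \<in> fst (leaf_chart c (snd c m))" using leaf_chart_mem[OF c m'(1)] by (simp add: join_nth)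
  moreover have "snd (leaf_chart c (snd c m)) m' = w" using m'(2) by (simp add: leaf_chart_def drop_join)
  ultimately show "w \<in> snd (leaf_chart c (snd c m)) ` fst (leaf_chart c (snd c m))" by blast
qed

lemma leaf_chart_is_chart:
  assumes c: "c \<in> F" and m: "m \<in> fst c"
  shows "is_chart q leaf_top (leaf_chart c (snd c m))"
proof -
  let ?l = "leaf_chart c (snd c m)"
  let ?L = "subtopology leaf_top (fst ?l)"
  have o: "openin leaf_top (fst ?l)" using openin_plaque[OF c openin_Rn_top] by (simp add: leaf_chart_def)
  have im: "open_n q (snd ?l ` fst ?l)" unfolding leaf_chart_image[OF c m] by (rule openin_nbox)
  have inj: "inj_on (snd ?l) (fst ?l)"
  proof (rule inj_onI)
    fix x y assume xy: "x \<in> fst ?l" "y \<in> fst ?l" "snd ?l x = snd ?l y"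
    hence "snd c x = snd c y" using leaf_chart_join by metis
    thus "x = y" using xy is_chartD(4)[OF F_chart[OF c]] by (auto simp: leaf_chart_def plaque_def dest: inj_onD)
  qed
  have "homeomorphic_map ?L (sub_n q (snd ?l ` fst ?l)) (snd ?l)"
  proof (rule bijective_open_imp_homeomorphic_map)
    have pre: "openin leaf_top {x \<in> fst ?l. snd ?l x \<in> V}" if V: "open_n q V" for V
    proof -
      have "{x \<in> fst ?l. snd ?l x \<in> V} = plaque c (snd c m) V"
        using openin_Rn_sub[OF V] by (auto simp: leaf_chart_def plaque_def)
      thus ?thesis using openin_plaque[OF c V] by simp
    qed
    have t: "topspace ?L = fst ?l" using openin_subset[OF o] by auto
    have "continuous_map ?L (Euclidean_space q) (snd ?l)"
      unfolding continuous_map_def t openin_open_subtopology[OF o] using pre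
      by (auto simp: leaf_chart_def plaque_def)
    thus "continuous_map ?L (sub_n q (snd ?l ` fst ?l)) (snd ?l)"
      by (simp add: continuous_map_in_subtopology t)
    show "open_map ?L (sub_n q (snd ?l ` fst ?l)) (snd ?l)"
      unfolding open_map_def openin_open_subtopology[OF o] openin_open_subtopology[OF im]
    proof (intro allI impI conjI)
      fix S assume S: "openin leaf_top S \<and> S \<subseteq> fst ?l"
      thus "snd ?l ` S \<subseteq> snd ?l ` fst ?l" by blast
      show "open_n q (snd ?l ` S)"
        unfolding openin_Euclidean_iff
      proof (intro conjI ballI)
        show "snd ?l ` S \<subseteq> R_n q" using S by (auto simp: leaf_chart_def plaque_def)
        fix w assume "w \<in> snd ?l ` S"
        then obtain x where x: "x \<in> S" "w = drop_n p (snd c x)" by (auto simp: leaf_chart_def)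
        have xl: "x \<in> fst ?l" "x \<in> fst c" "\<forall>i<p. snd c x i = snd c m i" using S x by (auto simp: leaf_chart_def plaque_def)
        obtain e where e: "e > 0" "plq c x e \<subseteq> S" using S x(1) c xl(2) unfolding openin_leaf_top by blast
        have "w \<in> snd ?l ` fst ?l" using xl(1) x(2) by (auto simp: leaf_chart_def)
        then obtain e' where e': "e' > 0" "nbox q w e' \<subseteq> snd ?l ` fst ?l" using im unfolding openin_Euclidean_iff by blast
        have "nbox q w (min e e') \<subseteq> snd ?l ` S"
        proof
          fix v assume v: "v \<in> nbox q w (min e e')"
          hence "v \<in> snd ?l ` fst ?l" "v \<in> nbox q w e" using e'(2) nbox_mono[of "min e e'" e q w] nbox_mono[of "min e e'" e' q w] by auto
          then obtain y where y: "y \<in> fst ?l" "v = snd ?l y" by blast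
          hence "y \<in> plq c x e" using xl(3) \<open>v \<in> nbox q w e\<close> x(2) by (auto simp: leaf_chart_def plaque_def)
          thus "v \<in> snd ?l ` S" using e(2) y by blast
        qed
        thus "\<exists>e>0. nbox q w e \<subseteq> snd ?l ` S" using e(1) e'(1) by (intro exI[of _ "min e e'"]) auto
      qed
    qed
    show "snd ?l ` topspace ?L = topspace (sub_n q (snd ?l ` fst ?l))"
      unfolding t using openin_subset[OF im] by auto
    show "inj_on (snd ?l) (topspace ?L)" unfolding t by (rule inj)
  qed
  thus ?thesis using o im by (simp add: is_chart_def)
qed

lemma leaf_chart_transition:
  assumes c: "c \<in> F" "m \<in> fst c" and d: "d \<in> F" "m' \<in> fst d"
  shows "smooth_transition q (leaf_chart c (snd c m)) (leaf_chart d (snd d m'))"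
proof -
  let ?l = "leaf_chart c (snd c m)" and ?k = "leaf_chart d (snd d m')"
  define W where "W = overlap c d"
  define D where "D = overlap ?l ?k"
  note lc = leaf_chart_is_chart[OF c] and kc = leaf_chart_is_chart[OF d]
  have W: "open_n n W" unfolding W_def by (rule overlap_open(1)[OF F_SC[OF c(1)] F_SC[OF d(1)] F_SC[OF d(1)]])
  have D: "open_n q D"
    unfolding D_def using is_chartD(6)[OF lc, of "fst ?l \<inter> fst ?k"] is_chartD(1)[OF lc] is_chartD(1)[OF kc] by auto
  have pt: "join p (snd c m) w \<in> W \<and> transition ?l ?k w j = transition c d (join p (snd c m) w) (p + j)" if w: "w \<in> D" for w j
  proof -
    obtain x where x: "x \<in> fst ?l" "x \<in> fst ?k" "w = snd ?l x" using w by (auto simp: D_def)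
    have xc: "x \<in> fst c" "x \<in> fst d" using x by (auto simp: leaf_chart_def plaque_def)
    have j: "join p (snd c m) w = snd c x" using leaf_chart_join[OF x(1)] x(3) by simp
    have "transition ?l ?k w = snd ?k x" using transition_chart[OF lc x(1)] x(3) by simp
    thus ?thesis using j xc transition_chart[OF F_chart[OF c(1)] xc(1), of d] by (auto simp: W_def leaf_chart_def drop_n_def)
  qed
  have "smooth_fun q D (cp (transition ?l ?k) j)" if j: "j < q" for j
  proof -
    have "smooth_fun n W (\<lambda>z. transition c d z (p + j))"
      using transition_smooth[OF F_SC[OF c(1)] F_SC[OF d(1)], of "p + j"] j by (simp add: W_def)
    hence "smooth_fun q (slice p q (snd c m) W) (\<lambda>w. transition c d (join p (snd c m) w) (p + j))"
      by (rule smooth_slice[OF W F_Rn[OF c]])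
    moreover have "D \<subseteq> slice p q (snd c m) W" using pt openin_Rn_sub[OF D] by (auto simp: slice_def)
    ultimately have "smooth_fun q D (\<lambda>w. transition c d (join p (snd c m) w) (p + j))" by (rule smooth_fun_subset)
    thus ?thesis by (rule smooth_fun_cong[OF D, rotated]) (use pt in auto)
  qed
  thus ?thesis by (simp add: smooth_transition_def D_def)
qed

text \<open>A map confined to one plaque is read in a single leaf chart, where continuity for the
  finer leaf topology is continuity of the leaf coordinates.\<close>

lemma leaf_continuous_map:
  assumes c: "c \<in> F" "m \<in> fst c" and h: "continuous_map X (Euclidean_space q) (\<lambda>w. drop_n p (snd c (s w)))"
    and s: "\<And>w. w \<in> topspace X \<Longrightarrow> s w \<in> fst c \<and> (\<forall>i<p. snd c (s w) i = snd c m i)"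
  shows "continuous_map X leaf_top s"
proof -
  let ?l = "leaf_chart c (snd c m)"
  note lc = leaf_chart_is_chart[OF c]
  have l: "s w \<in> fst ?l" "snd ?l (s w) = drop_n p (snd c (s w))" if "w \<in> topspace X" for w
    using s[OF that] leaf_chart_mem[OF c(1), of "s w" "snd c m"] by (auto simp: leaf_chart_def)
  have "continuous_map X (sub_n q (snd ?l ` fst ?l)) (\<lambda>w. drop_n p (snd c (s w)))"
    unfolding continuous_map_in_subtopology
  proof (intro conjI h funcsetI)
    fix w assume "w \<in> topspace X"
    thus "drop_n p (snd c (s w)) \<in> snd ?l ` fst ?l" using l[of w] by (metis imageI)
  qed
  hence "continuous_map X leaf_top (chart_inv ?l \<circ> (\<lambda>w. drop_n p (snd c (s w))))"
    using continuous_map_chart_inv[OF lc] by (rule continuous_map_compose)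
  thus ?thesis
    by (rule continuous_map_eq) (use l chart_inv(1)[OF lc] in \<open>metis comp_apply\<close>)
qed

end

section \<open>Leaves are inextendible causal submanifolds\<close>

lemma second_countable_Euclidean_space: "second_countable (Euclidean_space k)"
proof -
  obtain B :: "rvec set set" where B: "countable B" "\<And>C. C \<in> B \<Longrightarrow> open C" "\<And>S. open S \<Longrightarrow> \<exists>U. U \<subseteq> B \<and> S = \<Union>U"
    using univ_second_countable by blast
  have "\<exists>V\<in>B. x \<in> V \<and> V \<subseteq> S" if "open S" "x \<in> S" for S x using B(3)[OF that(1)] that(2) by blast
  hence "second_countable (euclidean :: rvec topology)"
    unfolding second_countable_def using B(1,2) by (intro exI[of _ B]) auto
  hence "second_countable (top_of_set (R_n k))" by (rule second_countable_subtopology)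
  thus ?thesis by (simp only: Euclidean_space_eq[symmetric])
qed

lemma continuous_map_Rn:
  "continuous_map X (Euclidean_space k) f \<longleftrightarrow> continuous_map X euclidean f \<and> f \<in> topspace X \<rightarrow> R_n k"
proof -
  have "continuous_map X (top_of_set (R_n k)) f \<longleftrightarrow> continuous_map X euclidean f \<and> f \<in> topspace X \<rightarrow> R_n k"
    by (auto simp: continuous_map_in_subtopology)
  thus ?thesis by (simp only: Euclidean_space_eq[symmetric])
qed

text \<open>Disjoint sets with nonempty interior contain distinct members of a countable
  base.\<close>

lemma second_countable_disjoint:
  assumes X: "second_countable X" and D: "\<And>Q. Q \<in> \<D> \<Longrightarrow> \<exists>U. openin X U \<and> U \<noteq> {} \<and> U \<subseteq> Q"
    and disj: "\<And>P Q. P \<in> \<D> \<Longrightarrow> Q \<in> \<D> \<Longrightarrow> P \<inter> Q \<noteq> {} \<Longrightarrow> P = Q"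
  shows "countable \<D>"
proof -
  obtain B where B: "countable B" "\<forall>U x. openin X U \<and> x \<in> U \<longrightarrow> (\<exists>V\<in>B. x \<in> V \<and> V \<subseteq> U)"
    using X unfolding second_countable_def by blast
  have "\<exists>V\<in>B. V \<noteq> {} \<and> V \<subseteq> Q" if "Q \<in> \<D>" for Q
  proof -
    from D[OF that] obtain U x where "openin X U" "x \<in> U" "U \<subseteq> Q" by blast
    thus ?thesis using B(2) by (metis empty_iff order_trans)
  qed
  then obtain f where f: "\<And>Q. Q \<in> \<D> \<Longrightarrow> f Q \<in> B \<and> f Q \<noteq> {} \<and> f Q \<subseteq> Q" by metis
  have "inj_on f \<D>"
  proof (rule inj_onI)
    fix P Q assume PQ: "P \<in> \<D>" "Q \<in> \<D>" "f P = f Q"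
    hence "P \<inter> Q \<noteq> {}" using f[of P] f[of Q] by blast
    thus "P = Q" using disj PQ by blast
  qed
  moreover have "countable (f ` \<D>)" using B(1) f by (meson countable_subset image_subsetI)
  ultimately show ?thesis using countable_image_inj_on by blast
qed

lemma second_countable_cover:
  assumes C: "countable \<C>" and P: "\<And>P. P \<in> \<C> \<Longrightarrow> openin X P \<and> second_countable (subtopology X P)" and cov: "topspace X \<subseteq> \<Union>\<C>"
  shows "second_countable X"
proof -
  have "\<exists>B. countable B \<and> (\<forall>V\<in>B. openin X V) \<and> (\<forall>U x. openin X U \<and> x \<in> U \<and> U \<subseteq> P \<longrightarrow> (\<exists>V\<in>B. x \<in> V \<and> V \<subseteq> U))" if "P \<in> \<C>" for P
    using P[OF that] unfolding second_countable_def openin_open_subtopology[OF conjunct1[OF P[OF that]]] by meson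
  then obtain B where B: "\<And>P. P \<in> \<C> \<Longrightarrow> countable (B P)" "\<And>P V. P \<in> \<C> \<Longrightarrow> V \<in> B P \<Longrightarrow> openin X V"
      "\<And>P U x. P \<in> \<C> \<Longrightarrow> openin X U \<Longrightarrow> x \<in> U \<Longrightarrow> U \<subseteq> P \<Longrightarrow> \<exists>V\<in>B P. x \<in> V \<and> V \<subseteq> U" by metis
  show ?thesis
    unfolding second_countable_def
  proof (intro exI[of _ "\<Union>(B ` \<C>)"] conjI allI impI ballI)
    show "countable (\<Union>(B ` \<C>))" using C B(1) by blast
    show "openin X V" if "V \<in> \<Union>(B ` \<C>)" for V using that B(2) by blast
    fix U x assume U: "openin X U \<and> x \<in> U"
    then obtain R where R: "R \<in> \<C>" "x \<in> R" using cov openin_subset by blast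
    hence "openin X (U \<inter> R)" using U P by blast
    then obtain V where "V \<in> B R" "x \<in> V" "V \<subseteq> U \<inter> R" using B(3)[OF R(1), of "U \<inter> R" x] U R(2) by blast
    thus "\<exists>V\<in>\<Union>(B ` \<C>). x \<in> V \<and> V \<subseteq> U" using R(1) by blast
  qed
qed

lemma star_connected:
  assumes "\<And>w t. w \<in> D \<Longrightarrow> 0 \<le> t \<Longrightarrow> t \<le> 1 \<Longrightarrow> (\<lambda>i. t * w i) \<in> D"
  shows "connected (D :: rvec set)"
proof (cases "D = {}")
  case False
  let ?r = "\<lambda>w. (\<lambda>(t::real) i. t * w i) ` {0..1}"
  have "connected (\<Union>(?r ` D))"
  proof (rule connected_Union)
    fix s assume "s \<in> ?r ` D"
    then obtain w where w: "s = ?r w" by blast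
    have "continuous_on {0..1} (\<lambda>(t::real) i. t * w i)"
      by (intro continuous_on_coordinatewise_then_product continuous_intros)
    thus "connected s" unfolding w by (rule connected_continuous_image) simp
  next
    have "zero_n \<in> s" if "s \<in> ?r ` D" for s
      using that by (force simp: image_iff intro!: bexI[of _ 0])
    thus "\<Inter>(?r ` D) \<noteq> {}" by blast
  qed
  moreover have "\<Union>(?r ` D) = D"
  proof
    show "\<Union>(?r ` D) \<subseteq> D" using assms by auto
    show "D \<subseteq> \<Union>(?r ` D)" by (force simp: image_iff intro!: bexI[of _ 1])
  qed
  ultimately show ?thesis by simp
qed simp

lemma continuous_map_drop: "continuous_map (Euclidean_space (p + q)) (Euclidean_space q) (drop_n p)"
  and continuous_map_fst_n: "continuous_map (Euclidean_space (p + q)) (Euclidean_space p) (fst_n p)"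
proof -
  have "continuous_on (R_n (p + q)) (drop_n p)"
  proof (rule continuous_on_vec[where m = q])
    show "continuous_on (R_n (p + q)) (\<lambda>z. drop_n p z j)" for j by (simp add: drop_n_def continuous_on_coord)
  qed (rule drop_Rn)
  hence "continuous_map (top_of_set (R_n (p + q))) (Euclidean_space q) (drop_n p)"
    using drop_Rn unfolding continuous_map_Rn by auto
  thus "continuous_map (Euclidean_space (p + q)) (Euclidean_space q) (drop_n p)"
    by (simp only: Euclidean_space_eq[symmetric])
  have "continuous_on (R_n (p + q)) (fst_n p)"
  proof (rule continuous_on_vec[where m = p])
    show "continuous_on (R_n (p + q)) (\<lambda>z. fst_n p z j)" if "j < p" for j using that by (simp add: fst_n_def continuous_on_coord)
  qed (rule fst_n_Rn)
  hence "continuous_map (top_of_set (R_n (p + q))) (Euclidean_space p) (fst_n p)"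
    using fst_n_Rn unfolding continuous_map_Rn by auto
  thus "continuous_map (Euclidean_space (p + q)) (Euclidean_space p) (fst_n p)"
    by (simp only: Euclidean_space_eq[symmetric])
qed

section \<open>Leaves as connected second countable manifolds, mapped causally and inextendibly into
  M\<close>

context causal_foliation
begin

definition leaf :: "'a \<Rightarrow> 'a set" where "leaf m = {y. (same_plaque p F)\<^sup>*\<^sup>* m y}"

abbreviation leaf_space :: "'a \<Rightarrow> 'a topology" where "leaf_space m \<equiv> subtopology leaf_top (leaf m)"

lemma leaf_refl: "m \<in> leaf m" by (simp add: leaf_def)

lemma leaf_eq: "y \<in> leaf m \<Longrightarrow> leaf y = leaf m"
proof -
  assume y: "y \<in> leaf m"
  have "symp (same_plaque p F)" by (auto simp: symp_def same_plaque_def)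
  hence "symp (same_plaque p F)\<^sup>*\<^sup>*" by (rule symp_rtranclp)
  hence "(same_plaque p F)\<^sup>*\<^sup>* y m" using y by (auto simp: leaf_def dest: sympD)
  thus ?thesis using y by (auto simp: leaf_def intro: rtranclp_trans)
qed

lemma leaves_eq: "leaves p M F = leaf ` topspace M" by (auto simp: leaves_def leaf_def)

lemma leaf_subset:
  assumes "m \<in> topspace M"
  shows "leaf m \<subseteq> topspace M"
proof
  fix y assume "y \<in> leaf m"
  hence "(same_plaque p F)\<^sup>*\<^sup>* m y" by (simp add: leaf_def)
  thus "y \<in> topspace M"
    by (induction rule: rtranclp_induct) (use assms SC_top[OF F_SC] in \<open>auto simp: same_plaque_def\<close>)
qed

lemma same_plaque_leaf: "c \<in> F \<Longrightarrow> x \<in> fst c \<Longrightarrow> y \<in> fst c \<Longrightarrow> (\<And>i. i < p \<Longrightarrow> snd c x i = snd c y i) \<Longrightarrow> y \<in> leaf x"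
  unfolding leaf_def same_plaque_def by (intro CollectI r_into_rtranclp bexI[of _ c] conjI allI impI)

lemma leaf_chart_leaf: "c \<in> F \<Longrightarrow> x \<in> fst c \<Longrightarrow> x \<in> leaf m \<Longrightarrow> fst (leaf_chart c (snd c x)) \<subseteq> leaf m"
  using same_plaque_leaf[of c x] leaf_eq[of x m] by (auto simp: leaf_chart_def plaque_def)

lemma leaf_chart_self: "c \<in> F \<Longrightarrow> x \<in> fst c \<Longrightarrow> x \<in> fst (leaf_chart c (snd c x))"
  by (simp add: leaf_chart_mem)

lemma leaf_chart_dom_open: "c \<in> F \<Longrightarrow> openin leaf_top (fst (leaf_chart c z))"
  using openin_plaque[OF _ openin_Rn_top] by (simp add: leaf_chart_def)

lemma leaf_open:
  assumes m: "m \<in> topspace M"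
  shows "openin leaf_top (leaf m)"
proof -
  have "leaf m = \<Union>{fst (leaf_chart c (snd c x)) | c x. c \<in> F \<and> x \<in> fst c \<and> x \<in> leaf m}"
  proof (intro equalityI subsetI)
    fix x assume x: "x \<in> leaf m"
    then obtain c where "c \<in> F" "x \<in> fst c" using F_cover leaf_subset[OF m] by blast
    thus "x \<in> \<Union>{fst (leaf_chart c (snd c x)) | c x. c \<in> F \<and> x \<in> fst c \<and> x \<in> leaf m}"
      using x leaf_chart_self by blast
  qed (use leaf_chart_leaf in blast)
  moreover have "openin leaf_top (\<Union>{fst (leaf_chart c (snd c x)) | c x. c \<in> F \<and> x \<in> fst c \<and> x \<in> leaf m})"
    using leaf_chart_dom_open by (intro openin_Union) auto
  ultimately show ?thesis by simp
qed

lemma topspace_leaf_space: "m \<in> topspace M \<Longrightarrow> topspace (leaf_space m) = leaf m"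
  using leaf_subset by (auto simp: topspace_leaf_top)

lemma openin_leaf_space: "m \<in> topspace M \<Longrightarrow> openin (leaf_space m) S \<longleftrightarrow> openin leaf_top S \<and> S \<subseteq> leaf m"
  using openin_open_subtopology[OF leaf_open] .

lemma leaf_chart_connected:
  assumes c: "c \<in> F" "m \<in> fst c"
  shows "connectedin leaf_top (fst (leaf_chart c (snd c m)))"
proof -
  let ?l = "leaf_chart c (snd c m)"
  note lc = leaf_chart_is_chart[OF c]
  have "connected (nbox q zero_n 1)"
  proof (rule star_connected)
    fix w and t :: real assume w: "w \<in> nbox q zero_n 1" and t: "0 \<le> t" "t \<le> 1"
    have "t * \<bar>w i\<bar> < 1" if "i < q" for i
      using w that t mult_left_le_one_le[of "\<bar>w i\<bar>" t] by (fastforce simp: nbox_def)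
    thus "(\<lambda>i. t * w i) \<in> nbox q zero_n 1" using w t by (auto simp: nbox_def R_n_iff abs_mult)
  qed
  hence "connectedin (sub_n q (nbox q zero_n 1)) (nbox q zero_n 1)"
    using openin_Rn_sub[OF openin_nbox, of q "\<lambda>_. 0" 1] by (simp add: subtopology_Rn connectedin_subtopology)
  hence "connectedin leaf_top (chart_inv ?l ` nbox q zero_n 1)"
    using connectedin_continuous_map_image[OF continuous_map_chart_inv[OF lc]] leaf_chart_image[OF c] by simp
  moreover have "chart_inv ?l ` nbox q zero_n 1 = fst ?l"
    unfolding leaf_chart_image[OF c, symmetric] image_image using chart_inv(1)[OF lc] by force
  ultimately show ?thesis by simp
qed

lemma leaf_connected:
  assumes m: "m \<in> topspace M"
  shows "connected_space (leaf_space m)"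
proof -
  have "connected_component_of (leaf_space m) m y" if "(same_plaque p F)\<^sup>*\<^sup>* m y" for y
    using that
  proof (induction rule: rtranclp_induct)
    case base
    thus ?case using m leaf_refl topspace_leaf_space[OF m] by (simp add: connected_component_of_refl)
  next
    case (step y z)
    then obtain c where c: "c \<in> F" "y \<in> fst c" "z \<in> fst c" "\<forall>i<p. snd c y i = snd c z i" by (auto simp: same_plaque_def)
    have "y \<in> leaf m" using step(1) by (simp add: leaf_def)
    hence "connectedin (leaf_space m) (fst (leaf_chart c (snd c y)))"
      using leaf_chart_connected[OF c(1,2)] leaf_chart_leaf[OF c(1,2)] by (simp add: connectedin_subtopology)
    moreover have "z \<in> fst (leaf_chart c (snd c y))" using c leaf_chart_mem by simp
    ultimately have "connected_component_of (leaf_space m) y z"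
      using leaf_chart_self[OF c(1,2)] by (auto simp: connected_component_of_def)
    thus ?case using step.IH connected_component_of_trans by metis
  qed
  hence "connected_component_of (leaf_space m) m y" if "y \<in> leaf m" for y using that by (simp add: leaf_def)
  thus ?thesis
    unfolding connected_space_iff_connected_component topspace_leaf_space[OF m]
    by (meson connected_component_of_sym connected_component_of_trans)
qed

lemma countable_subatlas: "\<exists>F0\<subseteq>F. countable F0 \<and> topspace M \<subseteq> \<Union>(fst ` F0)"
proof -
  have "Lindelof_space M"
    using manifold second_countable_imp_Lindelof_space by (auto simp: smooth_manifold_def)
  moreover have "\<forall>U\<in>fst ` F. openin M U" using is_chartD(1)[OF F_chart] by auto
  moreover have "\<Union>(fst ` F) = topspace M" using fol by (auto simp: foliation_def)
  ultimately obtain V where V: "countable V" "V \<subseteq> fst ` F" "\<Union>V = topspace M"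
    unfolding Lindelof_space_def by meson
  then obtain F0 where "F0 \<subseteq> F" "countable F0" "V = fst ` F0" using countable_subset_image by metis
  thus ?thesis using V(3) by blast
qed

text \<open>A plaque meets only countably many plaques of each of countably many charts, because
  these are disjoint and open and the plaque is second countable. Hence the plaques reached from a
  given one by chains are countable. Their union is open and closed in the leaf topology, so it
  contains the connected leaf.\<close>

lemma leaf_second_countable:
  assumes m: "m \<in> topspace M"
  shows "second_countable (leaf_space m)"
proof -
  obtain F0 where F0: "F0 \<subseteq> F" "countable F0" "topspace M \<subseteq> \<Union>(fst ` F0)" using countable_subatlas by blast
  define plaques where "plaques d = {fst (leaf_chart d (snd d x)) | x. x \<in> fst d}" for d :: "'a chart"
  define \<P> where "\<P> = (\<Union>d\<in>F0. plaques d)"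
  have plD: "openin leaf_top P" "second_countable (subtopology leaf_top P)" if "d \<in> F" "P \<in> plaques d" for P d
  proof -
    from that(2) obtain x where x: "x \<in> fst d" "P = fst (leaf_chart d (snd d x))" unfolding plaques_def by blast
    show "openin leaf_top P" unfolding x(2) by (rule leaf_chart_dom_open[OF that(1)])
    have "subtopology leaf_top P homeomorphic_space
        sub_n q (snd (leaf_chart d (snd d x)) ` P)"
      using leaf_chart_is_chart[OF that(1) x(1)] homeomorphic_map_imp_homeomorphic_space unfolding is_chart_def x(2) by blast
    thus "second_countable (subtopology leaf_top P)"
      using homeomorphic_space_second_countability second_countable_subtopology[OF second_countable_Euclidean_space] by metis
  qed
  have disj: "P = Q" if "d \<in> F" "P \<in> plaques d" "Q \<in> plaques d" "P \<inter> Q \<noteq> {}" for P Q d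
  proof -
    from that(2,3) obtain x y where xy: "x \<in> fst d" "P = fst (leaf_chart d (snd d x))" "y \<in> fst d" "Q = fst (leaf_chart d (snd d y))"
      unfolding plaques_def by blast
    from that(4) obtain u where "u \<in> P" "u \<in> Q" by blast
    hence "\<forall>i<p. snd d x i = snd d y i" using xy by (simp add: leaf_chart_def plaque_def)
    thus ?thesis using xy by (simp add: leaf_chart_def plaque_def)
  qed
  have cnt: "countable {Q \<in> plaques d. P \<inter> Q \<noteq> {}}" if "d \<in> F" "P \<in> \<P>" for P d
  proof -
    from that(2) obtain e where e: "e \<in> F" "P \<in> plaques e" using F0(1) unfolding \<P>_def by blast
    show ?thesis
    proof (rule second_countable_disjoint[OF plD(2)[OF e]])
      fix Q assume "Q \<in> {Q \<in> plaques d. P \<inter> Q \<noteq> {}}"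
      thus "\<exists>U. openin (subtopology leaf_top P) U \<and> U \<noteq> {} \<and> U \<subseteq> Q"
        using plD(1)[OF that(1), of Q] by (intro exI[of _ "Q \<inter> P"]) (auto simp: openin_subtopology)
    qed (use disj[OF that(1)] in blast)
  qed
  \<comment> \<open>Its reflexive transitive closure describes the chains of overlapping plaques of
    the countable subatlas.\<close>
  define R where "R = {(P, Q). P \<in> \<P> \<and> Q \<in> \<P> \<and> P \<inter> Q \<noteq> {}}"
  have Rc: "countable (R `` {P})" for P
  proof (cases "P \<in> \<P>")
    case True
    have "countable (\<Union>d\<in>F0. {Q \<in> plaques d. P \<inter> Q \<noteq> {}})" using F0(1,2) cnt[OF _ True] by (intro countable_UN) auto
    moreover have "R `` {P} \<subseteq> (\<Union>d\<in>F0. {Q \<in> plaques d. P \<inter> Q \<noteq> {}})" by (auto simp: R_def \<P>_def)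
    ultimately show ?thesis by (rule countable_subset[rotated])
  qed (auto simp: R_def)
  obtain d0 where d0: "d0 \<in> F0" "m \<in> fst d0" using F0(3) m by blast
  define P0 where "P0 = fst (leaf_chart d0 (snd d0 m))"
  have P0: "P0 \<in> \<P>" "m \<in> P0" using d0 leaf_chart_self[OF subsetD[OF F0(1) d0(1)] d0(2)] by (auto simp: P0_def \<P>_def plaques_def)
  have "countable ((R ^^ k) `` {P0})" for k
  proof (induction k)
    case (Suc k)
    have "(R ^^ Suc k) `` {P0} = (\<Union>P\<in>(R ^^ k) `` {P0}. R `` {P})" by auto
    thus ?case using Suc Rc by simp
  qed simp
  moreover have "R\<^sup>* `` {P0} = (\<Union>k. (R ^^ k) `` {P0})" by (auto simp: rtrancl_is_UN_relpow)
  ultimately have C: "countable (R\<^sup>* `` {P0})" by simp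
  define \<C> where "\<C> = R\<^sup>* `` {P0}"
  have C\<P>: "P \<in> \<P>" if "P \<in> \<C>" for P
  proof -
    have "(P0, P) \<in> R\<^sup>*" using that by (simp add: \<C>_def)
    thus ?thesis by (cases rule: rtrancl.cases) (use P0(1) in \<open>auto simp: R_def\<close>)
  qed
  have Cop: "openin leaf_top P" "second_countable (subtopology leaf_top P)" if "P \<in> \<C>" for P
    using C\<P>[OF that] plD F0(1) by (auto simp: \<P>_def)
  have UC: "openin leaf_top (\<Union>\<C>)" using Cop(1) by blast
  \<comment> \<open>A plaque around a point outside the union that met a plaque of the union would
    itself be reachable.\<close>
  have "openin leaf_top (topspace M - \<Union>\<C>)"
  proof (subst openin_subopen, intro ballI)
    fix x assume x: "x \<in> topspace M - \<Union>\<C>"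
    then obtain d where d: "d \<in> F0" "x \<in> fst d" using F0(3) by blast
    define Q where "Q = fst (leaf_chart d (snd d x))"
    have Q: "Q \<in> plaques d" "x \<in> Q" "Q \<in> \<P>"
      using d leaf_chart_self[OF subsetD[OF F0(1) d(1)] d(2)] by (auto simp: Q_def \<P>_def plaques_def)
    have "Q \<inter> \<Union>\<C> = {}"
    proof (rule ccontr)
      assume "Q \<inter> \<Union>\<C> \<noteq> {}"
      then obtain P where P: "P \<in> \<C>" "P \<inter> Q \<noteq> {}" by blast
      hence "(P, Q) \<in> R" using C\<P> Q(3) by (simp add: R_def)
      hence "Q \<in> \<C>" using P(1) by (auto simp: \<C>_def intro: rtrancl_into_rtrancl)
      thus False using x Q(2) by blast
    qed
    moreover have "openin leaf_top Q" using plD(1) Q(1) d(1) F0(1) by blast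
    ultimately show "\<exists>T. openin leaf_top T \<and> x \<in> T \<and> T \<subseteq> topspace M - \<Union>\<C>"
      using Q(2) openin_subset[of leaf_top Q] by (intro exI[of _ Q]) (auto simp: topspace_leaf_top)
  qed
  hence "closedin leaf_top (\<Union>\<C>)"
    using openin_subset[OF UC] by (simp add: closedin_def topspace_leaf_top)
  moreover have "connectedin leaf_top (leaf m)"
    using leaf_connected[OF m] leaf_subset[OF m] by (simp add: connectedin_def topspace_leaf_top)
  ultimately have "leaf m \<subseteq> \<Union>\<C> \<or> disjnt (leaf m) (\<Union>\<C>)" using connectedin_clopen_cases UC by blast
  moreover have "m \<in> \<Union>\<C>" using P0(2) by (auto simp: \<C>_def)
  ultimately have L: "leaf m \<subseteq> \<Union>\<C>" using leaf_refl[of m] by (auto simp: disjnt_def)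
  have "second_countable (subtopology leaf_top (\<Union>\<C>))"
  proof (rule second_countable_cover)
    show "countable \<C>" using C by (simp add: \<C>_def)
    fix P assume P: "P \<in> \<C>"
    hence "\<Union>\<C> \<inter> P = P" by blast
    thus "openin (subtopology leaf_top (\<Union>\<C>)) P \<and> second_countable (subtopology (subtopology leaf_top (\<Union>\<C>)) P)"
      using Cop[OF P] P openin_open_subtopology[OF UC] by (auto simp: subtopology_subtopology)
  qed auto
  hence "second_countable (subtopology (subtopology leaf_top (\<Union>\<C>)) (leaf m))" by (rule second_countable_subtopology)
  moreover have "\<Union>\<C> \<inter> leaf m = leaf m" using L by blast
  ultimately show ?thesis by (simp add: subtopology_subtopology)
qed

lemma leaf_manifold:
  assumes m: "m \<in> topspace M"
  shows "connected_smooth_manifold q (leaf_space m) {leaf_chart c (snd c x) | c x. c \<in> F \<and> x \<in> fst c \<and> x \<in> leaf m}"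
proof -
  let ?A = "{leaf_chart c (snd c x) | c x. c \<in> F \<and> x \<in> fst c \<and> x \<in> leaf m}"
  have "Hausdorff_space M" using manifold by (simp add: smooth_manifold_def)
  hence "Hausdorff_space leaf_top"
    using continuous_leaf_id by (rule Hausdorff_space_injective_preimage) simp
  hence "Hausdorff_space (leaf_space m)" by (rule Hausdorff_space_subtopology)
  moreover have "is_chart q (leaf_space m) c" if "c \<in> ?A" for c
  proof -
    from that obtain d x where d: "c = leaf_chart d (snd d x)" "d \<in> F" "x \<in> fst d" "x \<in> leaf m" by blast
    show ?thesis unfolding d(1) by (rule is_chart_subtopology[OF leaf_chart_is_chart[OF d(2,3)] leaf_chart_leaf[OF d(2-4)]])
  qed
  moreover have "(\<Union>c\<in>?A. fst c) = topspace (leaf_space m)"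
  proof (intro equalityI subsetI)
    fix x assume "x \<in> topspace (leaf_space m)"
    hence x: "x \<in> leaf m" "x \<in> topspace M" by (auto simp: topspace_leaf_top)
    then obtain c where c: "c \<in> F" "x \<in> fst c" using F_cover by blast
    thus "x \<in> (\<Union>c\<in>?A. fst c)" using x(1) leaf_chart_self[OF c] by blast
  qed (use leaf_chart_leaf topspace_leaf_space[OF m] in blast)
  moreover have "smooth_transition q c d" if "c \<in> ?A" "d \<in> ?A" for c d
    using that leaf_chart_transition by auto
  ultimately show ?thesis
    using leaf_second_countable[OF m] leaf_connected[OF m] topspace_leaf_space[OF m] leaf_refl[of m]
    by (auto simp: connected_smooth_manifold_def smooth_manifold_def)
qed

text \<open>The plaques of a chart are open in the leaf topology and partition its domain, so a
  connected set cannot pass from one to another.\<close>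

lemma connected_in_plaque:
  assumes S: "connectedin leaf_top S" and d: "d \<in> F" "S \<subseteq> fst d" and xy: "x \<in> S" "y \<in> S" and i: "i < p"
  shows "snd d x i = snd d y i"
proof (rule ccontr)
  assume ne: "snd d x i \<noteq> snd d y i"
  let ?P = "\<lambda>u. plaque d (snd d u) (R_n q)"
  have mem: "u \<in> ?P v \<longleftrightarrow> (\<forall>i<p. snd d u i = snd d v i)" if "u \<in> S" for u v
    using that d(2) leaf_chart_mem[OF d(1), of u "snd d v"] by (auto simp: leaf_chart_def)
  let ?E = "\<Union>{?P u | u. u \<in> S \<and> u \<notin> ?P x}"
  have o: "openin leaf_top (?P u)" for u by (rule openin_plaque[OF d(1) openin_Rn_top])
  have oE: "openin leaf_top ?E" using o by (intro openin_Union) auto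
  show False
  proof (rule connectedinD[OF S o[of x] oE])
    show "S \<subseteq> ?P x \<union> ?E" using mem by blast
    show "?P x \<inter> ?E \<inter> S = {}"
    proof (rule ccontr)
      assume "?P x \<inter> ?E \<inter> S \<noteq> {}"
      then obtain u v where uv: "u \<in> S" "u \<in> ?P x" "u \<in> ?P v" "v \<in> S" "v \<notin> ?P x" by blast
      thus False using mem[of u x] mem[of u v] mem[of v x] by simp
    qed
    show "?P x \<inter> S \<noteq> {}" using xy(1) mem[of x x] by blast
    have "y \<notin> ?P x" using mem[OF xy(2)] ne i by metis
    thus "?E \<inter> S \<noteq> {}" using xy(2) mem[of y y] by blast
  qed
qed

text \<open>The assumption on G is shared by the one-sided filters at both ends of the interval:
  eventual properties hold on a subinterval, whose image is connected. Near l the path thus stays in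
  one plaque. Its transverse coordinates are constant and tend to those of l, hence equal them, and
  convergence in M becomes convergence in the plaque of l.\<close>

lemma leaf_limit:
  assumes m: "m \<in> topspace M" and ab: "a < b" and \<gamma>: "continuous_map (top_of_set {a<..<b}) (leaf_space m) \<gamma>"
    and G: "\<And>P. eventually P G \<Longrightarrow> \<exists>u v. a \<le> u \<and> u < v \<and> v \<le> b \<and> (\<forall>t\<in>{u<..<v}. P t) \<and> eventually (\<lambda>t. t \<in> {u<..<v}) G"
    and l: "limitin M \<gamma> l G"
  shows "limitin (leaf_space m) \<gamma> l (G :: real filter)"
proof -
  have lM: "l \<in> topspace M" and lim: "\<And>U. openin M U \<Longrightarrow> l \<in> U \<Longrightarrow> \<forall>\<^sub>F t in G. \<gamma> t \<in> U"
    using l by (auto simp: limitin_def)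
  obtain d where d: "d \<in> F" "l \<in> fst d" using F_cover[OF lM] by blast
  note dc = F_chart[OF d(1)]
  have "\<forall>\<^sub>F t in G. \<gamma> t \<in> fst d" by (rule lim[OF is_chartD(1)[OF dc] d(2)])
  then obtain u v where uv: "a \<le> u" "u < v" "v \<le> b" "\<forall>t\<in>{u<..<v}. \<gamma> t \<in> fst d" "\<forall>\<^sub>F t in G. t \<in> {u<..<v}"
    using G by blast
  have sub: "{u<..<v} \<subseteq> {a<..<b}" using uv by auto
  have \<gamma>L: "\<gamma> t \<in> leaf m" if "t \<in> {a<..<b}" for t
    using continuous_map_funspace[OF \<gamma>] that topspace_leaf_space[OF m] by auto
  have "connectedin (top_of_set {a<..<b}) {u<..<v}" using sub by (simp add: connectedin_subtopology)
  moreover have "continuous_map (top_of_set {a<..<b}) leaf_top \<gamma>" using \<gamma> by (simp add: continuous_map_in_subtopology)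
  ultimately have con: "connectedin leaf_top (\<gamma> ` {u<..<v})" by (rule connectedin_continuous_map_image[rotated])
  have xl: "snd d (\<gamma> t) i = snd d l i" if t: "t \<in> {u<..<v}" and i: "i < p" for t i
  proof (rule ccontr)
    assume ne: "snd d (\<gamma> t) i \<noteq> snd d l i"
    define e where "e = \<bar>snd d (\<gamma> t) i - snd d l i\<bar>"
    have e: "e > 0" using ne by (simp add: e_def)
    have "\<forall>\<^sub>F s in G. \<gamma> s \<in> {x \<in> fst d. snd d x \<in> nbox n (snd d l) e}"
      by (rule lim[OF openin_chart_preimage[OF dc openin_nbox]]) (use d nbox_center[OF F_Rn[OF d] e] in simp)
    hence "\<forall>\<^sub>F s in G. s \<in> {u<..<v} \<and> snd d (\<gamma> s) \<in> nbox n (snd d l) e"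
      using uv(5) by (auto elim: eventually_elim2)
    then obtain s where s: "s \<in> {u<..<v}" "snd d (\<gamma> s) \<in> nbox n (snd d l) e"
      using G[of "\<lambda>s. s \<in> {u<..<v} \<and> snd d (\<gamma> s) \<in> nbox n (snd d l) e"] dense by (metis greaterThanLessThan_iff)
    have "snd d (\<gamma> s) i = snd d (\<gamma> t) i"
      by (rule connected_in_plaque[OF con d(1) _ _ _ i]) (use uv(4) s(1) t in auto)
    moreover have "\<bar>snd d (\<gamma> s) i - snd d l i\<bar> < e" using s(2) i by (simp add: nbox_def)
    ultimately show False by (simp add: e_def)
  qed
  obtain t0 where t0: "t0 \<in> {u<..<v}" using dense[OF uv(2)] by auto
  have "l \<in> leaf (\<gamma> t0)"
    by (rule same_plaque_leaf[OF d(1) _ d(2)]) (use uv(4) t0 xl in auto)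
  hence lL: "l \<in> leaf m" using leaf_eq[of "\<gamma> t0" m] \<gamma>L t0 sub by auto
  have "limitin leaf_top \<gamma> l G"
    unfolding limitin_def
  proof (intro conjI allI impI)
    show "l \<in> topspace leaf_top" using lM by (simp add: topspace_leaf_top)
    fix U assume U: "openin leaf_top U \<and> l \<in> U"
    then obtain e where e: "e > 0" "plq d l e \<subseteq> U" using d unfolding openin_leaf_top by blast
    have "\<forall>\<^sub>F s in G. \<gamma> s \<in> {x \<in> fst d. snd d x \<in> nbox n (snd d l) e}"
      by (rule lim[OF openin_chart_preimage[OF dc openin_nbox]]) (use d nbox_center[OF F_Rn[OF d] e(1)] in simp)
    thus "\<forall>\<^sub>F s in G. \<gamma> s \<in> U"
      using uv(5)
    proof (rule eventually_elim2)
      fix s assume s: "\<gamma> s \<in> {x \<in> fst d. snd d x \<in> nbox n (snd d l) e}" "s \<in> {u<..<v}"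
      hence "\<gamma> s \<in> plq d l e" using plq_mem[OF e(1) d(1)] xl[OF s(2)] by simp
      thus "\<gamma> s \<in> U" using e(2) by blast
    qed
  qed
  moreover have "\<forall>\<^sub>F t in G. \<gamma> t \<in> leaf m"
    using uv(5) by (rule eventually_mono) (use \<gamma>L sub in blast)
  ultimately show ?thesis using lL by (simp add: limitin_subtopology)
qed

text \<open>Contrapositive: if the image of a path converges in M at one end, it converges in the
  leaf topology by \<open>leaf_limit\<close>, and pulling the limit back gives one for the path
  itself.\<close>

lemma leaf_inextendible:
  assumes m: "m \<in> topspace M" and hm: "homeomorphic_maps (leaf_space m) X0 \<iota> j"
  shows "inextendible_map X0 M j"
  unfolding inextendible_map_def
proof (intro allI impI, elim conjE)
  fix a b :: real and c assume ab: "a < b" and c: "continuous_map (top_of_set {a<..<b}) X0 c" and inx: "inextendible_path X0 a b c"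
  have jc: "continuous_map X0 (leaf_space m) j" and ic: "continuous_map (leaf_space m) X0 \<iota>" and ij: "\<And>y. y \<in> topspace X0 \<Longrightarrow> \<iota> (j y) = y"
    using hm by (auto simp: homeomorphic_maps_def)
  have \<gamma>: "continuous_map (top_of_set {a<..<b}) (leaf_space m) (j \<circ> c)" by (rule continuous_map_compose[OF c jc])
  have ext: "\<exists>l. limitin X0 c l G"
    if G: "\<And>P. eventually P G \<Longrightarrow> \<exists>u v. a \<le> u \<and> u < v \<and> v \<le> b \<and> (\<forall>t\<in>{u<..<v}. P t) \<and> eventually (\<lambda>t. t \<in> {u<..<v}) G"
      and l: "limitin M (j \<circ> c) l G" for G :: "real filter" and l
  proof -
    have "limitin (leaf_space m) (j \<circ> c) l G" by (rule leaf_limit[OF m ab \<gamma> G l])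
    hence lX: "limitin X0 (\<iota> \<circ> (j \<circ> c)) (\<iota> l) G" by (rule continuous_map_limit[OF ic])
    obtain u v where uv: "a \<le> u" "v \<le> b" "\<forall>\<^sub>F t in G. t \<in> {u<..<v}" using G[of "\<lambda>_. True"] by auto
    have "\<forall>\<^sub>F t in G. (\<iota> \<circ> (j \<circ> c)) t = c t"
      using uv(3)
    proof (rule eventually_mono)
      fix t assume "t \<in> {u<..<v}"
      hence "t \<in> {a<..<b}" using uv(1,2) by auto
      hence "c t \<in> topspace X0" using continuous_map_funspace[OF c] by auto
      thus "(\<iota> \<circ> (j \<circ> c)) t = c t" using ij by simp
    qed
    hence "limitin X0 c (\<iota> l) G" using lX by (rule limitin_transform_eventually)
    thus ?thesis ..
  qed
  \<comment> \<open>The filters at the two ends satisfy the assumption of \<open>leaf_limit\<close>,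
    with a subinterval that begins at a or ends at b.\<close>
  have r: "\<exists>u v. a \<le> u \<and> u < v \<and> v \<le> b \<and> (\<forall>t\<in>{u<..<v}. P t) \<and> eventually (\<lambda>t. t \<in> {u<..<v}) (at_right a)" if "eventually P (at_right a)" for P
  proof -
    obtain s where s: "s > a" "\<forall>y>a. y < s \<longrightarrow> P y" using \<open>eventually P (at_right a)\<close> ab by (auto simp: eventually_at_right[OF ab])
    have "eventually (\<lambda>t. t \<in> {a<..<min s b}) (at_right a)"
      unfolding eventually_at_right[OF ab] using s ab by (intro exI[of _ "min s b"]) auto
    thus ?thesis using s ab by (intro exI[of _ a] exI[of _ "min s b"]) auto
  qed
  have lf: "\<exists>u v. a \<le> u \<and> u < v \<and> v \<le> b \<and> (\<forall>t\<in>{u<..<v}. P t) \<and> eventually (\<lambda>t. t \<in> {u<..<v}) (at_left b)" if "eventually P (at_left b)" for P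
  proof -
    obtain s where s: "s < b" "\<forall>y>s. y < b \<longrightarrow> P y" using \<open>eventually P (at_left b)\<close> ab by (auto simp: eventually_at_left[OF ab])
    have "eventually (\<lambda>t. t \<in> {max s a<..<b}) (at_left b)"
      unfolding eventually_at_left[OF ab] using s ab by (intro exI[of _ "max s a"]) auto
    thus ?thesis using s ab by (intro exI[of _ "max s a"] exI[of _ b]) auto
  qed
  show "inextendible_path M a b (j \<circ> c)"
    unfolding inextendible_path_def
  proof (intro conjI notI)
    assume "\<exists>l. limitin M (j \<circ> c) l (at_right a)"
    thus False using ext[OF r] inx unfolding inextendible_path_def by blast
  next
    assume "\<exists>l. limitin M (j \<circ> c) l (at_left b)"
    thus False using ext[OF lf] inx unfolding inextendible_path_def by blast
  qed
qed

text \<open>The graph over the disc is connected, open in the leaf topology, and closed in the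
  preimage of the cylinder, as the solution set of the graph equation. It is therefore the component
  asked for by the definition, even if the leaf returns to the same cylinder elsewhere.\<close>

lemma leaf_causal_map:
  assumes m: "m \<in> topspace M" and hm: "homeomorphic_maps (leaf_space m) X0 \<iota> j"
  shows "causal_map p q M A g X0 j"
proof -
  have jc: "continuous_map X0 (leaf_space m) j" and ic: "continuous_map (leaf_space m) X0 \<iota>"
    and ij: "\<And>y. y \<in> topspace X0 \<Longrightarrow> \<iota> (j y) = y" and ji: "\<And>x. x \<in> leaf m \<Longrightarrow> j (\<iota> x) = x"
    using hm topspace_leaf_space[OF m] by (auto simp: homeomorphic_maps_def)
  have h\<iota>: "homeomorphic_map (leaf_space m) X0 \<iota>" using hm homeomorphic_maps_map by blast
  have jM: "continuous_map X0 M j"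
    using continuous_map_compose[OF jc continuous_map_from_subtopology[OF continuous_leaf_id]] by (simp add: o_def)
  have jL: "j y \<in> leaf m" if "y \<in> topspace X0" for y
    using continuous_map_funspace[OF jc] that topspace_leaf_space[OF m] by auto
  have iX: "\<iota> x \<in> topspace X0" if "x \<in> leaf m" for x
    using continuous_map_funspace[OF ic] that topspace_leaf_space[OF m] by auto
  have loc: "\<exists>a b \<kappa>. cylindrical_nbhd p q M A g (j y) a b \<kappa> \<and>
        (let K = connected_component_of_set (subtopology X0 {z \<in> topspace X0. j z \<in> fst \<kappa>}) y in
         \<exists>\<phi>. continuous_map (sub_n q (disc q b)) (sub_n p (cube p a)) \<phi> \<and>
             homeomorphic_map (subtopology X0 K) (subtopology M (chart_inv \<kappa> ` {join p (\<phi> w) w | w. w \<in> disc q b})) j \<and>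
             (\<forall>w\<in>disc q b. quad p q 1 (join p (\<phi> w) w) \<le> 0))" if y: "y \<in> topspace X0" for y
  proof -
    have xM: "j y \<in> topspace M" using jL[OF y] leaf_subset[OF m] by blast
    obtain d where d: "d \<in> F" "j y \<in> fst d" using F_cover[OF xM] by blast
    obtain a b \<kappa> \<phi> s where cyl: "cylindrical_nbhd p q M A g (j y) a b \<kappa>" and \<phi>: "continuous_on (disc q b) \<phi>" "\<phi> ` disc q b \<subseteq> cube p a"
      and quad: "\<forall>w\<in>disc q b. quad p q 1 (join p (\<phi> w) w) \<le> 0" and s0: "s zero_n = j y"
      and s: "\<forall>w\<in>disc q b. s w \<in> fst \<kappa> \<and> snd \<kappa> (s w) = join p (\<phi> w) w \<and> s w \<in> fst d \<and> (\<forall>i<p. snd d (s w) i = snd d (j y) i)"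
      and sc: "continuous_on (disc q b) (\<lambda>w. drop_n p (snd d (s w)))"
      and so: "open_n q ((\<lambda>w. drop_n p (snd d (s w))) ` disc q b)"
      using leaf_causal_graph[OF d] by (elim exE conjE)
    define D where "D = disc q b"
    define Es where "Es = sub_n q D"
    have DR: "D \<subseteq> R_n q" by (auto simp: D_def disc_def)
    have Es: "Es = top_of_set D" "topspace Es = D" using DR by (auto simp: Es_def subtopology_Rn)
    have b: "0 < b" and k: "\<kappa> \<in> SC" "snd \<kappa> ` fst \<kappa> = cylinder p q a b" using cyl by (auto simp: cylindrical_nbhd_def)
    note kc = SC_chart[OF k(1)]
    have oD: "zero_n \<in> D" using b by (simp add: D_def disc_def R_n_iff)
    have sl: "s w \<in> leaf m" if "w \<in> D" for w
    proof -
      have "s w \<in> leaf (j y)"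
        by (rule same_plaque_leaf[OF d]) (use s that in \<open>auto simp: D_def\<close>)
      thus ?thesis using leaf_eq[OF jL[OF y]] by simp
    qed
    have "continuous_map Es (Euclidean_space q) (\<lambda>w. drop_n p (snd d (s w)))"
      unfolding Es(1) continuous_map_Rn using sc s drop_Rn F_Rn[OF d(1)] by (auto simp: D_def)
    hence "continuous_map Es leaf_top s"
      by (rule leaf_continuous_map[OF d]) (use s in \<open>auto simp: Es(2) D_def\<close>)
    hence sL: "continuous_map Es (leaf_space m) s"
      using sl by (auto simp: continuous_map_in_subtopology Es(2))
    have sX: "continuous_map Es X0 (\<iota> \<circ> s)" by (rule continuous_map_compose[OF sL ic])
    define K where "K = \<iota> ` s ` D"
    define Z where "Z = {z \<in> topspace X0. j z \<in> fst \<kappa>}"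
    have jK: "j ` K = s ` D"
    proof -
      have "j ` K = (\<lambda>w. j (\<iota> (s w))) ` D" by (simp add: K_def image_image)
      also have "\<dots> = s ` D" by (rule image_cong) (use ji sl in auto)
      finally show ?thesis .
    qed
    have KZ: "K \<subseteq> Z" using s sl ji iX by (auto simp: K_def Z_def D_def)
    have "connected D" unfolding D_def by (rule star_connected[OF disc_scale])
    hence "connectedin Es D" by (simp add: Es(1) connectedin_subtopology)
    hence "connectedin X0 K"
      using connectedin_continuous_map_image[OF sX] by (simp add: K_def image_comp)
    hence c1: "connectedin (subtopology X0 Z) K" using KZ by (simp add: connectedin_subtopology)
    \<comment> \<open>A point of the chart is determined by its transverse and leaf coordinates, so
      the graph is the full part of the plaque over an open set of leaf coordinates.\<close>
    have "s ` D = plaque d (snd d (j y)) ((\<lambda>w. drop_n p (snd d (s w))) ` D)"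
    proof (intro equalityI subsetI)
      fix x assume "x \<in> plaque d (snd d (j y)) ((\<lambda>w. drop_n p (snd d (s w))) ` D)"
      then obtain w where x: "x \<in> fst d" "\<forall>i<p. snd d x i = snd d (j y) i" "w \<in> D" "drop_n p (snd d x) = drop_n p (snd d (s w))"
        by (auto simp: plaque_def)
      have "snd d x = join p (snd d x) (drop_n p (snd d x))" by (simp add: join_drop)
      also have "\<dots> = join p (snd d (s w)) (drop_n p (snd d (s w)))"
        unfolding x(4) by (rule join_cong) (use x(2,3) s in \<open>auto simp: D_def\<close>)
      also have "\<dots> = snd d (s w)" by (simp add: join_drop)
      finally have "x = s w"
        using x(1,3) s is_chartD(4)[OF F_chart[OF d(1)]] by (auto simp: D_def dest: inj_onD)
      thus "x \<in> s ` D" using x(3) by blast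
    qed (use s in \<open>auto simp: plaque_def D_def\<close>)
    hence "openin leaf_top (s ` D)" using openin_plaque[OF d(1) so] by (simp add: D_def)
    hence "openin (leaf_space m) (s ` D)" using sl openin_leaf_space[OF m] by auto
    hence "openin X0 K" unfolding K_def using homeomorphic_map_openness_eq[OF h\<iota>] by blast
    moreover have "K \<inter> Z = K" using KZ by blast
    ultimately have c2: "openin (subtopology X0 Z) K" by (auto simp: openin_subtopology)
    have tZ: "topspace (subtopology X0 Z) = Z" by (auto simp: Z_def)
    have "continuous_map (subtopology X0 Z) (subtopology M (fst \<kappa>)) j"
      using continuous_map_from_subtopology[OF jM] by (auto simp: continuous_map_in_subtopology Z_def)
    hence kj: "continuous_map (subtopology X0 Z) (Euclidean_space n) (snd \<kappa> \<circ> j)"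
      using is_chartD(5)[OF kc] by (rule continuous_map_compose)
    have dropD: "drop_n p (snd \<kappa> x) \<in> D" if "x \<in> fst \<kappa>" for x
    proof -
      have "snd \<kappa> x \<in> cylinder p q a b" using k(2) that by blast
      thus ?thesis by (auto simp: cylinder_def D_def drop_join)
    qed
    have h1: "continuous_map (subtopology X0 Z) euclidean (\<lambda>z. fst_n p (snd \<kappa> (j z)))"
      using continuous_map_compose[OF kj continuous_map_fst_n] unfolding continuous_map_Rn by (simp add: o_def)
    have "continuous_map (subtopology X0 Z) Es (\<lambda>z. drop_n p (snd \<kappa> (j z)))"
      using continuous_map_compose[OF kj continuous_map_drop] dropD tZ
      unfolding Es_def continuous_map_in_subtopology by (auto simp: o_def Z_def)
    moreover have \<phi>c: "continuous_map Es euclidean \<phi>" using \<phi>(1) by (simp add: Es(1) D_def)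
    ultimately have h2: "continuous_map (subtopology X0 Z) euclidean (\<lambda>z. \<phi> (drop_n p (snd \<kappa> (j z))))"
      using continuous_map_compose by (fastforce simp: o_def)
    have "K = {z \<in> topspace (subtopology X0 Z). fst_n p (snd \<kappa> (j z)) = \<phi> (drop_n p (snd \<kappa> (j z)))}"
    proof (intro equalityI subsetI)
      fix z assume z: "z \<in> K"
      then obtain w where w: "w \<in> D" "j z = s w" using jK by blast
      have "\<phi> w \<in> R_n p" using w(1) \<phi>(2) by (auto simp: D_def cube_def)
      thus "z \<in> {z \<in> topspace (subtopology X0 Z). fst_n p (snd \<kappa> (j z)) = \<phi> (drop_n p (snd \<kappa> (j z)))}"
        using z KZ w s tZ by (auto simp: D_def fst_n_join drop_join)
    next
      fix z assume "z \<in> {z \<in> topspace (subtopology X0 Z). fst_n p (snd \<kappa> (j z)) = \<phi> (drop_n p (snd \<kappa> (j z)))}"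
      hence z: "z \<in> Z" "fst_n p (snd \<kappa> (j z)) = \<phi> (drop_n p (snd \<kappa> (j z)))" using tZ by auto
      define w where "w = drop_n p (snd \<kappa> (j z))"
      have w: "w \<in> D" "j z \<in> fst \<kappa>" using dropD z(1) by (auto simp: Z_def w_def)
      have "snd \<kappa> (j z) = join p (fst_n p (snd \<kappa> (j z))) (drop_n p (snd \<kappa> (j z)))" by (simp add: join_fst_n join_drop)
      also have "\<dots> = snd \<kappa> (s w)" using z(2) s w(1) by (simp add: w_def D_def)
      finally have "snd \<kappa> (j z) = snd \<kappa> (s w)" .
      moreover have "s w \<in> fst \<kappa>" using w(1) s by (simp add: D_def)
      ultimately have "j z = s w" using w(2) is_chartD(4)[OF kc] by (auto dest: inj_onD)
      hence "z = \<iota> (s w)" using ij[of z] z(1) by (simp add: Z_def)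
      thus "z \<in> K" using w(1) by (simp add: K_def)
    qed
    hence c3: "closedin (subtopology X0 Z) K"
      using closedin_continuous_maps_eq[OF _ h1 h2] by (simp add: Hausdorff_space_euclidean)
    have "y \<in> K" using oD s0 ij[OF y] by (force simp: K_def)
    hence comp: "connected_component_of_set (subtopology X0 Z) y = K" by (rule connected_component_clopen[OF c1 c2 c3])
    have graph: "chart_inv \<kappa> ` {join p (\<phi> w) w | w. w \<in> D} = s ` D"
    proof -
      have "chart_inv \<kappa> ` {join p (\<phi> w) w | w. w \<in> D} = (\<lambda>w. chart_inv \<kappa> (join p (\<phi> w) w)) ` D" by blast
      also have "\<dots> = s ` D"
      proof (rule image_cong)
        fix w assume "w \<in> D"
        hence "s w \<in> fst \<kappa>" "snd \<kappa> (s w) = join p (\<phi> w) w" using s by (auto simp: D_def)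
        thus "chart_inv \<kappa> (join p (\<phi> w) w) = s w" using chart_inv(1)[OF kc] by metis
      qed simp
      finally show ?thesis .
    qed
    have sDM: "s ` D \<subseteq> topspace M" "s ` D \<subseteq> fst \<kappa>" using sl leaf_subset[OF m] s by (auto simp: D_def)
    have "homeomorphic_maps (subtopology X0 K) (subtopology M (s ` D)) j \<iota>"
      unfolding homeomorphic_maps_def
    proof (intro conjI ballI)
      show "continuous_map (subtopology X0 K) (subtopology M (s ` D)) j"
        using continuous_map_from_subtopology[OF jM] jK by (auto simp: continuous_map_in_subtopology)
      have "continuous_map (subtopology M (s ` D)) (Euclidean_space n) (snd \<kappa>)"
        using continuous_map_from_subtopology_mono[OF is_chartD(5)[OF kc] sDM(2)] .
      hence "continuous_map (subtopology M (s ` D)) Es (\<lambda>x. drop_n p (snd \<kappa> x))"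
        using continuous_map_compose[OF _ continuous_map_drop] dropD sDM(2)
        unfolding Es_def continuous_map_in_subtopology by (fastforce simp: o_def)
      from continuous_map_compose[OF this sX]
      have "continuous_map (subtopology M (s ` D)) X0 (\<iota> \<circ> s \<circ> (\<lambda>x. drop_n p (snd \<kappa> x)))" .
      hence "continuous_map (subtopology M (s ` D)) X0 \<iota>"
        by (rule continuous_map_eq) (use s in \<open>auto simp: D_def drop_join\<close>)
      thus "continuous_map (subtopology M (s ` D)) (subtopology X0 K) \<iota>"
        by (auto simp: continuous_map_in_subtopology K_def)
    qed (use ij ji sl in \<open>auto\<close>)
    hence hom: "homeomorphic_map (subtopology X0 K) (subtopology M (s ` D)) j"
      using homeomorphic_maps_map by blast
    have "continuous_map Es (sub_n p (cube p a)) \<phi>"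
      using \<phi>c \<phi>(2) unfolding continuous_map_Rn continuous_map_in_subtopology
      by (auto simp: Es(2) D_def cube_def)
    thus ?thesis
      using cyl hom quad comp graph unfolding Let_def D_def Es_def Z_def
      by (intro exI[of _ a] exI[of _ b] exI[of _ \<kappa>] conjI exI[of _ \<phi>]) auto
  qed
  show ?thesis unfolding causal_map_def using jM loc by blast
qed

text \<open>The Cauchy property is applied to the relabelled leaf; composing with the relabelling
  removes it again.\<close>

theorem leaf_time_homeomorphism:
  assumes T: "cauchy_time_function p q M A g N T" and m: "m \<in> topspace M"
  shows "homeomorphic_map (leaf_space m) N T"
proof -
  note L = leaf_manifold[OF m]
  have "second_countable (leaf_space m)" "Hausdorff_space (leaf_space m)"
    using L by (auto simp: connected_smooth_manifold_def smooth_manifold_def)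
  then obtain \<iota> :: "'a \<Rightarrow> nat \<Rightarrow> real" where \<iota>: "inj_on \<iota> (topspace (leaf_space m))" using second_countable_inj by blast
  define j where "j = inv_into (topspace (leaf_space m)) \<iota>"
  define X0 where "X0 = pullback_topology (\<iota> ` topspace (leaf_space m)) j (leaf_space m)"
  note tr = transport_manifold[OF L \<iota>, folded j_def, folded X0_def]
  have ji: "j (\<iota> x) = x" if "x \<in> topspace (leaf_space m)" for x using that \<iota> by (simp add: j_def)
  have top0: "topspace X0 = \<iota> ` topspace (leaf_space m)"
    using tr(2) homeomorphic_imp_surjective_map by metis
  have hm: "homeomorphic_maps (leaf_space m) X0 \<iota> j"
    unfolding homeomorphic_maps_def using tr(1,2)[THEN homeomorphic_imp_continuous_map] ji top0 by auto
  obtain A0 where A0: "connected_smooth_manifold q X0 A0" using tr(3) by blast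
  have "homeomorphic_map X0 N (T \<circ> j)"
    using T A0 leaf_causal_map[OF m hm] leaf_inextendible[OF m hm] unfolding cauchy_time_function_def by blast
  hence "homeomorphic_map (leaf_space m) N (T \<circ> j \<circ> \<iota>)"
    using tr(2) homeomorphic_map_compose by blast
  thus ?thesis by (rule homeomorphic_map_eq) (simp add: ji)
qed

end

section \<open>The product structure\<close>

locale cauchy_foliation = causal_foliation p q M A g F
  for p q :: nat and M :: "'a topology" and A :: "'a chart set" and g :: "'a metr" and F :: "'a chart set" +
  fixes N :: "'b topology" and T :: "'a \<Rightarrow> 'b"
  assumes cauchy: "cauchy_time_function p q M A g N T"
begin

lemma N_chart: "u \<in> topspace N \<Longrightarrow> \<exists>\<psi>. is_chart q N \<psi> \<and> u \<in> fst \<psi>"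
  and T_continuous: "continuous_map M N T"
  using cauchy by (auto simp: cauchy_time_function_def topological_manifold_def)

lemma T_in: "m \<in> topspace M \<Longrightarrow> T m \<in> topspace N"
  using continuous_map_funspace[OF T_continuous] by auto

lemma T_leaf: "m \<in> topspace M \<Longrightarrow> bij_betw T (leaf m) (topspace N)"
  using leaf_time_homeomorphism[OF cauchy] homeomorphic_map_def topspace_leaf_space
  by (metis bij_betw_def homeomorphic_imp_injective_map homeomorphic_imp_surjective_map)

text \<open>Acts like a flow along the leaves with time in N: since it depends on m only through the
  leaf, going to time u and then to time v is the same as going to time v at once. This identity
  drives the chain argument and gives the inverse in \<open>product_structure\<close>.\<close>

definition leaf_point :: "'a \<Rightarrow> 'b \<Rightarrow> 'a" where "leaf_point m u = inv_into (leaf m) T u"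

lemma leaf_point:
  assumes "m \<in> topspace M" "u \<in> topspace N"
  shows "leaf_point m u \<in> leaf m" "T (leaf_point m u) = u" "leaf_point m u \<in> topspace M"
  using T_leaf[OF assms(1)] assms(2) leaf_subset[OF assms(1)] inv_into_into[of u T "leaf m"] f_inv_into_f[of u T "leaf m"]
  by (auto simp: leaf_point_def bij_betw_def)

lemma leaf_point_unique:
  assumes "m \<in> topspace M" "y \<in> leaf m" "T y = u"
  shows "leaf_point m u = y"
  using T_leaf[OF assms(1)] assms(2,3) by (auto simp: leaf_point_def bij_betw_def)

text \<open>The map \<open>m \<mapsto> (x, T m)\<close>, where \<open>x\<close> are the transverse coordinates in a foliated chart, is
  injective because \<open>T\<close> is injective on leaves; by invariance of domain it is open.\<close>

lemma transverse_time_open: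
  assumes c: "c \<in> F" and m: "m \<in> fst c" and S: "openin M S" "m \<in> S"
  shows "\<exists>e>0. \<exists>V. openin N V \<and> T m \<in> V \<and>
    (\<forall>x u. x \<in> R_n n \<and> (\<forall>i<p. \<bar>x i - snd c m i\<bar> < e) \<and> u \<in> V \<longrightarrow>
       (\<exists>y\<in>S \<inter> fst c. (\<forall>i<p. snd c y i = x i) \<and> T y = u))"
proof -
  note cc = F_chart[OF c]
  have mM: "m \<in> topspace M" using SC_top[OF F_SC[OF c] m] .
  obtain \<psi> where \<psi>: "is_chart q N \<psi>" "T m \<in> fst \<psi>" using N_chart[OF T_in[OF mM]] by blast
  define W where "W = {y \<in> topspace M. T y \<in> fst \<psi>} \<inter> (S \<inter> fst c)"
  have W: "openin M W" "W \<subseteq> fst c" "W \<subseteq> S" "m \<in> W" "\<And>y. y \<in> W \<Longrightarrow> T y \<in> fst \<psi>"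
    using openin_continuous_map_preimage[OF T_continuous is_chartD(1)[OF \<psi>(1)]] S is_chartD(1)[OF cc] mM m \<psi>(2)
    by (auto simp: W_def)
  define U where "U = snd c ` W"
  have U: "open_n n U" unfolding U_def by (rule is_chartD(6)[OF cc W(1,2)])
  \<comment> \<open>The transverse coordinates are kept and the leaf coordinates are replaced by
    those of T in a chart of N. Source and target both have dimension \<open>p + q\<close>, as
    invariance of domain requires.\<close>
  define f where "f z = join p z (snd \<psi> (T (chart_inv c z)))" for z
  have pt: "\<exists>y\<in>W. z = snd c y \<and> chart_inv c z = y" if "z \<in> U" for z
    using that W(2) chart_inv(1)[OF cc] by (auto simp: U_def)
  have fy: "f (snd c y) = join p (snd c y) (snd \<psi> (T y))" if "y \<in> W" for y
    using chart_inv(1)[OF cc] W(2) that by (auto simp: f_def)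
  have UR: "U \<subseteq> R_n n" by (rule openin_Rn_sub[OF U])
  have \<psi>R: "snd \<psi> (T y) \<in> R_n q" if "y \<in> W" for y using chart_Rn[OF \<psi>(1) W(5)[OF that]] .
  have fR: "f z \<in> R_n n" if "z \<in> U" for z
  proof -
    from pt[OF that] obtain y where y: "y \<in> W" "z = snd c y" by blast
    have "snd c y \<in> R_n n" using UR that y(2) by blast
    thus ?thesis using join_slice_Rn \<psi>R[OF y(1)] by (simp only: y(2) fy[OF y(1)])
  qed
  have inj: "inj_on f U"
  proof (rule inj_onI)
    fix z z' assume z: "z \<in> U" "z' \<in> U" "f z = f z'"
    obtain y where y: "y \<in> W" "z = snd c y" using pt[OF z(1)] by blast
    obtain y' where y': "y' \<in> W" "z' = snd c y'" using pt[OF z(2)] by blast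
    have j: "join p (snd c y) (snd \<psi> (T y)) = join p (snd c y') (snd \<psi> (T y'))" using z(3) y y' fy by simp
    hence "drop_n p (join p (snd c y) (snd \<psi> (T y))) = drop_n p (join p (snd c y') (snd \<psi> (T y')))" by simp
    hence "snd \<psi> (T y) = snd \<psi> (T y')" by (simp add: drop_join)
    hence Ty: "T y = T y'" using is_chartD(4)[OF \<psi>(1)] W(5) y(1) y'(1) by (auto dest: inj_onD)
    have "y' \<in> leaf y"
    proof (rule same_plaque_leaf[OF c])
      show "y \<in> fst c" "y' \<in> fst c" using y(1) y'(1) W(2) by auto
      fix i assume "i < p"
      thus "snd c y i = snd c y' i" using fun_cong[OF j, of i] by (simp add: join_nth)
    qed
    moreover have "y \<in> topspace M" using y(1) W(1) openin_subset by blast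
    ultimately have "y = y'" using T_leaf[of y] Ty leaf_refl[of y] by (auto simp: bij_betw_def dest: inj_onD)
    thus "z = z'" using y y' by simp
  qed
  have "continuous_map (sub_n n U) M (chart_inv c)"
    by (rule continuous_map_from_subtopology_mono[OF continuous_map_chart_inv[OF cc]]) (use W(2) in \<open>auto simp: U_def\<close>)
  hence "continuous_map (sub_n n U) N (T \<circ> chart_inv c)"
    using T_continuous by (rule continuous_map_compose)
  hence "continuous_map (sub_n n U) (subtopology N (fst \<psi>)) (T \<circ> chart_inv c)"
    using pt W(5) unfolding continuous_map_in_subtopology by fastforce
  hence "continuous_map (sub_n n U) (Euclidean_space q) (snd \<psi> \<circ> (T \<circ> chart_inv c))"
    using is_chartD(5)[OF \<psi>(1)] by (rule continuous_map_compose)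
  hence tc: "continuous_on U (\<lambda>z. snd \<psi> (T (chart_inv c z)))"
    unfolding subtopology_Rn[OF UR] continuous_map_Rn by (simp add: o_def)
  have "continuous_on U f"
  proof (rule continuous_on_vec[where m = n])
    fix i assume "i < n"
    show "continuous_on U (cp f i)"
    proof (cases "i < p")
      case True
      thus ?thesis by (simp add: f_def join_nth continuous_on_coord)
    next
      case False
      have "continuous_on U (\<lambda>z. snd \<psi> (T (chart_inv c z)) (i - p))"
        by (rule continuous_on_compose2[OF continuous_on_coord[of UNIV] tc]) simp
      thus ?thesis using False by (simp add: f_def join_def)
    qed
  qed (rule fR)
  hence "continuous_map (sub_n n U) (Euclidean_space n) f"
    unfolding subtopology_Rn[OF UR] continuous_map_Rn using fR by auto
  hence "open_n n (f ` U)" by (rule invariance_of_domain_Euclidean_space[OF U _ inj])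
  moreover have "f (snd c m) \<in> f ` U" using W(4) by (auto simp: U_def)
  ultimately obtain e where e: "e > 0" "nbox n (f (snd c m)) e \<subseteq> f ` U" unfolding openin_Euclidean_iff by blast
  define V where "V = {u \<in> fst \<psi>. snd \<psi> u \<in> nbox q (snd \<psi> (T m)) e}"
  have V: "openin N V" unfolding V_def by (rule openin_chart_preimage[OF \<psi>(1) openin_nbox])
  have TmV: "T m \<in> V" using \<psi>(2) nbox_center[OF \<psi>R[OF W(4)] e(1)] by (simp add: V_def)
  have "\<exists>y\<in>S \<inter> fst c. (\<forall>i<p. snd c y i = x i) \<and> T y = u"
    if x: "x \<in> R_n n" "\<forall>i<p. \<bar>x i - snd c m i\<bar> < e" and u: "u \<in> V" for x u
  proof -
    have u': "u \<in> fst \<psi>" "snd \<psi> u \<in> nbox q (snd \<psi> (T m)) e" using u by (auto simp: V_def)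
    have "\<bar>join p x (snd \<psi> u) i - f (snd c m) i\<bar> < e" if "i < n" for i
      using that x(2) u'(2) fy[OF W(4)] by (cases "i < p") (auto simp: join_def nbox_def)
    hence "join p x (snd \<psi> u) \<in> nbox n (f (snd c m)) e"
      using join_slice_Rn[OF x(1)] chart_Rn[OF \<psi>(1) u'(1)] by (simp add: nbox_def)
    then obtain z where z: "z \<in> U" "join p x (snd \<psi> u) = f z" using e(2) by blast
    obtain y where y: "y \<in> W" "z = snd c y" using pt[OF z(1)] by blast
    have j: "join p x (snd \<psi> u) = join p (snd c y) (snd \<psi> (T y))" using z(2) y fy by simp
    hence "drop_n p (join p x (snd \<psi> u)) = drop_n p (join p (snd c y) (snd \<psi> (T y)))" by simp
    hence "T y = u" using is_chartD(4)[OF \<psi>(1)] W(5)[OF y(1)] u'(1) by (auto simp: drop_join dest: inj_onD)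
    moreover have "snd c y i = x i" if "i < p" for i using fun_cong[OF j, of i] that by (simp add: join_nth)
    ultimately show ?thesis using y(1) W(2,3) by blast
  qed
  thus ?thesis using e(1) V TmV by blast
qed

lemma transverse_nbhd_open:
  assumes c: "c \<in> F" and e: "0 < e"
  shows "openin M {y \<in> fst c. \<forall>i<p. \<bar>snd c y i - z i\<bar> < e}"
proof -
  have "open_n n {w \<in> R_n n. fst_n p w \<in> nbox p z e}"
    by (rule openin_preimage_nbhd[OF openin_Rn_top openin_nbox _ fst_n_Rn]) (simp add: fst_n_def continuous_on_coord)
  hence "openin M {y \<in> fst c. snd c y \<in> {w \<in> R_n n. fst_n p w \<in> nbox p z e}}"
    by (rule openin_chart_preimage[OF F_chart[OF c]])
  moreover have "{y \<in> fst c. snd c y \<in> {w \<in> R_n n. fst_n p w \<in> nbox p z e}} = {y \<in> fst c. \<forall>i<p. \<bar>snd c y i - z i\<bar> < e}"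
    using F_Rn[OF c] fst_n_Rn by (auto simp: nbox_def) (auto simp: fst_n_def)
  ultimately show ?thesis by simp
qed

text \<open>Continuity of \<open>leaf_point\<close> propagates along chains of plaques: nearby points of the leaves are
  first transported to a plaque chart, where the previous lemma applies.\<close>

lemma leaf_point_near:
  assumes m: "m \<in> topspace M" and y: "y \<in> leaf m" and S: "openin M S" "y \<in> S"
  shows "\<exists>U V. openin M U \<and> m \<in> U \<and> openin N V \<and> T y \<in> V \<and> (\<forall>x\<in>U. \<forall>u\<in>V. leaf_point x u \<in> S)"
proof -
  \<comment> \<open>The point w supplied by \<open>transverse_time_open\<close> lies in the plaque
    of x and has time u, so it is \<open>leaf_point x u\<close>.\<close>
  have local: "\<exists>e>0. \<exists>V. openin N V \<and> T y \<in> V \<and>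
      (\<forall>x\<in>fst c. \<forall>u\<in>V. (\<forall>i<p. \<bar>snd c x i - snd c y i\<bar> < e) \<longrightarrow> leaf_point x u \<in> S)"
    if c: "c \<in> F" "y \<in> fst c" and S: "openin M S" "y \<in> S" for c y S
  proof -
    obtain e V where eV: "e > 0" "openin N V" "T y \<in> V" "\<forall>x u. x \<in> R_n n \<and> (\<forall>i<p. \<bar>x i - snd c y i\<bar> < e) \<and> u \<in> V \<longrightarrow>
       (\<exists>y\<in>S \<inter> fst c. (\<forall>i<p. snd c y i = x i) \<and> T y = u)"
      using transverse_time_open[OF c S] by (elim exE conjE)
    have "leaf_point x u \<in> S" if x: "x \<in> fst c" "\<forall>i<p. \<bar>snd c x i - snd c y i\<bar> < e" and u: "u \<in> V" for x u
    proof -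
      obtain w where w: "w \<in> S" "w \<in> fst c" "\<forall>i<p. snd c w i = snd c x i" "T w = u"
        using eV(4) F_Rn[OF c(1) x(1)] x(2) u by blast
      have "w \<in> leaf x" by (rule same_plaque_leaf[OF c(1) x(1) w(2)]) (use w(3) in simp)
      thus ?thesis using leaf_point_unique[OF SC_top[OF F_SC[OF c(1)] x(1)] _ w(4)] w(1) by simp
    qed
    thus ?thesis using eV(1-3) by blast
  qed
  have "(same_plaque p F)\<^sup>*\<^sup>* m y" using y by (simp add: leaf_def)
  thus ?thesis
    using S
  proof (induction arbitrary: S rule: rtranclp_induct)
    case base
    obtain c where c: "c \<in> F" "m \<in> fst c" using F_cover[OF m] by blast
    obtain e V where eV: "e > 0" "openin N V" "T m \<in> V"
       "\<forall>x\<in>fst c. \<forall>u\<in>V. (\<forall>i<p. \<bar>snd c x i - snd c m i\<bar> < e) \<longrightarrow> leaf_point x u \<in> S"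
      using local[OF c base] by (elim exE conjE)
    show ?case
      using eV transverse_nbhd_open[OF c(1) eV(1), of "snd c m"] c(2)
      by (intro exI[of _ "{y \<in> fst c. \<forall>i<p. \<bar>snd c y i - snd c m i\<bar> < e}"] exI[of _ V]) auto
  next
    case (step y z)
    obtain c where c: "c \<in> F" "y \<in> fst c" "z \<in> fst c" "\<forall>i<p. snd c y i = snd c z i"
      using step.hyps(2) by (auto simp: same_plaque_def)
    obtain e V where eV: "e > 0" "openin N V" "T z \<in> V"
       "\<forall>x\<in>fst c. \<forall>u\<in>V. (\<forall>i<p. \<bar>snd c x i - snd c z i\<bar> < e) \<longrightarrow> leaf_point x u \<in> S"
      using local[OF c(1,3) step.prems]
      by (elim exE conjE)
    \<comment> \<open>The induction hypothesis is applied to the points of c with transverse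
      coordinates close to those of z. As y shares the latter, this is a neighborhood of y, and from
      it S is reached inside the chart c.\<close>
    define S1 where "S1 = {x \<in> fst c. \<forall>i<p. \<bar>snd c x i - snd c z i\<bar> < e}"
    have S1: "openin M S1" "y \<in> S1"
      using transverse_nbhd_open[OF c(1) eV(1)] c eV(1) by (auto simp: S1_def)
    obtain U V1 where U: "openin M U" "m \<in> U" "openin N V1" "T y \<in> V1" "\<forall>x\<in>U. \<forall>u\<in>V1. leaf_point x u \<in> S1"
      using step.IH[OF S1] by blast
    have "leaf_point x u \<in> S" if x: "x \<in> U" and u: "u \<in> V" for x u
    proof -
      have xM: "x \<in> topspace M" using x U(1) openin_subset by blast
      have TN: "T y \<in> topspace N" "u \<in> topspace N" using U(3,4) eV(2) u openin_subset by blast+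
      \<comment> \<open>The leaf of x is first followed to the time of y, where it lies in S1; since
        \<open>leaf_point\<close> sees only the leaf, starting from x1 or from x gives the same
        result.\<close>
      define x1 where "x1 = leaf_point x (T y)"
      have x1: "x1 \<in> S1" "x1 \<in> leaf x" "x1 \<in> topspace M" using U(4,5) x leaf_point[OF xM TN(1)] by (auto simp: x1_def)
      have "leaf_point x1 u \<in> S" using eV(4) x1(1) u by (auto simp: S1_def)
      moreover have "leaf_point x1 u = leaf_point x u" by (simp add: leaf_point_def leaf_eq[OF x1(2)])
      ultimately show ?thesis by simp
    qed
    thus ?case using U(1,2) eV(2,3) by blast
  qed
qed

lemma leaf_point_continuous: "continuous_map (prod_topology M N) M (\<lambda>(m, u). leaf_point m u)"
  unfolding continuous_map_def
proof (intro conjI allI impI)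
  show "(\<lambda>(m, u). leaf_point m u) \<in> topspace (prod_topology M N) \<rightarrow> topspace M" using leaf_point(3) by auto
  fix S assume S: "openin M S"
  show "openin (prod_topology M N) {x \<in> topspace (prod_topology M N). (case x of (m, u) \<Rightarrow> leaf_point m u) \<in> S}"
    unfolding openin_prod_topology_alt
  proof (intro allI impI)
    fix m u assume "(m, u) \<in> {x \<in> topspace (prod_topology M N). (case x of (m, u) \<Rightarrow> leaf_point m u) \<in> S}"
    hence mu: "m \<in> topspace M" "u \<in> topspace N" "leaf_point m u \<in> S" by auto
    obtain U V where UV: "openin M U" "m \<in> U" "openin N V" "T (leaf_point m u) \<in> V" "\<forall>x\<in>U. \<forall>u\<in>V. leaf_point x u \<in> S"
      using leaf_point_near[OF mu(1) leaf_point(1)[OF mu(1,2)] S mu(3)] by blast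
    show "\<exists>U V. openin M U \<and> openin N V \<and> m \<in> U \<and> u \<in> V \<and>
        U \<times> V \<subseteq> {x \<in> topspace (prod_topology M N). (case x of (m, u) \<Rightarrow> leaf_point m u) \<in> S}"
      using UV leaf_point(2)[OF mu(1,2)] openin_subset[OF UV(1)] openin_subset[OF UV(3)]
      by (intro exI[of _ U] exI[of _ V]) auto
  qed
qed

lemma leaf_point_base: "x \<in> topspace M \<Longrightarrow> T x = t \<Longrightarrow> m \<in> leaf x \<Longrightarrow> leaf_point m t = x"
  using leaf_point_unique[of x x t] leaf_refl[of x] leaf_eq[of m x] by (simp add: leaf_point_def)

text \<open>The inverse is \<open>leaf_point\<close> on pairs (x, u) with x in P, so the joint
  continuity of \<open>leaf_point\<close> serves both directions. Each leaf meets P in exactly one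
  point because T maps it bijectively onto N.\<close>

theorem product_structure:
  assumes t: "t \<in> topspace N" and P: "P = {m \<in> topspace M. T m = t}"
  shows "\<exists>h. homeomorphic_map M (prod_topology (subtopology M P) N) h \<and> (\<forall>m\<in>topspace M. snd (h m) = T m) \<and>
    leaves p M F = {{m \<in> topspace M. fst (h m) = x} | x. x \<in> P}"
proof -
  let ?X = "prod_topology (subtopology M P) N"
  define h where "h m = (leaf_point m t, T m)" for m
  have LP: "leaf_point m t \<in> P" if "m \<in> topspace M" for m using leaf_point[OF that t] by (simp add: P)
  have "homeomorphic_maps M ?X h (\<lambda>(x, u). leaf_point x u)"
    unfolding homeomorphic_maps_def
  proof (intro conjI ballI)
    have "continuous_map M (prod_topology M N) (\<lambda>m. (m, t))" using t by (simp add: continuous_map_paired)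
    hence "continuous_map M M ((\<lambda>(m, u). leaf_point m u) \<circ> (\<lambda>m. (m, t)))"
      using leaf_point_continuous by (rule continuous_map_compose)
    hence "continuous_map M M (cp leaf_point t)" by (simp add: o_def)
    thus "continuous_map M ?X h"
      using T_continuous LP unfolding h_def by (simp add: continuous_map_paired continuous_map_in_subtopology)
    have "prod_topology (subtopology M P) N = subtopology (prod_topology M N) (P \<times> topspace N)"
      using prod_topology_subtopology(1)[of M P N] by simp
    thus "continuous_map ?X M (\<lambda>(x, u). leaf_point x u)"
      using continuous_map_from_subtopology[OF leaf_point_continuous] by simp
    show "(case h m of (x, u) \<Rightarrow> leaf_point x u) = m" if m: "m \<in> topspace M" for m
    proof -
      have "leaf (leaf_point m t) = leaf m" using leaf_eq leaf_point(1)[OF m t] by blast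
      hence "leaf_point (leaf_point m t) (T m) = leaf_point m (T m)" by (simp add: leaf_point_def)
      also have "\<dots> = m" by (rule leaf_point_unique[OF m leaf_refl refl])
      finally show ?thesis by (simp add: h_def)
    qed
    show "h (case y of (x, u) \<Rightarrow> leaf_point x u) = y" if "y \<in> topspace ?X" for y
    proof -
      obtain x u where y: "y = (x, u)" "x \<in> topspace M" "T x = t" "u \<in> topspace N"
        using \<open>y \<in> topspace ?X\<close> by (cases y) (auto simp: P)
      have "leaf_point (leaf_point x u) t = x" by (rule leaf_point_base[OF y(2,3) leaf_point(1)[OF y(2,4)]])
      thus ?thesis using leaf_point(2)[OF y(2,4)] by (simp add: h_def y(1))
    qed
  qed
  hence "homeomorphic_map M ?X h" using homeomorphic_maps_map by blast
  moreover have "{m \<in> topspace M. fst (h m) = x} = leaf x" if x: "x \<in> P" for x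
  proof -
    have xM: "x \<in> topspace M" "T x = t" using x by (auto simp: P)
    show ?thesis
    proof (intro equalityI subsetI)
      fix m assume "m \<in> {m \<in> topspace M. fst (h m) = x}"
      hence "x \<in> leaf m" using leaf_point(1)[OF _ t] by (auto simp: h_def)
      thus "m \<in> leaf x" using leaf_eq leaf_refl by blast
    qed (use leaf_subset[OF xM(1)] leaf_point_base[OF xM] in \<open>auto simp: h_def\<close>)
  qed
  moreover have "leaves p M F = leaf ` P"
  proof
    show "leaves p M F \<subseteq> leaf ` P"
      unfolding leaves_eq using LP leaf_eq leaf_point(1)[OF _ t] by (metis image_eqI image_subsetI)
    show "leaf ` P \<subseteq> leaves p M F" unfolding leaves_eq by (auto simp: P)
  qed
  moreover have "{{m \<in> topspace M. fst (h m) = x} | x. x \<in> P} = (\<lambda>x. {m \<in> topspace M. fst (h m) = x}) ` P" by blast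
  ultimately show ?thesis by (intro exI[of _ h]) (simp add: h_def)
qed

end

theorem theorem0p1:
  fixes p q :: nat
    and M :: "'a topology" and A :: "'a chart set" and g :: "'a metr"
    and N :: "'b topology" and T :: "'a \<Rightarrow> 'b"
    and F :: "'a chart set" and P :: "'a set" and t :: 'b
  assumes "spacetime p q M A g"
    and "cauchy_time_function p q M A g N T"
    and "foliation p q M A F"
    and "\<forall>L\<in>leaves p M F. causal_leaf p q A g F L"
    and "t \<in> topspace N"
    and "P = {m \<in> topspace M. T m = t}"
  shows "\<exists>h. homeomorphic_map M (prod_topology (subtopology M P) N) h \<and>
             (\<forall>m\<in>topspace M. snd (h m) = T m) \<and>
             leaves p M F = {{m \<in> topspace M. fst (h m) = x} | x. x \<in> P}"
proof -
  interpret cauchy_foliation p q M A g F N T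
    by unfold_locales (use assms in \<open>auto simp: spacetime_def connected_smooth_manifold_def\<close>)
  show ?thesis by (rule product_structure[OF assms(5,6)])
qed

end
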